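(* Suppose $n\delta_n\to0$ as $n\to+\infty$. For $\theta\in\Theta$ let $a=a(\theta)=\psi(\theta)$ and $b=b(\theta)=\psi(\theta)+r$. Then, for any continuous and strictly positive prior density $q$ on $\Theta$, the Bayesian estimator $\tilde\theta_n$ for quadratic loss has the following properties: \begin{itemize} \item $\tilde\theta_n$ is consistent: for every $\theta\in\Theta$, $\tilde\theta_n\to\theta$ in $\mathbf{P}_\theta$-probability; \item $\tilde\theta_n$ converges at rate $1/n$ with limit law that of $\zeta_{a,b}$: for every $\theta\in\Theta$, $n(\tilde\theta_n-\theta)$ converges in distribution under $\mathbf{P}_\theta$ to $\zeta_{a(\theta),b(\theta)}$; \item polynomial moments converge: for every $\theta\in\Theta$ and every $p>0$, $\lim_{n\to+\infty}n^p\,\mathbf{E}_\theta|\tilde\theta_n-\theta|^p=\mathbf{E}|\zeta_{a(\theta),b(\theta)}|^p$; \item $\tilde\theta_n$ is asymptotically efficient: for all $\theta_0\in\Theta$, \[ \lim_{\epsilon\to0}\ \lim_{n\to+\infty}\ \sup_{|\theta-\theta_0|<\epsilon}n^2\,\mathbf{E}_\theta\bigl(\tilde\theta_n-\theta\bigr)^2=\mathbf{E}\,\zeta_{a(\theta_0),b(\theta_0)}^2. \] \end{itemize}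
   Context: Let $0<\alpha<\beta<\tau$ be known constants, $\psi$ a known strictly positive continuous function on $[0,\tau]$, $r>-\min_{0\le t\le\tau}\psi(t)$ a known constant with $r\neq0$, and $(\delta_n)$ a known sequence of positive numbers decreasing to $0$. The unknown parameter is $\theta\in\Theta=(\alpha,\beta)$. For each $n\ge1$ one observes $X^{(n)}=(X_1,\ldots,X_n)$, where $X_j=(X_j(t),\ 0\le t\le\tau)$, $j=1,\ldots,n$, are independent inhomogeneous Poisson processes on $[0,\tau]$ with common intensity function \[ \lambda_\theta^{(n)}(t)=\psi(t)+\frac{r}{\delta_n}(t-\theta)\,\mathbb{1}_{[\theta,\theta+\delta_n)}(t)+r\,\mathbb{1}_{[\theta+\delta_n,\tau]}(t),\qquad 0\le t\le\tau. \] $\mathbf{P}_\theta=\mathbf{P}_\theta^{(n)}$ denotes the law of $X^{(n)}$ and $\mathbf{E}_\theta$ the corresponding expectation. The likelihood (with respect to the law of $n$ independent unit-intensity homogeneous Poisson processes) is \[ L(\theta,X^{(n)})=\exp\Bigl\{\sum_{j=1}^n\int_0^\tau\ln\bigl(\lambda^{(n)}_\theta(t)\bigr)\,\mathrm{d}X_j(t)-n\int_0^\tau\bigl(\lambda^{(n)}_\theta(t)-1\bigr)\mathrm{d}t\Bigr\}, \] and the Bayesian estimator for quadratic loss and prior density $q$ is \[ \tilde\theta_n=\frac{\int_\alpha^\beta\theta\,q(\theta)\,L(\theta,X^{(n)})\,\mathrm{d}\theta}{\int_\alpha^\beta q(\theta)\,L(\theta,X^{(n)})\,\mathrm{d}\theta}.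 \] For constants $a,b>0$, let $Y^+$ and $Y^-$ be independent Poisson processes on $\mathbb{R}_+$ of constant intensities $b$ and $a$ respectively, and let \[ Z^\star_{a,b}(u)=\begin{cases}\exp\bigl\{\ln\bigl(\frac ab\bigr)Y^+(u)+(b-a)u\bigr\},&u\ge0,\\ \exp\bigl\{\ln\bigl(\frac ba\bigr)Y^-(-u)+(b-a)u\bigr\},&u\le0.\end{cases} \] For $a\ne b$ set \[ \zeta_{a,b}=\frac{\int_{\mathbb{R}}u\,Z^\star_{a,b}(u)\,\mathrm{d}u}{\int_{\mathbb{R}}Z^\star_{a,b}(u)\,\mathrm{d}u}. \] *)

theory Defs
  imports "HOL-Probability.Probability"
begin

section \<open>Poisson processes\<close>

text \<open>
  A Poisson process with intensity function \<open>l\<close> on a time interval \<open>T\<close> that starts at \<open>0\<close>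
  (used with \<open>T = {0..\<tau>}\<close> and \<open>T = {0..}\<close>). The trajectories are counting paths surely, not just
  almost surely. The intensities used here are strictly positive, so the rate passed to
  \<open>poisson_pmf\<close> is positive, as that constant requires. In the independence clause, a
  monotone sequence of times may repeat a time; such increments are constantly \<open>0\<close>.
\<close>

definition poisson_process ::
    "'a measure \<Rightarrow> real set \<Rightarrow> (real \<Rightarrow> real) \<Rightarrow> (real \<Rightarrow> 'a \<Rightarrow> nat) \<Rightarrow> bool" where
  "poisson_process M T l X \<longleftrightarrow>
     prob_space M \<and>
     (\<forall>t\<in>T. X t \<in> measurable M (count_space UNIV)) \<and>
     (\<forall>\<omega>\<in>space M. X 0 \<omega> = 0 \<and> mono_on T (\<lambda>t. X t \<omega>) \<and>
        (\<forall>t\<in>T. ((\<lambda>s. X s \<omega>) \<longlongrightarrow> X t \<omega>) (at t within T \<inter> {t..}))) \<and>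
     (\<forall>s\<in>T. \<forall>t\<in>T. s < t \<longrightarrow>
        distr M (count_space UNIV) (\<lambda>\<omega>. X t \<omega> - X s \<omega>)
          = measure_pmf (poisson_pmf (LBINT u:{s..t}. l u))) \<and>
     (\<forall>(t :: nat \<Rightarrow> real) k. (\<forall>i\<le>k. t i \<in> T) \<and> mono_on {..k} t \<longrightarrow>
        prob_space.indep_vars M (\<lambda>_. count_space UNIV)
          (\<lambda>i \<omega>. X (t (Suc i)) \<omega> - X (t i) \<omega>) {..<k})"

text \<open>A process as a random element of the space of functions on \<open>T\<close>.\<close>

abbreviation path_space :: "real set \<Rightarrow> (real \<Rightarrow> nat) measure" where
  "path_space T \<equiv> PiM T (\<lambda>_. count_space UNIV)"

definition path_of :: "real set \<Rightarrow> (real \<Rightarrow> 'a \<Rightarrow> nat) \<Rightarrow> 'a \<Rightarrow> real \<Rightarrow> nat" where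
  "path_of T X \<omega> = (\<lambda>t\<in>T. X t \<omega>)"

section \<open>The statistical model\<close>

definition intensity ::
    "(real \<Rightarrow> real) \<Rightarrow> real \<Rightarrow> real \<Rightarrow> real \<Rightarrow> real \<Rightarrow> real \<Rightarrow> real" where
  "intensity \<psi> r \<tau> d \<theta> t =
     \<psi> t + r / d * (t - \<theta>) * indicator {\<theta>..<\<theta> + d} t + r * indicator {\<theta> + d..\<tau>} t"

text \<open>
  The Stieltjes measure \<open>dx\<close> of a counting path \<open>x\<close> on \<open>[0, \<tau>]\<close>. Library Stieltjes measures live
  on the whole line, so the path is extended by constants; this creates no further atoms.
\<close>

definition path_measure :: "real \<Rightarrow> (real \<Rightarrow> nat) \<Rightarrow> real measure" where
  "path_measure \<tau> x = interval_measure (\<lambda>t. real (x (max 0 (min t \<tau>))))"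

definition likelihood ::
    "(real \<Rightarrow> real) \<Rightarrow> real \<Rightarrow> real \<Rightarrow> real \<Rightarrow> nat \<Rightarrow> real \<Rightarrow> (nat \<Rightarrow> real \<Rightarrow> nat) \<Rightarrow> real" where
  "likelihood \<psi> r \<tau> d n \<theta> x =
     exp ((\<Sum>j=1..n. LINT t:{0..\<tau>}|path_measure \<tau> (x j). ln (intensity \<psi> r \<tau> d \<theta> t))
          - real n * (LBINT t:{0..\<tau>}. intensity \<psi> r \<tau> d \<theta> t - 1))"

definition bayes_estimator ::
    "real \<Rightarrow> real \<Rightarrow> (real \<Rightarrow> real) \<Rightarrow> (real \<Rightarrow> real) \<Rightarrow> real \<Rightarrow> real \<Rightarrow> real \<Rightarrow> nat
       \<Rightarrow> (nat \<Rightarrow> real \<Rightarrow> nat) \<Rightarrow> real" where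
  "bayes_estimator \<alpha> \<beta> q \<psi> r \<tau> d n x =
     (LBINT \<theta>:{\<alpha><..<\<beta>}. \<theta> * q \<theta> * likelihood \<psi> r \<tau> d n \<theta> x)
     / (LBINT \<theta>:{\<alpha><..<\<beta>}. q \<theta> * likelihood \<psi> r \<tau> d n \<theta> x)"

section \<open>The limit law\<close>

definition Z_star ::
    "real \<Rightarrow> real \<Rightarrow> (real \<Rightarrow> nat) \<Rightarrow> (real \<Rightarrow> nat) \<Rightarrow> real \<Rightarrow> real" where
  "Z_star a b yp ym u =
     (if 0 \<le> u then exp (ln (a / b) * real (yp u) + (b - a) * u)
      else exp (ln (b / a) * real (ym (- u)) + (b - a) * u))"

definition zeta ::
    "real \<Rightarrow> real \<Rightarrow> (real \<Rightarrow> nat) \<Rightarrow> (real \<Rightarrow> nat) \<Rightarrow> real" where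
  "zeta a b yp ym = (LBINT u. u * Z_star a b yp ym u) / (LBINT u. Z_star a b yp ym u)"

section \<open>Modes of convergence along varying probability spaces\<close>

text \<open>
  Measurability is required explicitly: without it \<open>measure\<close> and \<open>distr\<close> take arbitrary
  default values.
\<close>

definition converges_in_probability ::
    "(nat \<Rightarrow> 'a measure) \<Rightarrow> (nat \<Rightarrow> 'a \<Rightarrow> real) \<Rightarrow> real \<Rightarrow> bool" where
  "converges_in_probability M X c \<longleftrightarrow>
     (\<forall>\<^sub>F n in sequentially. X n \<in> borel_measurable (M n)) \<and>
     (\<forall>e>0. (\<lambda>n. measure (M n) {\<omega> \<in> space (M n). \<bar>X n \<omega> - c\<bar> > e}) \<longlonglongrightarrow> 0)"

definition converges_in_distribution ::
    "(nat \<Rightarrow> 'a measure) \<Rightarrow> (nat \<Rightarrow> 'a \<Rightarrow> real) \<Rightarrow> 'b measure \<Rightarrow> ('b \<Rightarrow> real) \<Rightarrow> bool" where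
  "converges_in_distribution M X N Y \<longleftrightarrow>
     (\<forall>\<^sub>F n in sequentially. X n \<in> borel_measurable (M n)) \<and> Y \<in> borel_measurable N \<and>
     weak_conv_m (\<lambda>n. distr (M n) borel (X n)) (distr N borel Y)"

end

theory Submission
  imports Defs
begin

text \<open>
  The \<open>n\<close> observed processes enter the likelihood only through their sum, a Poisson process with
  intensity \<open>n\<close> times that of one observation. In the local coordinate \<open>u = n * (\<theta>' - \<theta>)\<close> the
  variable \<open>n * (est - \<theta>)\<close> is the mean of the density proportional to \<open>w u * Z u\<close>, where \<open>Z\<close> is the
  likelihood ratio of \<open>\<theta>'\<close> to \<open>\<theta>\<close> and \<open>w\<close> the rescaled prior density. A ramp has length \<open>n * \<delta> n\<close>
  in this coordinate, which tends to \<open>0\<close>: up to the few points inside the two ramps,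
  \<open>ln (Z u) = - \<kappa> * Y u + r * u\<close>, where \<open>Y u\<close> counts the points between \<open>0\<close> and \<open>u\<close> with the sign
  of \<open>u\<close> and \<open>\<kappa> = ln ((\<psi> \<theta> + r) / \<psi> \<theta>)\<close> (\<open>loglik_diff_approx\<close>). The limit field \<open>Z_star\<close> has
  exactly this form, with a two-sided Poisson process as \<open>Y\<close>.

  Convergence in law of the posterior means does not need convergence of \<open>Z\<close> in a function space.
  It is reduced to finitely many counts:

  \<^item> The mean of \<open>sqrt (Z u)\<close> is at most the exponential of minus half the squared Hellinger distance
    of two intensities and decays exponentially in \<open>\<bar>u\<bar>\<close> (\<open>loglik_half_moment\<close>). Hence the posterior mass
    outside \<open>(-R, R)\<close>, weighted with any power of \<open>\<bar>u\<bar>\<close>, has a mean that is small for large \<open>R\<close>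
    (\<open>mean_le_post_trunc\<close>), and all moments of the posterior mean are bounded (\<open>mean_le_post_power\<close>).
  \<^item> Inside \<open>(-R, R)\<close> the field may be frozen on the cells of a grid of mesh \<open>1 / N\<close>, at a cost in
    mean that vanishes with \<open>1 / N\<close> and with the length of the ramps (\<open>mean_le_post_trunc_grid\<close>).
  \<^item> What remains is a bounded function of independent Poisson counts, whose rates converge
    (\<open>cell_rate_tendsto\<close>, \<open>poisson_vector_law_tendsto\<close>).

  The first two steps are carried out for an abstract field \<open>Z\<close> driven by a counting process \<open>Y\<close>. The
  observed experiments and the limit experiment are instances of it, the former with constants that do
  not depend on \<open>n\<close>; this makes the error terms uniform. The bounded moments then turn convergence
  in law into convergence of moments, and bounded first moments give consistency.

  All of this holds for a true parameter \<open>\<theta>s n\<close> that varies with \<open>n\<close> and converges. Convergence of the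
  risk along all such sequences is locally uniform convergence to a continuous limit, which is what the
  statement on the supremum of the risk requires (\<open>SUP_tendsto_of_continuous_convergence\<close>).
\<close>

section \<open>Poisson variables and superposition of Poisson processes\<close>

lemma nn_integral_poisson_exp:
  assumes "0 < \<mu>"
  shows "(\<integral>\<^sup>+k. ennreal (exp (c * real k)) \<partial>measure_pmf (poisson_pmf \<mu>))
           = ennreal (exp (\<mu> * (exp c - 1)))"
proof -
  have *: "ennreal (pmf (poisson_pmf \<mu>) k) * ennreal (exp (c * real k))
      = ennreal (exp (\<mu> * (exp c - 1))) * ennreal (pmf (poisson_pmf (\<mu> * exp c)) k)" for k
  proof -
    have "exp (c * real k) = exp c ^ k" by (metis exp_of_nat_mult mult.commute)
    then have "pmf (poisson_pmf \<mu>) k * exp (c * real k)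
        = exp (\<mu> * (exp c - 1)) * pmf (poisson_pmf (\<mu> * exp c)) k"
      using assms by (simp add: power_mult_distrib right_diff_distrib exp_diff exp_minus divide_inverse)
    then show ?thesis by (simp add: ennreal_mult'[symmetric])
  qed
  have "(\<integral>\<^sup>+k. ennreal (exp (c * real k)) \<partial>measure_pmf (poisson_pmf \<mu>))
     = (\<integral>\<^sup>+k. ennreal (pmf (poisson_pmf \<mu>) k) * ennreal (exp (c * real k)) \<partial>count_space UNIV)"
    by (rule nn_integral_measure_pmf)
  also have "\<dots> = ennreal (exp (\<mu> * (exp c - 1))) *
      (\<integral>\<^sup>+k. ennreal (pmf (poisson_pmf (\<mu> * exp c)) k) * 1 \<partial>count_space UNIV)"
    unfolding * by (simp add: nn_integral_cmult)
  also have "(\<integral>\<^sup>+k. ennreal (pmf (poisson_pmf (\<mu> * exp c)) k) * 1 \<partial>count_space UNIV) = 1"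
    unfolding nn_integral_measure_pmf[symmetric] by simp
  finally show ?thesis by simp
qed

text \<open>
  Agreement on the sample space only: outside of it the trajectories of a process are arbitrary.
\<close>

lemma (in prob_space) indep_vars_cong_space:
  assumes eq: "\<And>i \<omega>. i \<in> I \<Longrightarrow> \<omega> \<in> space M \<Longrightarrow> X i \<omega> = Y i \<omega>"
    and ind: "indep_vars N X I"
  shows "indep_vars N Y I"
proof -
  have "Y i -` A \<inter> space M = X i -` A \<inter> space M" if "i \<in> I" for i A
    using eq[OF that] by auto
  moreover have "Y i \<in> measurable M (N i) \<longleftrightarrow> X i \<in> measurable M (N i)" if "i \<in> I" for i
    using eq[OF that] by (intro measurable_cong) auto
  ultimately show ?thesis
    using ind unfolding indep_vars_def2 by (simp cong: indep_sets_cong)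
qed

text \<open>
  A joint probability factors first over \<open>j\<close>, by the independence of the \<open>V j\<close>, and then over \<open>i\<close>, by that
  of the \<open>D j\<close>.
\<close>

lemma (in prob_space) indep_vars_double_index:
  assumes fin: "finite J" "finite I"
    and V: "indep_vars N V J"
    and D: "\<And>j. j \<in> J \<Longrightarrow> indep_vars (\<lambda>_. count_space UNIV) (D j) I"
    and \<phi>: "\<And>i j. j \<in> J \<Longrightarrow> i \<in> I \<Longrightarrow> \<phi> j i \<in> measurable (N j) (count_space UNIV)"
    and D_eq: "\<And>i j \<omega>. j \<in> J \<Longrightarrow> i \<in> I \<Longrightarrow> \<omega> \<in> space M \<Longrightarrow> D j i \<omega> = \<phi> j i (V j \<omega>)"
  shows "indep_vars (\<lambda>_. count_space UNIV) (\<lambda>(j, i). D j i) (J \<times> I)"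
proof (cases "J \<times> I = {}")
  case True
  then show ?thesis by (simp only: indep_vars_def indep_sets_def) auto
next
  case False
  then have ne: "J \<noteq> {}" "I \<noteq> {}" by auto
  have Dm: "D j i \<in> measurable M (count_space UNIV)" if "j \<in> J" "i \<in> I" for j i
    using D[OF that(1)] that(2) by (auto simp: indep_vars_def)
  have Vm: "V j \<in> measurable M (N j)" if "j \<in> J" for j
    using V that by (auto simp: indep_vars_def)
  let ?F = "\<lambda>ji. {(case ji of (j, i) \<Rightarrow> D j i) -` A \<inter> space M |A. A \<in> sets (count_space UNIV)}"
  have "indep_sets ?F (J \<times> I)"
  proof (subst indep_sets_finite)
    show "J \<times> I \<noteq> {}" "finite (J \<times> I)" using False fin by auto
    show "?F x \<subseteq> events" if "x \<in> J \<times> I" for x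
      using that by (auto intro!: measurable_sets[OF Dm])
    show "space M \<in> ?F x" if "x \<in> J \<times> I" for x
      by (auto intro!: exI[of _ UNIV])
    show "\<forall>A\<in>Pi (J \<times> I) ?F. prob (\<Inter>j\<in>J \<times> I. A j) = (\<Prod>j\<in>J \<times> I. prob (A j))"
    proof
      fix A assume "A \<in> Pi (J \<times> I) ?F"
      then have "\<forall>x\<in>J \<times> I. \<exists>B. A x = (case x of (j, i) \<Rightarrow> D j i) -` B \<inter> space M"
        by (auto simp: Pi_iff)
      then obtain B where B: "\<And>x. x \<in> J \<times> I \<Longrightarrow> A x = (case x of (j, i) \<Rightarrow> D j i) -` B x \<inter> space M"
        by metis
      define C where "C j = {v \<in> space (N j). \<forall>i\<in>I. \<phi> j i v \<in> B (j, i)}" for j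
      have C: "C j \<in> sets (N j)" if "j \<in> J" for j
      proof -
        have [measurable]: "\<phi> j i \<in> measurable (N j) (count_space UNIV)" if "i \<in> I" for i
          using \<phi> \<open>j \<in> J\<close> that by auto
        have "C j = (\<Inter>i\<in>I. \<phi> j i -` B (j, i) \<inter> space (N j))"
          using ne by (auto simp: C_def)
        moreover have "(\<Inter>i\<in>I. \<phi> j i -` B (j, i) \<inter> space (N j)) \<in> sets (N j)"
          using ne fin that by (intro sets.finite_INT measurable_sets[OF \<phi>]) auto
        ultimately show ?thesis by simp
      qed
      have C_eq: "V j -` C j \<inter> space M = (\<Inter>i\<in>I. A (j, i))" if "j \<in> J" for j
        using ne that measurable_space[OF Vm[OF that]] by (auto simp: C_def B D_eq)
      have "(\<Inter>x\<in>J \<times> I. A x) = (\<Inter>j\<in>J. V j -` C j \<inter> space M)"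
        using C_eq by auto
      then have "prob (\<Inter>x\<in>J \<times> I. A x) = (\<Prod>j\<in>J. prob (V j -` C j \<inter> space M))"
        using indep_varsD_finite[OF V ne(1) fin(1), of C] C by simp
      also have "\<dots> = (\<Prod>j\<in>J. \<Prod>i\<in>I. prob (A (j, i)))"
      proof (rule prod.cong[OF refl])
        fix j assume j: "j \<in> J"
        have "(\<Inter>i\<in>I. A (j, i)) = (\<Inter>i\<in>I. D j i -` B (j, i) \<inter> space M)"
          using j by (auto simp: B)
        then have "prob (V j -` C j \<inter> space M) = (\<Prod>i\<in>I. prob (D j i -` B (j, i) \<inter> space M))"
          unfolding C_eq[OF j] using indep_varsD_finite[OF D[OF j] ne(2) fin(2), of "\<lambda>i. B (j, i)"]
          by simp
        then show "prob (V j -` C j \<inter> space M) = (\<Prod>i\<in>I. prob (A (j, i)))"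
          using j by (simp add: B)
      qed
      also have "\<dots> = (\<Prod>x\<in>J \<times> I. prob (A x))"
        by (simp add: prod.cartesian_product)
      finally show "prob (\<Inter>x\<in>J \<times> I. A x) = (\<Prod>x\<in>J \<times> I. prob (A x))" .
    qed
  qed
  then show ?thesis using Dm unfolding indep_vars_def2 by auto
qed

lemma (in prob_space) distr_add_poisson:
  fixes X Y :: "'a \<Rightarrow> nat"
  assumes ind: "indep_var (count_space UNIV) X (count_space UNIV) Y"
    and X: "distr M (count_space UNIV) X = measure_pmf (poisson_pmf a)" and a: "0 < a"
    and Y: "distr M (count_space UNIV) Y = measure_pmf (poisson_pmf b)" and b: "0 < b"
  shows "distr M (count_space UNIV) (\<lambda>\<omega>. X \<omega> + Y \<omega>) = measure_pmf (poisson_pmf (a + b))"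
proof (rule measure_eqI_countable[where A = UNIV])
  have Xm[measurable]: "X \<in> measurable M (count_space UNIV)" 
    and Ym[measurable]: "Y \<in> measurable M (count_space UNIV)"
    using indep_var_rv1[OF ind] indep_var_rv2[OF ind] .
  fix m :: nat
  have pX: "prob (X -` {i} \<inter> space M) = pmf (poisson_pmf a) i" for i
    unfolding measure_pmf_single[symmetric] X[symmetric] by (rule measure_distr[symmetric]) auto
  have pY: "prob (Y -` {i} \<inter> space M) = pmf (poisson_pmf b) i" for i
    unfolding measure_pmf_single[symmetric] Y[symmetric] by (rule measure_distr[symmetric]) auto
  have ab: "0 < a + b" using a b by simp
  have split: "(\<lambda>\<omega>. X \<omega> + Y \<omega>) -` {m} \<inter> space M
     = (\<Union>i\<in>{..m}. (X -` {i} \<inter> space M) \<inter> (Y -` {m - i} \<inter> space M))" by auto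
  have "measure (distr M (count_space UNIV) (\<lambda>\<omega>. X \<omega> + Y \<omega>)) {m}
      = prob ((\<lambda>\<omega>. X \<omega> + Y \<omega>) -` {m} \<inter> space M)"
    by (rule measure_distr) auto
  also have "\<dots> = (\<Sum>i\<in>{..m}. prob ((X -` {i} \<inter> space M) \<inter> (Y -` {m - i} \<inter> space M)))"
    unfolding split by (rule finite_measure_finite_Union) (auto simp: disjoint_family_on_def)
  also have "\<dots> = (\<Sum>i\<in>{..m}. pmf (poisson_pmf a) i * pmf (poisson_pmf b) (m - i))"
  proof (rule sum.cong[OF refl])
    fix i
    have "(X -` {i} \<inter> space M) \<inter> (Y -` {m - i} \<inter> space M) = (\<lambda>\<omega>. (X \<omega>, Y \<omega>)) -` ({i} \<times> {m - i}) \<inter> space M"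
      by auto
    moreover have "prob ((\<lambda>\<omega>. (X \<omega>, Y \<omega>)) -` ({i} \<times> {m - i}) \<inter> space M)
        = prob (X -` {i} \<inter> space M) * prob (Y -` {m - i} \<inter> space M)"
      by (rule indep_varD[OF ind]) auto
    ultimately show "prob ((X -` {i} \<inter> space M) \<inter> (Y -` {m - i} \<inter> space M))
        = pmf (poisson_pmf a) i * pmf (poisson_pmf b) (m - i)" by (simp add: pX pY)
  qed
  also have "\<dots> = (\<Sum>i\<in>{..m}. (real (m choose i) * a ^ i * b ^ (m - i)) * (exp (- (a + b)) / fact m))"
  proof (intro sum.cong refl)
    fix i assume "i \<in> {..m}"
    moreover have "exp (- (a + b)) = exp (- a) * exp (- b)" by (simp add: exp_add[symmetric])
    ultimately show "pmf (poisson_pmf a) i * pmf (poisson_pmf b) (m - i)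
        = (real (m choose i) * a ^ i * b ^ (m - i)) * (exp (- (a + b)) / fact m)"
      using a b by (simp add: binomial_fact field_simps)
  qed
  also have "\<dots> = (\<Sum>i\<in>{..m}. real (m choose i) * a ^ i * b ^ (m - i)) * (exp (- (a + b)) / fact m)"
    by (rule sum_distrib_right[symmetric])
  also have "\<dots> = (a + b) ^ m * (exp (- (a + b)) / fact m)"
    by (simp add: binomial_ring)
  also have "\<dots> = pmf (poisson_pmf (a + b)) m" using ab by simp
  finally have "measure (distr M (count_space UNIV) (\<lambda>\<omega>. X \<omega> + Y \<omega>)) {m} = measure (poisson_pmf (a + b)) {m}"
    by (simp add: measure_pmf_single)
  moreover have "prob_space (distr M (count_space UNIV) (\<lambda>\<omega>. X \<omega> + Y \<omega>))"
    by (rule prob_space_distr) simp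
  ultimately show "emeasure (distr M (count_space UNIV) (\<lambda>\<omega>. X \<omega> + Y \<omega>)) {m} = emeasure (poisson_pmf (a + b)) {m}"
    by (simp add: finite_measure.emeasure_eq_measure measure_pmf.emeasure_eq_measure prob_space.finite_measure)
qed simp_all


lemma (in prob_space) distr_sum_poisson:
  fixes N :: "'i \<Rightarrow> 'a \<Rightarrow> nat"
  assumes "finite J" "J \<noteq> {}"
    and "indep_vars (\<lambda>_. count_space UNIV) N J"
    and "\<And>j. j \<in> J \<Longrightarrow> distr M (count_space UNIV) (N j) = measure_pmf (poisson_pmf \<mu>)"
    and "0 < \<mu>"
  shows "distr M (count_space UNIV) (\<lambda>\<omega>. \<Sum>j\<in>J. N j \<omega>) = measure_pmf (poisson_pmf (real (card J) * \<mu>))"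
  using assms
proof (induction J rule: finite_ne_induct)
  case (singleton j)
  then show ?case by simp
next
  case (insert i J)
  note ind = \<open>indep_vars (\<lambda>_. count_space UNIV) N (insert i J)\<close>
  have sum_meas: "(\<lambda>f. \<Sum>i\<in>J. f i) \<in> measurable (PiM J (\<lambda>_. count_space UNIV)) (count_space (UNIV :: nat set))"
  proof -
    have "(\<lambda>f. \<Sum>i\<in>J. f i) \<in> measurable (PiM J (\<lambda>_. count_space (UNIV :: nat set))) borel"
      by (intro borel_measurable_sum measurable_compose[OF measurable_component_singleton]) auto
    then show ?thesis
      by (subst measurable_cong_sets[OF refl sets_borel_eq_count_space[symmetric]])
  qed
  have "indep_var
    (count_space UNIV) ((\<lambda>f. f i) \<circ> (\<lambda>\<omega>. restrict (\<lambda>i. N i \<omega>) {i}))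
    (count_space UNIV) ((\<lambda>f. \<Sum>i\<in>J. f i) \<circ> (\<lambda>\<omega>. restrict (\<lambda>i. N i \<omega>) J))"
    using insert.hyps sum_meas
    by (intro indep_var_compose[OF indep_var_restrict[OF ind]] measurable_component_singleton) auto
  also have "((\<lambda>f. f i) \<circ> (\<lambda>\<omega>. restrict (\<lambda>i. N i \<omega>) {i})) = N i"
    by auto
  also have "((\<lambda>f. \<Sum>i\<in>J. f i) \<circ> (\<lambda>\<omega>. restrict (\<lambda>i. N i \<omega>) J)) = (\<lambda>\<omega>. \<Sum>i\<in>J. N i \<omega>)"
    by (auto cong: rev_conj_cong)
  finally have iv: "indep_var (count_space UNIV) (N i) (count_space UNIV) (\<lambda>\<omega>. \<Sum>i\<in>J. N i \<omega>)" .
  have IH: "distr M (count_space UNIV) (\<lambda>\<omega>. \<Sum>j\<in>J. N j \<omega>) = measure_pmf (poisson_pmf (real (card J) * \<mu>))"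
    using insert.prems by (intro insert.IH indep_vars_subset[OF ind]) auto
  have card: "0 < real (card J) * \<mu>"
    using insert.hyps insert.prems(3) by (simp add: card_gt_0_iff)
  have "distr M (count_space UNIV) (\<lambda>\<omega>. N i \<omega> + (\<Sum>j\<in>J. N j \<omega>))
      = measure_pmf (poisson_pmf (\<mu> + real (card J) * \<mu>))"
    by (rule distr_add_poisson[OF iv insert.prems(2) \<open>0 < \<mu>\<close> IH card]) simp
  then show ?case using insert.hyps by (simp add: algebra_simps)
qed

lemma poisson_processD:
  assumes "poisson_process M T l X"
  shows "prob_space M"
    and "\<And>t. t \<in> T \<Longrightarrow> X t \<in> measurable M (count_space UNIV)"
    and "\<And>\<omega>. \<omega> \<in> space M \<Longrightarrow> X 0 \<omega> = 0"
    and "\<And>\<omega>. \<omega> \<in> space M \<Longrightarrow> mono_on T (\<lambda>t. X t \<omega>)"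
    and "\<And>\<omega> t. \<omega> \<in> space M \<Longrightarrow> t \<in> T \<Longrightarrow> ((\<lambda>s. X s \<omega>) \<longlongrightarrow> X t \<omega>) (at t within T \<inter> {t..})"
    and "\<And>s t. s \<in> T \<Longrightarrow> t \<in> T \<Longrightarrow> s < t \<Longrightarrow> distr M (count_space UNIV) (\<lambda>\<omega>. X t \<omega> - X s \<omega>)
          = measure_pmf (poisson_pmf (LBINT u:{s..t}. l u))"
    and "\<And>(t :: nat \<Rightarrow> real) k. (\<And>i. i \<le> k \<Longrightarrow> t i \<in> T) \<Longrightarrow> mono_on {..k} t \<Longrightarrow>
        prob_space.indep_vars M (\<lambda>_. count_space UNIV)
          (\<lambda>i \<omega>. X (t (Suc i)) \<omega> - X (t i) \<omega>) {..<k}"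
  using assms unfolding poisson_process_def by auto

text \<open>
  Two independence properties meet here: that of the processes and that of the increments of each of
  them. Together they make the doubly indexed family of increments independent, so that grouping it
  by time intervals leaves independent sums.
\<close>

theorem poisson_process_superposition:
  fixes X :: "'i \<Rightarrow> real \<Rightarrow> 'a \<Rightarrow> nat"
  assumes J: "finite J" "J \<noteq> {}"
    and pp: "\<And>j. j \<in> J \<Longrightarrow> poisson_process M T l (X j)"
    and ind: "prob_space.indep_vars M (\<lambda>_. path_space T) (\<lambda>j. path_of T (X j)) J"
    and pos: "\<And>s t. s \<in> T \<Longrightarrow> t \<in> T \<Longrightarrow> s < t \<Longrightarrow> 0 < (LBINT u:{s..t}. l u)"
  shows "poisson_process M T (\<lambda>t. real (card J) * l t) (\<lambda>t \<omega>. \<Sum>j\<in>J. X j t \<omega>)"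
proof -
  obtain j0 where j0: "j0 \<in> J" using J by auto
  interpret prob_space M using poisson_processD(1)[OF pp[OF j0]] .
  note D = poisson_processD[OF pp]
  have mono: "X j s \<omega> \<le> X j t \<omega>" if "j \<in> J" "\<omega> \<in> space M" "s \<in> T" "t \<in> T" "s \<le> t" for j \<omega> s t
    using D(4)[OF that(1,2)] that(3-5) by (auto simp: mono_on_def)
  have diff: "(\<Sum>j\<in>J. X j t \<omega>) - (\<Sum>j\<in>J. X j s \<omega>) = (\<Sum>j\<in>J. X j t \<omega> - X j s \<omega>)"
    if "\<omega> \<in> space M" "s \<in> T" "t \<in> T" "s \<le> t" for \<omega> s t
    by (rule sum_subtractf_nat[symmetric]) (use mono that in auto)
  have meas: "(\<lambda>\<omega>. \<Sum>j\<in>J. X j t \<omega>) \<in> measurable M (count_space UNIV)" if "t \<in> T" for t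
  proof -
    have "(\<lambda>\<omega>. \<Sum>j\<in>J. X j t \<omega>) \<in> borel_measurable M"
      by (intro borel_measurable_sum measurable_compose[OF D(2)]) (use that in auto)
    then show ?thesis
      by (subst measurable_cong_sets[OF refl sets_borel_eq_count_space[symmetric]])
  qed
  have double: "indep_vars (\<lambda>_. count_space UNIV) (\<lambda>(j, i) \<omega>. X j (t (Suc i)) \<omega> - X j (t i) \<omega>) (J \<times> {..<k})"
    if t: "\<And>i. i \<le> k \<Longrightarrow> t i \<in> T" "mono_on {..k} t" for t :: "nat \<Rightarrow> real" and k
  proof -
    have "indep_vars (\<lambda>_. count_space UNIV) (\<lambda>(j, i). \<lambda>\<omega>. X j (t (Suc i)) \<omega> - X j (t i) \<omega>) (J \<times> {..<k})"
    proof (rule indep_vars_double_index[where N = "\<lambda>_. path_space T" and V = "\<lambda>j. path_of T (X j)"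
          and \<phi> = "\<lambda>j i v. v (t (Suc i)) - v (t i)"])
      show "(\<lambda>v. v (t (Suc i)) - v (t i)) \<in> path_space T \<rightarrow>\<^sub>M count_space UNIV" if "i \<in> {..<k}" for i
      proof -
        have [measurable]: "t i \<in> T" "t (Suc i) \<in> T" using t(1)[of i] t(1)[of "Suc i"] that by auto
        show ?thesis by measurable
      qed
    qed (use J ind D(7) t in \<open>auto simp: path_of_def\<close>)
    then show ?thesis .
  qed
  have indep_sum: "indep_vars (\<lambda>_. count_space UNIV) (\<lambda>i \<omega>. \<Sum>j\<in>J. X j (t (Suc i)) \<omega> - X j (t i) \<omega>) {..<k}"
    if t: "\<And>i. i \<le> k \<Longrightarrow> t i \<in> T" "mono_on {..k} t" for t :: "nat \<Rightarrow> real" and k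
  proof -
    let ?D = "\<lambda>x. case x of (j, i) \<Rightarrow> \<lambda>\<omega>. X j (t (Suc i)) \<omega> - X j (t i) \<omega>"
    have 1: "indep_vars (\<lambda>i. PiM (J \<times> {i}) (\<lambda>_. count_space UNIV))
        (\<lambda>i \<omega>. restrict (\<lambda>x. ?D x \<omega>) (J \<times> {i})) {..<k}"
      by (rule indep_vars_restrict[OF double[OF t], where K = "\<lambda>i. J \<times> {i}"])
        (auto simp: disjoint_family_on_def split_beta')
    have "indep_vars (\<lambda>_. count_space UNIV)
        (\<lambda>i \<omega>. (\<lambda>f. \<Sum>j\<in>J. f (j, i)) (restrict (\<lambda>x. ?D x \<omega>) (J \<times> {i}))) {..<k}"
    proof (rule indep_vars_compose2[OF 1])
      fix i
      have "(\<lambda>f. \<Sum>j\<in>J. f (j, i)) \<in> measurable (PiM (J \<times> {i}) (\<lambda>_. count_space (UNIV :: nat set))) borel"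
        by (intro borel_measurable_sum measurable_compose[OF measurable_component_singleton]) auto
      then show "(\<lambda>f. \<Sum>j\<in>J. f (j, i)) \<in> measurable (PiM (J \<times> {i}) (\<lambda>_. count_space (UNIV :: nat set))) (count_space UNIV)"
        by (subst measurable_cong_sets[OF refl sets_borel_eq_count_space[symmetric]])
    qed
    then show ?thesis by (simp cong: sum.cong)
  qed
  have law: "distr M (count_space UNIV) (\<lambda>\<omega>. (\<Sum>j\<in>J. X j t \<omega>) - (\<Sum>j\<in>J. X j s \<omega>))
          = measure_pmf (poisson_pmf (LBINT u:{s..t}. real (card J) * l u))"
    if "s \<in> T" "t \<in> T" "s < t" for s t
  proof -
    have cong: "distr M (count_space UNIV) (\<lambda>\<omega>. (\<Sum>j\<in>J. X j t \<omega>) - (\<Sum>j\<in>J. X j s \<omega>))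
      = distr M (count_space UNIV) (\<lambda>\<omega>. \<Sum>j\<in>J. X j t \<omega> - X j s \<omega>)"
      by (intro distr_cong refl diff) (use that in auto)
    let ?t = "\<lambda>i :: nat. if i = 0 then s else t"
    have tt: "?t i \<in> T" "mono_on {..1} ?t" for i
      using that by (auto simp: mono_on_def)
    have 1: "indep_vars (\<lambda>_. count_space UNIV) (\<lambda>(j, i) \<omega>. X j (?t (Suc i)) \<omega> - X j (?t i) \<omega>) (J \<times> {..<1})"
      by (rule double) (use tt in auto)
    have "indep_vars (\<lambda>_. count_space UNIV) (\<lambda>j \<omega>. X j t \<omega> - X j s \<omega>) J"
    proof -
      let ?D = "\<lambda>x. case x of (j, i) \<Rightarrow> \<lambda>\<omega>. X j (?t (Suc i)) \<omega> - X j (?t i) \<omega>"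
      have 1: "indep_vars (\<lambda>j. PiM {(j, 0)} (\<lambda>_. count_space UNIV))
          (\<lambda>j \<omega>. restrict (\<lambda>x. ?D x \<omega>) {(j, 0 :: nat)}) J"
        by (rule indep_vars_restrict[OF 1, where K = "\<lambda>j. {(j, 0)}"])
          (auto simp: disjoint_family_on_def)
      have "indep_vars (\<lambda>_. count_space UNIV)
          (\<lambda>j \<omega>. (\<lambda>f. f (j, 0)) (restrict (\<lambda>x. ?D x \<omega>) {(j, 0 :: nat)})) J"
        by (rule indep_vars_compose2[OF 1]) (auto intro: measurable_component_singleton)
      then show ?thesis by simp
    qed
    then have "distr M (count_space UNIV) (\<lambda>\<omega>. \<Sum>j\<in>J. X j t \<omega> - X j s \<omega>)
      = measure_pmf (poisson_pmf (real (card J) * (LBINT u:{s..t}. l u)))"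
      by (rule distr_sum_poisson[OF J]) (use D(6) pos that in auto)
    then show ?thesis unfolding cong by simp
  qed
  show ?thesis
    unfolding poisson_process_def
  proof (intro conjI ballI allI impI)
    show "prob_space M" by (rule prob_space_axioms)
    show "(\<lambda>\<omega>. \<Sum>j\<in>J. X j t \<omega>) \<in> measurable M (count_space UNIV)" if "t \<in> T" for t using meas[OF that] .
    fix \<omega> assume \<omega>: "\<omega> \<in> space M"
    show "(\<Sum>j\<in>J. X j 0 \<omega>) = 0" using D(3) \<omega> by auto
    show "mono_on T (\<lambda>t. \<Sum>j\<in>J. X j t \<omega>)"
      using mono \<omega> by (auto simp: mono_on_def intro!: sum_mono)
    show "((\<lambda>s. \<Sum>j\<in>J. X j s \<omega>) \<longlongrightarrow> (\<Sum>j\<in>J. X j t \<omega>)) (at t within T \<inter> {t..})" if "t \<in> T" for t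
      using D(5) \<omega> that by (intro tendsto_sum) auto
  next
    fix s t assume st: "s \<in> T" "t \<in> T" "s < t"
    show "distr M (count_space UNIV) (\<lambda>\<omega>. (\<Sum>j\<in>J. X j t \<omega>) - (\<Sum>j\<in>J. X j s \<omega>))
          = measure_pmf (poisson_pmf (LBINT u:{s..t}. real (card J) * l u))"
      by (rule law[OF st])
  next
    fix t :: "nat \<Rightarrow> real" and k
    assume t: "(\<forall>i\<le>k. t i \<in> T) \<and> mono_on {..k} t"
    have "indep_vars (\<lambda>_. count_space UNIV) (\<lambda>i \<omega>. \<Sum>j\<in>J. X j (t (Suc i)) \<omega> - X j (t i) \<omega>) {..<k}"
      by (rule indep_sum) (use t in auto)
    then show "indep_vars (\<lambda>_. count_space UNIV)
          (\<lambda>i \<omega>. (\<Sum>j\<in>J. X j (t (Suc i)) \<omega>) - (\<Sum>j\<in>J. X j (t i) \<omega>)) {..<k}"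
      by (rule indep_vars_cong_space[rotated]) (use t in \<open>auto simp: diff mono_on_def\<close>)
  qed
qed

lemma poisson_increment_real:
  assumes "poisson_process M T l X" "s \<in> T" "t \<in> T" "s \<le> t" "\<omega> \<in> space M"
  shows "real (X t \<omega> - X s \<omega>) = real (X t \<omega>) - real (X s \<omega>)" and "real (X s \<omega>) \<le> real (X t \<omega>)"
  using poisson_processD(4)[OF assms(1,5)] assms(2-4) by (auto simp: mono_on_def of_nat_diff)

lemma poisson_increment_exp:
  assumes pp: "poisson_process M T l X" and st: "s \<in> T" "t \<in> T" "s \<le> t"
    and pos: "s < t \<Longrightarrow> 0 < (LBINT u:{s..t}. l u)"
  shows "(\<integral>\<^sup>+\<omega>. ennreal (exp (c * (real (X t \<omega>) - real (X s \<omega>)))) \<partial>M)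
       = ennreal (exp ((if s < t then LBINT u:{s..t}. l u else 0) * (exp c - 1)))"
proof (cases "s < t")
  case False
  interpret prob_space M using poisson_processD(1)[OF pp] .
  from False st show ?thesis by (simp add: emeasure_space_1)
next
  case True
  note [measurable] = poisson_processD(2)[OF pp st(1)] poisson_processD(2)[OF pp st(2)]
  have "(\<integral>\<^sup>+\<omega>. ennreal (exp (c * (real (X t \<omega>) - real (X s \<omega>)))) \<partial>M)
     = (\<integral>\<^sup>+\<omega>. ennreal (exp (c * real (X t \<omega> - X s \<omega>))) \<partial>M)"
    by (intro nn_integral_cong) (simp add: poisson_increment_real[OF pp st])
  also have "\<dots> = (\<integral>\<^sup>+k. ennreal (exp (c * real k)) \<partial>distr M (count_space UNIV) (\<lambda>\<omega>. X t \<omega> - X s \<omega>))"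
    by (subst nn_integral_distr) auto
  also have "\<dots> = ennreal (exp ((LBINT u:{s..t}. l u) * (exp c - 1)))"
    unfolding poisson_processD(6)[OF pp st(1,2) True] by (rule nn_integral_poisson_exp[OF pos[OF True]])
  finally show ?thesis using True by simp
qed

text \<open>
  The exponential moment of the integral of a step function: a product over independent increments.
\<close>

lemma poisson_exp_sum:
  assumes pp: "poisson_process M T l X"
    and t: "\<And>i. i \<le> k \<Longrightarrow> t i \<in> T" and mono: "\<And>i. i < k \<Longrightarrow> t i < t (Suc i)"
    and pos: "\<And>i. i < k \<Longrightarrow> 0 < (LBINT u:{t i..t (Suc i)}. l u)"
  shows "(\<integral>\<^sup>+\<omega>. ennreal (exp (\<Sum>i<k. g i * (real (X (t (Suc i)) \<omega>) - real (X (t i) \<omega>)))) \<partial>M)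
       = ennreal (exp (\<Sum>i<k. (LBINT u:{t i..t (Suc i)}. l u) * (exp (g i) - 1)))"
proof -
  interpret prob_space M using poisson_processD(1)[OF pp] .
  have "mono_on {..k} t"
  proof (rule mono_onI)
    fix i j assume "i \<in> {..k}" "j \<in> {..k}" "i \<le> j"
    from \<open>i \<le> j\<close> \<open>j \<in> {..k}\<close> show "t i \<le> t j"
    proof (induction rule: dec_induct)
      case (step n)
      then show ?case using mono[of n] by simp
    qed simp
  qed
  then have "indep_vars (\<lambda>_. count_space UNIV) (\<lambda>i \<omega>. X (t (Suc i)) \<omega> - X (t i) \<omega>) {..<k}"
    by (intro poisson_processD(7)[OF pp] t)
  then have ind: "indep_vars (\<lambda>_. borel) (\<lambda>i \<omega>. ennreal (exp (g i * real (X (t (Suc i)) \<omega> - X (t i) \<omega>)))) {..<k}"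
    by (rule indep_vars_compose2) simp
  have "(\<integral>\<^sup>+\<omega>. ennreal (exp (\<Sum>i<k. g i * (real (X (t (Suc i)) \<omega>) - real (X (t i) \<omega>)))) \<partial>M)
     = (\<integral>\<^sup>+\<omega>. (\<Prod>i<k. ennreal (exp (g i * real (X (t (Suc i)) \<omega> - X (t i) \<omega>)))) \<partial>M)"
  proof (intro nn_integral_cong)
    fix \<omega> assume "\<omega> \<in> space M"
    then have "(\<Sum>i<k. g i * (real (X (t (Suc i)) \<omega>) - real (X (t i) \<omega>)))
        = (\<Sum>i<k. g i * real (X (t (Suc i)) \<omega> - X (t i) \<omega>))"
      using mono by (intro sum.cong refl) (simp add: poisson_increment_real(1)[OF pp t t] less_imp_le)
    then show "ennreal (exp (\<Sum>i<k. g i * (real (X (t (Suc i)) \<omega>) - real (X (t i) \<omega>))))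
        = (\<Prod>i<k. ennreal (exp (g i * real (X (t (Suc i)) \<omega> - X (t i) \<omega>))))"
      by (simp add: exp_sum prod_ennreal)
  qed
  also have "\<dots> = (\<Prod>i<k. \<integral>\<^sup>+\<omega>. ennreal (exp (g i * real (X (t (Suc i)) \<omega> - X (t i) \<omega>))) \<partial>M)"
    by (rule indep_vars_nn_integral[OF _ ind]) auto
  also have "\<dots> = (\<Prod>i<k. ennreal (exp ((LBINT u:{t i..t (Suc i)}. l u) * (exp (g i) - 1))))"
  proof (intro prod.cong refl)
    fix i assume i: "i \<in> {..<k}"
    note [measurable] = poisson_processD(2)[OF pp t, of i] poisson_processD(2)[OF pp t, of "Suc i"]
    have ti: "t i \<in> T" "t (Suc i) \<in> T" "t i < t (Suc i)" using t[of i] t[of "Suc i"] mono[of i] i by auto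
    have "(\<integral>\<^sup>+\<omega>. ennreal (exp (g i * real (X (t (Suc i)) \<omega> - X (t i) \<omega>))) \<partial>M)
      = (\<integral>\<^sup>+\<omega>. ennreal (exp (g i * (real (X (t (Suc i)) \<omega>) - real (X (t i) \<omega>)))) \<partial>M)"
      using ti by (intro nn_integral_cong) (simp add: poisson_increment_real(1)[OF pp])
    also have "\<dots> = ennreal (exp ((LBINT u:{t i..t (Suc i)}. l u) * (exp (g i) - 1)))"
      using poisson_increment_exp[OF pp ti(1,2), of "g i"] ti pos i by auto
    finally show "(\<integral>\<^sup>+\<omega>. ennreal (exp (g i * real (X (t (Suc i)) \<omega> - X (t i) \<omega>))) \<partial>M)
      = ennreal (exp ((LBINT u:{t i..t (Suc i)}. l u) * (exp (g i) - 1)))" .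
  qed
  also have "\<dots> = ennreal (exp (\<Sum>i<k. (LBINT u:{t i..t (Suc i)}. l u) * (exp (g i) - 1)))"
    by (simp add: exp_sum prod_ennreal)
  finally show ?thesis .
qed

section \<open>Integration along a counting path\<close>

definition counting_path :: "real \<Rightarrow> (real \<Rightarrow> nat) \<Rightarrow> bool" where
  "counting_path \<tau> x \<longleftrightarrow> x 0 = 0 \<and> mono_on {0..\<tau>} x \<and>
     (\<forall>t\<in>{0..\<tau>}. (x \<longlongrightarrow> x t) (at t within {0..\<tau>} \<inter> {t..}))"

definition path_integral :: "real \<Rightarrow> (real \<Rightarrow> nat) \<Rightarrow> (real \<Rightarrow> real) \<Rightarrow> real" where
  "path_integral \<tau> x g = (LINT t:{0..\<tau>}|path_measure \<tau> x. g t)"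

lemma poisson_process_counting_path:
  "poisson_process M {0..\<tau>} l X \<Longrightarrow> \<omega> \<in> space M \<Longrightarrow> counting_path \<tau> (\<lambda>t. X t \<omega>)"
  using poisson_processD(3-5)[of M "{0..\<tau>}" l X] unfolding counting_path_def by auto

lemma counting_path_mono:
  "counting_path \<tau> x \<Longrightarrow> 0 \<le> s \<Longrightarrow> s \<le> t \<Longrightarrow> t \<le> \<tau> \<Longrightarrow> x s \<le> x t"
  unfolding counting_path_def mono_on_def by auto

lemma counting_path_sum:
  assumes "\<And>j. j \<in> J \<Longrightarrow> counting_path \<tau> (x j)"
  shows "counting_path \<tau> (\<lambda>t. \<Sum>j\<in>J. x j t)"
  using assms unfolding counting_path_def
  by (auto simp: mono_on_def intro!: sum_mono tendsto_sum)

context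
  fixes \<tau> :: real and x :: "real \<Rightarrow> nat"
  assumes \<tau>: "0 < \<tau>" and x: "counting_path \<tau> x"
begin

text \<open>
  The path, extended by constants, is nondecreasing and right-continuous, as Stieltjes measures require.
\<close>

lemma emeasure_path_measure_Ioc_all:
  assumes "a \<le> b"
  shows "emeasure (path_measure \<tau> x) {a<..b}
       = ennreal (real (x (max 0 (min b \<tau>))) - real (x (max 0 (min a \<tau>))))"
  unfolding path_measure_def
proof (rule emeasure_interval_measure_Ioc[OF assms])
  let ?F = "\<lambda>t. real (x (max 0 (min t \<tau>)))"
  show "?F s \<le> ?F t" if "s \<le> t" for s t
    using counting_path_mono[OF x, of "max 0 (min s \<tau>)" "max 0 (min t \<tau>)"] \<tau> that by auto
  show "continuous (at_right a) ?F" for a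
  proof -
    have "eventually (\<lambda>s. x (max 0 (min s \<tau>)) = x (max 0 (min a \<tau>))) (at_right a)"
    proof (cases "0 \<le> a \<and> a < \<tau>")
      case False
      show ?thesis
      proof (cases "a < 0")
        case True
        then show ?thesis
          by (intro eventually_at_right_less[THEN eventually_mono] eventually_at_rightI[of a 0]) auto
      next
        case False
        with \<open>\<not> (0 \<le> a \<and> a < \<tau>)\<close> have "\<tau> \<le> a" by auto
        then show ?thesis by (intro eventually_at_rightI[of a "a + 1"]) auto
      qed
    next
      case True
      then have "(x \<longlongrightarrow> x a) (at a within {0..\<tau>} \<inter> {a..})"
        using x unfolding counting_path_def by auto
      then have "eventually (\<lambda>s. x s = x a) (at a within {0..\<tau>} \<inter> {a..})"
        by (simp add: tendsto_discrete)
      then obtain d where d: "0 < d" "\<And>s. s \<in> {0..\<tau>} \<inter> {a..} \<Longrightarrow> s \<noteq> a \<Longrightarrow> dist s a < d \<Longrightarrow> x s = x a"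
        unfolding eventually_at by auto
      show ?thesis
        by (rule eventually_at_rightI[of a "min (a + d) \<tau>"]) (use d True in \<open>auto simp: dist_real_def\<close>)
    qed
    then have "eventually (\<lambda>s. ?F s = ?F a) (at_right a)" by eventually_elim simp
    then show ?thesis
      unfolding continuous_within by (rule tendsto_eventually)
  qed
qed

lemma emeasure_path_measure_Ioc:
  assumes "0 \<le> a" "a \<le> b" "b \<le> \<tau>"
  shows "emeasure (path_measure \<tau> x) {a<..b} = ennreal (real (x b) - real (x a))"
  using emeasure_path_measure_Ioc_all[OF assms(2)] assms by (simp add: max_def min_def)

lemma measure_path_measure_Ioc:
  assumes "0 \<le> a" "a \<le> b" "b \<le> \<tau>"
  shows "measure (path_measure \<tau> x) {a<..b} = real (x b) - real (x a)"
  using emeasure_path_measure_Ioc[OF assms] counting_path_mono[OF x assms] by (simp add: measure_def)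

lemma sets_path_measure [simp, measurable_cong]: "sets (path_measure \<tau> x) = sets borel"
  by (simp add: path_measure_def)

lemma space_path_measure [simp]: "space (path_measure \<tau> x) = UNIV"
  by (simp add: path_measure_def)

end

lemma set_integrable_continuous_finite:
  fixes g :: "real \<Rightarrow> real"
  assumes [measurable_cong]: "sets \<mu> = sets borel" and fin: "emeasure \<mu> A < \<infinity>"
    and A: "A \<in> sets borel" "A \<subseteq> {0..\<tau>}" and g: "continuous_on {0..\<tau>} g"
  shows "set_integrable \<mu> A g"
proof -
  have "compact (g ` {0..\<tau>})" using g by (intro compact_continuous_image) auto
  then obtain B where B: "\<And>t. t \<in> {0..\<tau>} \<Longrightarrow> \<bar>g t\<bar> \<le> B"
    using compact_imp_bounded bounded_iff[of "g ` {0..\<tau>}"] by (metis image_eqI real_norm_def)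
  have [measurable]: "A \<in> sets borel" by (rule A)
  have "(\<lambda>t. indicator {0..\<tau>} t *\<^sub>R g t) \<in> borel_measurable borel"
    using g by (intro borel_measurable_continuous_on_indicator) auto
  then have [measurable]: "(\<lambda>t. indicator {0..\<tau>} t * g t) \<in> borel_measurable \<mu>"
    by (simp add: measurable_cong_sets[OF assms(1) refl])
  have "integrable \<mu> (\<lambda>t. indicator A t *\<^sub>R (indicator {0..\<tau>} t *\<^sub>R g t))"
    by (rule integrableI_bounded_set_indicator[where B = B])
      (use fin A B in \<open>auto intro!: AE_I2 split: split_indicator\<close>)
  moreover have "(\<lambda>t. indicator A t *\<^sub>R (indicator {0..\<tau>} t *\<^sub>R g t)) = (\<lambda>t. indicator A t *\<^sub>R g t)"
    using A(2) by (intro ext) (auto split: split_indicator)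
  ultimately show ?thesis unfolding set_integrable_def by metis
qed

lemma UN_Ioc_mono:
  fixes p :: "nat \<Rightarrow> real"
  assumes "mono p"
  shows "(\<Union>i<k. {p i<..p (Suc i)}) = {p 0<..p k}" and "disjoint_family (\<lambda>i. {p i<..p (Suc i)})"
proof -
  show "(\<Union>i<k. {p i<..p (Suc i)}) = {p 0<..p k}"
  proof (induction k)
    case (Suc k)
    have "p 0 \<le> p k" "p k \<le> p (Suc k)" using assms by (auto simp: mono_def)
    then show ?case using Suc by (auto simp: lessThan_Suc)
  qed simp
  show "disjoint_family (\<lambda>i. {p i<..p (Suc i)})"
    unfolding disjoint_family_on_def
  proof (intro ballI impI)
    fix i j :: nat assume "i \<noteq> j"
    then have "p (Suc i) \<le> p j \<or> p (Suc j) \<le> p i"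
      using assms by (cases "i < j") (auto simp: mono_def)
    then show "{p i<..p (Suc i)} \<inter> {p j<..p (Suc j)} = {}" by auto
  qed
qed

lemma riemann_stieltjes_sum_tendsto:
  fixes g :: "real \<Rightarrow> real"
  assumes \<tau>: "0 < \<tau>" and \<mu>[measurable_cong]: "sets \<mu> = sets borel" and fin: "emeasure \<mu> {0<..\<tau>} < \<infinity>"
    and g: "continuous_on {0..\<tau>} g"
  shows "(\<lambda>m. \<Sum>i<Suc m. g (\<tau> * real i / real (Suc m)) *
            measure \<mu> {\<tau> * real i / real (Suc m)<..\<tau> * real (Suc i) / real (Suc m)})
         \<longlonglongrightarrow> (LINT t:{0<..\<tau>}|\<mu>. g t)"
proof (rule LIMSEQ_I)
  fix e :: real assume e: "0 < e"
  let ?T = "measure \<mu> {0<..\<tau>}"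
  define e' where "e' = e / (?T + 1)"
  have e': "0 < e'" using e by (simp add: e'_def add_nonneg_pos)
  have "uniformly_continuous_on {0..\<tau>} g" by (rule compact_uniformly_continuous[OF g]) auto
  then obtain d where d: "0 < d"
    "\<And>s t. s \<in> {0..\<tau>} \<Longrightarrow> t \<in> {0..\<tau>} \<Longrightarrow> dist t s < d \<Longrightarrow> dist (g t) (g s) < e'"
    unfolding uniformly_continuous_on_def using e' by metis
  obtain m0 :: nat where m0: "\<tau> / d < real m0" using reals_Archimedean2 by blast
  show "\<exists>m0. \<forall>m\<ge>m0. norm ((\<Sum>i<Suc m. g (\<tau> * real i / real (Suc m)) *
            measure \<mu> {\<tau> * real i / real (Suc m)<..\<tau> * real (Suc i) / real (Suc m)})
         - (LINT t:{0<..\<tau>}|\<mu>. g t)) < e"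
  proof (intro exI allI impI)
    fix m assume "m \<ge> m0"
    define p where "p = (\<lambda>i. \<tau> * real i / real (Suc m))"
    have "\<tau> / d < real (Suc m)" using m0 \<open>m \<ge> m0\<close> by simp
    then have "\<tau> / real (Suc m) < d"
      using d(1) by (simp add: field_simps del: of_nat_Suc)
    moreover have "p (Suc i) - p i = \<tau> / real (Suc m)" for i
      unfolding p_def diff_divide_distrib[symmetric] by (simp add: algebra_simps)
    ultimately have width: "p (Suc i) - p i < d" for i by simp
    have mono: "mono p" using \<tau> by (auto simp: mono_def p_def intro!: divide_right_mono mult_left_mono)
    have p0: "p 0 = 0" "p (Suc m) = \<tau>" by (auto simp: p_def)
    have rng: "0 \<le> p i" "p i \<le> \<tau>" if "i \<le> Suc m" for i
      using monoD[OF mono, of 0 i] monoD[OF mono, of i "Suc m"] p0 that by auto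
    let ?A = "\<lambda>i. {p i<..p (Suc i)}"
    have sub: "?A i \<subseteq> {0<..\<tau>}" if "i < Suc m" for i
      using rng[of i] rng[of "Suc i"] that by auto
    have finA: "emeasure \<mu> (?A i) < \<infinity>" if "i < Suc m" for i
      using emeasure_mono[OF sub[OF that], of \<mu>] fin by (auto simp: \<mu> intro: le_less_trans)
    have int: "set_integrable \<mu> (?A i) h" if "i < Suc m" "continuous_on {0..\<tau>} h" for i and h :: "real \<Rightarrow> real"
      using finA[OF that(1)] sub[OF that(1)] that(2)
      by (intro set_integrable_continuous_finite[OF \<mu>]) (auto simp: subset_eq less_imp_le)
    have eq: "(LINT t:{0<..\<tau>}|\<mu>. h t) = (\<Sum>i<Suc m. LINT t:?A i|\<mu>. h t)"
      if "continuous_on {0..\<tau>} h" for h :: "real \<Rightarrow> real"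
    proof -
      have "(\<Union>i<Suc m. ?A i) = {0<..\<tau>}" using UN_Ioc_mono(1)[OF mono, of "Suc m"] p0 by simp
      then have "(LINT t:{0<..\<tau>}|\<mu>. h t) = (LINT t:(\<Union>i<Suc m. ?A i)|\<mu>. h t)" by simp
      also have "\<dots> = (\<Sum>i<Suc m. LINT t:?A i|\<mu>. h t)"
        by (rule set_integral_finite_Union)
          (use UN_Ioc_mono(2)[OF mono] int that in \<open>auto simp: disjoint_family_on_def \<mu>\<close>)
      finally show ?thesis .
    qed
    have const: "(LINT t:?A i|\<mu>. c) = c * measure \<mu> (?A i)" if "i < Suc m" for i and c :: real
      using finA[OF that] by (simp add: set_lebesgue_integral_def \<mu>)
    have "norm ((\<Sum>i<Suc m. g (p i) * measure \<mu> (?A i)) - (LINT t:{0<..\<tau>}|\<mu>. g t))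
        = norm (\<Sum>i<Suc m. g (p i) * measure \<mu> (?A i) - (LINT t:?A i|\<mu>. g t))"
      by (simp add: eq[OF g] sum_subtractf)
    also have "\<dots> \<le> (\<Sum>i<Suc m. e' * measure \<mu> (?A i))"
    proof (rule sum_norm_le)
      fix i assume "i \<in> {..<Suc m}"
      then have i: "i < Suc m" by simp
      have bd: "g t \<le> g (p i) + e'" "g (p i) - e' \<le> g t" if "t \<in> ?A i" for t
      proof -
        have "dist t (p i) < d" using width[of i] that by (auto simp: dist_real_def)
        then have "dist (g t) (g (p i)) < e'"
          using d(2)[of "p i" t] rng[of i] rng[of "Suc i"] i that by auto
        then show "g t \<le> g (p i) + e'" "g (p i) - e' \<le> g t" by (auto simp: dist_real_def)
      qed
      have "(LINT t:?A i|\<mu>. g t) \<le> (LINT t:?A i|\<mu>. g (p i) + e')"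
        by (rule set_integral_mono[OF int int]) (use i g bd in auto)
      moreover have "(LINT t:?A i|\<mu>. g (p i) - e') \<le> (LINT t:?A i|\<mu>. g t)"
        by (rule set_integral_mono[OF int int]) (use i g bd in auto)
      ultimately show "norm (g (p i) * measure \<mu> (?A i) - (LINT t:?A i|\<mu>. g t)) \<le> e' * measure \<mu> (?A i)"
        using i by (auto simp: const algebra_simps abs_le_iff)
    qed
    also have "\<dots> = e' * ?T"
    proof -
      have "(\<Sum>i<Suc m. measure \<mu> (?A i)) = ?T"
        using eq[of "\<lambda>_. 1"] fin const[of _ 1] by (simp add: set_lebesgue_integral_def \<mu>)
      then show ?thesis by (simp only: sum_distrib_left[symmetric])
    qed
    also have "\<dots> < e"
    proof -
      have "?T / (?T + 1) < 1" by (simp add: divide_less_eq add_nonneg_pos)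
      then have "e * (?T / (?T + 1)) < e * 1" using e by (intro mult_strict_left_mono)
      then show ?thesis by (simp add: e'_def)
    qed
    finally show "norm ((\<Sum>i<Suc m. g (\<tau> * real i / real (Suc m)) *
            measure \<mu> {\<tau> * real i / real (Suc m)<..\<tau> * real (Suc i) / real (Suc m)})
         - (LINT t:{0<..\<tau>}|\<mu>. g t)) < e"
      unfolding p_def .
  qed
qed

definition stieltjes_sum :: "real \<Rightarrow> nat \<Rightarrow> (real \<Rightarrow> nat) \<Rightarrow> (real \<Rightarrow> real) \<Rightarrow> real" where
  "stieltjes_sum \<tau> m x g = (\<Sum>i<Suc m. g (\<tau> * real i / real (Suc m)) *
     (real (x (\<tau> * real (Suc i) / real (Suc m))) - real (x (\<tau> * real i / real (Suc m)))))"

context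
  fixes \<tau> :: real and x :: "real \<Rightarrow> nat"
  assumes \<tau>: "0 < \<tau>" and x: "counting_path \<tau> x"
begin

text \<open>
  The extended path does not jump at \<open>0\<close>, so the left end point carries no mass.
\<close>

lemma path_integral_Ioc:
  assumes g: "continuous_on {0..\<tau>} g"
  shows "path_integral \<tau> x g = (LINT t:{0<..\<tau>}|path_measure \<tau> x. g t)"
    and "set_integrable (path_measure \<tau> x) {0<..\<tau>} g"
proof -
  note sets = sets_path_measure[OF \<tau> x]
  have "emeasure (path_measure \<tau> x) {0} \<le> emeasure (path_measure \<tau> x) {-1<..0}"
    by (rule emeasure_mono) (auto simp: sets)
  also have "\<dots> = 0" using emeasure_path_measure_Ioc_all[OF \<tau> x, of "-1" 0] \<tau> by simp
  finally have "{0} \<in> null_sets (path_measure \<tau> x)" by (auto simp: null_sets_def sets)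
  then have ae: "AE t in path_measure \<tau> x. t \<noteq> 0"
    using AE_not_in by force
  have "emeasure (path_measure \<tau> x) {0..\<tau>} \<le> emeasure (path_measure \<tau> x) {-1<..\<tau>}"
    by (rule emeasure_mono) (auto simp: sets)
  also have "\<dots> < \<infinity>" using emeasure_path_measure_Ioc_all[OF \<tau> x, of "-1" \<tau>] \<tau> by simp
  finally have fin: "emeasure (path_measure \<tau> x) {0..\<tau>} < \<infinity>" .
  have fin': "emeasure (path_measure \<tau> x) {0<..\<tau>} < \<infinity>"
    using emeasure_path_measure_Ioc[OF \<tau> x, of 0 \<tau>] \<tau> by simp
  have 1: "set_integrable (path_measure \<tau> x) {0..\<tau>} g"
    by (rule set_integrable_continuous_finite[OF sets fin _ _ g]) auto
  show 2: "set_integrable (path_measure \<tau> x) {0<..\<tau>} g"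
    by (rule set_integrable_continuous_finite[OF sets fin' _ _ g]) auto
  show "path_integral \<tau> x g = (LINT t:{0<..\<tau>}|path_measure \<tau> x. g t)"
    unfolding path_integral_def set_lebesgue_integral_def
    by (rule integral_cong_AE)
      (use 1 2 ae in \<open>auto simp: set_integrable_def split: split_indicator elim!: eventually_mono\<close>)
qed

lemma stieltjes_sum_tendsto:
  assumes g: "continuous_on {0..\<tau>} g"
  shows "(\<lambda>m. stieltjes_sum \<tau> m x g) \<longlonglongrightarrow> path_integral \<tau> x g"
proof -
  have fin': "emeasure (path_measure \<tau> x) {0<..\<tau>} < \<infinity>"
    using emeasure_path_measure_Ioc[OF \<tau> x, of 0 \<tau>] \<tau> by simp
  have *: "measure (path_measure \<tau> x) {\<tau> * real i / real (Suc m)<..\<tau> * real (Suc i) / real (Suc m)}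
     = real (x (\<tau> * real (Suc i) / real (Suc m))) - real (x (\<tau> * real i / real (Suc m)))"
    if "i < Suc m" for i m
    by (rule measure_path_measure_Ioc[OF \<tau> x]) (use \<tau> that in \<open>auto simp: field_simps\<close>)
  have "stieltjes_sum \<tau> m x g = (\<Sum>i<Suc m. g (\<tau> * real i / real (Suc m)) * measure (path_measure \<tau> x)
      {\<tau> * real i / real (Suc m)<..\<tau> * real (Suc i) / real (Suc m)})" for m
    unfolding stieltjes_sum_def by (rule sum.cong[OF refl]) (simp only: * lessThan_iff)
  then show ?thesis
    using riemann_stieltjes_sum_tendsto[OF \<tau> sets_path_measure[OF \<tau> x] fin' g]
    unfolding path_integral_Ioc(1)[OF g] by simp
qed

text \<open>
  The integral of a step function is a combination of increments of the path. The list \<open>L\<close> allows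
  overlapping steps, such as those produced by two ramps.
\<close>

lemma path_integral_le_step:
  assumes g: "continuous_on {0..\<tau>} g"
    and L: "\<And>c a b. (c, a, b) \<in> set L \<Longrightarrow> 0 \<le> a \<and> a \<le> b \<and> b \<le> \<tau>"
    and le: "\<And>t. 0 < t \<Longrightarrow> t \<le> \<tau> \<Longrightarrow> g t \<le> (\<Sum>(c, a, b)\<leftarrow>L. c * indicator {a<..b} t)"
  shows "path_integral \<tau> x g \<le> (\<Sum>(c, a, b)\<leftarrow>L. c * (real (x b) - real (x a)))"
proof -
  let ?M = "path_measure \<tau> x"
  note [measurable_cong] = sets_path_measure[OF \<tau> x]
  have step: "integrable ?M (\<lambda>t. \<Sum>(c, a, b)\<leftarrow>L. c * indicator {a<..b} t :: real)
     \<and> (LINT t|?M. (\<Sum>(c, a, b)\<leftarrow>L. c * indicator {a<..b} t)) = (\<Sum>(c, a, b)\<leftarrow>L. c * (real (x b) - real (x a)))"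
    using L
  proof (induction L)
    case (Cons y L)
    obtain c a b where y: "y = (c, a, b)" by (cases y)
    have ab: "0 \<le> a" "a \<le> b" "b \<le> \<tau>" using Cons.prems[of c a b] y by auto
    have i: "integrable ?M (\<lambda>t. c * indicator {a<..b} t :: real)"
      using emeasure_path_measure_Ioc[OF \<tau> x ab] by (intro integrable_mult_right) (auto simp: less_top)
    have "(LINT t|?M. c * indicator {a<..b} t) = c * (real (x b) - real (x a))"
      using measure_path_measure_Ioc[OF \<tau> x ab] by simp
    moreover have IH: "integrable ?M (\<lambda>t. \<Sum>(c, a, b)\<leftarrow>L. c * indicator {a<..b} t :: real)"
      "(LINT t|?M. (\<Sum>(c, a, b)\<leftarrow>L. c * indicator {a<..b} t)) = (\<Sum>(c, a, b)\<leftarrow>L. c * (real (x b) - real (x a)))"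
      using Cons.IH Cons.prems by auto
    ultimately show ?case
      using Bochner_Integration.integral_add[OF i IH(1)] Bochner_Integration.integrable_add[OF i IH(1)]
      by (simp add: y)
  qed simp
  have "path_integral \<tau> x g = (LINT t:{0<..\<tau>}|?M. g t)" by (rule path_integral_Ioc[OF g])
  also have "\<dots> \<le> (LINT t:{0<..\<tau>}|?M. (\<Sum>(c, a, b)\<leftarrow>L. c * indicator {a<..b} t))"
  proof (rule set_integral_mono[OF path_integral_Ioc(2)[OF g]])
    show "set_integrable ?M {0<..\<tau>} (\<lambda>t. \<Sum>(c, a, b)\<leftarrow>L. c * indicator {a<..b} t :: real)"
      unfolding set_integrable_def by (rule integrable_mult_indicator) (use step in auto)
  qed (use le in auto)
  also have "\<dots> = (LINT t|?M. (\<Sum>(c, a, b)\<leftarrow>L. c * indicator {a<..b} t))"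
    unfolding set_lebesgue_integral_def
  proof (intro Bochner_Integration.integral_cong refl)
    fix t :: real
    show "indicator {0<..\<tau>} t *\<^sub>R (\<Sum>(c, a, b)\<leftarrow>L. c * indicator {a<..b} t)
        = (\<Sum>(c, a, b)\<leftarrow>L. c * indicator {a<..b} t)"
    proof (cases "t \<in> {0<..\<tau>}")
      case False
      have "map (\<lambda>(c, a, b). c * indicator {a<..b} t) L = map (\<lambda>_. 0 :: real) L"
        using L False by (intro map_cong refl) (force split: split_indicator)
      then have "(\<Sum>(c, a, b)\<leftarrow>L. c * indicator {a<..b} t) = (\<Sum>_\<leftarrow>L. 0 :: real)"
        by (rule arg_cong[where f = sum_list])
      then show ?thesis using False by simp
    qed simp
  qed
  finally show ?thesis using step by simp
qed

end

lemma path_integral_cong: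
  "(\<And>t. t \<in> {0..\<tau>} \<Longrightarrow> g t = h t) \<Longrightarrow> path_integral \<tau> x g = path_integral \<tau> x h"
  unfolding path_integral_def set_lebesgue_integral_def
  by (intro Bochner_Integration.integral_cong refl) (auto split: split_indicator)

lemma path_integral_sum:
  assumes \<tau>: "0 < \<tau>" and x: "\<And>j. j \<in> J \<Longrightarrow> counting_path \<tau> (x j)" and g: "continuous_on {0..\<tau>} g"
  shows "(\<Sum>j\<in>J. path_integral \<tau> (x j) g) = path_integral \<tau> (\<lambda>t. \<Sum>j\<in>J. x j t) g"
proof (rule LIMSEQ_unique)
  show "(\<lambda>m. stieltjes_sum \<tau> m (\<lambda>t. \<Sum>j\<in>J. x j t) g) \<longlonglongrightarrow> path_integral \<tau> (\<lambda>t. \<Sum>j\<in>J. x j t) g"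
    by (rule stieltjes_sum_tendsto[OF \<tau> counting_path_sum[OF x] g])
  have "stieltjes_sum \<tau> m (\<lambda>t. \<Sum>j\<in>J. x j t) g = (\<Sum>j\<in>J. stieltjes_sum \<tau> m (x j) g)" for m
    unfolding stieltjes_sum_def sum.swap[of _ _ J]
    by (simp add: sum_subtractf[symmetric] sum_distrib_left)
  then show "(\<lambda>m. stieltjes_sum \<tau> m (\<lambda>t. \<Sum>j\<in>J. x j t) g) \<longlonglongrightarrow> (\<Sum>j\<in>J. path_integral \<tau> (x j) g)"
    by (simp add: tendsto_sum stieltjes_sum_tendsto[OF \<tau> x g])
qed

lemma path_integral_diff:
  assumes \<tau>: "0 < \<tau>" and x: "counting_path \<tau> x"
    and g: "continuous_on {0..\<tau>} g" and h: "continuous_on {0..\<tau>} h"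
  shows "path_integral \<tau> x (\<lambda>t. g t - h t) = path_integral \<tau> x g - path_integral \<tau> x h"
  unfolding path_integral_Ioc(1)[OF \<tau> x g] path_integral_Ioc(1)[OF \<tau> x h]
    path_integral_Ioc(1)[OF \<tau> x continuous_on_diff[OF g h]]
  by (rule set_integral_diff(2)[OF path_integral_Ioc(2)[OF \<tau> x g] path_integral_Ioc(2)[OF \<tau> x h]])

lemma stieltjes_sum_measurable:
  assumes pp: "poisson_process M {0..\<tau>} l S" and \<tau>: "0 < \<tau>"
    and [measurable]: "\<And>t. t \<in> {0..\<tau>} \<Longrightarrow> (\<lambda>v. g v t) \<in> borel_measurable N"
  shows "(\<lambda>(\<omega>, v). stieltjes_sum \<tau> m (\<lambda>t. S t \<omega>) (g v)) \<in> borel_measurable (M \<Otimes>\<^sub>M N)"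
proof -
  have p: "\<tau> * real i / real (Suc m) \<in> {0..\<tau>}" if "i \<le> Suc m" for i
  proof -
    have "\<tau> * real i \<le> \<tau> * real (Suc m)" using \<tau> that by (intro mult_left_mono) auto
    then show ?thesis using \<tau> by (auto simp: divide_le_eq simp del: of_nat_Suc)
  qed
  have S: "(\<lambda>x. real (S (\<tau> * real i / real (Suc m)) (fst x))) \<in> borel_measurable (M \<Otimes>\<^sub>M N)" if "i \<le> Suc m" for i
    using poisson_processD(2)[OF pp p[OF that]] by measurable
  have g: "(\<lambda>x. g (snd x) (\<tau> * real i / real (Suc m))) \<in> borel_measurable (M \<Otimes>\<^sub>M N)" if "i \<le> Suc m" for i
    using p[OF that] by measurable
  show ?thesis unfolding stieltjes_sum_def split_beta
    by (intro borel_measurable_sum borel_measurable_times borel_measurable_diff S g) auto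
qed

text \<open>
  Riemann--Stieltjes sums involve the path at finitely many times only. This is what makes path
  integrals measurable, jointly in the trajectory and in a parameter of the integrand.
\<close>

lemma path_integral_joint_measurable:
  assumes pp: "poisson_process M {0..\<tau>} l S" and \<tau>: "0 < \<tau>"
    and g: "\<And>v. v \<in> space N \<Longrightarrow> continuous_on {0..\<tau>} (g v)"
    and [measurable]: "\<And>t. t \<in> {0..\<tau>} \<Longrightarrow> (\<lambda>v. g v t) \<in> borel_measurable N"
  shows "(\<lambda>(\<omega>, v). path_integral \<tau> (\<lambda>t. S t \<omega>) (g v)) \<in> borel_measurable (M \<Otimes>\<^sub>M N)"
proof (rule borel_measurable_LIMSEQ_metric)
  show "(\<lambda>(\<omega>, v). stieltjes_sum \<tau> m (\<lambda>t. S t \<omega>) (g v)) \<in> borel_measurable (M \<Otimes>\<^sub>M N)" for m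
    by (rule stieltjes_sum_measurable[OF pp \<tau>]) measurable
  fix x assume "x \<in> space (M \<Otimes>\<^sub>M N)"
  then have "fst x \<in> space M" "snd x \<in> space N" by (auto simp: space_pair_measure)
  then show "(\<lambda>m. case x of (\<omega>, v) \<Rightarrow> stieltjes_sum \<tau> m (\<lambda>t. S t \<omega>) (g v))
      \<longlonglongrightarrow> (case x of (\<omega>, v) \<Rightarrow> path_integral \<tau> (\<lambda>t. S t \<omega>) (g v))"
    using stieltjes_sum_tendsto[OF \<tau> poisson_process_counting_path[OF pp] g] by (simp add: split_beta)
qed

lemma path_integral_measurable:
  assumes pp: "poisson_process M {0..\<tau>} l S" and \<tau>: "0 < \<tau>" and g: "continuous_on {0..\<tau>} g"
  shows "(\<lambda>\<omega>. path_integral \<tau> (\<lambda>t. S t \<omega>) g) \<in> borel_measurable M"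
proof -
  have "(\<lambda>(\<omega>, v :: unit). path_integral \<tau> (\<lambda>t. S t \<omega>) g) \<in> borel_measurable (M \<Otimes>\<^sub>M count_space UNIV)"
    by (rule path_integral_joint_measurable[OF pp \<tau>]) (use g in auto)
  from measurable_compose[OF _ this, of "\<lambda>\<omega>. (\<omega>, ())" M] show ?thesis by simp
qed

text \<open>
  For a step function \<open>g\<close> the exponential moment is a product over independent increments; a
  continuous \<open>g\<close> is reached along its Riemann--Stieltjes sums. Fatou's lemma gives the inequality,
  which is the direction that upper bounds on likelihood ratios require.
\<close>

lemma poisson_process_exp_integral_le:
  assumes pp: "poisson_process M {0..\<tau>} l S" and \<tau>: "0 < \<tau>"
    and l: "continuous_on {0..\<tau>} l" and l_pos: "\<And>t. t \<in> {0..\<tau>} \<Longrightarrow> 0 < l t"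
    and g: "continuous_on {0..\<tau>} g"
  shows "(\<integral>\<^sup>+\<omega>. ennreal (exp (path_integral \<tau> (\<lambda>t. S t \<omega>) g)) \<partial>M)
     \<le> ennreal (exp (LBINT t:{0..\<tau>}. (exp (g t) - 1) * l t))"
proof -
  have S[measurable]: "S t \<in> measurable M (count_space UNIV)" if "t \<in> {0..\<tau>}" for t
    using poisson_processD(2)[OF pp] that by auto
  define p where "p m i = \<tau> * real i / real (Suc m)" for m i
  have p: "p m i \<in> {0..\<tau>}" if "i \<le> Suc m" for m i
  proof -
    have "\<tau> * real i \<le> \<tau> * real (Suc m)" using \<tau> that by (intro mult_left_mono) auto
    then show ?thesis using \<tau> by (auto simp: p_def divide_le_eq simp del: of_nat_Suc)
  qed
  have pS: "p m i < p m (Suc i)" for m i unfolding p_def using \<tau> by (intro divide_strict_right_mono mult_strict_left_mono) auto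
  have sum_meas: "(\<lambda>\<omega>. stieltjes_sum \<tau> m (\<lambda>t. S t \<omega>) g) \<in> borel_measurable M" for m
  proof -
    have [measurable]: "(\<lambda>\<omega>. real (S (p m i) \<omega>)) \<in> borel_measurable M" if "i \<le> Suc m" for i
      using p that by measurable
    show ?thesis unfolding stieltjes_sum_def p_def[symmetric]
      by (intro borel_measurable_sum borel_measurable_times borel_measurable_diff) auto
  qed
  have int_l: "set_integrable lborel {a..b} l" if "{a..b} \<subseteq> {0..\<tau>}" for a b
    by (rule borel_integrable_atLeastAtMost') (rule continuous_on_subset[OF l that])
  let ?\<mu> = "density lborel (\<lambda>t. ennreal (indicator {0<..\<tau>} t * l t))"
  have l_meas[measurable]: "(\<lambda>t. indicator {0<..\<tau>} t * l t) \<in> borel_measurable borel"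
  proof -
    have "(\<lambda>t. indicator {0<..\<tau>} t * (indicator {0..\<tau>} t *\<^sub>R l t)) \<in> borel_measurable borel"
      using l by (intro borel_measurable_times borel_measurable_continuous_on_indicator) auto
    moreover have "(\<lambda>t. indicator {0<..\<tau>} t * (indicator {0..\<tau>} t *\<^sub>R l t)) = (\<lambda>t. indicator {0<..\<tau>} t * l t)"
      by (intro ext) (auto split: split_indicator)
    ultimately show ?thesis by metis
  qed
  have em: "emeasure ?\<mu> {a<..b} = ennreal (LBINT t:{a..b}. l t)" and lpos: "a < b \<Longrightarrow> 0 < (LBINT t:{a..b}. l t)"
    if ab: "0 \<le> a" "a \<le> b" "b \<le> \<tau>" for a b
  proof -
    have "emeasure ?\<mu> {a<..b} = (\<integral>\<^sup>+t. ennreal (indicator {0<..\<tau>} t * l t) * indicator {a<..b} t \<partial>lborel)"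
      by (rule emeasure_density) measurable
    also have "\<dots> = (\<integral>\<^sup>+t. ennreal (indicator {a..b} t * l t) \<partial>lborel)"
    proof (rule nn_integral_cong_AE)
      have "AE t in lborel. t \<noteq> a" by (rule AE_lborel_singleton)
      then show "AE t in lborel. ennreal (indicator {0<..\<tau>} t * l t) * indicator {a<..b} t = ennreal (indicator {a..b} t * l t)"
      proof eventually_elim
        case (elim t)
        then show ?case using ab by (cases "t \<in> {a<..b}") (auto simp: indicator_def)
      qed
    qed
    also have "\<dots> = ennreal (\<integral>t. indicator {a..b} t * l t \<partial>lborel)"
    proof (rule nn_integral_eq_integral)
      show "integrable lborel (\<lambda>t. indicator {a..b} t * l t)"
        using int_l[of a b] ab by (simp add: set_integrable_def)
      show "AE t in lborel. 0 \<le> indicator {a..b} t * l t"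
        using l_pos ab by (intro AE_I2) (auto simp: indicator_def less_imp_le)
    qed
    also have "\<dots> = ennreal (LBINT t:{a..b}. l t)"
      by (simp add: set_lebesgue_integral_def)
    finally show "emeasure ?\<mu> {a<..b} = ennreal (LBINT t:{a..b}. l t)" .
    assume "a < b"
    have "continuous_on {a..b} l" by (rule continuous_on_subset[OF l]) (use ab in auto)
    then obtain c where c: "c \<in> {a..b}" "\<And>t. t \<in> {a..b} \<Longrightarrow> l c \<le> l t"
      using continuous_attains_inf[of "{a..b}" l] ab by auto
    have "0 < l c * (b - a)"
      using l_pos[of c] c(1) ab \<open>a < b\<close> by (intro mult_pos_pos) auto
    also have "l c * (b - a) = (LBINT t:{a..b}. l c)"
      using ab by (simp add: set_lebesgue_integral_def)
    also have "\<dots> \<le> (LBINT t:{a..b}. l t)"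
    proof (rule set_integral_mono)
      show "set_integrable lborel {a..b} (\<lambda>t. l c)"
        by (rule borel_integrable_atLeastAtMost') (rule continuous_on_const)
    qed (use c int_l[of a b] ab in auto)
    finally show "0 < (LBINT t:{a..b}. l t)" .
  qed
  have ms: "measure ?\<mu> {a<..b} = (LBINT t:{a..b}. l t)" if ab: "0 \<le> a" "a < b" "b \<le> \<tau>" for a b
    using em[of a b] lpos[of a b] ab by (simp add: measure_def)
  have moment: "(\<integral>\<^sup>+\<omega>. ennreal (exp (stieltjes_sum \<tau> m (\<lambda>t. S t \<omega>) g)) \<partial>M)
     = ennreal (exp (\<Sum>i<Suc m. (exp (g (p m i)) - 1) * measure ?\<mu> {p m i<..p m (Suc i)}))" for m
  proof -
    have "(\<integral>\<^sup>+\<omega>. ennreal (exp (stieltjes_sum \<tau> m (\<lambda>t. S t \<omega>) g)) \<partial>M)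
      = ennreal (exp (\<Sum>i<Suc m. (LBINT t:{p m i..p m (Suc i)}. l t) * (exp (g (p m i)) - 1)))"
      unfolding stieltjes_sum_def p_def[symmetric]
    proof (rule poisson_exp_sum[OF pp, where t = "p m" and k = "Suc m"])
      fix i assume i: "i < Suc m"
      show "p m i < p m (Suc i)" by (rule pS)
      show "0 < (LBINT t:{p m i..p m (Suc i)}. l t)"
        using p[of i m] p[of "Suc i" m] pS[of m i] i by (intro lpos) auto
    qed (rule p)
    also have "(\<Sum>i<Suc m. (LBINT t:{p m i..p m (Suc i)}. l t) * (exp (g (p m i)) - 1))
       = (\<Sum>i<Suc m. (exp (g (p m i)) - 1) * measure ?\<mu> {p m i<..p m (Suc i)})"
    proof (rule sum.cong[OF refl])
      fix i assume "i \<in> {..<Suc m}"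
      then show "(LBINT t:{p m i..p m (Suc i)}. l t) * (exp (g (p m i)) - 1)
         = (exp (g (p m i)) - 1) * measure ?\<mu> {p m i<..p m (Suc i)}"
        using ms[of "p m i" "p m (Suc i)"] p[of i m] p[of "Suc i" m] pS[of m i] by simp
    qed
    finally show ?thesis .
  qed
  have lim: "(\<lambda>m. \<Sum>i<Suc m. (exp (g (p m i)) - 1) * measure ?\<mu> {p m i<..p m (Suc i)})
     \<longlonglongrightarrow> (LINT t:{0<..\<tau>}|?\<mu>. exp (g t) - 1)"
    unfolding p_def
    by (rule riemann_stieltjes_sum_tendsto[OF \<tau>])
      (use em[of 0 \<tau>] \<tau> g in \<open>auto intro!: continuous_intros\<close>)
  have eq: "(LINT t:{0<..\<tau>}|?\<mu>. exp (g t) - 1) = (LBINT t:{0..\<tau>}. (exp (g t) - 1) * l t)"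
  proof -
    have gm[measurable]: "(\<lambda>t. indicator {0<..\<tau>} t * (exp (g t) - 1)) \<in> borel_measurable borel"
    proof -
      have "(\<lambda>t. indicator {0<..\<tau>} t * (indicator {0..\<tau>} t *\<^sub>R (exp (g t) - 1))) \<in> borel_measurable borel"
        using g by (intro borel_measurable_times borel_measurable_continuous_on_indicator) (auto intro!: continuous_intros)
      moreover have "(\<lambda>t. indicator {0<..\<tau>} t * (indicator {0..\<tau>} t *\<^sub>R (exp (g t) - 1)))
          = (\<lambda>t. indicator {0<..\<tau>} t * (exp (g t) - 1))"
        by (intro ext) (auto split: split_indicator)
      ultimately show ?thesis by metis
    qed
    have "(LINT t:{0<..\<tau>}|?\<mu>. exp (g t) - 1)
       = (LINT t|lborel. (indicator {0<..\<tau>} t * l t) *\<^sub>R (indicator {0<..\<tau>} t *\<^sub>R (exp (g t) - 1)))"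
      unfolding set_lebesgue_integral_def
      by (rule integral_density) (use l_pos in \<open>auto intro!: AE_I2 simp: less_imp_le split: split_indicator\<close>)
    also have "\<dots> = (LBINT t:{0..\<tau>}. (exp (g t) - 1) * l t)"
      unfolding set_lebesgue_integral_def
    proof (rule integral_cong_AE)
      show "(\<lambda>t. indicator {0..\<tau>} t *\<^sub>R ((exp (g t) - 1) * l t)) \<in> borel_measurable lborel"
        using g l by (intro borel_measurable_integrable[OF borel_integrable_atLeastAtMost'[unfolded set_integrable_def]])
          (auto intro!: continuous_intros)
      have "AE t in lborel. t \<noteq> (0 :: real)" by (rule AE_lborel_singleton)
      then show "AE t in lborel. (indicator {0<..\<tau>} t * l t) *\<^sub>R (indicator {0<..\<tau>} t *\<^sub>R (exp (g t) - 1))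
          = indicator {0..\<tau>} t *\<^sub>R ((exp (g t) - 1) * l t)"
        by eventually_elim (auto simp: indicator_def)
      show "(\<lambda>t. (indicator {0<..\<tau>} t * l t) *\<^sub>R (indicator {0<..\<tau>} t *\<^sub>R (exp (g t) - 1))) \<in> borel_measurable lborel"
        using borel_measurable_times[OF l_meas gm] by simp
    qed
    finally show ?thesis .
  qed
  have "(\<integral>\<^sup>+\<omega>. ennreal (exp (path_integral \<tau> (\<lambda>t. S t \<omega>) g)) \<partial>M)
     = (\<integral>\<^sup>+\<omega>. liminf (\<lambda>m. ennreal (exp (stieltjes_sum \<tau> m (\<lambda>t. S t \<omega>) g))) \<partial>M)"
  proof (intro nn_integral_cong lim_imp_Liminf[symmetric])
    fix \<omega> assume "\<omega> \<in> space M"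
    then show "(\<lambda>m. ennreal (exp (stieltjes_sum \<tau> m (\<lambda>t. S t \<omega>) g))) \<longlonglongrightarrow> ennreal (exp (path_integral \<tau> (\<lambda>t. S t \<omega>) g))"
      by (intro tendsto_ennrealI tendsto_exp stieltjes_sum_tendsto[OF \<tau> _ g] poisson_process_counting_path[OF pp])
  qed simp
  also have "\<dots> \<le> liminf (\<lambda>m. \<integral>\<^sup>+\<omega>. ennreal (exp (stieltjes_sum \<tau> m (\<lambda>t. S t \<omega>) g)) \<partial>M)"
    using sum_meas by (intro nn_integral_liminf) auto
  also have "\<dots> = ennreal (exp (LBINT t:{0..\<tau>}. (exp (g t) - 1) * l t))"
    unfolding moment using lim eq by (intro lim_imp_Liminf tendsto_ennrealI tendsto_exp) auto
  finally show ?thesis .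
qed

section \<open>The log-likelihood of the ramp model\<close>

definition ramp :: "real \<Rightarrow> real" where
  "ramp x = max 0 (min 1 x)"

locale ramp_model =
  fixes \<psi> :: "real \<Rightarrow> real" and r \<tau> lo hi :: real
  assumes \<tau>_pos: "0 < \<tau>" and r_nz: "r \<noteq> 0" and lo_pos: "0 < lo"
    and cont_\<psi>: "continuous_on {0..\<tau>} \<psi>"
    and \<psi>_bounds: "\<And>t. t \<in> {0..\<tau>} \<Longrightarrow> lo \<le> \<psi> t \<and> \<psi> t \<le> hi \<and> lo \<le> \<psi> t + r \<and> \<psi> t + r \<le> hi"
begin

text \<open>
  The intensity with its three pieces written as one clipped linear function, which is visibly continuous.
\<close>

definition lam :: "real \<Rightarrow> real \<Rightarrow> real \<Rightarrow> real" where
  "lam d \<theta> t = \<psi> t + r * ramp ((t - \<theta>) / d)"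

definition loglik :: "real \<Rightarrow> nat \<Rightarrow> (real \<Rightarrow> nat) \<Rightarrow> real \<Rightarrow> real" where
  "loglik d n x \<theta> = path_integral \<tau> x (\<lambda>t. ln (lam d \<theta> t)) - real n * (LBINT t:{0..\<tau>}. lam d \<theta> t - 1)"

definition log_jump :: "real \<Rightarrow> real" where
  "log_jump t = ln ((\<psi> t + r) / \<psi> t)"

definition log_range :: real where
  "log_range = ln (hi / lo)"

lemma lo_le_hi: "lo \<le> hi"
  using \<psi>_bounds[of 0] \<tau>_pos by force

lemma hi_pos: "0 < hi"
  using lo_le_hi lo_pos by linarith

lemma log_range_nonneg: "0 \<le> log_range"
  using lo_le_hi lo_pos by (simp add: log_range_def)

lemma ramp_bounds: "0 \<le> ramp x" "ramp x \<le> 1"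
  by (auto simp: ramp_def)

lemma lam_before: "0 < d \<Longrightarrow> t \<le> \<theta> \<Longrightarrow> lam d \<theta> t = \<psi> t"
  using divide_nonpos_pos[of "t - \<theta>" d] by (simp add: lam_def ramp_def)

lemma lam_after: "0 < d \<Longrightarrow> \<theta> + d \<le> t \<Longrightarrow> lam d \<theta> t = \<psi> t + r"
  by (simp add: lam_def ramp_def max_def min_def field_simps)

lemma lam_bounds:
  assumes "t \<in> {0..\<tau>}"
  shows "min (\<psi> t) (\<psi> t + r) \<le> lam d \<theta> t" and "lam d \<theta> t \<le> max (\<psi> t) (\<psi> t + r)"
    and "lo \<le> lam d \<theta> t" and "lam d \<theta> t \<le> hi" and "0 < lam d \<theta> t"
proof -
  let ?R = "ramp ((t - \<theta>) / d)"
  have "0 \<le> r * ?R \<and> r * ?R \<le> r \<or> r \<le> r * ?R \<and> r * ?R \<le> 0"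
    using ramp_bounds[of "(t - \<theta>) / d"]
    by (cases "0 \<le> r") (auto simp: mult_le_0_iff mult_left_le mult_le_cancel_left1)
  then show 1: "min (\<psi> t) (\<psi> t + r) \<le> lam d \<theta> t" "lam d \<theta> t \<le> max (\<psi> t) (\<psi> t + r)"
    by (auto simp: lam_def)
  then show "lo \<le> lam d \<theta> t" "lam d \<theta> t \<le> hi" "0 < lam d \<theta> t"
    using \<psi>_bounds[OF assms] lo_pos by auto
qed

lemma intensity_eq_lam:
  assumes "0 < d" "t \<in> {0..\<tau>}"
  shows "intensity \<psi> r \<tau> d \<theta> t = lam d \<theta> t"
  using assms by (auto simp: intensity_def lam_def ramp_def indicator_def max_def min_def field_simps)

lemma continuous_on_lam: "0 < d \<Longrightarrow> continuous_on {0..\<tau>} (lam d \<theta>)"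
  unfolding lam_def[abs_def] ramp_def by (intro continuous_intros cont_\<psi>) auto

lemma continuous_on_ln_lam: "0 < d \<Longrightarrow> continuous_on {0..\<tau>} (\<lambda>t. ln (lam d \<theta> t))"
  by (intro continuous_on_ln continuous_on_lam) (auto dest: lam_bounds(5)[of _ d \<theta>])

lemma set_integrable_lam: "0 < d \<Longrightarrow> set_integrable lborel {0..\<tau>} (lam d \<theta>)"
  by (intro borel_integrable_atLeastAtMost' continuous_on_lam)

text \<open>
  The sum of the observed paths is sufficient.
\<close>

lemma likelihood_eq_exp_loglik:
  assumes d: "0 < d" and x: "\<And>j. j \<in> {1..n} \<Longrightarrow> counting_path \<tau> (x j)"
  shows "likelihood \<psi> r \<tau> d n \<theta> x = exp (loglik d n (\<lambda>t. \<Sum>j=1..n. x j t) \<theta>)"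
proof -
  have "(LINT t:{0..\<tau>}|path_measure \<tau> (x j). ln (intensity \<psi> r \<tau> d \<theta> t))
      = path_integral \<tau> (x j) (\<lambda>t. ln (lam d \<theta> t))" for j
    unfolding path_integral_def[symmetric] by (rule path_integral_cong) (simp add: intensity_eq_lam[OF d])
  moreover have "(LBINT t:{0..\<tau>}. intensity \<psi> r \<tau> d \<theta> t - 1) = (LBINT t:{0..\<tau>}. lam d \<theta> t - 1)"
    unfolding set_lebesgue_integral_def
    by (intro Bochner_Integration.integral_cong refl) (auto simp: intensity_eq_lam[OF d] indicator_def)
  ultimately show ?thesis
    using path_integral_sum[OF \<tau>_pos x continuous_on_ln_lam[OF d], of "{1..n}" "\<lambda>j. j"]
    by (simp add: likelihood_def loglik_def)
qed

lemma abs_log_jump_le: "t \<in> {0..\<tau>} \<Longrightarrow> \<bar>log_jump t\<bar> \<le> log_range"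
proof -
  assume t: "t \<in> {0..\<tau>}"
  have b: "lo \<le> \<psi> t" "\<psi> t \<le> hi" "lo \<le> \<psi> t + r" "\<psi> t + r \<le> hi" using \<psi>_bounds[OF t] by auto
  then have "log_jump t = ln (\<psi> t + r) - ln (\<psi> t)" using lo_pos by (simp add: log_jump_def ln_div)
  moreover have "log_range = ln hi - ln lo" using lo_pos hi_pos by (simp add: log_range_def ln_div)
  moreover have "ln lo \<le> ln (\<psi> t)" "ln (\<psi> t) \<le> ln hi" "ln lo \<le> ln (\<psi> t + r)" "ln (\<psi> t + r) \<le> ln hi"
    using b lo_pos by (auto simp: ln_le_cancel_iff)
  ultimately show ?thesis by linarith
qed

text \<open>
  Off the window \<open>(\<theta>, \<theta> + d]\<close> the log-intensity is that of a clean jump at \<open>\<theta>\<close>; inside it the ramp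
  stays between the two levels, so the error is at most one log-jump.
\<close>

lemma ln_lam_step:
  assumes d: "0 < d" and t: "0 < t" "t \<le> \<tau>"
  shows "\<bar>ln (lam d \<theta> t) - (ln (\<psi> t + r) - log_jump t * indicator {0<..\<theta>} t)\<bar>
      \<le> log_range * indicator {\<theta><..\<theta> + d} t"
proof -
  have tt: "t \<in> {0..\<tau>}" using t by auto
  have pos: "0 < \<psi> t" "0 < \<psi> t + r" using \<psi>_bounds[OF tt] lo_pos by auto
  have lj: "log_jump t = ln (\<psi> t + r) - ln (\<psi> t)" using pos by (simp add: log_jump_def ln_div)
  consider "t \<le> \<theta>" | "\<theta> < t" "t \<le> \<theta> + d" | "\<theta> + d < t" by linarith
  then show ?thesis
  proof cases
    case 1
    then show ?thesis using t d by (simp add: lam_before lj)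
  next
    case 2
    have "ln (min (\<psi> t) (\<psi> t + r)) \<le> ln (lam d \<theta> t)" "ln (lam d \<theta> t) \<le> ln (max (\<psi> t) (\<psi> t + r))"
      using lam_bounds(1,2,5)[OF tt, of d \<theta>] pos by (auto simp del: min_le_iff_disj le_max_iff_disj)
    then have "\<bar>ln (lam d \<theta> t) - ln (\<psi> t + r)\<bar> \<le> \<bar>log_jump t\<bar>"
      using pos by (auto simp: lj min_def max_def split: if_splits)
    then show ?thesis using 2 abs_log_jump_le[OF tt] by simp
  next
    case 3
    then show ?thesis using d by (simp add: lam_after)
  qed
qed

lemma integral_lam_approx:
  assumes d: "0 < d" and \<theta>: "0 \<le> \<theta>" "\<theta> + d \<le> \<tau>"
  shows "\<bar>(LBINT t:{0..\<tau>}. lam d \<theta> t) - ((LBINT t:{0..\<tau>}. \<psi> t) + r * (\<tau> - \<theta>))\<bar> \<le> \<bar>r\<bar> * d"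
proof -
  have int\<psi>: "set_integrable lborel {0..\<tau>} \<psi>" by (intro borel_integrable_atLeastAtMost' cont_\<psi>)
  have ind: "set_integrable lborel {0..\<tau>} (\<lambda>t. c * indicator {a<..b} t)" 
    "0 \<le> a \<Longrightarrow> a \<le> b \<Longrightarrow> b \<le> \<tau> \<Longrightarrow> (LBINT t:{0..\<tau>}. c * indicator {a<..b} t) = c * (b - a)" for a b c :: real
  proof -
    show "set_integrable lborel {0..\<tau>} (\<lambda>t. c * indicator {a<..b} t)"
      unfolding set_integrable_def by (intro integrable_mult_indicator; cases "a \<le> b") auto
    assume ab: "0 \<le> a" "a \<le> b" "b \<le> \<tau>"
    have "(LBINT t:{0..\<tau>}. c * indicator {a<..b} t) = (LBINT t. c * indicator {a<..b} t)"
      unfolding set_lebesgue_integral_def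
      using ab by (intro Bochner_Integration.integral_cong refl) (auto simp: indicator_def)
    then show "(LBINT t:{0..\<tau>}. c * indicator {a<..b} t) = c * (b - a)" using ab by simp
  qed
  let ?s = "\<lambda>t. \<psi> t + r * indicator {\<theta><..\<tau>} t"
  have int_s: "set_integrable lborel {0..\<tau>} ?s" by (intro set_integral_add int\<psi> ind)
  have s: "(LBINT t:{0..\<tau>}. ?s t) = (LBINT t:{0..\<tau>}. \<psi> t) + r * (\<tau> - \<theta>)"
    unfolding set_integral_add(2)[OF int\<psi> ind(1)] using \<theta> d ind(2)[of \<theta> \<tau> r] by simp
  have "(LBINT t:{0..\<tau>}. lam d \<theta> t) - (LBINT t:{0..\<tau>}. ?s t) = (LBINT t:{0..\<tau>}. lam d \<theta> t - ?s t)"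
    by (rule set_integral_diff(2)[symmetric, OF set_integrable_lam[OF d] int_s])
  moreover have bd: "\<bar>lam d \<theta> t - ?s t\<bar> \<le> \<bar>r\<bar> * indicator {\<theta><..\<theta> + d} t" if "t \<in> {0..\<tau>}" for t
  proof -
    consider "t \<le> \<theta>" | "\<theta> < t" "t \<le> \<theta> + d" | "\<theta> + d < t" by linarith
    then show ?thesis
    proof cases
      case 2
      then show ?thesis using lam_bounds(1,2)[OF that, of d \<theta>] that by (auto simp: indicator_def min_def max_def split: if_splits)
    qed (use d that in \<open>auto simp: lam_before lam_after\<close>)
  qed
  have "(LBINT t:{0..\<tau>}. lam d \<theta> t - ?s t) \<le> (LBINT t:{0..\<tau>}. \<bar>r\<bar> * indicator {\<theta><..\<theta> + d} t)"
    by (rule set_integral_mono[OF set_integral_diff(1)[OF set_integrable_lam[OF d] int_s] ind(1)])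
      (use bd in \<open>auto simp: abs_le_iff\<close>)
  moreover have "(LBINT t:{0..\<tau>}. - \<bar>r\<bar> * indicator {\<theta><..\<theta> + d} t) \<le> (LBINT t:{0..\<tau>}. lam d \<theta> t - ?s t)"
    by (rule set_integral_mono[OF ind(1) set_integral_diff(1)[OF set_integrable_lam[OF d] int_s]])
      (use bd in \<open>force simp: abs_le_iff\<close>)
  ultimately show ?thesis
  proof -
    have "(LBINT t:{0..\<tau>}. c * indicator {\<theta><..\<theta> + d} t) = c * d" for c :: real
      by (subst ind(2)) (use \<theta> d in auto)
    note * = this[of "\<bar>r\<bar>"] this[of "- \<bar>r\<bar>"]
    show ?thesis
      using \<open>(LBINT t:{0..\<tau>}. lam d \<theta> t - ?s t) \<le> _\<close> \<open>_ \<le> (LBINT t:{0..\<tau>}. lam d \<theta> t - ?s t)\<close>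
        \<open>(LBINT t:{0..\<tau>}. lam d \<theta> t) - _ = _\<close>
      unfolding s * by linarith
  qed
qed

text \<open>
  The log-likelihood ratio of two parameter values sees the path only through its increment between
  them and through the points that fall into the two ramps.
\<close>

lemma loglik_diff_approx:
  assumes d: "0 < d" and x: "counting_path \<tau> x"
    and \<theta>1: "0 \<le> \<theta>1" "\<theta>1 + d \<le> \<tau>" and \<theta>2: "0 \<le> \<theta>2" "\<theta>2 + d \<le> \<tau>"
    and \<eta>: "0 \<le> \<eta>"
    and \<kappa>: "\<And>t. min \<theta>1 \<theta>2 < t \<Longrightarrow> t \<le> max \<theta>1 \<theta>2 \<Longrightarrow> \<bar>log_jump t - \<kappa>\<bar> \<le> \<eta>"
  shows "\<bar>loglik d n x \<theta>2 - loglik d n x \<theta>1 + \<kappa> * (real (x \<theta>2) - real (x \<theta>1)) - real n * r * (\<theta>2 - \<theta>1)\<bar>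
     \<le> \<eta> * (real (x (max \<theta>1 \<theta>2)) - real (x (min \<theta>1 \<theta>2)))
       + log_range * (real (x (\<theta>2 + d)) - real (x \<theta>2)) + log_range * (real (x (\<theta>1 + d)) - real (x \<theta>1))
       + 2 * real n * \<bar>r\<bar> * d"
proof -
  let ?a = "min \<theta>1 \<theta>2" and ?b = "max \<theta>1 \<theta>2"
  let ?P = "\<lambda>\<theta>. path_integral \<tau> x (\<lambda>t. ln (lam d \<theta> t))"
  let ?J = "\<lambda>\<theta>. LBINT t:{0..\<tau>}. lam d \<theta> t"
  have x0: "x 0 = 0" using x by (simp add: counting_path_def)
  note cl = continuous_on_ln_lam[OF d]
  have Pd: "?P \<theta> - ?P \<theta>' = path_integral \<tau> x (\<lambda>t. ln (lam d \<theta> t) - ln (lam d \<theta>' t))" for \<theta> \<theta>'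
    by (rule path_integral_diff[symmetric, OF \<tau>_pos x cl cl])
  have main: "\<bar>ln (lam d \<theta>2 t) - ln (lam d \<theta>1 t) + \<kappa> * indicator {0<..\<theta>2} t - \<kappa> * indicator {0<..\<theta>1} t\<bar>
      \<le> \<eta> * indicator {?a<..?b} t + log_range * indicator {\<theta>2<..\<theta>2 + d} t + log_range * indicator {\<theta>1<..\<theta>1 + d} t"
    if t: "0 < t" "t \<le> \<tau>" for t
  proof -
    have "\<bar>(log_jump t - \<kappa>) * (indicator {0<..\<theta>2} t - indicator {0<..\<theta>1} t)\<bar> \<le> \<eta> * indicator {?a<..?b} t"
      using \<kappa>[of t] \<eta> t by (auto simp: indicator_def min_def max_def abs_minus_commute split: if_splits)
    then show ?thesis
      using ln_lam_step[OF d t, of \<theta>1] ln_lam_step[OF d t, of \<theta>2] by (simp add: algebra_simps abs_le_iff)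
  qed
  have 1: "?P \<theta>2 - ?P \<theta>1 \<le> - \<kappa> * real (x \<theta>2) + \<kappa> * real (x \<theta>1) + \<eta> * (real (x ?b) - real (x ?a))
       + log_range * (real (x (\<theta>2 + d)) - real (x \<theta>2)) + log_range * (real (x (\<theta>1 + d)) - real (x \<theta>1))"
  proof -
    let ?L = "[(- \<kappa>, 0, \<theta>2), (\<kappa>, 0, \<theta>1), (\<eta>, ?a, ?b), (log_range, \<theta>2, \<theta>2 + d), (log_range, \<theta>1, \<theta>1 + d)]"
    have "path_integral \<tau> x (\<lambda>t. ln (lam d \<theta>2 t) - ln (lam d \<theta>1 t)) \<le> (\<Sum>(c, a, b)\<leftarrow>?L. c * (real (x b) - real (x a)))"
    proof (rule path_integral_le_step[OF \<tau>_pos x])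
      show "continuous_on {0..\<tau>} (\<lambda>t. ln (lam d \<theta>2 t) - ln (lam d \<theta>1 t))" by (intro continuous_on_diff cl)
      show "0 \<le> a \<and> a \<le> b \<and> b \<le> \<tau>" if "(c, a, b) \<in> set ?L" for c a b
        using that \<theta>1 \<theta>2 d by auto
      show "ln (lam d \<theta>2 t) - ln (lam d \<theta>1 t) \<le> (\<Sum>(c, a, b)\<leftarrow>?L. c * indicator {a<..b} t)"
        if "0 < t" "t \<le> \<tau>" for t
        using main[OF that] by (simp only: list.map sum_list.Cons sum_list.Nil prod.case abs_le_iff) linarith
    qed
    then show ?thesis unfolding Pd by (simp add: x0)
  qed
  have 2: "?P \<theta>1 - ?P \<theta>2 \<le> \<kappa> * real (x \<theta>2) - \<kappa> * real (x \<theta>1) + \<eta> * (real (x ?b) - real (x ?a))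
       + log_range * (real (x (\<theta>2 + d)) - real (x \<theta>2)) + log_range * (real (x (\<theta>1 + d)) - real (x \<theta>1))"
  proof -
    let ?L = "[(\<kappa>, 0, \<theta>2), (- \<kappa>, 0, \<theta>1), (\<eta>, ?a, ?b), (log_range, \<theta>2, \<theta>2 + d), (log_range, \<theta>1, \<theta>1 + d)]"
    have "path_integral \<tau> x (\<lambda>t. ln (lam d \<theta>1 t) - ln (lam d \<theta>2 t)) \<le> (\<Sum>(c, a, b)\<leftarrow>?L. c * (real (x b) - real (x a)))"
    proof (rule path_integral_le_step[OF \<tau>_pos x])
      show "continuous_on {0..\<tau>} (\<lambda>t. ln (lam d \<theta>1 t) - ln (lam d \<theta>2 t))" by (intro continuous_on_diff cl)
      show "0 \<le> a \<and> a \<le> b \<and> b \<le> \<tau>" if "(c, a, b) \<in> set ?L" for c a b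
        using that \<theta>1 \<theta>2 d by auto
      show "ln (lam d \<theta>1 t) - ln (lam d \<theta>2 t) \<le> (\<Sum>(c, a, b)\<leftarrow>?L. c * indicator {a<..b} t)"
        if "0 < t" "t \<le> \<tau>" for t
        using main[OF that] by (simp only: list.map sum_list.Cons sum_list.Nil prod.case abs_le_iff) linarith
    qed
    then show ?thesis unfolding Pd by (simp add: x0)
  qed
  have one: "set_integrable lborel {0..\<tau>} (\<lambda>t. 1 :: real)"
    by (rule borel_integrable_atLeastAtMost') (rule continuous_on_const)
  have J: "(LBINT t:{0..\<tau>}. lam d \<theta> t - 1) = ?J \<theta> - (LBINT t:{0..\<tau>}. 1)" for \<theta>
    by (rule set_integral_diff(2)[OF set_integrable_lam[OF d] one])
  have "\<bar>?J \<theta>2 - ?J \<theta>1 + r * (\<theta>2 - \<theta>1)\<bar> \<le> 2 * \<bar>r\<bar> * d"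
    using integral_lam_approx[OF d \<theta>1] integral_lam_approx[OF d \<theta>2] by (simp add: algebra_simps abs_le_iff)
  then have "real n * \<bar>?J \<theta>2 - ?J \<theta>1 + r * (\<theta>2 - \<theta>1)\<bar> \<le> real n * (2 * \<bar>r\<bar> * d)"
    by (rule mult_left_mono) simp
  moreover have "real n * \<bar>?J \<theta>2 - ?J \<theta>1 + r * (\<theta>2 - \<theta>1)\<bar> = \<bar>real n * ?J \<theta>2 - real n * ?J \<theta>1 + real n * r * (\<theta>2 - \<theta>1)\<bar>"
    by (subst abs_of_nat[symmetric], subst abs_mult[symmetric]) (simp add: algebra_simps)
  ultimately have 3: "\<bar>real n * ?J \<theta>2 - real n * ?J \<theta>1 + real n * r * (\<theta>2 - \<theta>1)\<bar> \<le> 2 * real n * \<bar>r\<bar> * d"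
    by (simp add: algebra_simps)
  have "loglik d n x \<theta>2 - loglik d n x \<theta>1 = (?P \<theta>2 - ?P \<theta>1) - (real n * ?J \<theta>2 - real n * ?J \<theta>1)"
    by (simp add: loglik_def J algebra_simps)
  moreover have "\<kappa> * (real (x \<theta>2) - real (x \<theta>1)) = \<kappa> * real (x \<theta>2) - \<kappa> * real (x \<theta>1)"
    by (simp add: algebra_simps)
  ultimately show ?thesis using 1 2 3 unfolding abs_le_iff minus_mult_left[symmetric] by linarith
qed

text \<open>
  From \<open>(sqrt (\<psi> t + r) - sqrt (\<psi> t)) * (sqrt (\<psi> t + r) + sqrt (\<psi> t)) = r\<close>, the two intensity levels
  contribute at least twice this number per unit of time to a squared Hellinger distance.
\<close>

definition hellinger_rate :: real where
  "hellinger_rate = r\<^sup>2 / (8 * hi)"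

lemma hellinger_rate_pos: "0 < hellinger_rate"
  using r_nz hi_pos by (simp add: hellinger_rate_def)

text \<open>
  Between the end of the first ramp and the start of the second one the two intensities differ by the
  whole jump.
\<close>

lemma hellinger_integral_ge:
  assumes d: "0 < d" and le: "\<theta>1 + d \<le> \<theta>2" and \<theta>: "0 \<le> \<theta>1" "\<theta>2 \<le> \<tau>"
  shows "2 * hellinger_rate * (\<theta>2 - \<theta>1 - d) \<le> (LBINT t:{0..\<tau>}. (sqrt (lam d \<theta>2 t) - sqrt (lam d \<theta>1 t))\<^sup>2)"
proof -
  let ?h = "\<lambda>t. (sqrt (lam d \<theta>2 t) - sqrt (lam d \<theta>1 t))\<^sup>2"
  have ge: "2 * hellinger_rate \<le> ?h t" if t: "t \<in> {\<theta>1 + d..\<theta>2}" for t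
  proof -
    have tt: "t \<in> {0..\<tau>}" using t \<theta> d by auto
    let ?u = "sqrt (\<psi> t)" and ?v = "sqrt (\<psi> t + r)"
    have b: "lo \<le> \<psi> t" "\<psi> t \<le> hi" "lo \<le> \<psi> t + r" "\<psi> t + r \<le> hi" using \<psi>_bounds[OF tt] by auto
    have uv: "0 < ?u" "0 < ?v" "?u \<le> sqrt hi" "?v \<le> sqrt hi" using b lo_pos by auto
    have "(?u + ?v)\<^sup>2 \<le> (2 * sqrt hi)\<^sup>2" using uv by (intro power_mono) linarith+
    then have 1: "(?u + ?v)\<^sup>2 \<le> 4 * hi" using hi_pos by (simp add: power_mult_distrib)
    have "(?v - ?u) * (?v + ?u) = r"
      using b lo_pos by (simp add: algebra_simps)
    then have "r\<^sup>2 = (?u - ?v)\<^sup>2 * (?u + ?v)\<^sup>2"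
      by (metis add.commute power2_commute power_mult_distrib)
    also have "\<dots> \<le> (?u - ?v)\<^sup>2 * (4 * hi)" using 1 by (intro mult_left_mono) auto
    finally have "2 * hellinger_rate \<le> (?u - ?v)\<^sup>2"
      using hi_pos by (simp add: hellinger_rate_def field_simps)
    then show ?thesis using t d by (simp add: lam_before lam_after)
  qed
  have "2 * hellinger_rate * (\<theta>2 - \<theta>1 - d) = (LBINT t:{0..\<tau>}. 2 * hellinger_rate * indicator {\<theta>1 + d..\<theta>2} t)"
  proof -
    have "(LBINT t:{0..\<tau>}. 2 * hellinger_rate * indicator {\<theta>1 + d..\<theta>2} t)
        = (LBINT t. 2 * hellinger_rate * indicator {\<theta>1 + d..\<theta>2} t)"
      unfolding set_lebesgue_integral_def
      using \<theta> d by (intro Bochner_Integration.integral_cong refl) (auto simp: indicator_def)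
    moreover have "(LBINT t. 2 * hellinger_rate * indicator {\<theta>1 + d..\<theta>2} t) = 2 * hellinger_rate * (\<theta>2 - (\<theta>1 + d))"
      using le by simp
    ultimately show ?thesis by (simp only: diff_diff_eq)
  qed
  also have "\<dots> \<le> (LBINT t:{0..\<tau>}. ?h t)"
  proof (rule set_integral_mono)
    show "set_integrable lborel {0..\<tau>} (\<lambda>t. 2 * hellinger_rate * indicator {\<theta>1 + d..\<theta>2} t)"
      unfolding set_integrable_def using le by (intro integrable_mult_indicator) auto
    show "set_integrable lborel {0..\<tau>} ?h"
      by (intro borel_integrable_atLeastAtMost' continuous_intros continuous_on_lam d)
  qed (use ge in \<open>auto simp: indicator_def\<close>)
  finally show ?thesis .
qed

text \<open>
  Completing the square in \<open>poisson_process_exp_integral_le\<close> bounds the half moment of the likelihood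
  ratio by the exponential of minus \<open>n / 2\<close> times the squared Hellinger distance of the intensities.
\<close>

lemma loglik_half_moment:
  assumes d: "0 < d" and pp: "poisson_process M {0..\<tau>} (\<lambda>t. real n * lam d \<theta>1 t) S"
    and n: "0 < n"
    and \<theta>1: "0 \<le> \<theta>1" "\<theta>1 \<le> \<tau>" and \<theta>2: "0 \<le> \<theta>2" "\<theta>2 \<le> \<tau>"
  shows "(\<integral>\<^sup>+\<omega>. ennreal (exp ((loglik d n (\<lambda>t. S t \<omega>) \<theta>2 - loglik d n (\<lambda>t. S t \<omega>) \<theta>1) / 2)) \<partial>M)
     \<le> ennreal (exp (- (real n * hellinger_rate * (\<bar>\<theta>2 - \<theta>1\<bar> - d))))"
proof -
  let ?l1 = "lam d \<theta>1" and ?l2 = "lam d \<theta>2"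
  let ?g = "\<lambda>t. (ln (?l2 t) - ln (?l1 t)) / 2"
  let ?J = "\<lambda>\<theta>. LBINT t:{0..\<tau>}. lam d \<theta> t"
  note cl = continuous_on_ln_lam[OF d]
  have cg: "continuous_on {0..\<tau>} ?g" by (intro continuous_intros cl) auto
  have one: "set_integrable lborel {0..\<tau>} (\<lambda>t. 1 :: real)"
    by (rule borel_integrable_atLeastAtMost') (rule continuous_on_const)
  have J: "(LBINT t:{0..\<tau>}. lam d \<theta> t - 1) = ?J \<theta> - (LBINT t:{0..\<tau>}. 1)" for \<theta>
    by (rule set_integral_diff(2)[OF set_integrable_lam[OF d] one])
  let ?h = "\<lambda>t. (sqrt (?l2 t) - sqrt (?l1 t))\<^sup>2"
  let ?E = "LBINT t:{0..\<tau>}. (exp (?g t) - 1) * (real n * ?l1 t)"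
  have half: "(loglik d n x \<theta>2 - loglik d n x \<theta>1) / 2 = path_integral \<tau> x ?g - real n * (?J \<theta>2 - ?J \<theta>1) / 2"
    if x: "counting_path \<tau> x" for x
  proof -
    have "path_integral \<tau> x ?g = (LINT t:{0<..\<tau>}|path_measure \<tau> x. (ln (?l2 t) - ln (?l1 t)) / 2)"
      by (rule path_integral_Ioc(1)[OF \<tau>_pos x cg])
    also have "\<dots> = (LINT t:{0<..\<tau>}|path_measure \<tau> x. ln (?l2 t) - ln (?l1 t)) / 2"
      by (simp add: set_lebesgue_integral_def)
    also have "\<dots> = path_integral \<tau> x (\<lambda>t. ln (?l2 t) - ln (?l1 t)) / 2"
      by (simp add: path_integral_Ioc(1)[OF \<tau>_pos x continuous_on_diff[OF cl cl]])
    finally show ?thesis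
      by (simp add: path_integral_diff[OF \<tau>_pos x cl cl] loglik_def J field_simps)
  qed
  have E: "?E - real n * (?J \<theta>2 - ?J \<theta>1) / 2 = - (real n / 2) * (LBINT t:{0..\<tau>}. ?h t)"
  proof -
    have pt: "(exp (?g t) - 1) * (real n * ?l1 t) - (real n / 2) * (?l2 t - ?l1 t) = - (real n / 2) * ?h t"
      if t: "t \<in> {0..\<tau>}" for t
    proof -
      have p: "0 < ?l1 t" "0 < ?l2 t" using lam_bounds(5)[OF t] by auto
      have "exp (?g t) = sqrt (?l2 t) / sqrt (?l1 t)"
      proof -
        have "ln (sqrt (?l2 t) / sqrt (?l1 t)) = ?g t"
          using p by (simp add: ln_div ln_sqrt diff_divide_distrib)
        then show ?thesis using p by (metis divide_pos_pos exp_ln real_sqrt_gt_zero)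
      qed
      moreover have "?l1 t = sqrt (?l1 t) * sqrt (?l1 t)" using p by simp
      ultimately have "exp (?g t) * ?l1 t = (sqrt (?l2 t) / sqrt (?l1 t)) * (sqrt (?l1 t) * sqrt (?l1 t))"
        by metis
      moreover have "x / y * (y * y) = x * y" if "y \<noteq> 0" for x y :: real using that by simp
      ultimately have "exp (?g t) * ?l1 t = sqrt (?l2 t) * sqrt (?l1 t)"
        using p by (metis less_irrefl real_sqrt_gt_zero)
      then show ?thesis using p by (simp add: power2_diff algebra_simps)
    qed
    have i1: "set_integrable lborel {0..\<tau>} (\<lambda>t. (exp (?g t) - 1) * (real n * ?l1 t))"
      by (intro borel_integrable_atLeastAtMost' continuous_intros cl continuous_on_lam d) auto
    have i2: "set_integrable lborel {0..\<tau>} (\<lambda>t. (real n / 2) * (?l2 t - ?l1 t))"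
      by (intro borel_integrable_atLeastAtMost' continuous_intros continuous_on_lam d)
    have "?E - real n * (?J \<theta>2 - ?J \<theta>1) / 2
       = ?E - (LBINT t:{0..\<tau>}. (real n / 2) * (?l2 t - ?l1 t))"
      by (simp add: set_integral_diff(2)[OF set_integrable_lam[OF d] set_integrable_lam[OF d]])
    also have "\<dots> = (LBINT t:{0..\<tau>}. (exp (?g t) - 1) * (real n * ?l1 t) - (real n / 2) * (?l2 t - ?l1 t))"
      by (rule set_integral_diff(2)[OF i1 i2, symmetric])
    also have "\<dots> = (LBINT t:{0..\<tau>}. - (real n / 2) * ?h t)"
      unfolding set_lebesgue_integral_def
      using pt by (intro Bochner_Integration.integral_cong refl) (auto simp: indicator_def)
    also have "\<dots> = - (real n / 2) * (LBINT t:{0..\<tau>}. ?h t)"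
      by (rule set_integral_mult_right)
    finally show ?thesis .
  qed
  have H: "2 * hellinger_rate * (\<bar>\<theta>2 - \<theta>1\<bar> - d) \<le> (LBINT t:{0..\<tau>}. ?h t)"
  proof (cases "d \<le> \<bar>\<theta>2 - \<theta>1\<bar>")
    case False
    have "0 \<le> (LBINT t:{0..\<tau>}. ?h t)" unfolding set_lebesgue_integral_def by (intro integral_nonneg_AE AE_I2) simp
    moreover have "2 * hellinger_rate * (\<bar>\<theta>2 - \<theta>1\<bar> - d) \<le> 0"
      using False hellinger_rate_pos by (intro mult_nonneg_nonpos) auto
    ultimately show ?thesis by linarith
  next
    case True
    show ?thesis
    proof (cases "\<theta>1 \<le> \<theta>2")
      case t: True
      then show ?thesis using hellinger_integral_ge[OF d, of \<theta>1 \<theta>2] True \<theta>1 \<theta>2 by simp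
    next
      case False
      then show ?thesis using hellinger_integral_ge[OF d, of \<theta>2 \<theta>1] True \<theta>1 \<theta>2 by (simp add: power2_commute)
    qed
  qed
  have "(\<integral>\<^sup>+\<omega>. ennreal (exp ((loglik d n (\<lambda>t. S t \<omega>) \<theta>2 - loglik d n (\<lambda>t. S t \<omega>) \<theta>1) / 2)) \<partial>M)
    = (\<integral>\<^sup>+\<omega>. ennreal (exp (path_integral \<tau> (\<lambda>t. S t \<omega>) ?g - real n * (?J \<theta>2 - ?J \<theta>1) / 2)) \<partial>M)"
    by (intro nn_integral_cong) (simp only: half poisson_process_counting_path[OF pp])
  also have "\<dots> = (\<integral>\<^sup>+\<omega>. ennreal (exp (- (real n * (?J \<theta>2 - ?J \<theta>1) / 2))) * ennreal (exp (path_integral \<tau> (\<lambda>t. S t \<omega>) ?g)) \<partial>M)"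
    by (simp add: ennreal_mult[symmetric] exp_add[symmetric] del: times_divide_eq_right)
  also have "\<dots> \<le> ennreal (exp (- (real n * (?J \<theta>2 - ?J \<theta>1) / 2))) * ennreal (exp ?E)"
  proof -
    have S[measurable]: "S t \<in> measurable M (count_space UNIV)" if "t \<in> {0..\<tau>}" for t
      using poisson_processD(2)[OF pp] that by auto
    have "(\<lambda>\<omega>. path_integral \<tau> (\<lambda>t. S t \<omega>) ?g) \<in> borel_measurable M"
      by (rule path_integral_measurable[OF pp \<tau>_pos cg])
    then have "(\<integral>\<^sup>+\<omega>. ennreal (exp (- (real n * (?J \<theta>2 - ?J \<theta>1) / 2))) * ennreal (exp (path_integral \<tau> (\<lambda>t. S t \<omega>) ?g)) \<partial>M)
      = ennreal (exp (- (real n * (?J \<theta>2 - ?J \<theta>1) / 2))) * (\<integral>\<^sup>+\<omega>. ennreal (exp (path_integral \<tau> (\<lambda>t. S t \<omega>) ?g)) \<partial>M)"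
      by (intro nn_integral_cmult) auto
    also have "\<dots> \<le> ennreal (exp (- (real n * (?J \<theta>2 - ?J \<theta>1) / 2))) * ennreal (exp ?E)"
      using n lam_bounds(5)[of _ d \<theta>1]
      by (intro mult_left_mono poisson_process_exp_integral_le[OF pp \<tau>_pos _ _ cg] continuous_intros continuous_on_lam d) auto
    finally show ?thesis .
  qed
  also have "\<dots> = ennreal (exp (- (real n / 2) * (LBINT t:{0..\<tau>}. ?h t)))"
    unfolding E[symmetric] by (simp add: ennreal_mult[symmetric] exp_add[symmetric])
  also have "\<dots> \<le> ennreal (exp (- (real n * hellinger_rate * (\<bar>\<theta>2 - \<theta>1\<bar> - d))))"
    using mult_left_mono[OF H, of "real n / 2"] by (intro ennreal_leI) (simp add: field_simps)
  finally show ?thesis .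
qed

end

section \<open>Posterior means of a local likelihood\<close>

text \<open>
  A bound on a mean, bundled with the side conditions that let bounds be added and scaled. The
  extended integral makes integrability a consequence instead of a premise.
\<close>

definition mean_le :: "'a measure \<Rightarrow> ('a \<Rightarrow> real) \<Rightarrow> real \<Rightarrow> bool" where
  "mean_le M f a \<longleftrightarrow> f \<in> borel_measurable M \<and> 0 \<le> a \<and> (\<integral>\<^sup>+\<omega>. ennreal (f \<omega>) \<partial>M) \<le> ennreal a"

lemma mean_leD:
  "mean_le M f a \<Longrightarrow> f \<in> borel_measurable M"
  "mean_le M f a \<Longrightarrow> 0 \<le> a"
  "mean_le M f a \<Longrightarrow> (\<integral>\<^sup>+\<omega>. ennreal (f \<omega>) \<partial>M) \<le> ennreal a"
  by (auto simp: mean_le_def)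

lemma mean_le_mono:
  assumes "mean_le M f a" "g \<in> borel_measurable M" "\<And>\<omega>. \<omega> \<in> space M \<Longrightarrow> g \<omega> \<le> f \<omega>" "a \<le> b"
  shows "mean_le M g b"
proof -
  have "(\<integral>\<^sup>+\<omega>. ennreal (g \<omega>) \<partial>M) \<le> (\<integral>\<^sup>+\<omega>. ennreal (f \<omega>) \<partial>M)"
    using assms by (intro nn_integral_mono ennreal_leI) auto
  also have "\<dots> \<le> ennreal b" using assms by (auto simp: mean_le_def intro: order_trans ennreal_leI)
  finally show ?thesis using assms by (auto simp: mean_le_def)
qed

lemma mean_le_add:
  assumes f: "mean_le M f a" and g: "mean_le M g b"
  shows "mean_le M (\<lambda>\<omega>. f \<omega> + g \<omega>) (a + b)"
proof -
  note [measurable] = mean_leD(1)[OF f] mean_leD(1)[OF g]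
  have "ennreal (x + y) \<le> ennreal x + ennreal y" for x y
  proof (cases "0 \<le> x \<and> 0 \<le> y")
    case True
    then show ?thesis by simp
  next
    case False
    then consider "x \<le> 0" | "y \<le> 0" by linarith
    then show ?thesis
      by cases (auto simp: ennreal_neg intro: ennreal_leI)
  qed
  then have "(\<integral>\<^sup>+\<omega>. ennreal (f \<omega> + g \<omega>) \<partial>M) \<le> (\<integral>\<^sup>+\<omega>. ennreal (f \<omega>) + ennreal (g \<omega>) \<partial>M)"
    by (intro nn_integral_mono)
  also have "\<dots> = (\<integral>\<^sup>+\<omega>. ennreal (f \<omega>) \<partial>M) + (\<integral>\<^sup>+\<omega>. ennreal (g \<omega>) \<partial>M)"
    by (rule nn_integral_add) auto
  also have "\<dots> \<le> ennreal a + ennreal b" by (intro add_mono mean_leD(3) f g)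
  also have "\<dots> = ennreal (a + b)" using f g by (simp add: mean_le_def)
  finally show ?thesis using f g by (auto simp: mean_le_def)
qed

lemma mean_le_cmult:
  assumes f: "mean_le M f a" and c: "0 \<le> c"
  shows "mean_le M (\<lambda>\<omega>. c * f \<omega>) (c * a)"
proof -
  note [measurable] = mean_leD(1)[OF f]
  have "(\<integral>\<^sup>+\<omega>. ennreal (c * f \<omega>) \<partial>M) = ennreal c * (\<integral>\<^sup>+\<omega>. ennreal (f \<omega>) \<partial>M)"
    using c by (subst nn_integral_cmult[symmetric]) (auto simp: ennreal_mult')
  also have "\<dots> \<le> ennreal c * ennreal a" by (intro mult_left_mono mean_leD(3)[OF f]) simp
  also have "\<dots> = ennreal (c * a)" using c by (simp add: ennreal_mult')
  finally show ?thesis using f c by (auto simp: mean_le_def)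
qed

lemma mean_le_sum:
  assumes "finite I" "\<And>i. i \<in> I \<Longrightarrow> mean_le M (f i) (a i)"
  shows "mean_le M (\<lambda>\<omega>. \<Sum>i\<in>I. f i \<omega>) (\<Sum>i\<in>I. a i)"
  using assms
proof (induction I rule: finite_induct)
  case empty
  then show ?case by (simp add: mean_le_def)
next
  case (insert x F)
  then show ?case using mean_le_add[of M "f x" "a x" "\<lambda>\<omega>. \<Sum>i\<in>F. f i \<omega>" "\<Sum>i\<in>F. a i"] by simp
qed

text \<open>
  Bounds the mean of a product by separate means of squares; the weight \<open>s\<close> distributes the loss between
  a factor with a large and a factor with a small mean.
\<close>

lemma amgm_scaled:
  fixes x y s :: real
  assumes "0 < s"
  shows "x * y \<le> (s * x\<^sup>2 + y\<^sup>2 / s) / 2"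
proof -
  have "0 \<le> (s * x - y)\<^sup>2 / s" using assms by simp
  also have "\<dots> = s * x\<^sup>2 - 2 * (x * y) + y\<^sup>2 / s"
    using assms by (simp add: power2_diff field_simps power2_eq_square)
  finally show ?thesis by simp
qed

subsection \<open>Deterministic inequalities between posterior means\<close>

lemma set_integrable_abs_real:
  fixes f :: "'a \<Rightarrow> real"
  shows "set_integrable M A f \<Longrightarrow> set_integrable M A (\<lambda>x. \<bar>f x\<bar>)"
  using integrable_abs[of M "\<lambda>x. indicator A x * f x"] by (simp add: set_integrable_def abs_mult)

lemma abs_set_integral_le:
  fixes f :: "'a \<Rightarrow> real"
  shows "set_integrable M A f \<Longrightarrow> \<bar>LINT x:A|M. f x\<bar> \<le> (LINT x:A|M. \<bar>f x\<bar>)"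
  using set_integral_norm_bound[of M A f] by simp

text \<open>
  Centred at the truncated mean, the integral over \<open>(-R, R)\<close> vanishes, so only the tail contributes to
  the difference.
\<close>

lemma posterior_mean_truncation:
  fixes f :: "real \<Rightarrow> real"
  assumes f0: "\<And>u. 0 \<le> f u" and f: "integrable lborel f" and uf: "integrable lborel (\<lambda>u. \<bar>u\<bar> * f u)"
    and R: "0 < R" and DR: "0 < (LBINT u:{-R<..<R}. f u)"
  shows "\<bar>(LBINT u. u * f u) / (LBINT u. f u) - (LBINT u:{-R<..<R}. u * f u) / (LBINT u:{-R<..<R}. f u)\<bar>
    \<le> 2 * (LBINT u:- {-R<..<R}. \<bar>u\<bar> * f u) / (LBINT u. f u)"
proof -
  let ?A = "{-R<..<R}"
  have fm[measurable]: "f \<in> borel_measurable borel" using f by (simp add: borel_measurable_integrable)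
  have uf': "integrable lborel (\<lambda>u. u * f u)"
    by (rule Bochner_Integration.integrable_bound[OF uf]) (auto simp: abs_mult f0)
  have si: "set_integrable lborel S g" if "integrable lborel g" "S \<in> sets borel" for g :: "real \<Rightarrow> real" and S
    unfolding set_integrable_def using that by (intro integrable_mult_indicator) auto
  have split: "(LBINT u. g u) = (LBINT u:?A. g u) + (LBINT u:- ?A. g u)" if "integrable lborel g" for g :: "real \<Rightarrow> real"
    using set_integral_Un[of ?A "- ?A" lborel g] si[OF that]
    by (simp add: set_integral_space[OF that, simplified])
  define N NR NT D DT T DRR where "N = (LBINT u. u * f u)" and "NR = (LBINT u:?A. u * f u)"
    and "NT = (LBINT u:- ?A. u * f u)" and "D = (LBINT u. f u)" and "DT = (LBINT u:- ?A. f u)"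
    and "T = (LBINT u:- ?A. \<bar>u\<bar> * f u)" and "DRR = (LBINT u:?A. f u)"
  note defs = N_def NR_def NT_def D_def DT_def T_def DRR_def
  have N: "N = NR + NT" and D: "D = DRR + DT"
    unfolding defs using split[OF uf'] split[OF f] by auto
  have DT0: "0 \<le> DT" unfolding defs set_lebesgue_integral_def using f0 by (intro integral_nonneg_AE AE_I2) auto
  have Dpos: "0 < DRR" "0 < D" using DR DT0 D by (auto simp: DRR_def)
  have "R * DT \<le> T"
  proof -
    have "R * DT = (LBINT u:- ?A. R * f u)" unfolding defs by simp
    also have "\<dots> \<le> T" unfolding defs
      by (rule set_integral_mono) (use si f uf f0 R in \<open>auto intro!: mult_right_mono\<close>)
    finally show ?thesis .
  qed
  have "\<bar>NT\<bar> \<le> T"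
  proof -
    have "\<bar>NT\<bar> \<le> (LBINT u:- ?A. \<bar>u * f u\<bar>)"
      unfolding defs using abs_set_integral_le[of lborel "- ?A" "\<lambda>u. u * f u"] si[OF uf'] by auto
    then show ?thesis unfolding defs by (simp add: abs_mult f0)
  qed
  have mR: "\<bar>NR / DRR\<bar> \<le> R"
  proof -
    have "NR \<le> (LBINT u:?A. R * f u)" unfolding defs
      by (rule set_integral_mono) (use si f uf' f0 R in \<open>auto intro!: mult_right_mono\<close>)
    moreover have "(LBINT u:?A. (- R) * f u) \<le> NR" unfolding defs
    proof (rule set_integral_mono)
      show "(- R) * f u \<le> u * f u" if "u \<in> ?A" for u
        using f0 that by (intro mult_right_mono) auto
    qed (rule set_integrable_mult_right si f uf' | simp)+
    moreover have "(LBINT u:?A. (- R) * f u) = (- R) * DRR" "(LBINT u:?A. R * f u) = R * DRR"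
      unfolding defs by (rule set_integral_mult_right)+
    ultimately have "\<bar>NR\<bar> \<le> R * DRR" by (auto simp: abs_le_iff minus_le_iff)
    then show ?thesis using Dpos by (simp add: divide_le_eq)
  qed
  have "\<bar>NT - NR / DRR * DT\<bar> \<le> \<bar>NT\<bar> + \<bar>NR / DRR * DT\<bar>"
    by (rule abs_triangle_ineq4)
  also have "\<bar>NR / DRR * DT\<bar> = \<bar>NR / DRR\<bar> * DT" using DT0 unfolding abs_mult by simp
  also have "\<bar>NT\<bar> + \<bar>NR / DRR\<bar> * DT \<le> \<bar>NT\<bar> + R * DT" using mR DT0 by (intro add_left_mono mult_right_mono)
  also have "\<dots> \<le> 2 * T" using \<open>R * DT \<le> T\<close> \<open>\<bar>NT\<bar> \<le> T\<close> by linarith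
  finally have "\<bar>NT - NR / DRR * DT\<bar> \<le> 2 * T" .
  moreover have "N / D - NR / DRR = (NT - NR / DRR * DT) / D"
    using Dpos unfolding N D by (simp add: field_simps)
  ultimately have "\<bar>N / D - NR / DRR\<bar> \<le> 2 * T / D"
    using Dpos by (simp add: divide_right_mono)
  then show ?thesis unfolding defs .
qed

text \<open>
  Jensen's inequality for the probability density proportional to \<open>f\<close>.
\<close>

lemma posterior_mean_power:
  fixes f :: "real \<Rightarrow> real"
  assumes f0: "\<And>u. 0 \<le> f u" and f: "integrable lborel f" and uf: "integrable lborel (\<lambda>u. \<bar>u\<bar> * f u)"
    and mf: "integrable lborel (\<lambda>u. \<bar>u\<bar> ^ m * f u)" and D: "0 < (LBINT u. f u)"
  shows "\<bar>(LBINT u. u * f u) / (LBINT u. f u)\<bar> ^ m \<le> (LBINT u. \<bar>u\<bar> ^ m * f u) / (LBINT u. f u)"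
proof -
  define D where "D = (LBINT u. f u)"
  define x where "x = (LBINT u. \<bar>u\<bar> * f u) / D"
  have D0: "0 < D" using D by (simp add: D_def)
  have x0: "0 \<le> x" unfolding x_def using f0 D0 by (intro divide_nonneg_pos integral_nonneg_AE AE_I2) auto
  have "\<bar>LBINT u. u * f u\<bar> \<le> (LBINT u. \<bar>u\<bar> * f u)"
    using integral_abs_bound[of lborel "\<lambda>u. u * f u"] by (simp add: abs_mult f0)
  then have "\<bar>(LBINT u. u * f u) / D\<bar> \<le> x"
    using D0 by (simp add: x_def divide_right_mono)
  then have "\<bar>(LBINT u. u * f u) / D\<bar> ^ m \<le> x ^ m" by (intro power_mono) auto
  also have "x ^ m \<le> (LBINT u. \<bar>u\<bar> ^ m * f u) / D"
  proof -
    \<comment> \<open>the tangent of \<open>y \<mapsto> y ^ m\<close> at \<open>x\<close> lies below the curve\<close>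
    have tangent: "x ^ m + real m * x ^ (m - 1) * (y - x) \<le> y ^ m" if "0 \<le> y" for y
    proof (cases "m = 0")
      case False
      show ?thesis
      proof (induction m)
        case (Suc m)
        show ?case
        proof (cases m)
          case (Suc m')
          have "x ^ Suc m + real (Suc m) * x ^ (Suc m - 1) * (y - x)
              = y * (x ^ m + real m * x ^ (m - 1) * (y - x)) - real m * x ^ (m - 1) * (y - x)\<^sup>2"
            unfolding Suc by (simp add: power2_eq_square algebra_simps)
          also have "\<dots> \<le> y * (x ^ m + real m * x ^ (m - 1) * (y - x))"
            using x0 by simp
          also have "\<dots> \<le> y * y ^ m" using Suc.IH that by (intro mult_left_mono)
          finally show ?thesis by simp
        qed simp
      qed simp
    qed simp
    have "x ^ m * D = (LBINT u. x ^ m * f u + real m * x ^ (m - 1) * (\<bar>u\<bar> * f u - x * f u))"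
    proof -
      have "(LBINT u. x ^ m * f u + real m * x ^ (m - 1) * (\<bar>u\<bar> * f u - x * f u))
         = x ^ m * D + real m * x ^ (m - 1) * ((LBINT u. \<bar>u\<bar> * f u) - x * D)"
        using f uf by (simp add: D_def)
      also have "(LBINT u. \<bar>u\<bar> * f u) - x * D = 0" using D0 by (simp add: x_def)
      finally show ?thesis by simp
    qed
    also have "\<dots> \<le> (LBINT u. \<bar>u\<bar> ^ m * f u)"
    proof (rule integral_mono)
      fix u :: real
      have "(x ^ m + real m * x ^ (m - 1) * (\<bar>u\<bar> - x)) * f u \<le> \<bar>u\<bar> ^ m * f u"
        using tangent[of "\<bar>u\<bar>"] f0 by (intro mult_right_mono) auto
      then show "x ^ m * f u + real m * x ^ (m - 1) * (\<bar>u\<bar> * f u - x * f u) \<le> \<bar>u\<bar> ^ m * f u"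
        by (simp add: algebra_simps)
    qed (use f uf mf in auto)
    finally show ?thesis using D0 by (simp add: pos_le_divide_eq)
  qed
  finally show ?thesis unfolding D_def .
qed

text \<open>
  On \<open>(-R, R)\<close> both densities lie between \<open>exp (- A)\<close> and \<open>exp A\<close>. Hence they differ by at most
  \<open>exp A * b u\<close>, which has to be compared with a normalising constant of at least \<open>2 * R * exp (- A)\<close>;
  the factor \<open>2 * R\<close> cancels against the size of \<open>u\<close> minus the other mean.
\<close>

lemma posterior_mean_perturbation:
  fixes f g b :: "real \<Rightarrow> real"
  assumes R: "0 < R" and [measurable]: "f \<in> borel_measurable borel" "g \<in> borel_measurable borel"
    and fA: "\<And>u. \<bar>u\<bar> < R \<Longrightarrow> 0 < f u \<and> \<bar>ln (f u)\<bar> \<le> A" and gA: "\<And>u. \<bar>u\<bar> < R \<Longrightarrow> 0 < g u \<and> \<bar>ln (g u)\<bar> \<le> A"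
    and fg: "\<And>u. \<bar>u\<bar> < R \<Longrightarrow> \<bar>ln (f u) - ln (g u)\<bar> \<le> b u"
    and b: "integrable lborel b" "\<And>u. 0 \<le> b u"
  shows "\<bar>(LBINT u:{-R<..<R}. u * f u) / (LBINT u:{-R<..<R}. f u) - (LBINT u:{-R<..<R}. u * g u) / (LBINT u:{-R<..<R}. g u)\<bar>
     \<le> exp (2 * A) * (LBINT u. b u)"
proof -
  let ?S = "{-R<..<R}"
  have ex: "exp (- A) \<le> x" "x \<le> exp A" if "0 < x" "\<bar>ln x\<bar> \<le> A" for x
  proof -
    have "exp (- A) \<le> exp (ln x)" "exp (ln x) \<le> exp A" using that(2) by (auto simp: abs_le_iff)
    then show "exp (- A) \<le> x" "x \<le> exp A" using that(1) by auto
  qed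
  have S: "?S \<in> sets lborel" "emeasure lborel ?S < \<infinity>" using R by auto
  have bi: "set_integrable lborel ?S h" if [measurable]: "h \<in> borel_measurable borel" and h: "\<And>u. u \<in> ?S \<Longrightarrow> \<bar>h u\<bar> \<le> B" for h :: "real \<Rightarrow> real" and B
    unfolding set_integrable_def
    by (rule integrableI_bounded_set_indicator[where B = B]) (use S h in auto)
  have fS: "0 < f u" "exp (- A) \<le> f u" "f u \<le> exp A" and gS: "0 < g u" "exp (- A) \<le> g u" "g u \<le> exp A"
    if "u \<in> ?S" for u
  proof -
    have u: "\<bar>u\<bar> < R" using that by auto
    show "0 < f u" "0 < g u" using fA[OF u] gA[OF u] by auto
    then show "exp (- A) \<le> f u" "f u \<le> exp A" "exp (- A) \<le> g u" "g u \<le> exp A"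
      using ex fA[OF u] gA[OF u] by blast+
  qed
  have uS: "\<bar>u\<bar> \<le> R" if "u \<in> ?S" for u using that by auto
  have if_: "set_integrable lborel ?S f" 
    by (rule bi[where B = "exp A"]) (use fS in \<open>auto simp: abs_of_pos\<close>)
  have ig: "set_integrable lborel ?S g"
    by (rule bi[where B = "exp A"]) (use gS in \<open>auto simp: abs_of_pos\<close>)
  have iuf: "set_integrable lborel ?S (\<lambda>u. u * f u)"
  proof (rule bi[where B = "R * exp A"])
    show "\<bar>u * f u\<bar> \<le> R * exp A" if "u \<in> ?S" for u
      unfolding abs_mult using fS[OF that] uS[OF that] R by (intro mult_mono) auto
  qed measurable
  have iug: "set_integrable lborel ?S (\<lambda>u. u * g u)"
  proof (rule bi[where B = "R * exp A"])
    show "\<bar>u * g u\<bar> \<le> R * exp A" if "u \<in> ?S" for u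
      unfolding abs_mult using gS[OF that] uS[OF that] R by (intro mult_mono) auto
  qed measurable
  define Nf Ng Df Dg I where "Nf = (LBINT u:?S. u * f u)" and "Ng = (LBINT u:?S. u * g u)"
    and "Df = (LBINT u:?S. f u)" and "Dg = (LBINT u:?S. g u)" and "I = (LBINT u:?S. \<bar>f u - g u\<bar>)"
  note defs = Nf_def Ng_def Df_def Dg_def I_def
  have iI: "set_integrable lborel ?S (\<lambda>u. \<bar>f u - g u\<bar>)"
    by (rule set_integrable_abs_real) (rule set_integral_diff(1)[OF if_ ig])
  have const: "(LBINT u:?S. c) = 2 * R * c" "set_integrable lborel ?S (\<lambda>u. c)" for c :: real
    using R by (auto simp: set_lebesgue_integral_def intro!: bi[where B = "\<bar>c\<bar>"])
  have lower: "2 * R * exp (- A) \<le> (LBINT u:?S. h u)" if "set_integrable lborel ?S h" "\<And>u. u \<in> ?S \<Longrightarrow> exp (- A) \<le> h u" for h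
    unfolding const(1)[symmetric] by (rule set_integral_mono[OF const(2) that])
  have "2 * R * exp (- A) \<le> Df" "2 * R * exp (- A) \<le> Dg"
    unfolding defs by (rule lower[OF if_ fS(2)] lower[OF ig gS(2)]; assumption)+
  moreover have "0 < 2 * R * exp (- A)" using R by simp
  ultimately have Dpos: "0 < Df" "0 < Dg" by linarith+
  have dD: "\<bar>Dg - Df\<bar> \<le> I"
  proof -
    have "Dg - Df = (LBINT u:?S. g u - f u)" unfolding defs by (rule set_integral_diff(2)[OF ig if_, symmetric])
    then show ?thesis
      using abs_set_integral_le[OF set_integral_diff(1)[OF ig if_]] by (simp add: I_def abs_minus_commute)
  qed
  have dN: "\<bar>Nf - Ng\<bar> \<le> R * I"
  proof -
    have "Nf - Ng = (LBINT u:?S. u * f u - u * g u)" unfolding defs by (rule set_integral_diff(2)[OF iuf iug, symmetric])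
    then have "\<bar>Nf - Ng\<bar> \<le> (LBINT u:?S. \<bar>u * f u - u * g u\<bar>)"
      using abs_set_integral_le[OF set_integral_diff(1)[OF iuf iug]] by simp
    also have "\<dots> \<le> (LBINT u:?S. R * \<bar>f u - g u\<bar>)"
    proof (rule set_integral_mono)
      show "set_integrable lborel ?S (\<lambda>u. \<bar>u * f u - u * g u\<bar>)"
        by (rule set_integrable_abs_real) (rule set_integral_diff(1)[OF iuf iug])
      show "set_integrable lborel ?S (\<lambda>u. R * \<bar>f u - g u\<bar>)" using iI by simp
      fix u assume "u \<in> ?S"
      then show "\<bar>u * f u - u * g u\<bar> \<le> R * \<bar>f u - g u\<bar>"
        unfolding right_diff_distrib[symmetric] abs_mult by (intro mult_right_mono) auto
    qed
    finally show ?thesis unfolding defs by simp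
  qed
  have mg: "\<bar>Ng / Dg\<bar> \<le> R"
  proof -
    have "Ng \<le> (LBINT u:?S. R * g u)" unfolding defs
    proof (rule set_integral_mono[OF iug])
      show "u * g u \<le> R * g u" if "u \<in> ?S" for u
        using gS(1)[OF that] that by (intro mult_right_mono) auto
    qed (use ig in simp)
    moreover have "(LBINT u:?S. (- R) * g u) \<le> Ng" unfolding defs
    proof (rule set_integral_mono[OF _ iug])
      show "(- R) * g u \<le> u * g u" if "u \<in> ?S" for u
        using gS(1)[OF that] that by (intro mult_right_mono) auto
    qed (rule set_integrable_mult_right, rule ig)
    moreover have "(LBINT u:?S. (- R) * g u) = (- R) * Dg" "(LBINT u:?S. R * g u) = R * Dg"
      unfolding defs by (rule set_integral_mult_right)+
    ultimately have "\<bar>Ng\<bar> \<le> R * Dg" by (auto simp: abs_le_iff minus_le_iff)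
    then show ?thesis using Dpos by (simp add: divide_le_eq)
  qed
  have I0: "0 \<le> I" using dD by linarith
  have "\<bar>(Nf - Ng) + Ng / Dg * (Dg - Df)\<bar> \<le> \<bar>Nf - Ng\<bar> + \<bar>Ng / Dg\<bar> * \<bar>Dg - Df\<bar>"
    unfolding abs_mult[symmetric] by (rule abs_triangle_ineq)
  also have "\<dots> \<le> R * I + R * I" using dN mg dD R by (intro add_mono mult_mono) auto
  finally have "\<bar>(Nf - Ng) + Ng / Dg * (Dg - Df)\<bar> \<le> 2 * R * I" by (simp add: mult.commute)
  moreover have "Nf / Df - Ng / Dg = ((Nf - Ng) + Ng / Dg * (Dg - Df)) / Df"
    using Dpos by (simp add: field_simps)
  ultimately have "\<bar>Nf / Df - Ng / Dg\<bar> \<le> 2 * R * I / Df"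
    using Dpos by (simp add: divide_right_mono)
  also have "\<dots> \<le> 2 * R * I / (2 * R * exp (- A))"
    using \<open>2 * R * exp (- A) \<le> Df\<close> R I0 Dpos by (intro divide_left_mono) auto
  also have "\<dots> = exp A * I" using R by (simp add: exp_minus field_simps)
  also have "\<dots> \<le> exp A * (exp A * (LBINT u. b u))"
  proof (intro mult_left_mono)
    have "I \<le> (LBINT u:?S. exp A * b u)" unfolding I_def
    proof (rule set_integral_mono[OF iI])
      show "set_integrable lborel ?S (\<lambda>u. exp A * b u)"
        unfolding set_integrable_def using b by (intro integrable_mult_indicator) auto
      fix u assume "u \<in> ?S"
      then have u: "\<bar>u\<bar> < R" by auto
      have main: "\<bar>exp x - exp y\<bar> \<le> exp A * \<bar>x - y\<bar>" if "\<bar>x\<bar> \<le> A" "\<bar>y\<bar> \<le> A" for x y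
      proof -
        have half: "exp y - exp x \<le> exp A * (y - x)" if "x \<le> y" "y \<le> A" for x y
        proof -
          have "1 - exp (x - y) \<le> y - x" using exp_ge_add_one_self[of "x - y"] by linarith
          then have "exp y * (1 - exp (x - y)) \<le> exp y * (y - x)" by (intro mult_left_mono) auto
          also have "\<dots> \<le> exp A * (y - x)" using that by (intro mult_right_mono) auto
          finally show ?thesis by (simp add: right_diff_distrib exp_add[symmetric])
        qed
        show ?thesis
        proof (cases "x \<le> y")
          case True
          then have "\<bar>exp x - exp y\<bar> = exp y - exp x" "\<bar>x - y\<bar> = y - x" by auto
          then show ?thesis using half[OF True] that by simp
        next
          case False
          then have "\<bar>exp x - exp y\<bar> = exp x - exp y" "\<bar>x - y\<bar> = x - y" by auto
          then show ?thesis using half[of y x] False that by simp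
        qed
      qed
      have "\<bar>f u - g u\<bar> = \<bar>exp (ln (f u)) - exp (ln (g u))\<bar>" using fA[OF u] gA[OF u] by simp
      also have "\<dots> \<le> exp A * \<bar>ln (f u) - ln (g u)\<bar>" using fA[OF u] gA[OF u] by (intro main) auto
      also have "\<dots> \<le> exp A * b u" using fg[OF u] by (intro mult_left_mono) auto
      finally show "\<bar>f u - g u\<bar> \<le> exp A * b u" .
    qed
    also have "\<dots> = (LBINT u. indicator ?S u * (exp A * b u))"
      by (simp only: set_lebesgue_integral_def real_scaleR_def)
    also have "\<dots> \<le> (LBINT u. exp A * b u)"
    proof (rule integral_mono)
      have "set_integrable lborel ?S (\<lambda>u. exp A * b u)"
        unfolding set_integrable_def using b by (intro integrable_mult_indicator) auto
      then show "integrable lborel (\<lambda>u. indicator ?S u * (exp A * b u))" by (simp add: set_integrable_def)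
    qed (use b in \<open>auto simp: indicator_def\<close>)
    finally show "I \<le> exp A * (LBINT u. b u)" by simp
  qed simp
  also have "\<dots> = exp (2 * A) * (LBINT u. b u)"
    by (simp only: mult_2 exp_add mult.assoc)
  finally show ?thesis unfolding defs .
qed

subsection \<open>Tails of the posterior\<close>

text \<open>
  The margin leaves room for a unit cell around a point of \<open>U\<close>, followed by a ramp of length at most
  \<open>1\<close>.
\<close>

definition near :: "real set \<Rightarrow> real \<Rightarrow> bool" where
  "near U v \<longleftrightarrow> (\<exists>u\<in>U. \<bar>v - u\<bar> \<le> 2)"

lemma power_le_fact_exp:
  fixes x :: real
  assumes "0 \<le> x"
  shows "x ^ m \<le> fact m * exp x"
proof -
  have "summable (\<lambda>n. x ^ n /\<^sub>R fact n)" by (rule summable_exp_generic)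
  then have "sum (\<lambda>n. x ^ n /\<^sub>R fact n) {m} \<le> (\<Sum>n. x ^ n /\<^sub>R fact n)"
    by (rule sum_le_suminf) (use assms in auto)
  then have "x ^ m / fact m \<le> exp x" by (simp add: exp_def divide_inverse mult.commute)
  then show ?thesis by (simp add: divide_le_eq mult.commute)
qed

lemma summable_power_exp:
  fixes c :: real
  assumes c: "0 < c"
  shows "summable (\<lambda>k. (1 + real k) ^ m * exp (- (c * real k)))"
proof (rule summable_comparison_test')
  let ?C = "fact m * (2 / c) ^ m * exp (c / 2)"
  have "0 \<le> exp (- (c / 2))" "exp (- (c / 2)) < 1" using c by auto
  then have "summable (\<lambda>k. exp (- (c / 2)) ^ k)" by (intro summable_geometric) auto
  then show "summable (\<lambda>k. ?C * exp (- (c / 2)) ^ k)" by (rule summable_mult)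
  fix k :: nat
  have "(c / 2 * (1 + real k)) ^ m \<le> fact m * exp (c / 2 * (1 + real k))"
    using c by (intro power_le_fact_exp) auto
  then have "(2 / c) ^ m * (c / 2 * (1 + real k)) ^ m \<le> (2 / c) ^ m * (fact m * exp (c / 2 * (1 + real k)))"
    using c by (intro mult_left_mono) auto
  moreover have "(2 / c) ^ m * (c / 2 * (1 + real k)) ^ m = (1 + real k) ^ m"
  proof -
    have "2 / c * (c / 2 * (1 + real k)) = 1 + real k" using c by (simp add: field_simps)
    then show ?thesis by (simp only: power_mult_distrib[symmetric])
  qed
  ultimately have "(1 + real k) ^ m * exp (- (c * real k))
      \<le> (2 / c) ^ m * (fact m * exp (c / 2 * (1 + real k))) * exp (- (c * real k))"
    by (intro mult_right_mono) auto
  also have "\<dots> = ?C * exp (- (c / 2)) ^ k"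
  proof -
    have "exp (c / 2 * (1 + real k)) * exp (- (c * real k)) = exp (c / 2) * exp (- (c / 2)) ^ k"
      unfolding exp_of_nat_mult[symmetric] exp_add[symmetric] by (simp add: field_simps)
    then show ?thesis by (simp add: mult.assoc)
  qed
  finally show "norm ((1 + real k) ^ m * exp (- (c * real k))) \<le> ?C * exp (- (c / 2)) ^ k" by simp
qed

text \<open>
  A random field \<open>Z\<close> of likelihood ratios in a local coordinate that ranges over \<open>U\<close>, with prior density
  \<open>w\<close>. Three assumptions carry the analysis: \<open>osc\<close>, over unit distances \<open>ln Z\<close> moves by at most a
  constant plus a multiple of the number of points counted by \<open>Y\<close>, where \<open>\<epsilon>\<close> is the length of a ramp; \<open>Y_exp\<close>, these
  numbers have the exponential moments of a Poisson process of rate \<open>B\<close>; and \<open>Z_half\<close>, the Hellinger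
  affinity with the origin decays at rate \<open>c\<close>. The bound \<open>w_cell\<close> grows in \<open>k\<close>, so that \<open>w\<close> may be
  unbounded far from the origin.
\<close>

locale local_likelihood = prob_space M for M :: "'a measure" +
  fixes Z Y :: "real \<Rightarrow> 'a \<Rightarrow> real" and w :: "real \<Rightarrow> real" and U :: "real set"
    and \<epsilon> K B c Cw cw :: real
  assumes eps: "0 \<le> \<epsilon>" "\<epsilon> \<le> 1"
    and const_bounds: "0 \<le> K" "0 \<le> B" "0 < c" "0 \<le> Cw" "0 < cw"
    and U: "is_interval U" "{0..1} \<subseteq> U"
    and w_meas [measurable]: "w \<in> borel_measurable borel"
    and w_nonneg: "\<And>u. 0 \<le> w u" and w_outside: "\<And>u. u \<notin> U \<Longrightarrow> w u = 0"
    and w_low: "\<And>u. 0 \<le> u \<Longrightarrow> u < 1 \<Longrightarrow> cw \<le> w u"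
    and w_cell: "\<And>k :: nat. (\<integral>\<^sup>+u. ennreal (w u) * indicator {u. real k \<le> \<bar>u\<bar> \<and> \<bar>u\<bar> < real k + 1} u \<partial>lborel)
        \<le> ennreal (Cw * (1 + real k))"
    and Z_meas [measurable]: "(\<lambda>(\<omega>, u). Z u \<omega>) \<in> borel_measurable (M \<Otimes>\<^sub>M lborel)"
    and Z_pos: "\<And>u \<omega>. \<omega> \<in> space M \<Longrightarrow> 0 < Z u \<omega>" and Z_0: "\<And>\<omega>. \<omega> \<in> space M \<Longrightarrow> Z 0 \<omega> = 1"
    and Y_mono: "\<And>u v \<omega>. \<omega> \<in> space M \<Longrightarrow> near U u \<Longrightarrow> near U v \<Longrightarrow> u \<le> v \<Longrightarrow> Y u \<omega> \<le> Y v \<omega>"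
    and osc: "\<And>u v \<omega>. \<omega> \<in> space M \<Longrightarrow> u \<in> U \<Longrightarrow> v \<in> U \<Longrightarrow> \<bar>u - v\<bar> \<le> 1 \<Longrightarrow>
        \<bar>ln (Z u \<omega>) - ln (Z v \<omega>)\<bar> \<le> K * (Y (max u v + \<epsilon>) \<omega> - Y (min u v) \<omega>) + K"
    and Y_exp: "\<And>u v s. near U u \<Longrightarrow> near U v \<Longrightarrow> u \<le> v \<Longrightarrow> 0 \<le> s \<Longrightarrow>
        mean_le M (\<lambda>\<omega>. exp (s * (Y v \<omega> - Y u \<omega>))) (exp (B * (v - u) * (exp s - 1)))"
    and Z_half: "\<And>u. u \<in> U \<Longrightarrow> mean_le M (\<lambda>\<omega>. sqrt (Z u \<omega>)) (exp (- (c * (\<bar>u\<bar> - \<epsilon>))))"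
begin

text \<open>
  The window contains everything that affects \<open>ln Z\<close> within unit distance of \<open>p\<close>, including a ramp.
\<close>

definition window_count :: "real \<Rightarrow> 'a \<Rightarrow> real" where
  "window_count p \<omega> = Y (p + 2) \<omega> - Y (p - 1) \<omega>"

text \<open>
  An upper bound, by the arithmetic--geometric mean inequality, for the fourth root of \<open>Z p\<close> times
  the square root of \<open>exp (K * window_count p)\<close>. Both summands have a mean of order \<open>exp (- c * k / 2)\<close> if \<open>\<bar>p\<bar> = k\<close>.
\<close>

definition bump :: "real \<Rightarrow> nat \<Rightarrow> 'a \<Rightarrow> real" where
  "bump p k \<omega> = (if p \<in> U then exp (c * real k / 2) * sqrt (Z p \<omega>) + exp (- (c * real k / 2)) * exp (K * window_count p \<omega>) else 0)"

definition bumps :: "nat \<Rightarrow> 'a \<Rightarrow> real" where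
  "bumps k \<omega> = bump (real k) k \<omega> + bump (- real k) k \<omega> + exp (- (c * real k / 2)) * exp (K * window_count 0 \<omega>)"

definition tail_const :: real where
  "tail_const = max 1 (Cw * exp (2 * K) / cw)"

definition cell_bound :: "nat \<Rightarrow> 'a \<Rightarrow> real" where
  "cell_bound k \<omega> = tail_const * (1 + real k) * bumps k \<omega>"

text \<open>
  A lower bound for \<open>w u * Z u\<close> on the unit interval to the right of the origin, hence for the
  normalising constant of the posterior.
\<close>

definition unit_mass :: "'a \<Rightarrow> real" where
  "unit_mass \<omega> = cw * exp (- (K * window_count 0 \<omega> + K))"

definition cell :: "nat \<Rightarrow> real set" where
  "cell k = {u. real k \<le> \<bar>u\<bar> \<and> \<bar>u\<bar> < real k + 1}"

lemma cell_sets [measurable]: "cell k \<in> sets borel"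
  unfolding cell_def by measurable

lemma zero_in_U: "0 \<in> U" using U(2) by auto

lemma Z_measurable_u [measurable]: "\<omega> \<in> space M \<Longrightarrow> (\<lambda>u. Z u \<omega>) \<in> borel_measurable borel"
  using measurable_compose[OF measurable_Pair1' Z_meas, of \<omega>] by simp

lemma unit_mass_pos: "0 < unit_mass \<omega>" using const_bounds by (simp add: unit_mass_def)

lemma bump_nonneg: "\<omega> \<in> space M \<Longrightarrow> 0 \<le> bump p k \<omega>"
  using Z_pos by (auto simp: bump_def less_imp_le intro!: add_nonneg_nonneg mult_nonneg_nonneg)

lemma bumps_pos: "\<omega> \<in> space M \<Longrightarrow> 0 < bumps k \<omega>"
  unfolding bumps_def by (intro add_nonneg_pos add_nonneg_nonneg bump_nonneg) auto

lemma cell_bound_pos: "\<omega> \<in> space M \<Longrightarrow> 0 < cell_bound k \<omega>"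
  unfolding cell_bound_def tail_const_def using bumps_pos by (intro mult_pos_pos) auto

lemma ln_Z_diff_le:
  assumes "\<omega> \<in> space M" "u \<in> U" "p \<in> U" "\<bar>u - p\<bar> \<le> 1"
  shows "\<bar>ln (Z u \<omega>) - ln (Z p \<omega>)\<bar> \<le> K * window_count p \<omega> + K"
proof -
  have n: "near U (max u p + \<epsilon>)" "near U (min u p)" "near U (p + 2)" "near U (p - 1)"
    using assms eps unfolding near_def by (auto intro!: bexI[of _ p])
  have "Y (max u p + \<epsilon>) \<omega> - Y (min u p) \<omega> \<le> window_count p \<omega>"
    unfolding window_count_def using assms eps by (intro diff_mono Y_mono n) auto
  then have "K * (Y (max u p + \<epsilon>) \<omega> - Y (min u p) \<omega>) \<le> K * window_count p \<omega>"
    using const_bounds by (intro mult_left_mono)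
  then show ?thesis using osc[OF assms] by linarith
qed

lemma lower_mass:
  assumes \<omega>: "\<omega> \<in> space M" and u: "0 \<le> u" "u < 1"
  shows "unit_mass \<omega> \<le> w u * Z u \<omega>"
proof -
  have uU: "u \<in> U" using u U(2) by auto
  have "\<bar>ln (Z u \<omega>) - ln (Z 0 \<omega>)\<bar> \<le> K * window_count 0 \<omega> + K"
    using u by (intro ln_Z_diff_le \<omega> uU zero_in_U) auto
  then have "- (K * window_count 0 \<omega> + K) \<le> ln (Z u \<omega>)" using Z_0[OF \<omega>] by simp
  then have "exp (- (K * window_count 0 \<omega> + K)) \<le> Z u \<omega>" using Z_pos[OF \<omega>] by (metis exp_le_cancel_iff exp_ln)
  then show ?thesis unfolding unit_mass_def using w_low[OF u] const_bounds by (intro mult_mono) auto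
qed

text \<open>
  Bounds on the mean are available for the square root of \<open>Z\<close>, and one more root is spent on
  separating \<open>Z\<close> from the exponential of the count. This is why \<open>bumps\<close>, whose mean decays in \<open>k\<close>,
  enters with its fourth power.
\<close>

lemma Z_le_bumps:
  assumes \<omega>: "\<omega> \<in> space M" and u: "u \<in> U" "u \<in> cell k"
  shows "Z u \<omega> \<le> unit_mass \<omega> * (exp (2 * K) / cw) * bumps k \<omega> ^ 4"
proof -
  define p where "p = (if 0 \<le> u then real k else - real k)"
  have up: "\<bar>u - p\<bar> \<le> 1" using u(2) by (auto simp: p_def cell_def)
  have pU: "p \<in> U"
  proof -
    have "u \<in> U" "0 \<in> U" using u zero_in_U by auto
    moreover have "0 \<le> p \<and> p \<le> u \<or> u \<le> p \<and> p \<le> 0" using u(2) by (auto simp: p_def cell_def)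
    ultimately show ?thesis using mem_is_interval_1_I[OF U(1)] by metis
  qed
  let ?E = "\<lambda>p. exp (K * window_count p \<omega>)"
  define z s where "z = sqrt (Z p \<omega>)" and "s = sqrt (?E p * ?E 0)"
  have z0: "0 \<le> z" "0 \<le> s" using Z_pos[OF \<omega>, of p] by (auto simp: z_def s_def)
  have "sqrt z * sqrt s \<le> (exp (c * real k / 2) * (sqrt z)\<^sup>2 + (sqrt s)\<^sup>2 / exp (c * real k / 2)) / 2"
    by (rule amgm_scaled) simp
  also have "\<dots> = (exp (c * real k / 2) * z + exp (- (c * real k / 2)) * s) / 2"
  proof -
    have "x / exp y = exp (- y) * x" for x y :: real by (simp add: exp_minus inverse_eq_divide)
    then show ?thesis using z0 by (simp only: real_sqrt_pow2)
  qed
  also have "\<dots> \<le> (exp (c * real k / 2) * z + exp (- (c * real k / 2)) * (?E p + ?E 0)) / 2"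
  proof -
    have "s \<le> (?E p + ?E 0) / 2" unfolding s_def by (rule arith_geo_mean_sqrt) auto
    also have "\<dots> \<le> ?E p + ?E 0" by (simp add: add_nonneg_nonneg)
    finally show ?thesis by (intro divide_right_mono add_left_mono mult_left_mono) auto
  qed
  also have "\<dots> \<le> exp (c * real k / 2) * z + exp (- (c * real k / 2)) * (?E p + ?E 0)"
    using z0 by (simp add: add_nonneg_nonneg)
  also have "\<dots> = bump p k \<omega> + exp (- (c * real k / 2)) * ?E 0"
    using pU by (simp add: bump_def z_def algebra_simps)
  also have "\<dots> \<le> bumps k \<omega>"
    unfolding bumps_def using bump_nonneg[OF \<omega>] by (auto simp: p_def)
  finally have "(sqrt z * sqrt s) ^ 4 \<le> bumps k \<omega> ^ 4"
    using z0 by (intro power_mono) auto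
  moreover have "(sqrt z * sqrt s) ^ 4 = Z p \<omega> * (?E p * ?E 0)"
  proof -
    have "(sqrt z * sqrt s) ^ 4 = ((sqrt z)\<^sup>2)\<^sup>2 * ((sqrt s)\<^sup>2)\<^sup>2" by (simp add: power_mult_distrib)
    also have "\<dots> = z\<^sup>2 * s\<^sup>2" using z0 by simp
    also have "\<dots> = Z p \<omega> * (?E p * ?E 0)" using Z_pos[OF \<omega>, of p] by (simp add: z_def s_def)
    finally show ?thesis .
  qed
  ultimately have 1: "Z p \<omega> * (?E p * ?E 0) \<le> bumps k \<omega> ^ 4" by simp
  have "ln (Z u \<omega>) \<le> ln (Z p \<omega>) + (K * window_count p \<omega> + K)"
    using ln_Z_diff_le[OF \<omega> u(1) pU up] by linarith
  then have "exp (ln (Z u \<omega>)) \<le> exp (ln (Z p \<omega>) + (K * window_count p \<omega> + K))" by simp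
  then have "Z u \<omega> \<le> Z p \<omega> * (?E p * exp K)"
    using Z_pos[OF \<omega>] by (simp add: exp_add)
  also have "\<dots> = exp (K - K * window_count 0 \<omega>) * (Z p \<omega> * (?E p * ?E 0))"
    by (simp add: exp_diff)
  also have "\<dots> \<le> exp (K - K * window_count 0 \<omega>) * bumps k \<omega> ^ 4" using 1 by (intro mult_left_mono) auto
  also have "exp (K - K * window_count 0 \<omega>) = unit_mass \<omega> * (exp (2 * K) / cw)"
    using const_bounds by (simp add: unit_mass_def exp_add[symmetric])
  finally show ?thesis .
qed

definition mass :: "'a \<Rightarrow> ennreal" where
  "mass \<omega> = (\<integral>\<^sup>+u. ennreal (w u * Z u \<omega>) \<partial>lborel)"

definition cell_mass :: "nat \<Rightarrow> 'a \<Rightarrow> ennreal" where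
  "cell_mass k \<omega> = (\<integral>\<^sup>+u. ennreal (w u * Z u \<omega>) * indicator (cell k) u \<partial>lborel)"

lemma cell_mass_le_mass: "\<omega> \<in> space M \<Longrightarrow> cell_mass k \<omega> \<le> mass \<omega>"
  unfolding cell_mass_def mass_def by (intro nn_integral_mono) (auto simp: indicator_def)

lemma unit_mass_le_mass: "\<omega> \<in> space M \<Longrightarrow> ennreal (unit_mass \<omega>) \<le> mass \<omega>"
proof -
  assume \<omega>: "\<omega> \<in> space M"
  have "ennreal (unit_mass \<omega>) = (\<integral>\<^sup>+u. ennreal (unit_mass \<omega>) * indicator {0..<1 :: real} u \<partial>lborel)"
    by (subst nn_integral_cmult_indicator) auto
  also have "\<dots> \<le> mass \<omega>"
    unfolding mass_def using lower_mass[OF \<omega>] by (intro nn_integral_mono) (auto simp: indicator_def intro: ennreal_leI)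
  finally show ?thesis .
qed

lemma cell_mass_le:
  assumes \<omega>: "\<omega> \<in> space M"
  shows "cell_mass k \<omega> \<le> ennreal (cell_bound k \<omega> ^ 4 * unit_mass \<omega>)"
proof -
  define b where "b = unit_mass \<omega> * (exp (2 * K) / cw) * bumps k \<omega> ^ 4"
  have b0: "0 \<le> b" unfolding b_def
    using unit_mass_pos[of \<omega>] bumps_pos[OF \<omega>, of k] const_bounds by (intro mult_nonneg_nonneg) auto
  have "cell_mass k \<omega> \<le> (\<integral>\<^sup>+u. ennreal b * (ennreal (w u) * indicator (cell k) u) \<partial>lborel)"
    unfolding cell_mass_def
  proof (intro nn_integral_mono)
    fix u
    show "ennreal (w u * Z u \<omega>) * indicator (cell k) u \<le> ennreal b * (ennreal (w u) * indicator (cell k) u)"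
    proof (cases "u \<in> cell k \<and> u \<in> U")
      case True
      then have "Z u \<omega> \<le> b" using Z_le_bumps[OF \<omega>] by (simp add: b_def)
      then have "w u * Z u \<omega> \<le> w u * b" using w_nonneg[of u] by (rule mult_left_mono)
      then have "w u * Z u \<omega> \<le> b * w u" by (simp only: mult.commute)
      then have "ennreal (w u * Z u \<omega>) \<le> ennreal (b * w u)" by (rule ennreal_leI)
      also have "\<dots> = ennreal b * ennreal (w u)" using b0 w_nonneg[of u] by (rule ennreal_mult)
      finally show ?thesis using True by simp
    next
      case False
      then show ?thesis using w_outside[of u] by (cases "u \<in> cell k") auto
    qed
  qed
  also have "\<dots> = ennreal b * (\<integral>\<^sup>+u. ennreal (w u) * indicator (cell k) u \<partial>lborel)"
    by (rule nn_integral_cmult) measurable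
  also have "\<dots> \<le> ennreal b * ennreal (Cw * (1 + real k))"
    using w_cell[of k] unfolding cell_def by (intro mult_left_mono) auto
  also have "\<dots> = ennreal (b * (Cw * (1 + real k)))"
    using b0 const_bounds by (subst ennreal_mult) auto
  also have "\<dots> \<le> ennreal (cell_bound k \<omega> ^ 4 * unit_mass \<omega>)"
  proof (rule ennreal_leI)
    let ?q = "Cw * exp (2 * K) / cw * (1 + real k)"
    let ?t = "tail_const * (1 + real k)"
    have "?q \<le> ?t" unfolding tail_const_def by (intro mult_right_mono) auto
    also have "\<dots> \<le> ?t ^ 4"
    proof -
      have "1 * 1 \<le> ?t" unfolding tail_const_def by (intro mult_mono) auto
      then show ?thesis using power_increasing[of 1 4 ?t] by simp
    qed
    finally have h1: "?q * (unit_mass \<omega> * bumps k \<omega> ^ 4) \<le> ?t ^ 4 * (unit_mass \<omega> * bumps k \<omega> ^ 4)"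
      using unit_mass_pos[of \<omega>] by (intro mult_right_mono) auto
    have h2: "b * (Cw * (1 + real k)) = ?q * (unit_mass \<omega> * bumps k \<omega> ^ 4)"
      by (simp add: b_def)
    have h3: "cell_bound k \<omega> ^ 4 * unit_mass \<omega> = ?t ^ 4 * (unit_mass \<omega> * bumps k \<omega> ^ 4)"
      unfolding cell_bound_def power_mult_distrib by (simp only: mult_ac)
    show "b * (Cw * (1 + real k)) \<le> cell_bound k \<omega> ^ 4 * unit_mass \<omega>"
      unfolding h2 h3 by (rule h1)
  qed
  finally show ?thesis .
qed

text \<open>
  The cell carries a fraction of the total mass that is at most \<open>1\<close> and at most the fourth power of
  \<open>cell_bound\<close>. One of the two is at most \<open>cell_bound\<close> itself, which has a finite mean.
\<close>

lemma cell_mass_le_cell_bound: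
  assumes \<omega>: "\<omega> \<in> space M"
  shows "cell_mass k \<omega> \<le> ennreal (cell_bound k \<omega>) * mass \<omega>"
proof (cases "1 \<le> cell_bound k \<omega>")
  case True
  have "1 * mass \<omega> \<le> ennreal (cell_bound k \<omega>) * mass \<omega>"
    using True by (intro mult_right_mono) (auto simp: ennreal_leI[of 1, simplified])
  then show ?thesis using cell_mass_le_mass[OF \<omega>, of k] by simp
next
  case False
  have p: "0 < cell_bound k \<omega>" by (rule cell_bound_pos[OF \<omega>])
  have "cell_bound k \<omega> ^ 4 \<le> cell_bound k \<omega> ^ 1" using False p by (intro power_decreasing) auto
  then have "cell_bound k \<omega> ^ 4 * unit_mass \<omega> \<le> cell_bound k \<omega> * unit_mass \<omega>" using unit_mass_pos[of \<omega>] by (intro mult_right_mono) auto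
  then have "cell_mass k \<omega> \<le> ennreal (cell_bound k \<omega> * unit_mass \<omega>)"
    using cell_mass_le[OF \<omega>, of k] by (auto intro: order_trans ennreal_leI)
  also have "\<dots> = ennreal (cell_bound k \<omega>) * ennreal (unit_mass \<omega>)"
    using p unit_mass_pos[of \<omega>] by (subst ennreal_mult) auto
  also have "\<dots> \<le> ennreal (cell_bound k \<omega>) * mass \<omega>"
    using unit_mass_le_mass[OF \<omega>] by (intro mult_left_mono) auto
  finally show ?thesis .
qed

text \<open>
  A bound for the mean of \<open>(1 + k) ^ m * cell_bound k\<close>, from \<open>mean_le_bump\<close>. It depends only on the constants of
  the field, so bounds in terms of \<open>tail_sum\<close> are uniform over fields that share them.
\<close>

definition tail_rate :: "nat \<Rightarrow> nat \<Rightarrow> real" where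
  "tail_rate m k = (1 + real k) ^ m * (tail_const * (2 * (exp c + exp (B * 3 * (exp K - 1))) + exp (B * 3 * (exp K - 1)))
     * (1 + real k) * exp (- (c * real k / 2)))"

definition tail_sum :: "nat \<Rightarrow> nat \<Rightarrow> real" where
  "tail_sum m R = (\<Sum>k. tail_rate m (k + R))"

lemma summable_tail_rate: "summable (tail_rate m)"
proof -
  have "summable (\<lambda>k. (1 + real k) ^ (m + 1) * exp (- (c / 2 * real k)))"
    using const_bounds by (intro summable_power_exp) auto
  from summable_mult[OF this, of "tail_const * (2 * (exp c + exp (B * 3 * (exp K - 1))) + exp (B * 3 * (exp K - 1)))"]
  show ?thesis unfolding tail_rate_def[abs_def] by (simp add: mult_ac)
qed

lemma tail_rate_nonneg: "0 \<le> tail_rate m k"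
  unfolding tail_rate_def tail_const_def by (intro mult_nonneg_nonneg add_nonneg_nonneg) auto

lemma mean_le_bump:
  assumes p: "\<bar>p\<bar> = real k"
  shows "mean_le M (bump p k) ((exp c + exp (B * 3 * (exp K - 1))) * exp (- (c * real k / 2)))"
proof (cases "p \<in> U")
  case False
  then have "bump p k = (\<lambda>_. 0)" by (auto simp: bump_def)
  then show ?thesis by (simp add: mean_le_def add_nonneg_nonneg)
next
  case True
  have "mean_le M (\<lambda>\<omega>. exp (K * window_count p \<omega>)) (exp (B * ((p + 2) - (p - 1)) * (exp K - 1)))"
    unfolding window_count_def using True const_bounds by (intro Y_exp) (auto simp: near_def intro!: bexI[of _ p])
  then have "mean_le M (\<lambda>\<omega>. exp (K * window_count p \<omega>)) (exp (B * 3 * (exp K - 1)))" by simp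
  from mean_le_cmult[OF this, of "exp (- (c * real k / 2))"] mean_le_cmult[OF Z_half[OF True], of "exp (c * real k / 2)"]
  have "mean_le M (\<lambda>\<omega>. exp (c * real k / 2) * sqrt (Z p \<omega>) + exp (- (c * real k / 2)) * exp (K * window_count p \<omega>))
     (exp (c * real k / 2) * exp (- (c * (\<bar>p\<bar> - \<epsilon>))) + exp (- (c * real k / 2)) * exp (B * 3 * (exp K - 1)))"
    by (intro mean_le_add) auto
  moreover have "(\<lambda>\<omega>. exp (c * real k / 2) * sqrt (Z p \<omega>) + exp (- (c * real k / 2)) * exp (K * window_count p \<omega>)) = bump p k"
    using True by (auto simp: bump_def)
  ultimately have 1: "mean_le M (bump p k) (exp (c * real k / 2) * exp (- (c * (\<bar>p\<bar> - \<epsilon>)))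
      + exp (- (c * real k / 2)) * exp (B * 3 * (exp K - 1)))" by simp
  show ?thesis
  proof (rule mean_le_mono[OF 1 mean_leD(1)[OF 1] order_refl])
    have "c * \<epsilon> \<le> c * 1" using const_bounds eps by (intro mult_left_mono) auto
    then have "exp (c * real k / 2) * exp (- (c * (\<bar>p\<bar> - \<epsilon>))) \<le> exp (- (c * real k / 2)) * exp c"
      unfolding p exp_add[symmetric] exp_le_cancel_iff by (simp add: right_diff_distrib)
    moreover have "(x + y) * z = z * x + z * y" for x y z :: real by (simp add: algebra_simps)
    ultimately show "exp (c * real k / 2) * exp (- (c * (\<bar>p\<bar> - \<epsilon>))) + exp (- (c * real k / 2)) * exp (B * 3 * (exp K - 1))
       \<le> (exp c + exp (B * 3 * (exp K - 1))) * exp (- (c * real k / 2))"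
      by (simp only: add_right_mono)
  qed
qed

lemma mean_le_cell_bound: "mean_le M (\<lambda>\<omega>. (1 + real k) ^ m * cell_bound k \<omega>) (tail_rate m k)"
proof -
  have "mean_le M (\<lambda>\<omega>. exp (K * window_count 0 \<omega>)) (exp (B * ((0 + 2) - (0 - 1)) * (exp K - 1)))"
    unfolding window_count_def using zero_in_U const_bounds by (intro Y_exp) (auto simp: near_def intro!: bexI[of _ 0])
  then have "mean_le M (\<lambda>\<omega>. exp (K * window_count 0 \<omega>)) (exp (B * 3 * (exp K - 1)))" by simp
  from mean_le_cmult[OF this, of "exp (- (c * real k / 2))"]
  have 1: "mean_le M (bumps k) ((exp c + exp (B * 3 * (exp K - 1))) * exp (- (c * real k / 2))
      + (exp c + exp (B * 3 * (exp K - 1))) * exp (- (c * real k / 2))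
      + exp (- (c * real k / 2)) * exp (B * 3 * (exp K - 1)))"
    unfolding bumps_def[abs_def] by (intro mean_le_add mean_le_bump) auto
  have "mean_le M (\<lambda>\<omega>. ((1 + real k) ^ m * (tail_const * (1 + real k))) * bumps k \<omega>) (((1 + real k) ^ m * (tail_const * (1 + real k))) *
     ((exp c + exp (B * 3 * (exp K - 1))) * exp (- (c * real k / 2))
      + (exp c + exp (B * 3 * (exp K - 1))) * exp (- (c * real k / 2))
      + exp (- (c * real k / 2)) * exp (B * 3 * (exp K - 1))))"
    by (rule mean_le_cmult[OF 1]) (auto simp: tail_const_def)
  moreover have "((1 + real k) ^ m * (tail_const * (1 + real k))) *
     ((exp c + exp (B * 3 * (exp K - 1))) * exp (- (c * real k / 2))
      + (exp c + exp (B * 3 * (exp K - 1))) * exp (- (c * real k / 2))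
      + exp (- (c * real k / 2)) * exp (B * 3 * (exp K - 1))) = tail_rate m k"
    unfolding tail_rate_def by (simp add: distrib_left distrib_right mult_ac)
  ultimately show ?thesis by (simp add: cell_bound_def[abs_def] mult.assoc)
qed

text \<open>
  A majorant of the posterior mean of \<open>\<bar>u\<bar> ^ m\<close> restricted to \<open>\<bar>u\<bar> \<ge> R\<close>; its mean is at most
  \<open>tail_sum m R\<close>.
\<close>

definition tail_weight :: "nat \<Rightarrow> nat \<Rightarrow> 'a \<Rightarrow> ennreal" where
  "tail_weight m R \<omega> = (\<Sum>k. ennreal ((1 + real (k + R)) ^ m * cell_bound (k + R) \<omega>))"

lemma tail_weight_measurable [measurable]: "tail_weight m R \<in> borel_measurable M"
proof -
  have [measurable]: "(\<lambda>\<omega>. (1 + real k) ^ m * cell_bound k \<omega>) \<in> borel_measurable M" for k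
    by (rule mean_leD(1)[OF mean_le_cell_bound])
  show ?thesis unfolding tail_weight_def[abs_def] by measurable
qed

lemma nn_integral_tail_weight: "(\<integral>\<^sup>+\<omega>. tail_weight m R \<omega> \<partial>M) \<le> ennreal (tail_sum m R)"
proof -
  have [measurable]: "(\<lambda>\<omega>. (1 + real k) ^ m * cell_bound k \<omega>) \<in> borel_measurable M" for k
    by (rule mean_leD(1)[OF mean_le_cell_bound])
  have "(\<integral>\<^sup>+\<omega>. tail_weight m R \<omega> \<partial>M) = (\<Sum>k. \<integral>\<^sup>+\<omega>. ennreal ((1 + real (k + R)) ^ m * cell_bound (k + R) \<omega>) \<partial>M)"
    unfolding tail_weight_def by (rule nn_integral_suminf) measurable
  also have "\<dots> \<le> (\<Sum>k. ennreal (tail_rate m (k + R)))"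
    by (intro suminf_le mean_leD(3) mean_le_cell_bound summableI)
  also have "\<dots> = ennreal (tail_sum m R)"
    unfolding tail_sum_def using summable_tail_rate[of m]
    by (intro suminf_ennreal2 tail_rate_nonneg) (simp add: summable_iff_shift)
  finally show ?thesis .
qed

lemma tail_sum_nonneg: "0 \<le> tail_sum m R"
  unfolding tail_sum_def using summable_tail_rate[of m]
  by (intro suminf_nonneg tail_rate_nonneg) (simp add: summable_iff_shift)

lemma tail_mass_le:
  assumes \<omega>: "\<omega> \<in> space M"
  shows "(\<integral>\<^sup>+u. ennreal (\<bar>u\<bar> ^ m * (w u * Z u \<omega>)) * indicator (- {- real R<..<real R}) u \<partial>lborel)
     \<le> (\<Sum>k. ennreal ((1 + real (k + R)) ^ m) * cell_mass (k + R) \<omega>)"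
proof -
  have [measurable]: "(\<lambda>u. Z u \<omega>) \<in> borel_measurable borel" by (rule Z_measurable_u[OF \<omega>])
  have "(\<integral>\<^sup>+u. ennreal (\<bar>u\<bar> ^ m * (w u * Z u \<omega>)) * indicator (- {- real R<..<real R}) u \<partial>lborel)
    \<le> (\<integral>\<^sup>+u. (\<Sum>k. ennreal ((1 + real (k + R)) ^ m) * (ennreal (w u * Z u \<omega>) * indicator (cell (k + R)) u)) \<partial>lborel)"
  proof (rule nn_integral_mono)
    fix u :: real
    let ?f = "\<lambda>k. ennreal ((1 + real (k + R)) ^ m) * (ennreal (w u * Z u \<omega>) * indicator (cell (k + R)) u)"
    show "ennreal (\<bar>u\<bar> ^ m * (w u * Z u \<omega>)) * indicator (- {- real R<..<real R}) u \<le> suminf ?f"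
    proof (cases "u \<in> - {- real R<..<real R}")
      case True
      define k where "k = nat \<lfloor>\<bar>u\<bar>\<rfloor> - R"
      have ge: "real R \<le> \<bar>u\<bar>" using True by auto
      then have "R \<le> nat \<lfloor>\<bar>u\<bar>\<rfloor>" by (simp add: le_nat_floor)
      then have kR: "real (k + R) = of_int \<lfloor>\<bar>u\<bar>\<rfloor>" by (simp add: k_def)
      then have cell: "u \<in> cell (k + R)" unfolding cell_def kR by (auto simp: floor_le_iff)
      have wZ: "0 \<le> w u * Z u \<omega>" using w_nonneg Z_pos[OF \<omega>] by (simp add: less_imp_le)
      have "\<bar>u\<bar> ^ m \<le> (1 + real (k + R)) ^ m" using cell by (intro power_mono) (auto simp: cell_def)
      then have "\<bar>u\<bar> ^ m * (w u * Z u \<omega>) \<le> (1 + real (k + R)) ^ m * (w u * Z u \<omega>)"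
        using wZ by (rule mult_right_mono)
      then have "ennreal (\<bar>u\<bar> ^ m * (w u * Z u \<omega>)) * indicator (- {- real R<..<real R}) u \<le> sum ?f {k}"
        using True cell wZ by (simp add: ennreal_mult[symmetric] ennreal_leI)
      also have "\<dots> \<le> suminf ?f" by (rule sum_le_suminf) (auto intro: summableI)
      finally show ?thesis .
    qed simp
  qed
  also have "\<dots> = (\<Sum>k. ennreal ((1 + real (k + R)) ^ m) * cell_mass (k + R) \<omega>)"
    unfolding cell_mass_def by (subst nn_integral_suminf) (auto simp: nn_integral_cmult)
  finally show ?thesis .
qed

lemma tail_mass_le_weight:
  assumes \<omega>: "\<omega> \<in> space M"
  shows "(\<integral>\<^sup>+u. ennreal (\<bar>u\<bar> ^ m * (w u * Z u \<omega>)) * indicator (- {- real R<..<real R}) u \<partial>lborel)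
     \<le> tail_weight m R \<omega> * mass \<omega>"
proof -
  note tail_mass_le[OF \<omega>, of m R]
  also have "(\<Sum>k. ennreal ((1 + real (k + R)) ^ m) * cell_mass (k + R) \<omega>)
     \<le> (\<Sum>k. ennreal ((1 + real (k + R)) ^ m * cell_bound (k + R) \<omega>) * mass \<omega>)"
  proof (intro suminf_le summableI)
    fix k
    have "ennreal ((1 + real (k + R)) ^ m) * cell_mass (k + R) \<omega>
        \<le> ennreal ((1 + real (k + R)) ^ m) * (ennreal (cell_bound (k + R) \<omega>) * mass \<omega>)"
      by (intro mult_left_mono cell_mass_le_cell_bound \<omega>) auto
    also have "\<dots> = ennreal ((1 + real (k + R)) ^ m * cell_bound (k + R) \<omega>) * mass \<omega>"
      using cell_bound_pos[OF \<omega>, of "k + R"] by (simp add: ennreal_mult mult.assoc)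
    finally show "ennreal ((1 + real (k + R)) ^ m) * cell_mass (k + R) \<omega>
       \<le> ennreal ((1 + real (k + R)) ^ m * cell_bound (k + R) \<omega>) * mass \<omega>" .
  qed
  also have "\<dots> = tail_weight m R \<omega> * mass \<omega>" unfolding tail_weight_def by simp
  finally show ?thesis .
qed

lemma tail_weight_finite_imp_mass_finite:
  assumes \<omega>: "\<omega> \<in> space M" and fin: "tail_weight 0 0 \<omega> \<noteq> \<infinity>"
  shows "mass \<omega> < \<infinity>"
proof -
  have s: "summable (\<lambda>k. cell_bound k \<omega>)"
    using fin cell_bound_pos[OF \<omega>] unfolding tail_weight_def
    by (intro summable_suminf_not_top) (auto simp: less_imp_le top_ennreal_def[symmetric] infinity_ennreal_def)
  then have "(\<lambda>k. cell_bound k \<omega>) \<longlonglongrightarrow> 0" by (rule summable_LIMSEQ_zero)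
  then have "eventually (\<lambda>k. cell_bound k \<omega> < 1) sequentially" by (rule order_tendstoD) simp
  then have ev: "eventually (\<lambda>k. norm (cell_bound k \<omega> ^ 4 * unit_mass \<omega>) \<le> cell_bound k \<omega> * unit_mass \<omega>) sequentially"
  proof eventually_elim
    case (elim k)
    have p: "0 < cell_bound k \<omega>" by (rule cell_bound_pos[OF \<omega>])
    have "cell_bound k \<omega> ^ 4 \<le> cell_bound k \<omega> ^ 1" using elim p by (intro power_decreasing) auto
    then show ?case using unit_mass_pos[of \<omega>] p by (simp add: mult_right_mono)
  qed
  have s': "summable (\<lambda>k. cell_bound k \<omega> ^ 4 * unit_mass \<omega>)"
    by (rule summable_comparison_test_ev[OF ev]) (rule summable_mult2[OF s])
  have "mass \<omega> = (\<integral>\<^sup>+u. ennreal (\<bar>u\<bar> ^ 0 * (w u * Z u \<omega>)) * indicator (- {- real 0<..<real 0}) u \<partial>lborel)"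
    by (simp add: mass_def)
  also have "\<dots> \<le> (\<Sum>k. ennreal ((1 + real (k + 0)) ^ 0) * cell_mass (k + 0) \<omega>)" by (rule tail_mass_le[OF \<omega>])
  also have "\<dots> \<le> (\<Sum>k. ennreal (cell_bound k \<omega> ^ 4 * unit_mass \<omega>))"
    by (intro suminf_le summableI) (use cell_mass_le[OF \<omega>] in auto)
  also have "\<dots> = ennreal (\<Sum>k. cell_bound k \<omega> ^ 4 * unit_mass \<omega>)"
    using unit_mass_pos[of \<omega>] s' by (intro suminf_ennreal2) (auto simp: less_imp_le)
  finally show ?thesis using le_less_trans[OF _ ennreal_less_top] by (simp add: infinity_ennreal_def)
qed

definition post :: "'a \<Rightarrow> real" where
  "post \<omega> = (LBINT u. u * (w u * Z u \<omega>)) / (LBINT u. w u * Z u \<omega>)"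

definition post_trunc :: "nat \<Rightarrow> 'a \<Rightarrow> real" where
  "post_trunc R \<omega> = (LBINT u:{- real R<..<real R}. u * (w u * Z u \<omega>)) / (LBINT u:{- real R<..<real R}. w u * Z u \<omega>)"

lemma post_measurable [measurable]: "post \<in> borel_measurable M" "post_trunc R \<in> borel_measurable M"
  unfolding post_def[abs_def] post_trunc_def[abs_def] set_lebesgue_integral_def by measurable

lemma posterior_integrable:
  assumes \<omega>: "\<omega> \<in> space M" and fin0: "tail_weight 0 0 \<omega> \<noteq> \<infinity>" and fin: "tail_weight m 0 \<omega> \<noteq> \<infinity>"
  shows "integrable lborel (\<lambda>u. \<bar>u\<bar> ^ m * (w u * Z u \<omega>))"
    and "ennreal (LBINT u:- {- real R<..<real R}. \<bar>u\<bar> ^ m * (w u * Z u \<omega>)) \<le> tail_weight m R \<omega> * mass \<omega>"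
    and "mass \<omega> = ennreal (LBINT u. w u * Z u \<omega>)" and "0 < (LBINT u. w u * Z u \<omega>)"
proof -
  have [measurable]: "(\<lambda>u. Z u \<omega>) \<in> borel_measurable borel" by (rule Z_measurable_u[OF \<omega>])
  have wZ: "0 \<le> w u * Z u \<omega>" for u using w_nonneg Z_pos[OF \<omega>] by (simp add: less_imp_le)
  have mf: "mass \<omega> < \<infinity>" by (rule tail_weight_finite_imp_mass_finite[OF \<omega> fin0])
  have int: "integrable lborel (\<lambda>u. \<bar>u\<bar> ^ m * (w u * Z u \<omega>))"
    if fin: "tail_weight m 0 \<omega> \<noteq> \<infinity>" for m
  proof (rule integrableI_nonneg)
    have "(\<integral>\<^sup>+u. ennreal (\<bar>u\<bar> ^ m * (w u * Z u \<omega>)) \<partial>lborel) \<le> tail_weight m 0 \<omega> * mass \<omega>"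
      using tail_mass_le_weight[OF \<omega>, of m 0] by simp
    also have "\<dots> < \<infinity>" using fin mf by (simp add: ennreal_mult_less_top less_top)
    finally show "(\<integral>\<^sup>+u. ennreal (\<bar>u\<bar> ^ m * (w u * Z u \<omega>)) \<partial>lborel) < \<infinity>" .
  qed (use wZ in auto)
  show i: "integrable lborel (\<lambda>u. \<bar>u\<bar> ^ m * (w u * Z u \<omega>))" by (rule int[OF fin])
  have i0: "integrable lborel (\<lambda>u. w u * Z u \<omega>)" using int[OF fin0] by simp
  show m: "mass \<omega> = ennreal (LBINT u. w u * Z u \<omega>)"
    unfolding mass_def using wZ by (intro nn_integral_eq_integral i0) auto
  show "0 < (LBINT u. w u * Z u \<omega>)"
  proof (rule ccontr)
    assume "\<not> 0 < (LBINT u. w u * Z u \<omega>)"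
    then have "ennreal (unit_mass \<omega>) \<le> 0"
      using unit_mass_le_mass[OF \<omega>] unfolding m by (simp add: ennreal_neg not_less)
    then show False using unit_mass_pos[of \<omega>] by simp
  qed
  have "integrable lborel (\<lambda>u. indicator (- {- real R<..<real R}) u *\<^sub>R (\<bar>u\<bar> ^ m * (w u * Z u \<omega>)))"
    by (rule integrable_mult_indicator[OF _ i]) simp
  then have "ennreal (LBINT u:- {- real R<..<real R}. \<bar>u\<bar> ^ m * (w u * Z u \<omega>))
    = (\<integral>\<^sup>+u. ennreal (indicator (- {- real R<..<real R}) u *\<^sub>R (\<bar>u\<bar> ^ m * (w u * Z u \<omega>))) \<partial>lborel)"
    unfolding set_lebesgue_integral_def using wZ by (subst nn_integral_eq_integral) auto
  also have "\<dots> = (\<integral>\<^sup>+u. ennreal (\<bar>u\<bar> ^ m * (w u * Z u \<omega>)) * indicator (- {- real R<..<real R}) u \<partial>lborel)"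
    by (intro nn_integral_cong) (auto simp: indicator_def)
  also have "\<dots> \<le> tail_weight m R \<omega> * mass \<omega>" by (rule tail_mass_le_weight[OF \<omega>])
  finally show "ennreal (LBINT u:- {- real R<..<real R}. \<bar>u\<bar> ^ m * (w u * Z u \<omega>)) \<le> tail_weight m R \<omega> * mass \<omega>" .
qed

lemma AE_tail_weight_finite: "AE \<omega> in M. tail_weight m 0 \<omega> \<noteq> \<infinity>"
proof (rule nn_integral_PInf_AE)
  show "(\<integral>\<^sup>+\<omega>. tail_weight m 0 \<omega> \<partial>M) \<noteq> \<infinity>"
    using nn_integral_tail_weight[of m 0] by (metis ennreal_less_top infinity_ennreal_def leD)
qed measurable

lemma ratio_le_weight:
  assumes "ennreal a \<le> t * ennreal b" "0 < b" "0 \<le> a"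
  shows "ennreal (a / b) \<le> t"
proof (cases t)
  case (real x)
  then have "ennreal a \<le> ennreal (x * b)" using assms by (simp add: ennreal_mult)
  then have "a \<le> x * b" using real assms by (simp add: ennreal_le_iff)
  then show ?thesis using real assms by (simp add: pos_divide_le_eq ennreal_leI)
qed simp

lemma mean_le_post_trunc:
  assumes R: "1 \<le> R"
  shows "mean_le M (\<lambda>\<omega>. \<bar>post \<omega> - post_trunc R \<omega>\<bar>) (2 * tail_sum 1 R)"
proof -
  have "AE \<omega> in M. ennreal \<bar>post \<omega> - post_trunc R \<omega>\<bar> \<le> 2 * tail_weight 1 R \<omega>"
    using AE_tail_weight_finite[of 0] AE_tail_weight_finite[of 1] AE_space
  proof eventually_elim
    case (elim \<omega>)
    note \<omega> = elim(3)
    have [measurable]: "(\<lambda>u. Z u \<omega>) \<in> borel_measurable borel" by (rule Z_measurable_u[OF \<omega>])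
    let ?f = "\<lambda>u. w u * Z u \<omega>" and ?S = "{- real R<..<real R}"
    have wZ: "0 \<le> ?f u" for u using w_nonneg Z_pos[OF \<omega>] by (simp add: less_imp_le)
    note i0 = posterior_integrable[OF \<omega> elim(1,1), simplified]
    note i1 = posterior_integrable[OF \<omega> elim(1,2), simplified]
    have "0 < (LBINT u:?S. ?f u)"
    proof -
      have iS: "integrable lborel (\<lambda>u. indicator ?S u * ?f u)"
        using integrable_mult_indicator[OF _ i0(1), of ?S] by simp
      have "unit_mass \<omega> = (LBINT u. indicator {0..<1 :: real} u * unit_mass \<omega>)" by (simp add: measure_def emeasure_lborel_Ico)
      also have "\<dots> \<le> (LBINT u. indicator ?S u * ?f u)"
      proof (rule integral_mono[OF _ iS])
        show "integrable lborel (\<lambda>u :: real. indicator {0..<1} u * unit_mass \<omega>)" by simp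
      qed (use lower_mass[OF \<omega>] wZ R in \<open>auto simp: indicator_def\<close>)
      finally show ?thesis using unit_mass_pos[of \<omega>] by (simp add: set_lebesgue_integral_def)
    qed
    then have "\<bar>post \<omega> - post_trunc R \<omega>\<bar> \<le> 2 * (LBINT u:- ?S. \<bar>u\<bar> * ?f u) / (LBINT u. ?f u)"
      unfolding post_def post_trunc_def using R i0(1) i1(1) wZ by (intro posterior_mean_truncation) auto
    also have "\<dots> = 2 * ((LBINT u:- ?S. \<bar>u\<bar> * ?f u) / (LBINT u. ?f u))" by simp
    finally have "ennreal \<bar>post \<omega> - post_trunc R \<omega>\<bar> \<le> ennreal (2 * ((LBINT u:- ?S. \<bar>u\<bar> * ?f u) / (LBINT u. ?f u)))"
      by (rule ennreal_leI)
    also have "\<dots> = 2 * ennreal ((LBINT u:- ?S. \<bar>u\<bar> * ?f u) / (LBINT u. ?f u))"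
      by (subst ennreal_mult') auto
    also have "\<dots> \<le> 2 * tail_weight 1 R \<omega>"
    proof (intro mult_left_mono ratio_le_weight)
      show "ennreal (LBINT u:- ?S. \<bar>u\<bar> * ?f u) \<le> tail_weight 1 R \<omega> * ennreal (LBINT u. ?f u)"
        using i1(2)[of R] i1(3) by simp
      show "0 < (LBINT u. ?f u)" by (rule i0(4))
      show "0 \<le> (LBINT u:- ?S. \<bar>u\<bar> * ?f u)"
        unfolding set_lebesgue_integral_def using wZ by (intro integral_nonneg_AE AE_I2) auto
    qed simp
    finally show ?case .
  qed
  then have "(\<integral>\<^sup>+\<omega>. ennreal \<bar>post \<omega> - post_trunc R \<omega>\<bar> \<partial>M) \<le> (\<integral>\<^sup>+\<omega>. 2 * tail_weight 1 R \<omega> \<partial>M)"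
    by (rule nn_integral_mono_AE)
  also have "\<dots> = 2 * (\<integral>\<^sup>+\<omega>. tail_weight 1 R \<omega> \<partial>M)" by (rule nn_integral_cmult) measurable
  also have "\<dots> \<le> 2 * ennreal (tail_sum 1 R)" by (intro mult_left_mono nn_integral_tail_weight) simp
  also have "\<dots> = ennreal (2 * tail_sum 1 R)" by (subst ennreal_mult') auto
  finally show ?thesis unfolding mean_le_def using tail_sum_nonneg by auto
qed

lemma mean_le_post_power: "mean_le M (\<lambda>\<omega>. \<bar>post \<omega>\<bar> ^ m) (tail_sum m 0)"
proof -
  have "AE \<omega> in M. ennreal (\<bar>post \<omega>\<bar> ^ m) \<le> tail_weight m 0 \<omega>"
    using AE_tail_weight_finite[of 0] AE_tail_weight_finite[of 1] AE_tail_weight_finite[of m] AE_space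
  proof eventually_elim
    case (elim \<omega>)
    note \<omega> = elim(4)
    let ?f = "\<lambda>u. w u * Z u \<omega>"
    have wZ: "0 \<le> ?f u" for u using w_nonneg Z_pos[OF \<omega>] by (simp add: less_imp_le)
    note i0 = posterior_integrable[OF \<omega> elim(1,1), simplified]
    note i1 = posterior_integrable[OF \<omega> elim(1,2), simplified]
    note im = posterior_integrable[OF \<omega> elim(1,3)]
    have "\<bar>post \<omega>\<bar> ^ m \<le> (LBINT u. \<bar>u\<bar> ^ m * ?f u) / (LBINT u. ?f u)"
      unfolding post_def using i0(1,4) i1(1) im(1) wZ by (intro posterior_mean_power) auto
    then have "ennreal (\<bar>post \<omega>\<bar> ^ m) \<le> ennreal ((LBINT u. \<bar>u\<bar> ^ m * ?f u) / (LBINT u. ?f u))"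
      by (rule ennreal_leI)
    also have "\<dots> \<le> tail_weight m 0 \<omega>"
    proof (rule ratio_le_weight)
      show "ennreal (LBINT u. \<bar>u\<bar> ^ m * ?f u) \<le> tail_weight m 0 \<omega> * ennreal (LBINT u. ?f u)"
        using im(2)[of 0] im(3) by (simp add: set_lebesgue_integral_def)
      show "0 < (LBINT u. ?f u)" by (rule im(4))
      show "0 \<le> (LBINT u. \<bar>u\<bar> ^ m * ?f u)" using wZ by (intro integral_nonneg_AE AE_I2) auto
    qed
    finally show ?case .
  qed
  then have "(\<integral>\<^sup>+\<omega>. ennreal (\<bar>post \<omega>\<bar> ^ m) \<partial>M) \<le> (\<integral>\<^sup>+\<omega>. tail_weight m 0 \<omega> \<partial>M)"
    by (rule nn_integral_mono_AE)
  also have "\<dots> \<le> ennreal (tail_sum m 0)" by (rule nn_integral_tail_weight)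
  finally show ?thesis unfolding mean_le_def using tail_sum_nonneg by auto
qed

end

subsection \<open>Discretisation of the posterior mean\<close>

definition grid :: "nat \<Rightarrow> nat \<Rightarrow> int set" where
  "grid R N = {- int (R * N)..<int (R * N)}"

definition step :: "nat \<Rightarrow> nat \<Rightarrow> (int \<Rightarrow> real) \<Rightarrow> real \<Rightarrow> real" where
  "step R N h u = (\<Sum>i\<in>grid R N. h i * indicator {real_of_int i / real N..<(real_of_int i + 1) / real N} u)"

text \<open>
  The mean on \<open>(-R, R)\<close> of the density \<open>exp (- \<kappa> * Y u + r * u)\<close>, frozen on each cell at its left end
  point, where \<open>Y\<close> takes the value \<open>y i\<close>.
\<close>

definition grid_mean :: "real \<Rightarrow> real \<Rightarrow> nat \<Rightarrow> nat \<Rightarrow> (int \<Rightarrow> real) \<Rightarrow> real" where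
  "grid_mean \<kappa> r R N y =
     (LBINT u:{- real R<..<real R}. u * step R N (\<lambda>i. exp (- \<kappa> * y i + r * (real_of_int i / real N))) u)
     / (LBINT u:{- real R<..<real R}. step R N (\<lambda>i. exp (- \<kappa> * y i + r * (real_of_int i / real N))) u)"

lemma finite_grid [simp]: "finite (grid R N)"
  by (simp add: grid_def)

lemma card_grid: "card (grid R N) = 2 * R * N"
  by (simp add: grid_def nat_mult_distrib mult.assoc flip: mult_2)

lemma step_measurable [measurable]: "step R N h \<in> borel_measurable borel"
  unfolding step_def[abs_def] by measurable

lemma step_eq:
  assumes N: "1 \<le> N" and u: "\<bar>u\<bar> < real R"
  shows "\<lfloor>u * real N\<rfloor> \<in> grid R N" and "step R N h u = h \<lfloor>u * real N\<rfloor>"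
    and "real_of_int \<lfloor>u * real N\<rfloor> / real N \<le> u" and "u < (real_of_int \<lfloor>u * real N\<rfloor> + 1) / real N"
proof -
  have N0: "0 < real N" using N by simp
  have "- real R * real N < u * real N" "u * real N < real R * real N"
    using u N0 by (intro mult_strict_right_mono; simp add: abs_less_iff)+
  then show g: "\<lfloor>u * real N\<rfloor> \<in> grid R N"
    unfolding grid_def by (auto simp: le_floor_iff floor_less_iff)
  have mem: "u \<in> {real_of_int i / real N..<(real_of_int i + 1) / real N} \<longleftrightarrow> \<lfloor>u * real N\<rfloor> = i" for i :: int
    using N0 by (auto simp: divide_le_eq pos_less_divide_eq floor_eq_iff)
  show "real_of_int \<lfloor>u * real N\<rfloor> / real N \<le> u" "u < (real_of_int \<lfloor>u * real N\<rfloor> + 1) / real N"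
    using mem[of "\<lfloor>u * real N\<rfloor>"] by auto
  have "step R N h u = (\<Sum>i\<in>grid R N. if \<lfloor>u * real N\<rfloor> = i then h i else 0)"
    unfolding step_def by (intro sum.cong refl) (simp only: mem indicator_def, simp)
  also have "\<dots> = h \<lfloor>u * real N\<rfloor>" using g by (simp add: sum.delta')
  finally show "step R N h u = h \<lfloor>u * real N\<rfloor>" .
qed

lemma integral_step:
  assumes N: "1 \<le> N"
  shows "integrable lborel (step R N h)" and "(LBINT u. step R N h u) = (\<Sum>i\<in>grid R N. h i / real N)"
proof -
  have le: "real_of_int i / real N \<le> (real_of_int i + 1) / real N" for i
    by (intro divide_right_mono) auto
  have i: "integrable lborel (\<lambda>u. h i * indicator {real_of_int i / real N..<(real_of_int i + 1) / real N} u)" for i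
    using le[of i] by (intro integrable_mult_right) (simp add: emeasure_lborel_Ico)
  have v: "(LBINT u. h i * indicator {real_of_int i / real N..<(real_of_int i + 1) / real N} u) = h i / real N" for i
    using le[of i] N by (simp add: measure_def emeasure_lborel_Ico diff_divide_distrib[symmetric])
  show "integrable lborel (step R N h)" unfolding step_def[abs_def] using i by (intro Bochner_Integration.integrable_sum)
  show "(LBINT u. step R N h u) = (\<Sum>i\<in>grid R N. h i / real N)"
    unfolding step_def by (subst Bochner_Integration.integral_sum[OF i]) (simp only: v)
qed

lemma grid_mean_measurable:
  assumes "\<And>i. i \<in> grid R N \<Longrightarrow> (\<lambda>\<omega>. y i \<omega>) \<in> borel_measurable M"
  shows "(\<lambda>\<omega>. grid_mean \<kappa> r R N (\<lambda>i. y i \<omega>)) \<in> borel_measurable M"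
proof -
  have y: "(\<lambda>x. exp (- \<kappa> * y i (fst x) + r * (real_of_int i / real N))) \<in> borel_measurable (M \<Otimes>\<^sub>M lborel)" if "i \<in> grid R N" for i
    using assms[OF that] by measurable
  have "(\<lambda>x. step R N (\<lambda>i. exp (- \<kappa> * y i (fst x) + r * (real_of_int i / real N))) (snd x)) \<in> borel_measurable (M \<Otimes>\<^sub>M lborel)"
    unfolding step_def by (intro borel_measurable_sum borel_measurable_times y) measurable
  then have [measurable]: "(\<lambda>(\<omega>, u). step R N (\<lambda>i. exp (- \<kappa> * y i \<omega> + r * (real_of_int i / real N))) u) \<in> borel_measurable (M \<Otimes>\<^sub>M lborel)"
    by (simp add: split_beta')
  show ?thesis unfolding grid_mean_def set_lebesgue_integral_def by measurable
qed

lemma square_add_two_le_exp: "0 \<le> u \<Longrightarrow> u\<^sup>2 + 2 \<le> 2 * exp (u :: real)"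
  using exp_lower_Taylor_quadratic[of u] by simp

text \<open>
  The constant produced by the proof of \<open>mean_le_post_trunc_grid\<close>. What matters is that it does not
  involve \<open>N\<close>, \<open>\<epsilon>\<close> and \<open>\<eta>\<close>.
\<close>

definition grid_const :: "real \<Rightarrow> real \<Rightarrow> real \<Rightarrow> real \<Rightarrow> nat \<Rightarrow> real" where
  "grid_const K B \<kappa> r R =
    (let a0 = 2 * (2 + \<bar>r\<bar> * (real R + 1)); a1 = 2 * (1 + 2 * K + 2 * \<bar>\<kappa>\<bar>);
         E = (\<lambda>s. exp (B * (2 * real R + 4) * (exp s - 1)))
     in 2 * real R * (2 * ((2 + \<bar>r\<bar>) * exp a0 * E (a1 + 1))
         + (2 * K + \<bar>\<kappa>\<bar>) * ((exp (2 * a0) * E (2 * a1) + 2 * B * (exp 1 - 1) * exp (2 * B * (exp 1 - 1))) / 2)))"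

text \<open>
  On \<open>(-R, R)\<close> the field has the form \<open>exp (- \<kappa> * Y u + r * u)\<close>, except for the points in the ramps at
  \<open>u\<close> and at \<open>0\<close> and for relative errors \<open>\<eta>\<close>, which account for the variation of the jump and of the
  prior.
\<close>

locale local_grid = local_likelihood +
  fixes \<kappa> r q0 \<eta> :: real and R :: nat
  assumes R: "1 \<le> R" "{- real R..real R} \<subseteq> U"
    and q0: "0 < q0" and \<eta>: "0 \<le> \<eta>" "\<eta> \<le> 1"
    and Y_0: "\<And>\<omega>. \<omega> \<in> space M \<Longrightarrow> Y 0 \<omega> = 0"
    and approx: "\<And>u \<omega>. \<omega> \<in> space M \<Longrightarrow> \<bar>u\<bar> < real R \<Longrightarrow>
        \<bar>ln (Z u \<omega>) + \<kappa> * Y u \<omega> - r * u\<bar>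
          \<le> \<eta> * \<bar>Y u \<omega>\<bar> + K * (Y (u + \<epsilon>) \<omega> - Y u \<omega>) + K * (Y \<epsilon> \<omega> - Y 0 \<omega>) + \<eta>"
    and w_approx: "\<And>u. \<bar>u\<bar> < real R \<Longrightarrow> 0 < w u \<and> \<bar>ln (w u / q0)\<bar> \<le> \<eta>"
    and Y_meas: "\<And>u. near U u \<Longrightarrow> Y u \<in> borel_measurable M"
begin

lemma near_R: "\<bar>v\<bar> \<le> real R + 2 \<Longrightarrow> near U v"
  unfolding near_def
proof (rule bexI)
  show "max (- real R) (min (real R) v) \<in> U" using R by auto
qed auto

definition range_count :: "'a \<Rightarrow> real" where
  "range_count \<omega> = Y (real R + 2) \<omega> - Y (- real R - 2) \<omega>"

lemma Y_le: "\<omega> \<in> space M \<Longrightarrow> \<bar>u\<bar> \<le> real R + 2 \<Longrightarrow> \<bar>v\<bar> \<le> real R + 2 \<Longrightarrow> u \<le> v \<Longrightarrow>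
    0 \<le> Y v \<omega> - Y u \<omega> \<and> Y v \<omega> - Y u \<omega> \<le> range_count \<omega>"
  using Y_mono[of \<omega> u v] Y_mono[of \<omega> "- real R - 2" u] Y_mono[of \<omega> v "real R + 2"]
    near_R[of u] near_R[of v] near_R[of "real R + 2"] near_R[of "- real R - 2"]
  unfolding range_count_def abs_le_iff by force

lemma Y_incr: "\<omega> \<in> space M \<Longrightarrow> \<bar>v\<bar> \<le> real R \<Longrightarrow> 0 \<le> l \<Longrightarrow> l \<le> 2 \<Longrightarrow>
    0 \<le> Y (v + l) \<omega> - Y v \<omega> \<and> Y (v + l) \<omega> - Y v \<omega> \<le> range_count \<omega>"
  by (rule Y_le) auto

lemma abs_Y_le: "\<omega> \<in> space M \<Longrightarrow> \<bar>u\<bar> \<le> real R + 2 \<Longrightarrow> \<bar>Y u \<omega>\<bar> \<le> range_count \<omega>"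
  using Y_le[of \<omega> 0 u] Y_le[of \<omega> u 0] Y_0[of \<omega>] by (cases "0 \<le> u") auto

lemma mean_le_range_count: "0 \<le> s \<Longrightarrow>
    mean_le M (\<lambda>\<omega>. exp (s * range_count \<omega>)) (exp (B * (2 * real R + 4) * (exp s - 1)))"
  using Y_exp[of "- real R - 2" "real R + 2" s] near_R unfolding range_count_def by (simp add: algebra_simps)

text \<open>
  A window of length \<open>l\<close> is empty with probability close to \<open>1\<close>, so that even the second moment is of
  order \<open>l\<close>. The proof compares the square with an exponential moment.
\<close>

lemma mean_le_square_increment:
  assumes v: "\<bar>v\<bar> \<le> real R" and l: "0 \<le> l" "l \<le> 2"
  shows "mean_le M (\<lambda>\<omega>. (Y (v + l) \<omega> - Y v \<omega>)\<^sup>2) (l * (2 * B * (exp 1 - 1) * exp (2 * B * (exp 1 - 1))))"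
proof -
  let ?x = "B * l * (exp 1 - 1)"
  let ?U = "\<lambda>\<omega>. Y (v + l) \<omega> - Y v \<omega>"
  have e1: "1 \<le> exp (1 :: real)" using exp_ge_add_one_self[of "1 :: real"] by linarith
  have n: "near U v" "near U (v + l)" using v l by (auto intro!: near_R)
  note [measurable] = Y_meas[OF n(1)] Y_meas[OF n(2)]
  have "mean_le M (\<lambda>\<omega>. exp (1 * ?U \<omega>)) (exp (B * ((v + l) - v) * (exp 1 - 1)))"
    by (rule Y_exp[OF n]) (use l in auto)
  then have "mean_le M (\<lambda>\<omega>. 2 * exp (?U \<omega>)) (2 * exp ?x)"
    using mean_le_cmult[of M "\<lambda>\<omega>. exp (?U \<omega>)" "exp ?x" 2] by simp
  then have "mean_le M (\<lambda>\<omega>. (?U \<omega>)\<^sup>2 + 2) (2 * exp ?x)"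
    by (rule mean_le_mono) (use Y_le[of _ v "v + l"] v l in \<open>auto intro!: square_add_two_le_exp\<close>)
  then have "(\<integral>\<^sup>+\<omega>. ennreal ((?U \<omega>)\<^sup>2) + 2 \<partial>M) \<le> ennreal (2 * exp ?x)"
    by (simp add: mean_le_def)
  also have "(\<integral>\<^sup>+\<omega>. ennreal ((?U \<omega>)\<^sup>2) + 2 \<partial>M) = (\<integral>\<^sup>+\<omega>. ennreal ((?U \<omega>)\<^sup>2) \<partial>M) + 2"
    by (subst nn_integral_add) (auto simp: emeasure_space_1)
  finally have le: "(\<integral>\<^sup>+\<omega>. ennreal ((?U \<omega>)\<^sup>2) \<partial>M) + 2 \<le> ennreal (2 * exp ?x)" .
  have "(\<integral>\<^sup>+\<omega>. ennreal ((?U \<omega>)\<^sup>2) \<partial>M) \<le> ennreal (2 * exp ?x - 2)"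
  proof (cases "\<integral>\<^sup>+\<omega>. ennreal ((?U \<omega>)\<^sup>2) \<partial>M")
    case (real a)
    then have "ennreal (a + 2) \<le> ennreal (2 * exp ?x)" using le by simp
    then have "a + 2 \<le> 2 * exp ?x" by (simp only: ennreal_le_iff mult_nonneg_nonneg exp_ge_zero zero_le_numeral)
    then show ?thesis using real by (simp add: ennreal_leI)
  next
    case top
    then show ?thesis using le by (simp add: top_unique)
  qed
  also have "2 * exp ?x - 2 \<le> l * (2 * B * (exp 1 - 1) * exp (2 * B * (exp 1 - 1)))"
  proof -
    have "l * (B * (exp 1 - 1)) \<le> 2 * (B * (exp 1 - 1))"
      using l const_bounds e1 by (intro mult_right_mono) auto
    then have x: "0 \<le> ?x" "?x \<le> 2 * B * (exp 1 - 1)"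
      using l const_bounds e1 by (auto simp: mult_ac)
    have "1 - ?x \<le> exp (- ?x)" using exp_ge_add_one_self[of "- ?x"] by simp
    then have "exp ?x * (1 - ?x) \<le> exp ?x * exp (- ?x)" by (intro mult_left_mono) auto
    then have "exp ?x - 1 \<le> ?x * exp ?x" by (simp add: exp_add[symmetric] algebra_simps)
    also have "\<dots> \<le> ?x * exp (2 * B * (exp 1 - 1))" using x by (intro mult_left_mono) auto
    finally show ?thesis by (simp add: algebra_simps)
  qed
  finally have "(\<integral>\<^sup>+\<omega>. ennreal ((?U \<omega>)\<^sup>2) \<partial>M) \<le> ennreal (l * (2 * B * (exp 1 - 1) * exp (2 * B * (exp 1 - 1))))"
    by (simp add: ennreal_leI)
  then show ?thesis
    unfolding mean_le_def using l const_bounds e1 by (auto intro!: mult_nonneg_nonneg)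
qed

text \<open>
  Replacing \<open>Z\<close> by the step function costs, at \<open>u\<close>, the number of points in one grid cell enlarged by
  \<open>\<epsilon>\<close>. The exponential of the total count that comes in as a factor is separated from this number by
  the arithmetic--geometric mean inequality.
\<close>

lemma mean_le_post_trunc_grid:
  assumes N: "1 \<le> N"
  shows "mean_le M (\<lambda>\<omega>. \<bar>post_trunc R \<omega> - grid_mean \<kappa> r R N (\<lambda>i. Y (real_of_int i / real N) \<omega>)\<bar>)
    (grid_const K B \<kappa> r R * sqrt (\<eta> + 1 / real N + \<epsilon>))"
proof -
  define s where "s = \<eta> + 1 / real N + \<epsilon>"
  have N1: "0 < 1 / real N" "1 / real N \<le> 1" using N by auto
  have s: "0 < s" "s \<le> 3" using N1 \<eta> eps unfolding s_def by linarith+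
  define \<sigma> where "\<sigma> = sqrt s"
  have "sqrt s \<le> sqrt 4" using s by (intro real_sqrt_le_mono) auto
  then have \<sigma>: "0 < \<sigma>" "\<sigma> \<le> 2" "\<sigma> * \<sigma> = s" using s by (auto simp: \<sigma>_def)
  have s\<sigma>: "s \<le> 2 * \<sigma>" using \<sigma> mult_right_mono[of \<sigma> 2 \<sigma>] by auto
  define l where "l = 1 / real N + \<epsilon>"
  have l: "0 \<le> l" "l \<le> 2" "l \<le> s" using N1 eps \<eta> unfolding l_def s_def by linarith+
  define a0 a1 where "a0 = 2 * (2 + \<bar>r\<bar> * (real R + 1))" and "a1 = 2 * (1 + 2 * K + 2 * \<bar>\<kappa>\<bar>)"
  have a: "0 \<le> a0" "0 \<le> a1" using const_bounds by (auto simp: a0_def a1_def)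
  let ?v = "\<lambda>i. real_of_int i / real N"
  let ?I = "\<lambda>i \<omega>. Y (?v i + l) \<omega> - Y (?v i) \<omega>"
  let ?V0 = "\<lambda>\<omega>. Y \<epsilon> \<omega> - Y 0 \<omega>"
  \<comment> \<open>\<open>b\<close> bounds the difference of the two log-densities and is constant on grid cells; \<open>A\<close> bounds both
    log-densities.\<close>
  define b where "b i \<omega> = (2 * \<eta> + \<eta> * range_count \<omega> + \<bar>r\<bar> / real N) + ((K + \<bar>\<kappa>\<bar>) * ?I i \<omega> + K * ?V0 \<omega>)" for i \<omega>
  define A where "A \<omega> = a0 / 2 + a1 / 2 * range_count \<omega>" for \<omega>
  have vR: "\<bar>?v i\<bar> \<le> real R" if "i \<in> grid R N" for i
  proof -
    have "real_of_int (- int (R * N)) \<le> real_of_int i" "real_of_int i \<le> real_of_int (int (R * N))"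
      using that unfolding grid_def of_int_le_iff by auto
    then have "- real R * real N \<le> real_of_int i" "real_of_int i \<le> real R * real N" by auto
    then show ?thesis using N by (auto simp: abs_le_iff divide_le_eq pos_le_divide_eq minus_le_iff)
  qed
  have pathwise: "\<bar>post_trunc R \<omega> - grid_mean \<kappa> r R N (\<lambda>i. Y (?v i) \<omega>)\<bar>
     \<le> exp (2 * A \<omega>) * (\<Sum>i\<in>grid R N. b i \<omega> / real N)" if \<omega>: "\<omega> \<in> space M" for \<omega>
  proof -
    have [measurable]: "(\<lambda>u. Z u \<omega>) \<in> borel_measurable borel" by (rule Z_measurable_u[OF \<omega>])
    let ?f = "\<lambda>u. w u * Z u \<omega> / q0"
    let ?h = "\<lambda>i. exp (- \<kappa> * Y (?v i) \<omega> + r * ?v i)"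
    have rc: "0 \<le> range_count \<omega>" using Y_le[OF \<omega>, of 0 0] by auto
    have b0: "0 \<le> b i \<omega>" if "i \<in> grid R N" for i
    proof -
      have "0 \<le> ?I i \<omega>" "0 \<le> ?V0 \<omega>" using Y_incr[OF \<omega> vR[OF that], of l] Y_le[OF \<omega>, of 0 \<epsilon>] l eps by auto
      then show ?thesis unfolding b_def using \<eta> rc const_bounds by (intro add_nonneg_nonneg mult_nonneg_nonneg) auto
    qed
    have main: "\<bar>ln (?f u) - ln (?h \<lfloor>u * real N\<rfloor>)\<bar> \<le> b \<lfloor>u * real N\<rfloor> \<omega>"
      and hA: "\<bar>ln (?h \<lfloor>u * real N\<rfloor>)\<bar> \<le> \<bar>\<kappa>\<bar> * range_count \<omega> + \<bar>r\<bar> * real R"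
      and bA: "b \<lfloor>u * real N\<rfloor> \<omega> \<le> 2 + \<bar>r\<bar> + (1 + 2 * K + \<bar>\<kappa>\<bar>) * range_count \<omega>"
      if u: "\<bar>u\<bar> < real R" for u
    proof -
      define i where "i = \<lfloor>u * real N\<rfloor>"
      define v where "v = ?v i"
      have i: "i \<in> grid R N" "v \<le> u" "u < v + 1 / real N"
        using step_eq(1,3,4)[OF N u] by (auto simp: i_def v_def add_divide_distrib)
      have v: "\<bar>v\<bar> \<le> real R" using vR[OF i(1)] by (simp add: v_def)
      have I: "?I i \<omega> = Y (v + l) \<omega> - Y v \<omega>" by (simp add: v_def)
      have "ln (?f u) = ln (w u / q0) + ln (Z u \<omega>)"
      proof -
        have "?f u = (w u / q0) * Z u \<omega>" by simp
        then show ?thesis using w_approx[OF u] q0 Z_pos[OF \<omega>, of u] by (metis divide_pos_pos ln_mult_pos)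
      qed
      then have eq: "ln (?f u) - ln (?h i) = ln (w u / q0) + (ln (Z u \<omega>) + \<kappa> * Y u \<omega> - r * u) - \<kappa> * (Y u \<omega> - Y v \<omega>) + r * (u - v)"
        by (simp add: v_def algebra_simps)
      have 1: "\<bar>\<kappa> * (Y u \<omega> - Y v \<omega>)\<bar> \<le> \<bar>\<kappa>\<bar> * ?I i \<omega>"
      proof -
        have "0 \<le> Y u \<omega> - Y v \<omega>" using Y_le[OF \<omega>, of v u] u v i by auto
        moreover have "Y u \<omega> \<le> Y (v + l) \<omega>" using Y_le[OF \<omega>, of u "v + l"] u v i l eps by (auto simp: l_def)
        ultimately show ?thesis unfolding I abs_mult by (intro mult_left_mono) auto
      qed
      have 2: "\<bar>r * (u - v)\<bar> \<le> \<bar>r\<bar> / real N"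
        using i mult_left_mono[of "\<bar>u - v\<bar>" "1 / real N" "\<bar>r\<bar>"] by (auto simp: abs_mult)
      have 3: "\<eta> * \<bar>Y u \<omega>\<bar> \<le> \<eta> * range_count \<omega>" using abs_Y_le[OF \<omega>, of u] u \<eta> by (intro mult_left_mono) auto
      have 4: "K * (Y (u + \<epsilon>) \<omega> - Y u \<omega>) \<le> K * ?I i \<omega>"
      proof (rule mult_left_mono)
        have "Y (u + \<epsilon>) \<omega> \<le> Y (v + l) \<omega>" using Y_le[OF \<omega>, of "u + \<epsilon>" "v + l"] u v i l eps by (auto simp: l_def)
        moreover have "Y v \<omega> \<le> Y u \<omega>" using Y_le[OF \<omega>, of v u] u v i by auto
        ultimately show "Y (u + \<epsilon>) \<omega> - Y u \<omega> \<le> ?I i \<omega>" unfolding I by linarith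
      qed (use const_bounds in auto)
      have "\<bar>ln (?f u) - ln (?h i)\<bar> \<le> \<eta> + (\<eta> * \<bar>Y u \<omega>\<bar> + K * (Y (u + \<epsilon>) \<omega> - Y u \<omega>) + K * ?V0 \<omega> + \<eta>)
          + \<bar>\<kappa> * (Y u \<omega> - Y v \<omega>)\<bar> + \<bar>r * (u - v)\<bar>"
        unfolding eq using w_approx[OF u] approx[OF \<omega> u] by linarith
      also have "\<dots> \<le> b i \<omega>"
        unfolding b_def using 1 2 3 4 by (simp add: distrib_right)
      finally show "\<bar>ln (?f u) - ln (?h \<lfloor>u * real N\<rfloor>)\<bar> \<le> b \<lfloor>u * real N\<rfloor> \<omega>" by (simp add: i_def)
      have "\<bar>\<kappa> * Y v \<omega>\<bar> \<le> \<bar>\<kappa>\<bar> * range_count \<omega>" unfolding abs_mult using abs_Y_le[OF \<omega>, of v] v by (intro mult_left_mono) auto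
      have "\<bar>r * v\<bar> \<le> \<bar>r\<bar> * real R" unfolding abs_mult using v by (intro mult_left_mono) auto
      then have "\<bar>ln (?h i)\<bar> \<le> \<bar>\<kappa>\<bar> * range_count \<omega> + \<bar>r\<bar> * real R"
      proof -
        have "ln (?h i) = r * v - \<kappa> * Y v \<omega>" by (simp add: v_def)
        then show ?thesis
          using \<open>\<bar>\<kappa> * Y v \<omega>\<bar> \<le> _\<close> \<open>\<bar>r * v\<bar> \<le> _\<close> by linarith
      qed
      then show "\<bar>ln (?h \<lfloor>u * real N\<rfloor>)\<bar> \<le> \<bar>\<kappa>\<bar> * range_count \<omega> + \<bar>r\<bar> * real R" by (simp add: i_def)
      have "(K + \<bar>\<kappa>\<bar>) * ?I i \<omega> \<le> (K + \<bar>\<kappa>\<bar>) * range_count \<omega>" "K * ?V0 \<omega> \<le> K * range_count \<omega>"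
        using Y_le[OF \<omega>, of v "v + l"] Y_le[OF \<omega>, of 0 \<epsilon>] v l eps const_bounds
        unfolding I by (auto intro!: mult_left_mono)
      moreover have "\<eta> * range_count \<omega> \<le> 1 * range_count \<omega>" using rc \<eta> by (intro mult_right_mono)
      moreover have "\<bar>r\<bar> / real N \<le> \<bar>r\<bar>" using N1 mult_left_mono[of "1 / real N" 1 "\<bar>r\<bar>"] by simp
      ultimately have "b i \<omega> \<le> 2 + \<bar>r\<bar> + (1 + 2 * K + \<bar>\<kappa>\<bar>) * range_count \<omega>"
        unfolding b_def using \<eta> by (simp add: distrib_right)
      then show "b \<lfloor>u * real N\<rfloor> \<omega> \<le> 2 + \<bar>r\<bar> + (1 + 2 * K + \<bar>\<kappa>\<bar>) * range_count \<omega>" by (simp add: i_def)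
    qed
    have A: "A \<omega> = 2 + \<bar>r\<bar> * (real R + 1) + (1 + 2 * K + 2 * \<bar>\<kappa>\<bar>) * range_count \<omega>"
      by (simp add: A_def a0_def a1_def field_simps)
    have "\<bar>(LBINT u:{- real R<..<real R}. u * ?f u) / (LBINT u:{- real R<..<real R}. ?f u)
        - (LBINT u:{- real R<..<real R}. u * step R N ?h u) / (LBINT u:{- real R<..<real R}. step R N ?h u)\<bar>
        \<le> exp (2 * A \<omega>) * (LBINT u. step R N (\<lambda>i. b i \<omega>) u)"
    proof (rule posterior_mean_perturbation)
      fix u :: real assume u: "\<bar>u\<bar> < real R"
      note eqs = step_eq(2)[OF N u]
      have pos: "0 < ?f u" using w_approx[OF u] q0 Z_pos[OF \<omega>, of u] by simp
      have nn: "0 \<le> \<bar>\<kappa>\<bar> * range_count \<omega>" "0 \<le> K * range_count \<omega>" using rc const_bounds by auto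
      have A': "A \<omega> = 2 + \<bar>r\<bar> * real R + \<bar>r\<bar> + range_count \<omega> + 2 * (K * range_count \<omega>) + 2 * (\<bar>\<kappa>\<bar> * range_count \<omega>)"
        unfolding A by (simp add: algebra_simps)
      have bA': "b \<lfloor>u * real N\<rfloor> \<omega> \<le> 2 + \<bar>r\<bar> + range_count \<omega> + 2 * (K * range_count \<omega>) + \<bar>\<kappa>\<bar> * range_count \<omega>"
        using bA[OF u] by (simp add: distrib_right)
      have hA': "\<bar>ln (?h \<lfloor>u * real N\<rfloor>)\<bar> \<le> A \<omega>"
        using hA[OF u] nn rc unfolding A' by linarith
      moreover have "\<bar>ln (?f u)\<bar> \<le> A \<omega>"
        using main[OF u] hA[OF u] bA' nn rc unfolding A' by linarith
      ultimately have "\<bar>ln (?h \<lfloor>u * real N\<rfloor>)\<bar> \<le> A \<omega>" "\<bar>ln (?f u)\<bar> \<le> A \<omega>" by blast+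
      then show "0 < ?f u \<and> \<bar>ln (?f u)\<bar> \<le> A \<omega>" "0 < step R N ?h u \<and> \<bar>ln (step R N ?h u)\<bar> \<le> A \<omega>"
        using pos unfolding eqs by auto
      show "\<bar>ln (?f u) - ln (step R N ?h u)\<bar> \<le> step R N (\<lambda>i. b i \<omega>) u" unfolding eqs by (rule main[OF u])
    next
      show "0 \<le> step R N (\<lambda>i. b i \<omega>) u" for u unfolding step_def using b0 by (intro sum_nonneg mult_nonneg_nonneg) auto
    qed (use R integral_step(1)[OF N] in auto)
    also have "(LBINT u:{- real R<..<real R}. u * ?f u) / (LBINT u:{- real R<..<real R}. ?f u) = post_trunc R \<omega>"
      unfolding post_trunc_def using q0 by (simp add: set_lebesgue_integral_def mult.assoc[symmetric])
    finally show ?thesis unfolding grid_mean_def integral_step(2)[OF N] .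
  qed
  let ?E = "\<lambda>s. exp (B * (2 * real R + 4) * (exp s - 1))"
  define \<beta> where "\<beta> = 2 * B * (exp 1 - 1) * exp (2 * B * (exp 1 - 1))"
  have \<beta>0: "0 \<le> \<beta>" unfolding \<beta>_def using const_bounds exp_ge_add_one_self[of "1 :: real"] by (intro mult_nonneg_nonneg) auto
  \<comment> \<open>With weight \<open>\<sigma>\<close> in the arithmetic--geometric mean inequality both terms are of order \<open>\<sigma>\<close>: the second
    one is the mean square \<open>s * \<beta>\<close>, divided by \<open>\<sigma> = sqrt s\<close>.\<close>
  have incr: "mean_le M (\<lambda>\<omega>. exp (2 * A \<omega>) * (Y (v + l') \<omega> - Y v \<omega>)) (\<sigma> * ((exp (2 * a0) * ?E (2 * a1) + \<beta>) / 2))"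
    if v: "\<bar>v\<bar> \<le> real R" and l': "0 \<le> l'" "l' \<le> s" "l' \<le> 2" for v l'
  proof -
    let ?U = "\<lambda>\<omega>. Y (v + l') \<omega> - Y v \<omega>"
    have n: "near U v" "near U (v + l')" using v l' by (auto intro!: near_R)
    note [measurable] = Y_meas[OF n(1)] Y_meas[OF n(2)] Y_meas[OF near_R, of "real R + 2"] Y_meas[OF near_R, of "- real R - 2"]
    have [measurable]: "range_count \<in> borel_measurable M" unfolding range_count_def[abs_def] by measurable
    have "mean_le M (\<lambda>\<omega>. (\<sigma> * exp (2 * a0) / 2) * exp ((2 * a1) * range_count \<omega>) + (1 / (2 * \<sigma>)) * (?U \<omega>)\<^sup>2)
      ((\<sigma> * exp (2 * a0) / 2) * ?E (2 * a1) + (1 / (2 * \<sigma>)) * (s * \<beta>))"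
    proof (intro mean_le_add mean_le_cmult mean_le_range_count)
      have sq: "mean_le M (\<lambda>\<omega>. (?U \<omega>)\<^sup>2) (l' * \<beta>)" unfolding \<beta>_def by (rule mean_le_square_increment[OF v l'(1,3)])
      then show "mean_le M (\<lambda>\<omega>. (?U \<omega>)\<^sup>2) (s * \<beta>)"
        by (rule mean_le_mono) (use mult_right_mono[OF l'(2) \<beta>0] in auto)
    qed (use a \<sigma> in auto)
    then show ?thesis
    proof (rule mean_le_mono)
      fix \<omega>
      have "exp (2 * A \<omega>) * ?U \<omega> \<le> (\<sigma> * (exp (2 * A \<omega>))\<^sup>2 + (?U \<omega>)\<^sup>2 / \<sigma>) / 2" by (rule amgm_scaled[OF \<sigma>(1)])
      also have "(exp (2 * A \<omega>))\<^sup>2 = exp (2 * a0) * exp ((2 * a1) * range_count \<omega>)"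
        unfolding power2_eq_square exp_add[symmetric] A_def by (simp add: algebra_simps)
      finally show "exp (2 * A \<omega>) * ?U \<omega> \<le> (\<sigma> * exp (2 * a0) / 2) * exp ((2 * a1) * range_count \<omega>) + (1 / (2 * \<sigma>)) * (?U \<omega>)\<^sup>2"
        by (simp add: field_simps)
      have "(1 / (2 * \<sigma>)) * (s * \<beta>) = \<sigma> * \<beta> / 2" using \<sigma> by (simp add: \<sigma>(3)[symmetric])
      then show "(\<sigma> * exp (2 * a0) / 2) * ?E (2 * a1) + (1 / (2 * \<sigma>)) * (s * \<beta>) \<le> \<sigma> * ((exp (2 * a0) * ?E (2 * a1) + \<beta>) / 2)"
        by (simp add: algebra_simps)
    qed (unfold A_def, measurable)
  qed
  have first: "mean_le M (\<lambda>\<omega>. exp (2 * A \<omega>) * (2 * \<eta> + \<eta> * range_count \<omega> + \<bar>r\<bar> / real N)) (\<sigma> * (2 * ((2 + \<bar>r\<bar>) * exp a0 * ?E (a1 + 1))))"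
  proof -
    note [measurable] = Y_meas[OF near_R, of "real R + 2"] Y_meas[OF near_R, of "- real R - 2"]
    have [measurable]: "range_count \<in> borel_measurable M" unfolding range_count_def[abs_def] by measurable
    have "mean_le M (\<lambda>\<omega>. (s * (2 + \<bar>r\<bar>) * exp a0) * exp ((a1 + 1) * range_count \<omega>)) ((s * (2 + \<bar>r\<bar>) * exp a0) * ?E (a1 + 1))"
      by (intro mean_le_cmult mean_le_range_count) (use a s in auto)
    then show ?thesis
    proof (rule mean_le_mono)
      fix \<omega> assume \<omega>: "\<omega> \<in> space M"
      have rc: "0 \<le> range_count \<omega>" using Y_le[OF \<omega>, of 0 0] by auto
      have "\<eta> \<le> s" "1 / real N \<le> s" using \<eta> N1 eps by (auto simp: s_def)
      then have "\<eta> * (2 + range_count \<omega>) \<le> s * (2 + range_count \<omega>)"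
        using rc by (intro mult_right_mono) auto
      moreover have "\<bar>r\<bar> * (1 / real N) \<le> \<bar>r\<bar> * s"
        using \<open>1 / real N \<le> s\<close> by (intro mult_left_mono) auto
      moreover have "2 * \<eta> + \<eta> * range_count \<omega> = \<eta> * (2 + range_count \<omega>)"
        "s * (2 + range_count \<omega> + \<bar>r\<bar>) = s * (2 + range_count \<omega>) + \<bar>r\<bar> * s"
        by (simp_all add: algebra_simps)
      moreover have "\<bar>r\<bar> / real N = \<bar>r\<bar> * (1 / real N)" by simp
      ultimately have "2 * \<eta> + \<eta> * range_count \<omega> + \<bar>r\<bar> / real N \<le> s * (2 + range_count \<omega> + \<bar>r\<bar>)"
        by linarith
      also have "\<dots> \<le> s * ((2 + \<bar>r\<bar>) * exp (range_count \<omega>))"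
      proof (rule mult_left_mono)
        have "(2 + \<bar>r\<bar>) * (1 + range_count \<omega>) \<le> (2 + \<bar>r\<bar>) * exp (range_count \<omega>)"
          by (intro mult_left_mono exp_ge_add_one_self) auto
        moreover have "0 \<le> \<bar>r\<bar> * range_count \<omega>" using rc by simp
        moreover have "(2 + \<bar>r\<bar>) * (1 + range_count \<omega>) = 2 + \<bar>r\<bar> + 2 * range_count \<omega> + \<bar>r\<bar> * range_count \<omega>"
          by (simp add: algebra_simps)
        ultimately show "2 + range_count \<omega> + \<bar>r\<bar> \<le> (2 + \<bar>r\<bar>) * exp (range_count \<omega>)"
          using rc by linarith
      qed (use s in auto)
      finally have "exp (2 * A \<omega>) * (2 * \<eta> + \<eta> * range_count \<omega> + \<bar>r\<bar> / real N)
         \<le> exp (2 * A \<omega>) * (s * ((2 + \<bar>r\<bar>) * exp (range_count \<omega>)))" by (intro mult_left_mono) auto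
      also have "\<dots> = (s * (2 + \<bar>r\<bar>)) * (exp (2 * A \<omega>) * exp (range_count \<omega>))" by (simp only: mult_ac)
      also have "exp (2 * A \<omega>) * exp (range_count \<omega>) = exp a0 * exp ((a1 + 1) * range_count \<omega>)"
        unfolding exp_add[symmetric] A_def by (simp add: field_simps)
      finally show "exp (2 * A \<omega>) * (2 * \<eta> + \<eta> * range_count \<omega> + \<bar>r\<bar> / real N)
         \<le> (s * (2 + \<bar>r\<bar>) * exp a0) * exp ((a1 + 1) * range_count \<omega>)" by (simp only: mult.assoc)
    next
      have "s * ((2 + \<bar>r\<bar>) * exp a0 * ?E (a1 + 1)) \<le> (2 * \<sigma>) * ((2 + \<bar>r\<bar>) * exp a0 * ?E (a1 + 1))"
        using s\<sigma> by (intro mult_right_mono) auto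
      then show "(s * (2 + \<bar>r\<bar>) * exp a0) * ?E (a1 + 1) \<le> \<sigma> * (2 * ((2 + \<bar>r\<bar>) * exp a0 * ?E (a1 + 1)))"
        by (simp only: mult_ac)
    qed (unfold A_def, measurable)
  qed
  let ?G1 = "2 * ((2 + \<bar>r\<bar>) * exp a0 * ?E (a1 + 1))" and ?G2 = "(exp (2 * a0) * ?E (2 * a1) + \<beta>) / 2"
  have cell: "mean_le M (\<lambda>\<omega>. (1 / real N) * (exp (2 * A \<omega>) * b i \<omega>)) ((1 / real N) * (\<sigma> * (?G1 + (2 * K + \<bar>\<kappa>\<bar>) * ?G2)))"
    if i: "i \<in> grid R N" for i
  proof (rule mean_le_cmult)
    have "mean_le M (\<lambda>\<omega>. exp (2 * A \<omega>) * (2 * \<eta> + \<eta> * range_count \<omega> + \<bar>r\<bar> / real N)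
       + ((K + \<bar>\<kappa>\<bar>) * (exp (2 * A \<omega>) * ?I i \<omega>) + K * (exp (2 * A \<omega>) * (Y (0 + \<epsilon>) \<omega> - Y 0 \<omega>))))
       (\<sigma> * ?G1 + ((K + \<bar>\<kappa>\<bar>) * (\<sigma> * ?G2) + K * (\<sigma> * ?G2)))"
      by (intro mean_le_add mean_le_cmult first incr) (use vR[OF i] l eps \<eta> N1 const_bounds in \<open>auto simp: s_def\<close>)
    moreover have "(\<lambda>\<omega>. exp (2 * A \<omega>) * (2 * \<eta> + \<eta> * range_count \<omega> + \<bar>r\<bar> / real N)
       + ((K + \<bar>\<kappa>\<bar>) * (exp (2 * A \<omega>) * ?I i \<omega>) + K * (exp (2 * A \<omega>) * (Y (0 + \<epsilon>) \<omega> - Y 0 \<omega>)))) = (\<lambda>\<omega>. exp (2 * A \<omega>) * b i \<omega>)"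
      unfolding b_def by (intro ext) (simp only: distrib_left mult_ac add_0_left)
    moreover have "x * g + ((k + j) * (x * g') + k * (x * g')) = x * (g + (2 * k + j) * g')" for x g g' k j :: real
      by (simp add: algebra_simps)
    ultimately show "mean_le M (\<lambda>\<omega>. exp (2 * A \<omega>) * b i \<omega>) (\<sigma> * (?G1 + (2 * K + \<bar>\<kappa>\<bar>) * ?G2))" by (simp only:)
  qed simp
  have "mean_le M (\<lambda>\<omega>. \<Sum>i\<in>grid R N. (1 / real N) * (exp (2 * A \<omega>) * b i \<omega>))
     (\<Sum>i\<in>grid R N. (1 / real N) * (\<sigma> * (?G1 + (2 * K + \<bar>\<kappa>\<bar>) * ?G2)))"
    by (rule mean_le_sum[OF finite_grid cell])
  then show ?thesis
  proof (rule mean_le_mono)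
    show "(\<lambda>\<omega>. \<bar>post_trunc R \<omega> - grid_mean \<kappa> r R N (\<lambda>i. Y (?v i) \<omega>)\<bar>) \<in> borel_measurable M"
      using Y_meas[OF near_R] vR by (intro borel_measurable_abs borel_measurable_diff post_measurable grid_mean_measurable) force
    show "\<bar>post_trunc R \<omega> - grid_mean \<kappa> r R N (\<lambda>i. Y (?v i) \<omega>)\<bar> \<le> (\<Sum>i\<in>grid R N. (1 / real N) * (exp (2 * A \<omega>) * b i \<omega>))"
      if "\<omega> \<in> space M" for \<omega>
      using pathwise[OF that] by (simp add: sum_distrib_left)
    have "(\<Sum>i\<in>grid R N. (1 / real N) * (\<sigma> * (?G1 + (2 * K + \<bar>\<kappa>\<bar>) * ?G2))) = 2 * real R * (?G1 + (2 * K + \<bar>\<kappa>\<bar>) * ?G2) * \<sigma>"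
      using N by (simp add: card_grid)
    also have "\<dots> = grid_const K B \<kappa> r R * sqrt (\<eta> + 1 / real N + \<epsilon>)"
      unfolding grid_const_def Let_def \<beta>_def \<sigma>_def s_def a0_def a1_def by simp
    finally show "(\<Sum>i\<in>grid R N. (1 / real N) * (\<sigma> * (?G1 + (2 * K + \<bar>\<kappa>\<bar>) * ?G2))) \<le> grid_const K B \<kappa> r R * sqrt (\<eta> + 1 / real N + \<epsilon>)"
      by simp
  qed
qed

end

section \<open>Convergence of the laws of Poisson increments\<close>

lemma PiM_poisson:
  fixes \<mu> :: "'i \<Rightarrow> real"
  assumes J: "finite J"
  shows "PiM J (\<lambda>i. measure_pmf (poisson_pmf (\<mu> i)))
     = density (count_space (PiE J (\<lambda>_. UNIV))) (\<lambda>x. ennreal (\<Prod>i\<in>J. pmf (poisson_pmf (\<mu> i)) (x i)))"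
    (is "?L = ?R")
proof -
  interpret product_sigma_finite "\<lambda>i. measure_pmf (poisson_pmf (\<mu> i))"
    by (intro product_sigma_finite.intro measure_pmf.sigma_finite_measure_axioms)
  have sets: "sets ?L = Pow (PiE J (\<lambda>_. UNIV))"
  proof -
    have "sets ?L = sets (PiM J (\<lambda>_. count_space (UNIV :: nat set)))" by (intro sets_PiM_cong) auto
    also have "\<dots> = Pow (PiE J (\<lambda>_. UNIV))" by (subst count_space_PiM_finite[OF J]) auto
    finally show ?thesis .
  qed
  show ?thesis
  proof (rule measure_eqI_countable)
    show "sets ?L = Pow (PiE J (\<lambda>_. UNIV))" "sets ?R = Pow (PiE J (\<lambda>_. UNIV))" using sets by auto
    show "countable (PiE J (\<lambda>_. UNIV :: nat set))" by (rule countable_PiE[OF J]) auto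
    fix x :: "'i \<Rightarrow> nat" assume x: "x \<in> PiE J (\<lambda>_. UNIV)"
    have "PiE J (\<lambda>i. {x i}) = {x}" using x by (intro PiE_singleton) (auto simp: PiE_def)
    then have "emeasure ?L {x} = (\<Prod>i\<in>J. emeasure (measure_pmf (poisson_pmf (\<mu> i))) {x i})"
      using emeasure_PiM[OF J, of "\<lambda>i. {x i}"] by simp
    also have "\<dots> = ennreal (\<Prod>i\<in>J. pmf (poisson_pmf (\<mu> i)) (x i))"
      by (simp add: emeasure_pmf_single prod_ennreal)
    also have "\<dots> = emeasure ?R {x}"
      using x by (subst emeasure_density) (auto simp: nn_integral_count_space_indicator[symmetric] one_ennreal_def[symmetric] 
          nn_integral_count_space_indicator)
    finally show "emeasure ?L {x} = emeasure ?R {x}" .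
  qed
qed

lemma (in prob_space) expectation_poisson_vector:
  fixes X :: "'i \<Rightarrow> 'a \<Rightarrow> nat" and g :: "('i \<Rightarrow> nat) \<Rightarrow> real"
  assumes J: "finite J" "J \<noteq> {}"
    and ind: "indep_vars (\<lambda>_. count_space UNIV) X J"
    and law: "\<And>i. i \<in> J \<Longrightarrow> distr M (count_space UNIV) (X i) = measure_pmf (poisson_pmf (\<mu> i))"
  shows "expectation (\<lambda>\<omega>. g (\<lambda>i\<in>J. X i \<omega>))
     = (\<integral>x. (\<Prod>i\<in>J. pmf (poisson_pmf (\<mu> i)) (x i)) * g x \<partial>count_space (PiE J (\<lambda>_. UNIV)))"
proof -
  have X: "X i \<in> measurable M (count_space UNIV)" if "i \<in> J" for i
    using ind that by (auto simp: indep_vars_def)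
  have PiM_eq: "PiM J (\<lambda>_. count_space (UNIV :: nat set)) = count_space (PiE J (\<lambda>_. UNIV))"
    by (rule count_space_PiM_finite[OF J(1)]) auto
  have meas: "(\<lambda>\<omega>. \<lambda>i\<in>J. X i \<omega>) \<in> measurable M (PiM J (\<lambda>_. count_space UNIV))"
    using X by (intro measurable_restrict)
  have "distr M (PiM J (\<lambda>_. count_space UNIV)) (\<lambda>\<omega>. \<lambda>i\<in>J. X i \<omega>) = PiM J (\<lambda>i. distr M (count_space UNIV) (X i))"
    using indep_vars_iff_distr_eq_PiM'[OF J(2), of X "\<lambda>_. count_space UNIV"] X ind by auto
  also have "\<dots> = PiM J (\<lambda>i. measure_pmf (poisson_pmf (\<mu> i)))" by (intro PiM_cong law) auto
  finally have distr: "distr M (PiM J (\<lambda>_. count_space UNIV)) (\<lambda>\<omega>. \<lambda>i\<in>J. X i \<omega>)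
     = density (count_space (PiE J (\<lambda>_. UNIV))) (\<lambda>x. ennreal (\<Prod>i\<in>J. pmf (poisson_pmf (\<mu> i)) (x i)))"
    unfolding PiM_poisson[OF J(1)] .
  have "expectation (\<lambda>\<omega>. g (\<lambda>i\<in>J. X i \<omega>)) = integral\<^sup>L (distr M (PiM J (\<lambda>_. count_space UNIV)) (\<lambda>\<omega>. \<lambda>i\<in>J. X i \<omega>)) g"
    by (rule integral_distr[OF meas, symmetric]) (simp add: PiM_eq)
  also have "\<dots> = (\<integral>x. (\<Prod>i\<in>J. pmf (poisson_pmf (\<mu> i)) (x i)) *\<^sub>R g x \<partial>count_space (PiE J (\<lambda>_. UNIV)))"
    unfolding distr by (rule integral_density) (auto intro!: AE_I2 prod_nonneg)
  finally show ?thesis by simp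
qed

text \<open>
  The probability weights of all Poisson vectors with rates below \<open>2 \<mu>\<close> are dominated by a multiple
  of those of the Poisson vector with rates \<open>2 \<mu>\<close>, so the expectations converge by dominated
  convergence.
\<close>

lemma poisson_vector_law_tendsto:
  fixes X :: "nat \<Rightarrow> 'i \<Rightarrow> 'a \<Rightarrow> nat" and X' :: "'i \<Rightarrow> 'b \<Rightarrow> nat" and g :: "('i \<Rightarrow> nat) \<Rightarrow> real"
  assumes J: "finite J" "J \<noteq> {}"
    and M: "\<forall>\<^sub>F n in sequentially. prob_space (M n) \<and> prob_space.indep_vars (M n) (\<lambda>_. count_space UNIV) (X n) J
      \<and> (\<forall>i\<in>J. 0 < \<mu> n i \<and> distr (M n) (count_space UNIV) (X n i) = measure_pmf (poisson_pmf (\<mu> n i)))"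
    and M': "prob_space M'" "prob_space.indep_vars M' (\<lambda>_. count_space UNIV) X' J"
      "\<And>i. i \<in> J \<Longrightarrow> 0 < \<mu>' i" "\<And>i. i \<in> J \<Longrightarrow> distr M' (count_space UNIV) (X' i) = measure_pmf (poisson_pmf (\<mu>' i))"
    and \<mu>: "\<And>i. i \<in> J \<Longrightarrow> (\<lambda>n. \<mu> n i) \<longlonglongrightarrow> \<mu>' i"
    and g: "\<And>x. \<bar>g x\<bar> \<le> C"
  shows "(\<lambda>n. \<integral>\<omega>. g (\<lambda>i\<in>J. X n i \<omega>) \<partial>M n) \<longlonglongrightarrow> (\<integral>\<omega>. g (\<lambda>i\<in>J. X' i \<omega>) \<partial>M')"
proof -
  let ?S = "count_space (PiE J (\<lambda>_. UNIV :: nat set))"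
  let ?p = "\<lambda>\<mu> x. \<Prod>i\<in>J. pmf (poisson_pmf (\<mu> i)) (x i)"
  define \<nu> where "\<nu> i = 2 * \<mu>' i" for i
  have ev: "\<forall>\<^sub>F n in sequentially. \<forall>i\<in>J. 0 < \<mu> n i \<and> \<mu> n i \<le> \<nu> i"
  proof (intro eventually_ball_finite ballI J(1))
    fix i assume i: "i \<in> J"
    have "\<mu>' i < \<nu> i" using M'(3)[OF i] by (simp add: \<nu>_def)
    then have "\<forall>\<^sub>F n in sequentially. \<mu> n i < \<nu> i" by (rule order_tendstoD(2)[OF \<mu>[OF i]])
    with M show "\<forall>\<^sub>F n in sequentially. 0 < \<mu> n i \<and> \<mu> n i \<le> \<nu> i"
      by eventually_elim (use i in auto)
  qed
  obtain n0 where n0: "\<And>n i. n0 \<le> n \<Longrightarrow> i \<in> J \<Longrightarrow> 0 < \<mu> n i \<and> \<mu> n i \<le> \<nu> i"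
    using ev unfolding eventually_sequentially by blast
  have dom: "?p (\<mu> n) x \<le> (\<Prod>i\<in>J. exp (\<nu> i)) * ?p \<nu> x" if n: "n0 \<le> n" for n x
  proof -
    have "?p (\<mu> n) x \<le> (\<Prod>i\<in>J. exp (\<nu> i) * pmf (poisson_pmf (\<nu> i)) (x i))"
    proof (rule prod_mono, safe)
      fix i assume i: "i \<in> J"
      have m: "0 < \<mu> n i" "\<mu> n i \<le> \<nu> i" "0 < \<nu> i" using n0[OF n i] by auto
      have "\<mu> n i ^ x i / fact (x i) * exp (- \<mu> n i) \<le> \<nu> i ^ x i / fact (x i) * 1"
        using m by (intro mult_mono divide_right_mono power_mono) auto
      also have "\<dots> = exp (\<nu> i) * (\<nu> i ^ x i / fact (x i) * exp (- \<nu> i))" by (simp add: exp_minus)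
      finally show "pmf (poisson_pmf (\<mu> n i)) (x i) \<le> exp (\<nu> i) * pmf (poisson_pmf (\<nu> i)) (x i)"
        using m by (simp only: pmf_poisson)
    qed (rule pmf_nonneg)
    then show ?thesis by (simp add: prod.distrib)
  qed
  have int: "integrable ?S (?p \<nu>)"
  proof (rule integrableI_nonneg)
    interpret product_prob_space "\<lambda>i. measure_pmf (poisson_pmf (\<nu> i))" J
      by (unfold_locales)
    have "(\<integral>\<^sup>+x. ennreal (?p \<nu> x) \<partial>?S) = emeasure (density ?S (\<lambda>x. ennreal (?p \<nu> x))) (space ?S)"
      by (subst emeasure_density) (auto intro!: nn_integral_cong)
    also have "\<dots> = emeasure (PiM J (\<lambda>i. measure_pmf (poisson_pmf (\<nu> i)))) (space (PiM J (\<lambda>i. measure_pmf (poisson_pmf (\<nu> i)))))"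
      unfolding PiM_poisson[OF J(1)] by simp
    also have "\<dots> = 1" by (rule P.emeasure_space_1)
    finally show "(\<integral>\<^sup>+x. ennreal (?p \<nu> x) \<partial>?S) < \<infinity>" by simp
  qed (auto intro!: AE_I2 prod_nonneg)
  have C: "0 \<le> C" using g[of undefined] by linarith
  have "(\<lambda>n. \<integral>x. ?p (\<mu> (n + n0)) x * g x \<partial>?S) \<longlonglongrightarrow> (\<integral>x. ?p \<mu>' x * g x \<partial>?S)"
  proof (rule integral_dominated_convergence)
    show "integrable ?S (\<lambda>x. ((\<Prod>i\<in>J. exp (\<nu> i)) * C) * ?p \<nu> x)" using int by (rule integrable_mult_right)
    show "AE x in ?S. (\<lambda>n. ?p (\<mu> (n + n0)) x * g x) \<longlonglongrightarrow> ?p \<mu>' x * g x"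
    proof (intro AE_I2 tendsto_mult tendsto_const tendsto_prod)
      fix x i assume i: "i \<in> J"
      have "(\<lambda>n. \<mu> (n + n0) i) \<longlonglongrightarrow> \<mu>' i" using \<mu>[OF i] by (rule LIMSEQ_ignore_initial_segment)
      then have "(\<lambda>n. \<mu> (n + n0) i ^ x i / fact (x i) * exp (- \<mu> (n + n0) i)) \<longlonglongrightarrow> \<mu>' i ^ x i / fact (x i) * exp (- \<mu>' i)"
        by (intro tendsto_intros) auto
      then show "(\<lambda>n. pmf (poisson_pmf (\<mu> (n + n0) i)) (x i)) \<longlonglongrightarrow> pmf (poisson_pmf (\<mu>' i)) (x i)"
        using n0[of _ i] M'(3)[OF i] i by simp
    qed
    show "AE x in ?S. norm (?p (\<mu> (n + n0)) x * g x) \<le> ((\<Prod>i\<in>J. exp (\<nu> i)) * C) * ?p \<nu> x" for n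
    proof (rule AE_I2)
      fix x
      have "norm (?p (\<mu> (n + n0)) x * g x) = ?p (\<mu> (n + n0)) x * \<bar>g x\<bar>"
        by (simp add: abs_mult prod_nonneg)
      also have "\<dots> \<le> ((\<Prod>i\<in>J. exp (\<nu> i)) * ?p \<nu> x) * C"
        using dom[of "n + n0" x] g[of x] by (intro mult_mono) (auto intro!: mult_nonneg_nonneg prod_nonneg)
      finally show "norm (?p (\<mu> (n + n0)) x * g x) \<le> ((\<Prod>i\<in>J. exp (\<nu> i)) * C) * ?p \<nu> x"
        by (simp add: mult_ac)
    qed
  qed auto
  then have lim: "(\<lambda>n. \<integral>x. ?p (\<mu> n) x * g x \<partial>?S) \<longlonglongrightarrow> (\<integral>x. ?p \<mu>' x * g x \<partial>?S)"
    by (rule LIMSEQ_offset)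
  have eq': "(\<integral>\<omega>. g (\<lambda>i\<in>J. X' i \<omega>) \<partial>M') = (\<integral>x. ?p \<mu>' x * g x \<partial>?S)"
    by (rule prob_space.expectation_poisson_vector[OF M'(1) J M'(2) M'(4)])
  show ?thesis unfolding eq'
  proof (rule Lim_transform_eventually[OF lim])
    show "\<forall>\<^sub>F n in sequentially. (\<integral>x. ?p (\<mu> n) x * g x \<partial>?S) = (\<integral>\<omega>. g (\<lambda>i\<in>J. X n i \<omega>) \<partial>M n)"
      using M
    proof eventually_elim
      case (elim n)
      then show ?case
        by (intro prob_space.expectation_poisson_vector[symmetric] J) auto
    qed
  qed
qed

text \<open>
  The values at the grid points of a path that vanishes at \<open>0\<close>, from its increments over the cells; to
  the left of \<open>0\<close> the increments are subtracted.
\<close>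

definition cumsum :: "(int \<Rightarrow> nat) \<Rightarrow> int \<Rightarrow> real" where
  "cumsum x i = (if 0 \<le> i then \<Sum>j\<in>{0..<i}. real (x j) else - (\<Sum>j\<in>{i..<0}. real (x j)))"

lemma cumsum_increments:
  fixes y :: "int \<Rightarrow> real"
  assumes i: "i \<in> grid R N" and y0: "y 0 = 0" and x: "\<And>j. j \<in> grid R N \<Longrightarrow> real (x j) = y (j + 1) - y j"
  shows "cumsum x i = y i"
proof (cases "0 \<le> i")
  case True
  then have "i \<in> grid R N \<longrightarrow> (\<Sum>j\<in>{0..<i}. real (x j)) = y i"
  proof (induction i rule: int_ge_induct)
    case base
    then show ?case using y0 by simp
  next
    case (step i)
    show ?case
    proof
      assume "i + 1 \<in> grid R N"
      with step have "i \<in> grid R N" by (auto simp: grid_def)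
      moreover have "{0..<i + 1} = insert i {0..<i}" using step by auto
      ultimately show "(\<Sum>j\<in>{0..<i + 1}. real (x j)) = y (i + 1)" using step x[of i] by simp
    qed
  qed
  then show ?thesis using True i by (simp add: cumsum_def)
next
  case False
  then have "i \<le> 0" by simp
  then have "i \<in> grid R N \<longrightarrow> (\<Sum>j\<in>{i..<0}. real (x j)) = - y i"
  proof (induction i rule: int_le_induct)
    case base
    then show ?case using y0 by simp
  next
    case (step i)
    show ?case
    proof
      assume g: "i - 1 \<in> grid R N"
      have "(\<Sum>j\<in>{i..<0}. real (x j)) = - y i"
      proof (cases "i = 0")
        case False
        then have "i \<in> grid R N" using g step by (auto simp: grid_def)
        then show ?thesis using step by simp
      qed (use y0 in simp)
      moreover have "{i - 1..<0} = insert (i - 1) {i..<0}" using step by auto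
      ultimately show "(\<Sum>j\<in>{i - 1..<0}. real (x j)) = - y (i - 1)" using x[OF g] by simp
    qed
  qed
  then show ?thesis using False i by (simp add: cumsum_def)
qed

lemma cumsum_restrict:
  assumes "i \<in> grid R N"
  shows "cumsum (restrict x (grid R N)) i = cumsum x i"
  using assms unfolding cumsum_def by (auto simp: grid_def intro!: sum.cong)

lemma grid_mean_cong:
  assumes "\<And>i. i \<in> grid R N \<Longrightarrow> y i = y' i"
  shows "grid_mean \<kappa> r R N y = grid_mean \<kappa> r R N y'"
proof -
  have "step R N (\<lambda>i. exp (- \<kappa> * y i + r * (real_of_int i / real N))) = step R N (\<lambda>i. exp (- \<kappa> * y' i + r * (real_of_int i / real N)))"
    unfolding step_def using assms by (intro ext sum.cong) auto
  then show ?thesis unfolding grid_mean_def by simp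
qed

section \<open>The limit experiment\<close>

definition two_sided :: "(real \<Rightarrow> nat) \<Rightarrow> (real \<Rightarrow> nat) \<Rightarrow> real \<Rightarrow> real" where
  "two_sided yp ym u = (if 0 \<le> u then real (yp u) else - real (ym (- u)))"

text \<open>
  Counting with a sign to the left of the origin merges the two cases of the definition.
\<close>

lemma Z_star_two_sided:
  assumes "0 < a" "0 < b"
  shows "Z_star a b yp ym u = exp (- ln (b / a) * two_sided yp ym u + (b - a) * u)"
proof -
  have "ln (a / b) = - ln (b / a)" using assms by (simp add: ln_div)
  then show ?thesis by (simp add: Z_star_def two_sided_def)
qed

text \<open>
  By right-continuity the process is the limit of its values at grid points to the right.
\<close>

lemma poisson_process_joint_measurable:
  fixes X :: "real \<Rightarrow> 'a \<Rightarrow> nat"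
  assumes pp: "poisson_process M {0..} l X"
  shows "(\<lambda>(\<omega>, u). real (X (max 0 u) \<omega>)) \<in> borel_measurable (M \<Otimes>\<^sub>M lborel)"
proof (rule borel_measurable_LIMSEQ_metric)
  let ?t = "\<lambda>m u. (of_int \<lfloor>max 0 u * real (Suc m)\<rfloor> + 1) / real (Suc m) :: real"
  show "(\<lambda>(\<omega>, u). real (X (?t m u) \<omega>)) \<in> borel_measurable (M \<Otimes>\<^sub>M lborel)" for m
  proof -
    have "(\<lambda>x. (\<lambda>k x. real (X (max 0 ((of_int k + 1) / real (Suc m))) (fst x))) (\<lfloor>max 0 (snd x :: real) * real (Suc m)\<rfloor>) x) \<in> borel_measurable (M \<Otimes>\<^sub>M lborel)"
    proof (rule measurable_compose_countable[where f = "\<lambda>k x. real (X (max 0 ((of_int k + 1) / real (Suc m))) (fst x))"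
          and g = "\<lambda>x. \<lfloor>max 0 (snd x :: real) * real (Suc m)\<rfloor>"])
      fix k :: int
      have [measurable]: "X (max 0 ((of_int k + 1) / real (Suc m))) \<in> measurable M (count_space UNIV)"
        by (rule poisson_processD(2)[OF pp]) simp
      show "(\<lambda>x. real (X (max 0 ((of_int k + 1) / real (Suc m))) (fst x))) \<in> borel_measurable (M \<Otimes>\<^sub>M lborel)"
        by measurable
    qed measurable
    moreover have "max 0 (?t m u) = ?t m u" for u :: real
      by (intro max_absorb2 divide_nonneg_nonneg) (auto intro!: add_nonneg_nonneg)
    ultimately show ?thesis by (simp only: split_beta')
  qed
  fix x :: "'a \<times> real" assume "x \<in> space (M \<Otimes>\<^sub>M lborel)"
  then have \<omega>: "fst x \<in> space M" by (auto simp: space_pair_measure)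
  define u where "u = max 0 (snd x)"
  have u: "u \<in> {0..}" by (simp add: u_def)
  have lim: "((\<lambda>s. X s (fst x)) \<longlongrightarrow> X u (fst x)) (at u within {0..} \<inter> {u..})"
    by (rule poisson_processD(5)[OF pp \<omega> u])
  have gt: "u < ?t m (snd x)" and le: "?t m (snd x) \<le> u + 1 / real (Suc m)" for m
  proof -
    have "u * real (Suc m) < of_int \<lfloor>u * real (Suc m)\<rfloor> + 1" by linarith
    then show "u < ?t m (snd x)" by (simp add: u_def[symmetric] pos_less_divide_eq del: of_nat_Suc)
    have "(of_int \<lfloor>u * real (Suc m)\<rfloor> + 1) / real (Suc m) \<le> (u * real (Suc m) + 1) / real (Suc m)"
      by (intro divide_right_mono) linarith+
    also have "\<dots> = u + 1 / real (Suc m)" by (simp add: add_divide_distrib del: of_nat_Suc)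
    finally show "?t m (snd x) \<le> u + 1 / real (Suc m)" by (simp add: u_def[symmetric] del: of_nat_Suc)
  qed
  have "(\<lambda>m. ?t m (snd x)) \<longlonglongrightarrow> u"
  proof (rule tendsto_sandwich[of "\<lambda>_. u" _ _ "\<lambda>m. u + 1 / real (Suc m)"])
    show "(\<lambda>m. u + 1 / real (Suc m)) \<longlonglongrightarrow> u"
      using tendsto_add[OF tendsto_const LIMSEQ_inverse_real_of_nat, of u] by (simp add: inverse_eq_divide)
  qed (use gt le in \<open>auto intro!: always_eventually less_imp_le simp del: of_nat_Suc\<close>)
  then have "filterlim (\<lambda>m. ?t m (snd x)) (at u within {0..} \<inter> {u..}) sequentially"
    unfolding filterlim_at using gt u by (auto intro!: always_eventually less_imp_le simp del: of_nat_Suc intro: order_trans less_imp_neq[symmetric])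
  from filterlim_compose[OF lim this] have "\<forall>\<^sub>F m in sequentially. X (?t m (snd x)) (fst x) = X u (fst x)"
    by (simp only: tendsto_discrete)
  then have "(\<lambda>m. real (X (?t m (snd x)) (fst x))) \<longlonglongrightarrow> real (X u (fst x))"
    by (intro tendsto_eventually) (auto elim: eventually_mono)
  then show "(\<lambda>m. case x of (\<omega>, u) \<Rightarrow> real (X (?t m u) \<omega>)) \<longlonglongrightarrow> (case x of (\<omega>, u) \<Rightarrow> real (X (max 0 u) \<omega>))"
    by (simp add: split_beta u_def)
qed

lemma emeasure_abs_cell_le: "emeasure lborel {u :: real. real k \<le> \<bar>u\<bar> \<and> \<bar>u\<bar> < real k + 1} \<le> ennreal 2"
proof -
  have "emeasure lborel {u :: real. real k \<le> \<bar>u\<bar> \<and> \<bar>u\<bar> < real k + 1}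
      \<le> emeasure lborel ({- real k - 1..- real k} \<union> {real k..real k + 1})"
    by (intro emeasure_mono) (auto simp: abs_if split: if_splits)
  also have "\<dots> \<le> emeasure lborel {- real k - 1..- real k} + emeasure lborel {real k..real k + 1}"
    by (rule emeasure_subadditive) auto
  also have "\<dots> = ennreal 2" by simp
  finally show ?thesis .
qed

locale limit_experiment =
  fixes N :: "'b measure" and Yp Ym :: "real \<Rightarrow> 'b \<Rightarrow> nat" and a b :: real
  assumes ab: "0 < a" "0 < b" "a \<noteq> b"
    and Yp: "poisson_process N {0..} (\<lambda>_. b) Yp"
    and Ym: "poisson_process N {0..} (\<lambda>_. a) Ym"
    and indep: "prob_space.indep_var N (path_space {0..}) (path_of {0..} Yp) (path_space {0..}) (path_of {0..} Ym)"
begin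

sublocale N: prob_space N by (rule poisson_processD(1)[OF Yp])

definition Y :: "real \<Rightarrow> 'b \<Rightarrow> real" where
  "Y u \<omega> = two_sided (\<lambda>u. Yp u \<omega>) (\<lambda>u. Ym u \<omega>) u"

definition Z :: "real \<Rightarrow> 'b \<Rightarrow> real" where
  "Z u \<omega> = Z_star a b (\<lambda>u. Yp u \<omega>) (\<lambda>u. Ym u \<omega>) u"

lemma Z_eq: "Z u \<omega> = exp (- ln (b / a) * Y u \<omega> + (b - a) * u)"
  unfolding Z_def Y_def by (rule Z_star_two_sided[OF ab(1,2)])

lemma Y_meas: "Y u \<in> borel_measurable N"
proof -
  have "(\<lambda>\<omega>. real (Yp u \<omega>)) \<in> borel_measurable N" if "0 \<le> u" 
    by (rule measurable_compose[OF poisson_processD(2)[OF Yp]]) (use that in auto)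
  moreover have "(\<lambda>\<omega>. real (Ym (- u) \<omega>)) \<in> borel_measurable N" if "\<not> 0 \<le> u"
    by (rule measurable_compose[OF poisson_processD(2)[OF Ym]]) (use that in auto)
  ultimately show ?thesis unfolding Y_def[abs_def] two_sided_def by (cases "0 \<le> u") auto
qed

lemma Z_meas: "(\<lambda>(\<omega>, u). Z u \<omega>) \<in> borel_measurable (N \<Otimes>\<^sub>M lborel)"
proof -
  note [measurable] = poisson_process_joint_measurable[OF Yp]
  have [measurable]: "(\<lambda>(\<omega>, u). real (Ym (max 0 (- u)) \<omega>)) \<in> borel_measurable (N \<Otimes>\<^sub>M lborel)"
  proof -
    have "(\<lambda>x. (fst x, - snd x :: real)) \<in> measurable (N \<Otimes>\<^sub>M lborel) (N \<Otimes>\<^sub>M lborel)" by measurable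
    from measurable_compose[OF this poisson_process_joint_measurable[OF Ym]] show ?thesis by (simp add: split_beta')
  qed
  have "(\<lambda>x. if 0 \<le> snd x then (case x of (\<omega>, u) \<Rightarrow> real (Yp (max 0 u) \<omega>)) else - (case x of (\<omega>, u) \<Rightarrow> real (Ym (max 0 (- u)) \<omega>)))
     \<in> borel_measurable (N \<Otimes>\<^sub>M lborel)" by measurable
  moreover have "(if 0 \<le> snd x then (case x of (\<omega>, u) \<Rightarrow> real (Yp (max 0 u) \<omega>)) else - (case x of (\<omega>, u) \<Rightarrow> real (Ym (max 0 (- u)) \<omega>)))
     = Y (snd x) (fst x)" for x :: "'b \<times> real"
    by (auto simp: Y_def two_sided_def split_beta max_def)
  ultimately have [measurable]: "(\<lambda>x. Y (snd x) (fst x)) \<in> borel_measurable (N \<Otimes>\<^sub>M lborel)" by simp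
  show ?thesis unfolding Z_eq split_beta' by measurable
qed

lemma Y_mono: "\<omega> \<in> space N \<Longrightarrow> u \<le> v \<Longrightarrow> Y u \<omega> \<le> Y v \<omega>"
  using poisson_processD(4)[OF Yp, of \<omega>] poisson_processD(4)[OF Ym, of \<omega>]
  by (auto simp: Y_def two_sided_def mono_on_def intro: order_trans[of _ 0])

lemma Y_zero: "\<omega> \<in> space N \<Longrightarrow> Y 0 \<omega> = 0"
  using poisson_processD(3)[OF Yp] by (simp add: Y_def two_sided_def)

lemma LBINT_const_Icc: "s \<le> t \<Longrightarrow> (LBINT u:{s..t}. c) = (t - s) * (c :: real)"
  by (simp add: set_lebesgue_integral_def)

lemma exp_Yp: "0 \<le> s \<Longrightarrow> s \<le> t \<Longrightarrow>
    (\<integral>\<^sup>+\<omega>. ennreal (exp (x * (real (Yp t \<omega>) - real (Yp s \<omega>)))) \<partial>N) = ennreal (exp (b * (t - s) * (exp x - 1)))"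
  using poisson_increment_exp[OF Yp, of s t x] ab LBINT_const_Icc[of s t b] by (cases "s < t") (auto simp: mult.commute)

lemma exp_Ym: "0 \<le> s \<Longrightarrow> s \<le> t \<Longrightarrow>
    (\<integral>\<^sup>+\<omega>. ennreal (exp (x * (real (Ym t \<omega>) - real (Ym s \<omega>)))) \<partial>N) = ennreal (exp (a * (t - s) * (exp x - 1)))"
  using poisson_increment_exp[OF Ym, of s t x] ab LBINT_const_Icc[of s t a] by (cases "s < t") (auto simp: mult.commute)

lemma Y_exp:
  assumes uv: "u \<le> v" and s: "0 \<le> s"
  shows "mean_le N (\<lambda>\<omega>. exp (s * (Y v \<omega> - Y u \<omega>))) (exp (max a b * (v - u) * (exp s - 1)))"
proof -
  have es: "0 \<le> exp s - 1" using s by simp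
  have "(\<integral>\<^sup>+\<omega>. ennreal (exp (s * (Y v \<omega> - Y u \<omega>))) \<partial>N) \<le> ennreal (exp (max a b * (v - u) * (exp s - 1)))"
  proof -
    consider "0 \<le> u" | "v < 0" | "u < 0" "0 \<le> v" by linarith
    then show ?thesis
    proof cases
      case 1
      then have "(\<integral>\<^sup>+\<omega>. ennreal (exp (s * (Y v \<omega> - Y u \<omega>))) \<partial>N) = ennreal (exp (b * (v - u) * (exp s - 1)))"
        using exp_Yp[of u v s] uv by (simp add: Y_def two_sided_def)
      also have "\<dots> \<le> ennreal (exp (max a b * (v - u) * (exp s - 1)))"
        using uv es by (intro ennreal_leI) (auto intro!: mult_right_mono)
      finally show ?thesis .
    next
      case 2
      then have "(\<integral>\<^sup>+\<omega>. ennreal (exp (s * (Y v \<omega> - Y u \<omega>))) \<partial>N) = ennreal (exp (a * (v - u) * (exp s - 1)))"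
        using exp_Ym[of "- v" "- u" s] uv by (simp add: Y_def two_sided_def algebra_simps)
      also have "\<dots> \<le> ennreal (exp (max a b * (v - u) * (exp s - 1)))"
        using uv es by (intro ennreal_leI) (auto intro!: mult_right_mono)
      finally show ?thesis .
    next
      case 3
      let ?f = "\<lambda>v (y :: real \<Rightarrow> nat). ennreal (exp (s * real (y v)))"
      have m: "(\<lambda>y. ?f v y) \<in> borel_measurable (path_space {0..})" if "v \<in> {0..}" for v
        by (rule measurable_compose[OF measurable_component_singleton[OF that]]) simp
      have "N.indep_var borel ((\<lambda>y. ?f v y) \<circ> path_of {0..} Yp) borel ((\<lambda>y. ?f (- u) y) \<circ> path_of {0..} Ym)"
        by (rule N.indep_var_compose[OF indep m m]) (use 3 in auto)
      moreover have "(\<lambda>y. ?f v y) \<circ> path_of {0..} Yp = (\<lambda>\<omega>. ennreal (exp (s * real (Yp v \<omega>))))"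
        "(\<lambda>y. ?f (- u) y) \<circ> path_of {0..} Ym = (\<lambda>\<omega>. ennreal (exp (s * real (Ym (- u) \<omega>))))"
        using 3 by (auto simp: path_of_def)
      moreover have "case_bool borel borel = (\<lambda>_. borel :: ennreal measure)" by (auto split: bool.split)
      ultimately have iv: "N.indep_vars (\<lambda>_. borel) (case_bool (\<lambda>\<omega>. ennreal (exp (s * real (Yp v \<omega>)))) (\<lambda>\<omega>. ennreal (exp (s * real (Ym (- u) \<omega>))))) UNIV"
        unfolding N.indep_var_def by (simp only:)
      have "(\<integral>\<^sup>+\<omega>. ennreal (exp (s * (Y v \<omega> - Y u \<omega>))) \<partial>N)
        = (\<integral>\<^sup>+\<omega>. (\<Prod>i\<in>UNIV. case_bool (\<lambda>\<omega>. ennreal (exp (s * real (Yp v \<omega>)))) (\<lambda>\<omega>. ennreal (exp (s * real (Ym (- u) \<omega>)))) i \<omega>) \<partial>N)"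
        using 3 by (intro nn_integral_cong) (simp add: Y_def two_sided_def UNIV_bool distrib_left exp_add ennreal_mult mult.commute)
      also have "\<dots> = (\<Prod>i\<in>UNIV. \<integral>\<^sup>+\<omega>. case_bool (\<lambda>\<omega>. ennreal (exp (s * real (Yp v \<omega>)))) (\<lambda>\<omega>. ennreal (exp (s * real (Ym (- u) \<omega>)))) i \<omega> \<partial>N)"
        by (rule N.indep_vars_nn_integral[OF _ iv]) auto
      also have "\<dots> = (\<integral>\<^sup>+\<omega>. ennreal (exp (s * real (Yp v \<omega>))) \<partial>N) * (\<integral>\<^sup>+\<omega>. ennreal (exp (s * real (Ym (- u) \<omega>))) \<partial>N)"
        by (simp add: UNIV_bool mult.commute)
      also have "(\<integral>\<^sup>+\<omega>. ennreal (exp (s * real (Yp v \<omega>))) \<partial>N) = ennreal (exp (b * (v - 0) * (exp s - 1)))"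
        using exp_Yp[of 0 v s] 3 poisson_processD(3)[OF Yp] by (simp cong: nn_integral_cong)
      also have "(\<integral>\<^sup>+\<omega>. ennreal (exp (s * real (Ym (- u) \<omega>))) \<partial>N) = ennreal (exp (a * (- u - 0) * (exp s - 1)))"
        using exp_Ym[of 0 "- u" s] 3 poisson_processD(3)[OF Ym] by (simp cong: nn_integral_cong)
      also have "ennreal (exp (b * (v - 0) * (exp s - 1))) * ennreal (exp (a * (- u - 0) * (exp s - 1)))
        = ennreal (exp ((b * v + a * (- u)) * (exp s - 1)))"
        by (simp add: ennreal_mult[symmetric] exp_add[symmetric] algebra_simps)
      also have "\<dots> \<le> ennreal (exp (max a b * (v - u) * (exp s - 1)))"
      proof (intro ennreal_leI, unfold exp_le_cancel_iff, intro mult_right_mono es)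
        have "b * v \<le> max a b * v" "a * (- u) \<le> max a b * (- u)" using 3 by (auto intro!: mult_right_mono)
        then show "b * v + a * (- u) \<le> max a b * (v - u)" by (simp add: algebra_simps)
      qed
      finally show ?thesis .
    qed
  qed
  then show ?thesis unfolding mean_le_def using Y_meas[of u] Y_meas[of v] by auto
qed

text \<open>
  Half the squared Hellinger distance, per unit of time, of the constant intensities \<open>a\<close> and \<open>b\<close>.
\<close>

definition half_rate :: real where
  "half_rate = (sqrt b - sqrt a)\<^sup>2 / 2"

lemma half_rate_pos: "0 < half_rate"
  using ab by (simp add: half_rate_def)

lemma Z_half: "mean_le N (\<lambda>\<omega>. sqrt (Z u \<omega>)) (exp (- (half_rate * (\<bar>u\<bar> - 0))))"
proof -
  let ?k = "ln (b / a)"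
  have sq: "sqrt (exp x) = exp (x / 2)" for x :: real
    by (rule real_sqrt_unique) (auto simp: power2_eq_square exp_add[symmetric])
  have e1: "exp (- ?k / 2) = sqrt a / sqrt b" and e2: "exp (?k / 2) = sqrt b / sqrt a"
  proof -
    have "exp (- ?k / 2) = sqrt (exp (- ?k))" by (simp add: sq)
    also have "exp (- ?k) = a / b" using ab by (simp add: exp_minus)
    finally show "exp (- ?k / 2) = sqrt a / sqrt b" by (simp add: real_sqrt_divide)
    have "exp (?k / 2) = sqrt (exp ?k)" by (simp add: sq)
    then show "exp (?k / 2) = sqrt b / sqrt a" using ab by (simp add: real_sqrt_divide)
  qed
  have rr: "half_rate = (a + b) / 2 - sqrt a * sqrt b" using ab by (simp add: half_rate_def power2_diff field_simps)
  have "(\<integral>\<^sup>+\<omega>. ennreal (sqrt (Z u \<omega>)) \<partial>N) = ennreal (exp (- (half_rate * \<bar>u\<bar>)))"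
  proof (cases "0 \<le> u")
    case True
    have "(\<integral>\<^sup>+\<omega>. ennreal (sqrt (Z u \<omega>)) \<partial>N)
       = (\<integral>\<^sup>+\<omega>. ennreal (exp ((b - a) * u / 2)) * ennreal (exp ((- ?k / 2) * (real (Yp u \<omega>) - real (Yp 0 \<omega>)))) \<partial>N)"
      using True poisson_processD(3)[OF Yp]
      by (intro nn_integral_cong) (simp add: Z_eq sq Y_def two_sided_def ennreal_mult[symmetric] exp_add[symmetric] add_divide_distrib)
    also have "\<dots> = ennreal (exp ((b - a) * u / 2)) * (\<integral>\<^sup>+\<omega>. ennreal (exp ((- ?k / 2) * (real (Yp u \<omega>) - real (Yp 0 \<omega>)))) \<partial>N)"
    proof -
      have [measurable]: "Yp (u) \<in> measurable N (count_space UNIV)" "Yp 0 \<in> measurable N (count_space UNIV)"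
        using poisson_processD(2)[OF Yp] True by auto
      show ?thesis by (rule nn_integral_cmult) measurable
    qed
    also have "\<dots> = ennreal (exp ((b - a) * u / 2 + b * u * (exp (- ?k / 2) - 1)))"
      using exp_Yp[of 0 u "- ?k / 2"] True by (simp add: ennreal_mult[symmetric] exp_add[symmetric])
    also have "(b - a) * u / 2 + b * u * (exp (- ?k / 2) - 1) = - (half_rate * \<bar>u\<bar>)"
    proof -
      have "b * (sqrt a / sqrt b) = sqrt a * sqrt b"
        using ab by (simp add: field_simps real_sqrt_mult[symmetric]) (metis less_imp_le mult.assoc mult.commute real_sqrt_mult_self real_sqrt_mult abs_of_pos)
      moreover have "b * u * (exp (- ?k / 2) - 1) = u * (b * (sqrt a / sqrt b)) - b * u" unfolding e1 by (simp add: algebra_simps)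
      ultimately have "b * u * (exp (- ?k / 2) - 1) = u * (sqrt a * sqrt b) - b * u" by simp
      then show ?thesis using True unfolding rr by (simp add: field_simps)
    qed
    finally show ?thesis .
  next
    case False
    have "(\<integral>\<^sup>+\<omega>. ennreal (sqrt (Z u \<omega>)) \<partial>N)
       = (\<integral>\<^sup>+\<omega>. ennreal (exp ((b - a) * u / 2)) * ennreal (exp ((?k / 2) * (real (Ym (- u) \<omega>) - real (Ym 0 \<omega>)))) \<partial>N)"
      using False poisson_processD(3)[OF Ym]
      by (intro nn_integral_cong) (simp add: Z_eq sq Y_def two_sided_def ennreal_mult[symmetric] exp_add[symmetric] add_divide_distrib)
    also have "\<dots> = ennreal (exp ((b - a) * u / 2)) * (\<integral>\<^sup>+\<omega>. ennreal (exp ((?k / 2) * (real (Ym (- u) \<omega>) - real (Ym 0 \<omega>)))) \<partial>N)"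
    proof -
      have [measurable]: "Ym (- u) \<in> measurable N (count_space UNIV)" "Ym 0 \<in> measurable N (count_space UNIV)"
        using poisson_processD(2)[OF Ym] False by auto
      show ?thesis by (rule nn_integral_cmult) measurable
    qed
    also have "\<dots> = ennreal (exp ((b - a) * u / 2 + a * (- u) * (exp (?k / 2) - 1)))"
      using exp_Ym[of 0 "- u" "?k / 2"] False by (simp add: ennreal_mult[symmetric] exp_add[symmetric])
    also have "(b - a) * u / 2 + a * (- u) * (exp (?k / 2) - 1) = - (half_rate * \<bar>u\<bar>)"
    proof -
      have "a * (sqrt b / sqrt a) = sqrt a * sqrt b"
        using ab by (simp add: field_simps real_sqrt_mult[symmetric]) (metis less_imp_le mult.assoc mult.commute real_sqrt_mult_self real_sqrt_mult abs_of_pos)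
      moreover have "a * (- u) * (exp (?k / 2) - 1) = - u * (a * (sqrt b / sqrt a)) + a * u" unfolding e2 by (simp add: algebra_simps)
      ultimately have "a * (- u) * (exp (?k / 2) - 1) = - u * (sqrt a * sqrt b) + a * u" by simp
      then show ?thesis using False unfolding rr by (simp add: field_simps)
    qed
    finally show ?thesis .
  qed
  moreover have "(\<lambda>\<omega>. sqrt (Z u \<omega>)) \<in> borel_measurable N" unfolding Z_eq using Y_meas[of u] by measurable
  ultimately show ?thesis by (simp add: mean_le_def)
qed

definition K :: real where
  "K = \<bar>ln (b / a)\<bar> + \<bar>b - a\<bar>"

text \<open>
  The limit experiment has a flat prior and jumps in place of ramps.
\<close>

lemma local_likelihood_limit: "local_likelihood N Z Y (\<lambda>_. 1) UNIV 0 K (max a b) half_rate 2 1"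
proof (unfold_locales)
  fix k :: nat
  have "(\<integral>\<^sup>+u. ennreal 1 * indicator {u :: real. real k \<le> \<bar>u\<bar> \<and> \<bar>u\<bar> < real k + 1} u \<partial>lborel)
      = emeasure lborel {u :: real. real k \<le> \<bar>u\<bar> \<and> \<bar>u\<bar> < real k + 1}"
    by simp
  also have "\<dots> \<le> ennreal 2" by (rule emeasure_abs_cell_le)
  also have "\<dots> \<le> ennreal (2 * (1 + real k))" by (intro ennreal_leI) simp
  finally show "(\<integral>\<^sup>+u. ennreal 1 * indicator {u. real k \<le> \<bar>u\<bar> \<and> \<bar>u\<bar> < real k + 1} u \<partial>lborel) \<le> ennreal (2 * (1 + real k))" .
next
  show "(\<lambda>(\<omega>, u). Z u \<omega>) \<in> borel_measurable (N \<Otimes>\<^sub>M lborel)" by (rule Z_meas)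
next
  show "Z 0 \<omega> = 1" if "\<omega> \<in> space N" for \<omega> using Y_zero[OF that] by (simp add: Z_eq)
next
  fix u v :: real and \<omega> assume \<omega>: "\<omega> \<in> space N" and uv: "\<bar>u - v\<bar> \<le> 1"
  let ?d = "Y (max u v) \<omega> - Y (min u v) \<omega>"
  have d: "0 \<le> ?d" using Y_mono[OF \<omega>, of "min u v" "max u v"] by simp
  have "\<bar>Y u \<omega> - Y v \<omega>\<bar> = ?d" using d by (cases "u \<le> v") (auto simp: max_def min_def)
  then have "\<bar>ln (b / a) * (Y u \<omega> - Y v \<omega>)\<bar> = \<bar>ln (b / a)\<bar> * ?d" by (simp add: abs_mult)
  also have "\<dots> \<le> K * ?d" using d by (intro mult_right_mono) (auto simp: K_def)
  finally have 1: "\<bar>ln (b / a) * (Y u \<omega> - Y v \<omega>)\<bar> \<le> K * ?d" .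
  have "\<bar>(b - a) * (u - v)\<bar> \<le> \<bar>b - a\<bar> * 1" unfolding abs_mult using uv by (intro mult_left_mono) auto
  then have 2: "\<bar>(b - a) * (u - v)\<bar> \<le> K" by (simp add: K_def)
  have "ln (Z u \<omega>) - ln (Z v \<omega>) = - (ln (b / a) * (Y u \<omega> - Y v \<omega>)) + (b - a) * (u - v)"
    by (simp add: Z_eq algebra_simps)
  then show "\<bar>ln (Z u \<omega>) - ln (Z v \<omega>)\<bar> \<le> K * (Y (max u v + 0) \<omega> - Y (min u v) \<omega>) + K"
    using 1 2 by simp
next
  show "mean_le N (\<lambda>\<omega>. sqrt (Z u \<omega>)) (exp (- (half_rate * (\<bar>u\<bar> - 0))))" for u by (rule Z_half)
qed (use ab half_rate_pos Y_mono Y_exp in \<open>auto simp: K_def Z_eq\<close>)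

sublocale lim: local_likelihood N Z Y "\<lambda>_. 1" UNIV 0 K "max a b" half_rate 2 1
  by (rule local_likelihood_limit)

lemma post_eq_zeta: "lim.post \<omega> = zeta a b (\<lambda>u. Yp u \<omega>) (\<lambda>u. Ym u \<omega>)"
  unfolding lim.post_def zeta_def Z_def by simp

lemma local_grid_limit:
  assumes "1 \<le> R"
  shows "local_grid N Z Y (\<lambda>_. 1) UNIV 0 K (max a b) half_rate 2 1 (ln (b / a)) (b - a) 1 0 R"
proof (unfold_locales)
  show "\<bar>ln (Z u \<omega>) + ln (b / a) * Y u \<omega> - (b - a) * u\<bar>
     \<le> 0 * \<bar>Y u \<omega>\<bar> + K * (Y (u + 0) \<omega> - Y u \<omega>) + K * (Y 0 \<omega> - Y 0 \<omega>) + 0" for u \<omega>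
    by (simp add: Z_eq)
qed (use assms Y_zero Y_meas in auto)

text \<open>
  Every grid cell lies on one side of the origin; the cells on the left carry the increments of
  \<open>Ym\<close>, read backwards.
\<close>

definition cell_count :: "nat \<Rightarrow> int \<Rightarrow> 'b \<Rightarrow> nat" where
  "cell_count m i \<omega> = (if 0 \<le> i then Yp ((of_int i + 1) / real m) \<omega> - Yp (of_int i / real m) \<omega>
      else Ym (- of_int i / real m) \<omega> - Ym (- (of_int i + 1) / real m) \<omega>)"

lemma real_cell_count:
  assumes m: "1 \<le> m" and \<omega>: "\<omega> \<in> space N"
  shows "real (cell_count m i \<omega>) = Y (of_int (i + 1) / real m) \<omega> - Y (of_int i / real m) \<omega>"
proof (cases "0 \<le> i")
  case True
  have "Yp (of_int i / real m) \<omega> \<le> Yp ((of_int i + 1) / real m) \<omega>"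
    using poisson_processD(4)[OF Yp \<omega>] True m by (auto simp: mono_on_def divide_right_mono)
  then show ?thesis using True m by (simp add: cell_count_def Y_def two_sided_def of_nat_diff)
next
  case False
  have neg: "of_int i / real m < 0" using False m by (simp add: divide_less_0_iff)
  have le: "(of_int i + 1) / real m \<le> 0" using False m by (simp add: divide_le_0_iff)
  have "- (of_int i + 1) / real m \<le> - of_int i / real m" by (intro divide_right_mono) auto
  moreover have "0 \<le> - (of_int i + 1) / real m" using le unfolding minus_divide_left[symmetric] by linarith
  ultimately have "Ym (- (of_int i + 1) / real m) \<omega> \<le> Ym (- of_int i / real m) \<omega>"
    using poisson_processD(4)[OF Ym \<omega>] unfolding mono_on_def by auto
  moreover have "Y ((of_int i + 1) / real m) \<omega> = - real (Ym (- (of_int i + 1) / real m) \<omega>)"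
  proof (cases "(of_int i + 1) / real m = 0")
    case True
    then have z: "- (of_int i + 1) / real m = 0" unfolding minus_divide_left[symmetric] by simp
    show ?thesis unfolding True z Y_zero[OF \<omega>] using poisson_processD(3)[OF Ym \<omega>] by simp
  next
    case False
    then have "\<not> 0 \<le> (real_of_int i + 1) / real m" using le by linarith
    then show ?thesis unfolding Y_def two_sided_def minus_divide_left by (simp only: if_False)
  qed
  ultimately show ?thesis using False neg by (simp add: cell_count_def Y_def two_sided_def of_nat_diff)
qed

lemma cell_count_law:
  assumes m: "1 \<le> m"
  shows "distr N (count_space UNIV) (cell_count m i) = measure_pmf (poisson_pmf ((if 0 \<le> i then b else a) / real m))"
proof (cases "0 \<le> i")
  case True
  have lt: "real_of_int i / real m < (real_of_int i + 1) / real m" using m by (intro divide_strict_right_mono) auto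
  have "distr N (count_space UNIV) (\<lambda>\<omega>. Yp ((of_int i + 1) / real m) \<omega> - Yp (of_int i / real m) \<omega>)
     = measure_pmf (poisson_pmf (LBINT u:{of_int i / real m..(of_int i + 1) / real m}. b))"
    by (rule poisson_processD(6)[OF Yp]) (use True lt in auto)
  also have "(LBINT u:{of_int i / real m..(of_int i + 1) / real m}. b) = b / real m"
    using lt by (subst LBINT_const_Icc) (auto simp: diff_divide_distrib[symmetric])
  finally show ?thesis using True by (simp add: cell_count_def[abs_def])
next
  case False
  have lt: "- (real_of_int i + 1) / real m < - real_of_int i / real m" using m by (intro divide_strict_right_mono) auto
  have "distr N (count_space UNIV) (\<lambda>\<omega>. Ym (- of_int i / real m) \<omega> - Ym (- (of_int i + 1) / real m) \<omega>)
     = measure_pmf (poisson_pmf (LBINT u:{- (of_int i + 1) / real m..- of_int i / real m}. a))"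
    by (rule poisson_processD(6)[OF Ym]) (use False lt in \<open>auto simp: divide_nonneg_nonneg divide_le_0_iff\<close>)
  also have "(LBINT u:{- (of_int i + 1) / real m..- of_int i / real m}. a) = a / real m"
  proof -
    have "- real_of_int i / real m - (- (real_of_int i + 1) / real m) = 1 / real m"
      unfolding diff_divide_distrib[symmetric] by simp
    then show ?thesis using lt by (subst LBINT_const_Icc) auto
  qed
  finally show ?thesis using False by (simp add: cell_count_def[abs_def])
qed

lemma cell_count_indep:
  assumes m: "1 \<le> m"
  shows "N.indep_vars (\<lambda>_. count_space UNIV) (cell_count m) (grid R m)"
proof -
  define V where "V = case_bool (path_of {0..} Yp) (path_of {0..} Ym)"
  define D where "D = (\<lambda>s :: bool. \<lambda>i :: nat. \<lambda>\<omega>. (if s then Yp else Ym) (real (Suc i) / real m) \<omega> - (if s then Yp else Ym) (real i / real m) \<omega>)"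
  let ?n = "R * m"
  have mono: "mono_on {..?n} (\<lambda>i. real i / real m)" by (auto simp: mono_on_def divide_right_mono)
  have V: "N.indep_vars (case_bool (path_space {0..}) (path_space {0..})) V UNIV"
    using indep unfolding N.indep_var_def V_def .
  have "N.indep_vars (\<lambda>_. count_space UNIV) (\<lambda>(s, i). D s i) (UNIV \<times> {..<?n})"
  proof (rule N.indep_vars_double_index[OF _ _ V, where \<phi> = "\<lambda>s i v. v (real (Suc i) / real m) - v (real i / real m)"])
    fix s
    show "N.indep_vars (\<lambda>_. count_space UNIV) (D s) {..<?n}"
      using poisson_processD(7)[OF Yp _ mono] poisson_processD(7)[OF Ym _ mono] by (cases s) (auto simp: D_def)
    fix i
    have [measurable]: "real (Suc i) / real m \<in> {0..}" "real i / real m \<in> {0..}" by auto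
    have "(\<lambda>v. v (real (Suc i) / real m) - v (real i / real m)) \<in> path_space {0..} \<rightarrow>\<^sub>M count_space UNIV" by measurable
    then show "(\<lambda>v. v (real (Suc i) / real m) - v (real i / real m)) \<in> (case s of True \<Rightarrow> path_space {0..} | False \<Rightarrow> path_space {0..}) \<rightarrow>\<^sub>M count_space UNIV"
      by (cases s) auto
    show "D s i \<omega> = V s \<omega> (real (Suc i) / real m) - V s \<omega> (real i / real m)" for \<omega>
      by (cases s) (auto simp: D_def V_def path_of_def)
  qed auto
  then have 1: "N.indep_vars (\<lambda>_. count_space UNIV) (\<lambda>(s, i). D s i) (UNIV \<times> {..<?n})" .
  define e :: "int \<Rightarrow> bool \<times> nat" where "e i = (if 0 \<le> i then (True, nat i) else (False, nat (- i - 1)))" for i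
  have inj: "inj_on e (grid R m)" by (auto simp: inj_on_def e_def split: if_splits)
  have sub: "e ` grid R m \<subseteq> UNIV \<times> {..<?n}" by (auto simp: e_def grid_def nat_less_iff)
  have "N.indep_vars (\<lambda>i. PiM {e i} (\<lambda>_. count_space UNIV)) (\<lambda>i \<omega>. restrict (\<lambda>x. (\<lambda>(s, i). D s i) x \<omega>) {e i}) (grid R m)"
    by (rule N.indep_vars_restrict[OF 1]) (use sub inj in \<open>auto simp: disjoint_family_on_def inj_on_def\<close>)
  then have "N.indep_vars (\<lambda>_. count_space UNIV) (\<lambda>i \<omega>. (\<lambda>f. f (e i)) (restrict (\<lambda>x. (\<lambda>(s, i). D s i) x \<omega>) {e i})) (grid R m)"
    by (rule N.indep_vars_compose2) (auto intro: measurable_component_singleton)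
  then show ?thesis
  proof (rule N.indep_vars_cong_space[rotated])
    fix i \<omega>
    show "(\<lambda>f. f (e i)) (restrict (\<lambda>x. (\<lambda>(s, i). D s i) x \<omega>) {e i}) = cell_count m i \<omega>"
    proof (cases "0 \<le> i")
      case True
      then show ?thesis by (simp add: e_def D_def cell_count_def of_nat_nat add.commute)
    next
      case False
      then have h: "real (Suc (nat (- i - 1))) = - of_int i" "real (nat (- i - 1)) = - (of_int i + 1)" by auto
      have "e i = (False, nat (- i - 1))" using False by (simp add: e_def)
      then show ?thesis using False unfolding cell_count_def by (simp only: restrict_apply' singletonI prod.case D_def h if_False)
    qed
  qed
qed

end

section \<open>The experiment in local coordinates\<close>

lemma poisson_process_cong_intensity:
  assumes pp: "poisson_process M {0..\<tau>} l X" and eq: "\<And>t. t \<in> {0..\<tau>} \<Longrightarrow> l t = l' t"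
  shows "poisson_process M {0..\<tau>} l' X"
proof -
  have "(LBINT u:{s..t}. l u) = (LBINT u:{s..t}. l' u)" if "s \<in> {0..\<tau>}" "t \<in> {0..\<tau>}" for s t
    unfolding set_lebesgue_integral_def
    using that eq by (intro Bochner_Integration.integral_cong refl) (auto simp: indicator_def)
  then show ?thesis using pp unfolding poisson_process_def by simp
qed

context ramp_model
begin

lemma integral_lam_bounds:
  assumes d: "0 < d" and st: "0 \<le> s" "s \<le> t" "t \<le> \<tau>"
  shows "lo * (t - s) \<le> (LBINT u:{s..t}. lam d \<theta> u)" and "(LBINT u:{s..t}. lam d \<theta> u) \<le> hi * (t - s)"
proof -
  have i: "set_integrable lborel {s..t} (lam d \<theta>)"
    by (rule borel_integrable_atLeastAtMost') (rule continuous_on_subset[OF continuous_on_lam[OF d]], use st in auto)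
  have c: "set_integrable lborel {s..t} (\<lambda>_. c :: real)" for c
    by (rule borel_integrable_atLeastAtMost') (rule continuous_on_const)
  have v: "(LBINT u:{s..t}. c) = c * (t - s)" for c :: real using st by (simp add: set_lebesgue_integral_def)
  show "lo * (t - s) \<le> (LBINT u:{s..t}. lam d \<theta> u)"
    unfolding v[symmetric] by (rule set_integral_mono[OF c i]) (use lam_bounds(3)[of _ d \<theta>] st in auto)
  show "(LBINT u:{s..t}. lam d \<theta> u) \<le> hi * (t - s)"
    unfolding v[symmetric] by (rule set_integral_mono[OF i c]) (use lam_bounds(4)[of _ d \<theta>] st in auto)
qed

lemma loglik_joint_measurable:
  assumes d: "0 < d" and pp: "poisson_process M {0..\<tau>} l S"
  shows "(\<lambda>(\<omega>, v). loglik d n (\<lambda>t. S t \<omega>) v) \<in> borel_measurable (M \<Otimes>\<^sub>M lborel)"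
proof -
  have [measurable]: "ramp \<in> borel_measurable borel" unfolding ramp_def[abs_def] by measurable
  have 1: "(\<lambda>(\<omega>, v). path_integral \<tau> (\<lambda>t. S t \<omega>) (\<lambda>t. ln (lam d v t))) \<in> borel_measurable (M \<Otimes>\<^sub>M lborel)"
  proof (rule path_integral_joint_measurable[OF pp \<tau>_pos])
    show "continuous_on {0..\<tau>} (\<lambda>t. ln (lam d v t))" for v by (rule continuous_on_ln_lam[OF d])
    show "(\<lambda>v. ln (lam d v t)) \<in> borel_measurable lborel" for t unfolding lam_def by measurable
  qed
  have [measurable]: "(\<lambda>t. indicator {0..\<tau>} t *\<^sub>R \<psi> t) \<in> borel_measurable borel"
    using cont_\<psi> by (intro borel_measurable_continuous_on_indicator) auto
  have "(\<lambda>(v, t). indicator {0..\<tau>} t *\<^sub>R \<psi> t + indicator {0..\<tau>} t * (r * ramp ((t - v) / d) - 1)) \<in> borel_measurable (lborel \<Otimes>\<^sub>M lborel)"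
    by measurable
  moreover have "indicator {0..\<tau>} t *\<^sub>R \<psi> t + indicator {0..\<tau>} t * (r * ramp ((t - v) / d) - 1) = indicator {0..\<tau>} t *\<^sub>R (lam d v t - 1)" for t v
    by (auto simp: lam_def indicator_def)
  ultimately have "(\<lambda>(v, t). indicator {0..\<tau>} t *\<^sub>R (lam d v t - 1)) \<in> borel_measurable (lborel \<Otimes>\<^sub>M lborel)"
    by (simp only:)
  from lborel.borel_measurable_lebesgue_integral[OF this]
  have [measurable]: "(\<lambda>v. LBINT t:{0..\<tau>}. lam d v t - 1) \<in> borel_measurable lborel"
    unfolding set_lebesgue_integral_def .
  have "(\<lambda>x. (case x of (\<omega>, v) \<Rightarrow> path_integral \<tau> (\<lambda>t. S t \<omega>) (\<lambda>t. ln (lam d v t))) - real n * (LBINT t:{0..\<tau>}. lam d (snd x) t - 1)) \<in> borel_measurable (M \<Otimes>\<^sub>M lborel)"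
    using 1 by measurable
  then show ?thesis by (simp add: loglik_def split_beta')
qed

end

locale ramp_experiment = ramp_model \<psi> r \<tau> lo hi for \<psi> r \<tau> lo hi +
  fixes \<alpha> \<beta> :: real and q :: "real \<Rightarrow> real" and \<delta> :: "nat \<Rightarrow> real"
    and P :: "nat \<Rightarrow> real \<Rightarrow> 'a measure" and X :: "nat \<Rightarrow> nat \<Rightarrow> real \<Rightarrow> 'a \<Rightarrow> nat"
  assumes \<alpha>\<beta>: "0 < \<alpha>" "\<alpha> < \<beta>" "\<beta> < \<tau>"
    and \<delta>_pos: "\<And>n. 1 \<le> n \<Longrightarrow> 0 < \<delta> n" and \<delta>_lim: "\<delta> \<longlonglongrightarrow> 0" and n\<delta>_lim: "(\<lambda>n. real n * \<delta> n) \<longlonglongrightarrow> 0"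
    and pp: "\<And>n \<theta> j. 1 \<le> n \<Longrightarrow> \<theta> \<in> {\<alpha><..<\<beta>} \<Longrightarrow> j \<in> {1..n} \<Longrightarrow>
           poisson_process (P n \<theta>) {0..\<tau>} (intensity \<psi> r \<tau> (\<delta> n) \<theta>) (X n j)"
    and ind: "\<And>n \<theta>. 1 \<le> n \<Longrightarrow> \<theta> \<in> {\<alpha><..<\<beta>} \<Longrightarrow>
           prob_space.indep_vars (P n \<theta>) (\<lambda>_. path_space {0..\<tau>}) (\<lambda>j. path_of {0..\<tau>} (X n j)) {1..n}"
    and q_cont: "continuous_on {\<alpha><..<\<beta>} q" and q_pos: "\<And>\<theta>. \<theta> \<in> {\<alpha><..<\<beta>} \<Longrightarrow> 0 < q \<theta>"
    and q_int: "set_integrable lborel {\<alpha><..<\<beta>} q" and q_one: "(LBINT \<theta>:{\<alpha><..<\<beta>}. q \<theta>) = 1"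
begin

text \<open>
  For a true parameter \<open>\<theta>\<close> and the local coordinate \<open>u = n * (\<theta>' - \<theta>)\<close>: the likelihood ratio \<open>Zn\<close>, the
  points \<open>Yn\<close> of the pooled process \<open>S\<close> between \<open>\<theta>\<close> and \<open>\<theta>'\<close>, counted with the sign of \<open>u\<close>, the prior
  density \<open>wn\<close> and the range \<open>Dn\<close> of \<open>u\<close>. The constant \<open>Kn\<close> plays the part of \<open>K\<close> in
  \<open>local_likelihood\<close>.
\<close>

definition S :: "nat \<Rightarrow> real \<Rightarrow> 'a \<Rightarrow> nat" where
  "S n t \<omega> = (\<Sum>j=1..n. X n j t \<omega>)"

definition est :: "nat \<Rightarrow> 'a \<Rightarrow> real" where
  "est n \<omega> = bayes_estimator \<alpha> \<beta> q \<psi> r \<tau> (\<delta> n) n (\<lambda>j t. X n j t \<omega>)"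

definition L :: "nat \<Rightarrow> 'a \<Rightarrow> real \<Rightarrow> real" where
  "L n \<omega> \<theta> = loglik (\<delta> n) n (\<lambda>t. S n t \<omega>) \<theta>"

definition Zn :: "nat \<Rightarrow> real \<Rightarrow> real \<Rightarrow> 'a \<Rightarrow> real" where
  "Zn n \<theta> u \<omega> = exp (L n \<omega> (\<theta> + u / real n) - L n \<omega> \<theta>)"

definition Yn :: "nat \<Rightarrow> real \<Rightarrow> real \<Rightarrow> 'a \<Rightarrow> real" where
  "Yn n \<theta> u \<omega> = real (S n (\<theta> + u / real n) \<omega>) - real (S n \<theta> \<omega>)"

definition wn :: "nat \<Rightarrow> real \<Rightarrow> real \<Rightarrow> real" where
  "wn n \<theta> u = indicator {\<alpha><..<\<beta>} (\<theta> + u / real n) * q (\<theta> + u / real n)"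

definition Dn :: "nat \<Rightarrow> real \<Rightarrow> real set" where
  "Dn n \<theta> = {u. \<theta> + u / real n \<in> {\<alpha><..<\<beta>}}"

definition Kn :: real where
  "Kn = 3 * log_range + 3 * \<bar>r\<bar>"

lemma S_poisson:
  assumes n: "1 \<le> n" and \<theta>: "\<theta> \<in> {\<alpha><..<\<beta>}"
  shows "poisson_process (P n \<theta>) {0..\<tau>} (\<lambda>t. real n * lam (\<delta> n) \<theta> t) (S n)"
proof -
  have "poisson_process (P n \<theta>) {0..\<tau>} (\<lambda>t. real (card {1..n}) * lam (\<delta> n) \<theta> t) (\<lambda>t \<omega>. \<Sum>j=1..n. X n j t \<omega>)"
  proof (rule poisson_process_superposition)
    show "poisson_process (P n \<theta>) {0..\<tau>} (lam (\<delta> n) \<theta>) (X n j)" if "j \<in> {1..n}" for j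
      by (rule poisson_process_cong_intensity[OF pp[OF n \<theta> that]]) (rule intensity_eq_lam[OF \<delta>_pos[OF n]])
    show "prob_space.indep_vars (P n \<theta>) (\<lambda>_. path_space {0..\<tau>}) (\<lambda>j. path_of {0..\<tau>} (X n j)) {1..n}"
      by (rule ind[OF n \<theta>])
    show "0 < (LBINT u:{s..t}. lam (\<delta> n) \<theta> u)" if "s \<in> {0..\<tau>}" "t \<in> {0..\<tau>}" "s < t" for s t
    proof -
      have "0 < lo * (t - s)" using lo_pos that by simp
      then show ?thesis using integral_lam_bounds(1)[OF \<delta>_pos[OF n], of s t \<theta>] that by auto
    qed
  qed (use n in auto)
  then show ?thesis by (simp add: S_def[abs_def])
qed

lemma S_mono:
  assumes "1 \<le> n" "\<theta> \<in> {\<alpha><..<\<beta>}" "\<omega> \<in> space (P n \<theta>)" "0 \<le> s" "s \<le> t" "t \<le> \<tau>"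
  shows "real (S n s \<omega>) \<le> real (S n t \<omega>)"
  using counting_path_mono[OF poisson_process_counting_path[OF S_poisson[OF assms(1,2)] assms(3)] assms(4-6)] by simp

lemma L_joint_measurable:
  assumes n: "1 \<le> n" and \<theta>: "\<theta> \<in> {\<alpha><..<\<beta>}"
  shows "(\<lambda>(\<omega>, v). L n \<omega> v) \<in> borel_measurable (P n \<theta> \<Otimes>\<^sub>M lborel)"
  unfolding L_def by (rule loglik_joint_measurable[OF \<delta>_pos[OF n] S_poisson[OF n \<theta>]])

lemma Zn_measurable:
  assumes n: "1 \<le> n" and \<theta>: "\<theta> \<in> {\<alpha><..<\<beta>}"
  shows "(\<lambda>(\<omega>, u). Zn n \<theta> u \<omega>) \<in> borel_measurable (P n \<theta> \<Otimes>\<^sub>M lborel)"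
proof -
  have "(\<lambda>x. (fst x, \<theta> + snd x / real n)) \<in> measurable (P n \<theta> \<Otimes>\<^sub>M lborel) (P n \<theta> \<Otimes>\<^sub>M (lborel :: real measure))" by measurable
  from measurable_compose[OF this L_joint_measurable[OF n \<theta>]]
  have [measurable]: "(\<lambda>x. L n (fst x) (\<theta> + snd x / real n)) \<in> borel_measurable (P n \<theta> \<Otimes>\<^sub>M lborel)" by (simp add: split_beta')
  have "(\<lambda>x. (fst x, \<theta>)) \<in> measurable (P n \<theta> \<Otimes>\<^sub>M (lborel :: real measure)) (P n \<theta> \<Otimes>\<^sub>M (lborel :: real measure))" by measurable
  from measurable_compose[OF this L_joint_measurable[OF n \<theta>]]
  have [measurable]: "(\<lambda>x. L n (fst x) \<theta>) \<in> borel_measurable (P n \<theta> \<Otimes>\<^sub>M (lborel :: real measure))" by (simp add: split_beta')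
  show ?thesis unfolding Zn_def split_beta' by measurable
qed

lemma q_measurable: "(\<lambda>t. indicator {\<alpha><..<\<beta>} t * q t) \<in> borel_measurable borel"
  using borel_measurable_integrable[OF q_int[unfolded set_integrable_def]] by simp

lemma wn_measurable: "wn n \<theta> \<in> borel_measurable borel"
proof -
  note [measurable] = q_measurable
  have "(\<lambda>u. (\<lambda>t. indicator {\<alpha><..<\<beta>} t * q t) (\<theta> + u / real n)) \<in> borel_measurable borel"
    by (rule measurable_compose[OF _ q_measurable]) measurable
  then show ?thesis by (simp add: wn_def[abs_def])
qed

lemma est_eq:
  assumes n: "1 \<le> n" and \<theta>: "\<theta> \<in> {\<alpha><..<\<beta>}" and \<omega>: "\<omega> \<in> space (P n \<theta>)"
  shows "est n \<omega> = (LBINT t. t * ((indicator {\<alpha><..<\<beta>} t * q t) * exp (L n \<omega> t))) / (LBINT t. (indicator {\<alpha><..<\<beta>} t * q t) * exp (L n \<omega> t))"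
proof -
  have "likelihood \<psi> r \<tau> (\<delta> n) n t (\<lambda>j t. X n j t \<omega>) = exp (L n \<omega> t)" for t
    unfolding L_def S_def
    by (rule likelihood_eq_exp_loglik[OF \<delta>_pos[OF n]]) (rule poisson_process_counting_path[OF pp[OF n \<theta>] \<omega>])
  then show ?thesis
    unfolding est_def bayes_estimator_def set_lebesgue_integral_def by (simp add: mult_ac)
qed

lemma est_measurable:
  assumes n: "1 \<le> n" and \<theta>: "\<theta> \<in> {\<alpha><..<\<beta>}"
  shows "est n \<in> borel_measurable (P n \<theta>)"
proof -
  note [measurable] = L_joint_measurable[OF n \<theta>] q_measurable
  have "(\<lambda>\<omega>. (LBINT t. t * ((indicator {\<alpha><..<\<beta>} t * q t) * exp (L n \<omega> t))) / (LBINT t. (indicator {\<alpha><..<\<beta>} t * q t) * exp (L n \<omega> t))) \<in> borel_measurable (P n \<theta>)"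
    by measurable
  then show ?thesis by (rule measurable_cong[THEN iffD2, rotated]) (rule est_eq[OF n \<theta>])
qed

lemma Yn_measurable:
  assumes n: "1 \<le> n" and \<theta>: "\<theta> \<in> {\<alpha><..<\<beta>}" and u: "\<theta> + u / real n \<in> {0..\<tau>}"
  shows "Yn n \<theta> u \<in> borel_measurable (P n \<theta>)"
proof -
  have [measurable]: "S n (\<theta> + u / real n) \<in> measurable (P n \<theta>) (count_space UNIV)" "S n \<theta> \<in> measurable (P n \<theta>) (count_space UNIV)"
    using poisson_processD(2)[OF S_poisson[OF n \<theta>]] u \<theta> \<alpha>\<beta> by auto
  show ?thesis unfolding Yn_def[abs_def] by measurable
qed

text \<open>
  Time points up to two local units outside the parameter interval, and complete ramps, stay inside the
  observation window; the unit interval to the right of \<open>\<theta>\<close> stays inside the parameter interval.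
\<close>

definition small_enough :: "nat \<Rightarrow> real \<Rightarrow> bool" where
  "small_enough n \<theta> \<longleftrightarrow> 1 \<le> n \<and> \<theta> \<in> {\<alpha><..<\<beta>} \<and> 2 / real n \<le> \<alpha> \<and> 2 / real n \<le> \<tau> - \<beta> \<and> \<delta> n \<le> \<tau> - \<beta>
     \<and> real n * \<delta> n \<le> 1 \<and> \<theta> + 1 / real n < \<beta>"

lemma near_Dn:
  assumes s: "small_enough n \<theta>" and v: "near (Dn n \<theta>) v"
  shows "0 \<le> \<theta> + v / real n" "\<theta> + v / real n \<le> \<tau>"
proof -
  obtain u where u: "\<theta> + u / real n \<in> {\<alpha><..<\<beta>}" "\<bar>v - u\<bar> \<le> 2" using v by (auto simp: near_def Dn_def)
  have "\<bar>v / real n - u / real n\<bar> \<le> 2 / real n"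
    unfolding diff_divide_distrib[symmetric] abs_divide using u(2) by (auto intro: divide_right_mono)
  then show "0 \<le> \<theta> + v / real n" "\<theta> + v / real n \<le> \<tau>"
    using u(1) s unfolding small_enough_def by auto
qed

text \<open>
  This is \<open>loglik_diff_approx\<close> in the local coordinate, where the ramps have length \<open>n * \<delta> n\<close>.
\<close>

lemma Zn_log_diff:
  assumes s: "small_enough n \<theta>" and \<omega>: "\<omega> \<in> space (P n \<theta>)"
    and u: "u \<in> Dn n \<theta>" and v: "v \<in> Dn n \<theta>" and \<eta>: "0 \<le> \<eta>"
    and \<kappa>: "\<And>t. \<theta> + min u v / real n < t \<Longrightarrow> t \<le> \<theta> + max u v / real n \<Longrightarrow> \<bar>log_jump t - \<kappa>\<bar> \<le> \<eta>"
  shows "\<bar>ln (Zn n \<theta> u \<omega>) - ln (Zn n \<theta> v \<omega>) + \<kappa> * (Yn n \<theta> u \<omega> - Yn n \<theta> v \<omega>) - r * (u - v)\<bar>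
     \<le> \<eta> * (Yn n \<theta> (max u v) \<omega> - Yn n \<theta> (min u v) \<omega>)
       + log_range * (Yn n \<theta> (u + real n * \<delta> n) \<omega> - Yn n \<theta> u \<omega>) + log_range * (Yn n \<theta> (v + real n * \<delta> n) \<omega> - Yn n \<theta> v \<omega>)
       + 2 * \<bar>r\<bar> * (real n * \<delta> n)"
proof -
  have n: "1 \<le> n" "0 < real n" and \<theta>: "\<theta> \<in> {\<alpha><..<\<beta>}" and d: "0 < \<delta> n" "\<delta> n \<le> \<tau> - \<beta>"
    using s \<delta>_pos unfolding small_enough_def by auto
  let ?t = "\<lambda>u. \<theta> + u / real n"
  have cp: "counting_path \<tau> (\<lambda>t. S n t \<omega>)" by (rule poisson_process_counting_path[OF S_poisson[OF n(1) \<theta>] \<omega>])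
  have tu: "0 \<le> ?t u" "?t u + \<delta> n \<le> \<tau>" and tv: "0 \<le> ?t v" "?t v + \<delta> n \<le> \<tau>"
    using u v d \<alpha>\<beta> unfolding Dn_def by auto
  have mm: "min (?t v) (?t u) = ?t (min u v)" "max (?t v) (?t u) = ?t (max u v)"
    using n by (auto simp: min_def max_def divide_le_cancel)
  have sh: "?t (x + real n * \<delta> n) = ?t x + \<delta> n" for x using n by (simp add: add_divide_distrib)
  have h: "\<bar>loglik (\<delta> n) n (\<lambda>t. S n t \<omega>) (?t u) - loglik (\<delta> n) n (\<lambda>t. S n t \<omega>) (?t v)
       + \<kappa> * (real (S n (?t u) \<omega>) - real (S n (?t v) \<omega>)) - real n * r * (?t u - ?t v)\<bar>
     \<le> \<eta> * (real (S n (max (?t v) (?t u)) \<omega>) - real (S n (min (?t v) (?t u)) \<omega>))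
       + log_range * (real (S n (?t u + \<delta> n) \<omega>) - real (S n (?t u) \<omega>))
       + log_range * (real (S n (?t v + \<delta> n) \<omega>) - real (S n (?t v) \<omega>)) + 2 * real n * \<bar>r\<bar> * \<delta> n"
    by (rule loglik_diff_approx[OF d(1) cp tv tu \<eta>]) (use \<kappa> mm in auto)
  have e1: "real n * r * (?t u - ?t v) = r * (u - v)" using n by (simp add: field_simps)
  have Yd: "Yn n \<theta> x \<omega> - Yn n \<theta> y \<omega> = real (S n (?t x) \<omega>) - real (S n (?t y) \<omega>)" for x y by (simp add: Yn_def)
  have Zd: "ln (Zn n \<theta> u \<omega>) - ln (Zn n \<theta> v \<omega>) = loglik (\<delta> n) n (\<lambda>t. S n t \<omega>) (?t u) - loglik (\<delta> n) n (\<lambda>t. S n t \<omega>) (?t v)"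
    by (simp add: Zn_def L_def)
  have e2: "2 * real n * \<bar>r\<bar> * \<delta> n = 2 * \<bar>r\<bar> * (real n * \<delta> n)" by simp
  show ?thesis using h unfolding mm e1 e2 Yd Zd sh .
qed

lemma Yn_mono:
  assumes s: "small_enough n \<theta>" and \<omega>: "\<omega> \<in> space (P n \<theta>)"
    and "near (Dn n \<theta>) u" "near (Dn n \<theta>) v" "u \<le> v"
  shows "Yn n \<theta> u \<omega> \<le> Yn n \<theta> v \<omega>"
proof -
  have n: "1 \<le> n" and \<theta>: "\<theta> \<in> {\<alpha><..<\<beta>}" using s unfolding small_enough_def by auto
  show ?thesis unfolding Yn_def
    using S_mono[OF n \<theta> \<omega>, of "\<theta> + u / real n" "\<theta> + v / real n"] near_Dn[OF s] assms(3-5) n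
    by (auto simp: divide_right_mono)
qed

text \<open>
  The oscillation bound is \<open>Zn_log_diff\<close> for the trivial choice \<open>\<kappa> = 0\<close>, where the whole log-jump counts
  as error; the half moments are \<open>loglik_half_moment\<close>, with \<open>n\<close> absorbed by the change of scale.
\<close>

lemma local_likelihood_Zn:
  assumes s: "small_enough n \<theta>" and C: "0 \<le> Cw" "0 < cw"
    and low: "\<And>t. \<theta> \<le> t \<Longrightarrow> t \<le> \<theta> + 1 / real n \<Longrightarrow> cw \<le> q t"
    and cell: "\<And>k :: nat. (\<integral>\<^sup>+u. ennreal (wn n \<theta> u) * indicator {u. real k \<le> \<bar>u\<bar> \<and> \<bar>u\<bar> < real k + 1} u \<partial>lborel)
        \<le> ennreal (Cw * (1 + real k))"
  shows "local_likelihood (P n \<theta>) (Zn n \<theta>) (Yn n \<theta>) (wn n \<theta>) (Dn n \<theta>) (real n * \<delta> n) Kn hi hellinger_rate Cw cw"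
proof -
  have n: "1 \<le> n" "0 < real n" and \<theta>: "\<theta> \<in> {\<alpha><..<\<beta>}" and d: "0 < \<delta> n" "\<delta> n \<le> \<tau> - \<beta>" "real n * \<delta> n \<le> 1"
    and t1: "\<theta> + 1 / real n < \<beta>"
    using s \<delta>_pos unfolding small_enough_def by auto
  note S = S_poisson[OF n(1) \<theta>]
  interpret prob_space "P n \<theta>" by (rule poisson_processD(1)[OF S])
  have U01: "{0..1} \<subseteq> Dn n \<theta>"
  proof
    fix u :: real assume "u \<in> {0..1}"
    then have "0 \<le> u / real n" "u / real n \<le> 1 / real n" using n by (auto intro: divide_right_mono)
    then show "u \<in> Dn n \<theta>" using \<theta> t1 by (auto simp: Dn_def)
  qed
  show ?thesis
  proof (unfold_locales)
    show "0 \<le> real n * \<delta> n" using d by simp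
    show "real n * \<delta> n \<le> 1" by (rule d(3))
    show "0 \<le> Kn" using log_range_nonneg by (simp add: Kn_def)
    show "0 \<le> hi" using hi_pos by simp
    show "0 < hellinger_rate" by (rule hellinger_rate_pos)
    show "is_interval (Dn n \<theta>)"
      unfolding is_interval_1
    proof (intro ballI allI impI)
      fix a b x assume ab: "a \<in> Dn n \<theta>" "b \<in> Dn n \<theta>" "a \<le> x \<and> x \<le> b"
      have "a / real n \<le> x / real n" "x / real n \<le> b / real n" using ab n by (auto intro: divide_right_mono)
      then show "x \<in> Dn n \<theta>" using ab unfolding Dn_def by auto
    qed
    show "{0..1} \<subseteq> Dn n \<theta>" by (rule U01)
    show "wn n \<theta> \<in> borel_measurable borel" by (rule wn_measurable)
    show "0 \<le> wn n \<theta> u" for u using q_pos by (auto simp: wn_def indicator_def less_imp_le)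
    show "wn n \<theta> u = 0" if "u \<notin> Dn n \<theta>" for u using that by (auto simp: wn_def Dn_def indicator_def)
    show "cw \<le> wn n \<theta> u" if "0 \<le> u" "u < 1" for u
    proof -
      have "u \<in> Dn n \<theta>" using U01 that by auto
      moreover have "0 \<le> u / real n" "u / real n \<le> 1 / real n" using that n by (auto intro: divide_right_mono)
      ultimately show ?thesis using low[of "\<theta> + u / real n"] by (simp add: wn_def Dn_def)
    qed
    show "(\<lambda>(\<omega>, u). Zn n \<theta> u \<omega>) \<in> borel_measurable (P n \<theta> \<Otimes>\<^sub>M lborel)" by (rule Zn_measurable[OF n(1) \<theta>])
    show "Yn n \<theta> u \<omega> \<le> Yn n \<theta> v \<omega>" if "\<omega> \<in> space (P n \<theta>)" "near (Dn n \<theta>) u" "near (Dn n \<theta>) v" "u \<le> v" for u v \<omega>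
      by (rule Yn_mono[OF s that])
  next
    fix u v \<omega> assume \<omega>: "\<omega> \<in> space (P n \<theta>)" and uv: "u \<in> Dn n \<theta>" "v \<in> Dn n \<theta>" "\<bar>u - v\<bar> \<le> 1"
    let ?e = "real n * \<delta> n"
    let ?W = "Yn n \<theta> (max u v + ?e) \<omega> - Yn n \<theta> (min u v) \<omega>"
    have e0: "0 \<le> ?e" using d by simp
    have nr: "near (Dn n \<theta>) x" if "min u v \<le> x" "x \<le> max u v + 1" for x
      unfolding near_def using uv that by (intro bexI[of _ "max u v"]) (auto simp: max_def min_def split: if_splits)
    have inc: "Yn n \<theta> y \<omega> - Yn n \<theta> x \<omega> \<le> ?W" if "min u v \<le> x" "x \<le> y" "y \<le> max u v + ?e" for x y
      using that d(3) e0 by (intro diff_mono Yn_mono[OF s \<omega>] nr) auto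
    have "\<bar>ln (Zn n \<theta> u \<omega>) - ln (Zn n \<theta> v \<omega>) + 0 * (Yn n \<theta> u \<omega> - Yn n \<theta> v \<omega>) - r * (u - v)\<bar>
     \<le> log_range * (Yn n \<theta> (max u v) \<omega> - Yn n \<theta> (min u v) \<omega>)
       + log_range * (Yn n \<theta> (u + ?e) \<omega> - Yn n \<theta> u \<omega>) + log_range * (Yn n \<theta> (v + ?e) \<omega> - Yn n \<theta> v \<omega>)
       + 2 * \<bar>r\<bar> * ?e"
    proof (rule Zn_log_diff[OF s \<omega> uv(1,2) log_range_nonneg])
      fix t assume t: "\<theta> + min u v / real n < t" "t \<le> \<theta> + max u v / real n"
      have "near (Dn n \<theta>) (min u v)" "near (Dn n \<theta>) (max u v)" by (auto intro!: nr)
      then have "t \<in> {0..\<tau>}" using near_Dn[OF s, of "min u v"] near_Dn[OF s, of "max u v"] t by auto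
      then show "\<bar>log_jump t - 0\<bar> \<le> log_range" using abs_log_jump_le by simp
    qed
    also have "\<dots> \<le> log_range * ?W + log_range * ?W + log_range * ?W + 2 * \<bar>r\<bar> * 1"
      using log_range_nonneg d(3) e0 by (intro add_mono mult_left_mono inc) auto
    finally have 1: "\<bar>ln (Zn n \<theta> u \<omega>) - ln (Zn n \<theta> v \<omega>) - r * (u - v)\<bar> \<le> 3 * (log_range * ?W) + 2 * \<bar>r\<bar>" by simp
    have "\<bar>r * (u - v)\<bar> \<le> \<bar>r\<bar> * 1" unfolding abs_mult using uv(3) by (intro mult_left_mono) auto
    with 1 have "\<bar>ln (Zn n \<theta> u \<omega>) - ln (Zn n \<theta> v \<omega>)\<bar> \<le> 3 * (log_range * ?W) + 3 * \<bar>r\<bar>" by linarith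
    moreover have "0 \<le> ?W" using inc[of "min u v" "min u v"] e0 by simp
    then have "0 \<le> \<bar>r\<bar> * ?W" by simp
    moreover have "Kn * ?W = 3 * (log_range * ?W) + 3 * (\<bar>r\<bar> * ?W)" by (simp add: Kn_def algebra_simps)
    ultimately show "\<bar>ln (Zn n \<theta> u \<omega>) - ln (Zn n \<theta> v \<omega>)\<bar> \<le> Kn * ?W + Kn"
      using log_range_nonneg by (simp add: Kn_def)
  next
    fix u v s' :: real assume uv: "near (Dn n \<theta>) u" "near (Dn n \<theta>) v" "u \<le> v" and s': "0 \<le> s'"
    let ?t = "\<lambda>u. \<theta> + u / real n"
    have T: "?t u \<in> {0..\<tau>}" "?t v \<in> {0..\<tau>}" "?t u \<le> ?t v"
      using near_Dn[OF s uv(1)] near_Dn[OF s uv(2)] uv(3) n by (auto simp: divide_right_mono)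
    have i: "(LBINT x:{?t u..?t v}. real n * lam (\<delta> n) \<theta> x) = real n * (LBINT x:{?t u..?t v}. lam (\<delta> n) \<theta> x)" by simp
    have ub: "real n * (LBINT x:{?t u..?t v}. lam (\<delta> n) \<theta> x) \<le> hi * (v - u)"
    proof -
      have "real n * (LBINT x:{?t u..?t v}. lam (\<delta> n) \<theta> x) \<le> real n * (hi * (?t v - ?t u))"
        using integral_lam_bounds(2)[OF d(1), of "?t u" "?t v" \<theta>] T by (intro mult_left_mono) auto
      also have "\<dots> = hi * (v - u)" using n by (simp add: field_simps)
      finally show ?thesis .
    qed
    have pos: "0 < (LBINT x:{?t u..?t v}. real n * lam (\<delta> n) \<theta> x)" if "?t u < ?t v"
    proof -
      have "0 < lo * (?t v - ?t u)" using lo_pos that by simp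
      then show ?thesis unfolding i using integral_lam_bounds(1)[OF d(1), of "?t u" "?t v" \<theta>] T n by simp
    qed
    have "(\<integral>\<^sup>+\<omega>. ennreal (exp (s' * (Yn n \<theta> v \<omega> - Yn n \<theta> u \<omega>))) \<partial>P n \<theta>)
       = ennreal (exp ((if ?t u < ?t v then LBINT x:{?t u..?t v}. real n * lam (\<delta> n) \<theta> x else 0) * (exp s' - 1)))"
      using poisson_increment_exp[OF S T pos, of s'] by (simp add: Yn_def)
    also have "\<dots> \<le> ennreal (exp (hi * (v - u) * (exp s' - 1)))"
    proof (intro ennreal_leI, unfold exp_le_cancel_iff, intro mult_right_mono)
      show "(if ?t u < ?t v then LBINT x:{?t u..?t v}. real n * lam (\<delta> n) \<theta> x else 0) \<le> hi * (v - u)"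
        using ub uv(3) hi_pos unfolding i by simp
    qed (use s' in simp)
    finally show "mean_le (P n \<theta>) (\<lambda>\<omega>. exp (s' * (Yn n \<theta> v \<omega> - Yn n \<theta> u \<omega>))) (exp (hi * (v - u) * (exp s' - 1)))"
      using Yn_measurable[OF n(1) \<theta> T(1)] Yn_measurable[OF n(1) \<theta> T(2)] unfolding mean_le_def by auto
  next
    fix u assume u: "u \<in> Dn n \<theta>"
    let ?t = "\<theta> + u / real n"
    have sq: "sqrt (exp x) = exp (x / 2)" for x :: real
      by (rule real_sqrt_unique) (auto simp: power2_eq_square exp_add[symmetric])
    have "(\<integral>\<^sup>+\<omega>. ennreal (sqrt (Zn n \<theta> u \<omega>)) \<partial>P n \<theta>) \<le> ennreal (exp (- (real n * hellinger_rate * (\<bar>?t - \<theta>\<bar> - \<delta> n))))"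
      unfolding Zn_def sq L_def
      by (rule loglik_half_moment[OF d(1) S]) (use n \<theta> u \<alpha>\<beta> in \<open>auto simp: Dn_def\<close>)
    also have "real n * hellinger_rate * (\<bar>?t - \<theta>\<bar> - \<delta> n) = hellinger_rate * (\<bar>u\<bar> - real n * \<delta> n)"
      using n by (simp add: field_simps)
    finally have "(\<integral>\<^sup>+\<omega>. ennreal (sqrt (Zn n \<theta> u \<omega>)) \<partial>P n \<theta>) \<le> ennreal (exp (- (hellinger_rate * (\<bar>u\<bar> - real n * \<delta> n))))" .
    moreover have "(\<lambda>\<omega>. Zn n \<theta> u \<omega>) \<in> borel_measurable (P n \<theta>)"
      using measurable_compose[OF measurable_Pair2' Zn_measurable[OF n(1) \<theta>], of u] by simp
    ultimately show "mean_le (P n \<theta>) (\<lambda>\<omega>. sqrt (Zn n \<theta> u \<omega>)) (exp (- (hellinger_rate * (\<bar>u\<bar> - real n * \<delta> n))))"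
      unfolding mean_le_def by auto
  qed (use C cell in \<open>auto simp: Zn_def\<close>)
qed

end

section \<open>Approximation by functions of finitely many counts\<close>

text \<open>
  The tails vanish because \<open>tail_rate\<close> is summable.
\<close>

lemma (in local_likelihood) tail_sum_tendsto: "(\<lambda>R. tail_sum m R) \<longlonglongrightarrow> 0"
proof -
  have "(\<lambda>R. suminf (tail_rate m) - sum (tail_rate m) {..<R}) \<longlonglongrightarrow> suminf (tail_rate m) - suminf (tail_rate m)"
    by (intro tendsto_diff tendsto_const summable_LIMSEQ summable_tail_rate)
  then show ?thesis
    unfolding tail_sum_def suminf_minus_initial_segment[OF summable_tail_rate] by simp
qed

lemma (in local_grid) near_grid:
  assumes N: "1 \<le> N" and i: "i \<in> grid R N"
  shows "near U (real_of_int i / real N)"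
proof (rule near_R)
  have "real_of_int (- int (R * N)) \<le> real_of_int i" "real_of_int i \<le> real_of_int (int (R * N))"
    using i unfolding grid_def of_int_le_iff by auto
  then have "- real R * real N \<le> real_of_int i" "real_of_int i \<le> real R * real N" by auto
  then have "\<bar>real_of_int i / real N\<bar> \<le> real R"
    using N by (auto simp: abs_le_iff divide_le_eq pos_le_divide_eq minus_le_iff)
  then show "\<bar>real_of_int i / real N\<bar> \<le> real R + 2" by simp
qed

lemma (in local_grid) mean_le_post_grid:
  assumes "1 \<le> N"
  shows "mean_le M (\<lambda>\<omega>. \<bar>post \<omega> - grid_mean \<kappa> r R N (\<lambda>i. Y (real_of_int i / real N) \<omega>)\<bar>)
    (2 * tail_sum 1 R + grid_const K B \<kappa> r R * sqrt (\<eta> + 1 / real N + \<epsilon>))"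
proof (rule mean_le_mono[OF mean_le_add[OF mean_le_post_trunc[OF R(1)] mean_le_post_trunc_grid[OF assms]]])
  show "(\<lambda>\<omega>. \<bar>post \<omega> - grid_mean \<kappa> r R N (\<lambda>i. Y (real_of_int i / real N) \<omega>)\<bar>) \<in> borel_measurable M"
    by (intro borel_measurable_abs borel_measurable_diff post_measurable grid_mean_measurable Y_meas near_grid assms)
qed auto

lemma mean_le_cong_AE:
  assumes "mean_le M f a" "AE \<omega> in M. f \<omega> = g \<omega>" "g \<in> borel_measurable M"
  shows "mean_le M g a"
proof -
  have "(\<integral>\<^sup>+\<omega>. ennreal (f \<omega>) \<partial>M) = (\<integral>\<^sup>+\<omega>. ennreal (g \<omega>) \<partial>M)"
    using assms(2) by (intro nn_integral_cong_AE) (auto elim: eventually_mono)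
  then show ?thesis using assms by (simp add: mean_le_def)
qed

definition mean_close :: "'a measure \<Rightarrow> ('a \<Rightarrow> real) \<Rightarrow> ('a \<Rightarrow> real) \<Rightarrow> real \<Rightarrow> bool" where
  "mean_close M A B e \<longleftrightarrow> A \<in> borel_measurable M \<and> B \<in> borel_measurable M \<and> mean_le M (\<lambda>\<omega>. \<bar>A \<omega> - B \<omega>\<bar>) e"

context limit_experiment
begin

lemma zeta_measurable: "(\<lambda>\<omega>. zeta a b (\<lambda>u. Yp u \<omega>) (\<lambda>u. Ym u \<omega>)) \<in> borel_measurable N"
  unfolding post_eq_zeta[symmetric] by (rule lim.post_measurable)

text \<open>
  First \<open>R\<close> is chosen from the tails and then \<open>m\<close> in terms of \<open>R\<close>; this order is forced by the growth of
  \<open>grid_const\<close> in \<open>R\<close>.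
\<close>

lemma limit_approx:
  assumes e: "0 < e"
  shows "\<exists>R0. \<forall>R\<ge>R0. \<exists>m0. \<forall>m\<ge>m0. mean_close N (\<lambda>\<omega>. zeta a b (\<lambda>u. Yp u \<omega>) (\<lambda>u. Ym u \<omega>))
       (\<lambda>\<omega>. grid_mean (ln (b / a)) (b - a) R m (\<lambda>i. Y (real_of_int i / real m) \<omega>)) e"
proof -
  have "\<forall>\<^sub>F R in sequentially. lim.tail_sum 1 R < e / 4"
    using lim.tail_sum_tendsto[of 1] e by (intro order_tendstoD(2)) auto
  then obtain R0 where R0: "\<And>R. R0 \<le> R \<Longrightarrow> lim.tail_sum 1 R < e / 4" unfolding eventually_sequentially by blast
  show ?thesis
  proof (rule exI[of _ "max R0 1"], intro allI impI)
    fix R assume R: "max R0 1 \<le> R"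
    interpret g: local_grid N Z Y "\<lambda>_. 1" UNIV 0 K "max a b" half_rate 2 1 "ln (b / a)" "b - a" 1 0 R
      by (rule local_grid_limit) (use R in simp)
    let ?C = "grid_const K (max a b) (ln (b / a)) (b - a) R"
    have "(\<lambda>m. ?C * sqrt (1 / real m)) \<longlonglongrightarrow> ?C * sqrt 0"
      by (intro tendsto_intros lim_1_over_n)
    then have "\<forall>\<^sub>F m in sequentially. ?C * sqrt (1 / real m) < e / 2"
      by (rule order_tendstoD(2)) (use e in simp)
    then obtain m0 where m0: "\<And>m. m0 \<le> m \<Longrightarrow> ?C * sqrt (1 / real m) < e / 2" unfolding eventually_sequentially by blast
    show "\<exists>m0. \<forall>m\<ge>m0. mean_close N (\<lambda>\<omega>. zeta a b (\<lambda>u. Yp u \<omega>) (\<lambda>u. Ym u \<omega>))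
       (\<lambda>\<omega>. grid_mean (ln (b / a)) (b - a) R m (\<lambda>i. Y (real_of_int i / real m) \<omega>)) e"
    proof (rule exI[of _ "max m0 1"], intro allI impI)
      fix m assume m: "max m0 1 \<le> m"
      then have "1 \<le> m" by simp
      from g.mean_le_post_grid[OF this]
      have 1: "mean_le N (\<lambda>\<omega>. \<bar>lim.post \<omega> - grid_mean (ln (b / a)) (b - a) R m (\<lambda>i. Y (real_of_int i / real m) \<omega>)\<bar>)
        (2 * lim.tail_sum 1 R + ?C * sqrt (1 / real m))" by simp
      show "mean_close N (\<lambda>\<omega>. zeta a b (\<lambda>u. Yp u \<omega>) (\<lambda>u. Ym u \<omega>))
       (\<lambda>\<omega>. grid_mean (ln (b / a)) (b - a) R m (\<lambda>i. Y (real_of_int i / real m) \<omega>)) e"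
        unfolding post_eq_zeta[symmetric] mean_close_def
      proof (intro conjI lim.post_measurable grid_mean_measurable Y_meas)
        show "mean_le N (\<lambda>\<omega>. \<bar>lim.post \<omega> - grid_mean (ln (b / a)) (b - a) R m (\<lambda>i. Y (real_of_int i / real m) \<omega>)\<bar>) e"
          by (rule mean_le_mono[OF 1 mean_leD(1)[OF 1] order_refl]) (use R0[of R] m0[of m] R m in auto)
      qed
    qed
  qed
qed

end

context ramp_experiment
begin

text \<open>
  Near \<open>\<theta>\<close> the prior is bounded above and below. Away from \<open>\<theta>\<close> it may be unbounded, but there the
  cells are so remote that the crude bound by its total mass, of order \<open>n\<close>, is of order \<open>k\<close>.
\<close>

lemma prior_bounds:
  assumes \<theta>: "\<theta> \<in> {\<alpha><..<\<beta>}"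
  obtains \<rho> cw Cw where "0 < \<rho>" "0 < cw" "0 \<le> Cw"
    "\<And>n \<theta>' t. 1 \<le> n \<Longrightarrow> \<bar>\<theta>' - \<theta>\<bar> \<le> \<rho> \<Longrightarrow> 1 / real n \<le> \<rho> \<Longrightarrow> \<theta>' \<le> t \<Longrightarrow> t \<le> \<theta>' + 1 / real n \<Longrightarrow> cw \<le> q t"
    "\<And>n \<theta>' k. 1 \<le> n \<Longrightarrow> \<bar>\<theta>' - \<theta>\<bar> \<le> \<rho> \<Longrightarrow>
       (\<integral>\<^sup>+u. ennreal (wn n \<theta>' u) * indicator {u. real k \<le> \<bar>u\<bar> \<and> \<bar>u\<bar> < real k + 1} u \<partial>lborel) \<le> ennreal (Cw * (1 + real k))"
proof -
  define \<rho> where "\<rho> = min (\<theta> - \<alpha>) (\<beta> - \<theta>) / 3"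
  have \<rho>: "0 < \<rho>" "\<alpha> < \<theta> - 2 * \<rho>" "\<theta> + 2 * \<rho> < \<beta>" using \<theta> by (auto simp: \<rho>_def min_def field_simps)
  let ?I = "{\<theta> - 2 * \<rho>..\<theta> + 2 * \<rho>}"
  have sub: "?I \<subseteq> {\<alpha><..<\<beta>}" using \<rho> by auto
  have c: "continuous_on ?I q" by (rule continuous_on_subset[OF q_cont sub])
  obtain tm where tm: "tm \<in> ?I" "\<And>t. t \<in> ?I \<Longrightarrow> q tm \<le> q t"
    using continuous_attains_inf[OF _ _ c] \<rho> by auto
  obtain tM where tM: "tM \<in> ?I" "\<And>t. t \<in> ?I \<Longrightarrow> q t \<le> q tM"
    using continuous_attains_sup[OF _ _ c] \<rho> by auto
  have pos: "0 < q tm" "0 < q tM" using q_pos sub tm(1) tM(1) by auto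
  define Cw where "Cw = max (2 * q tM) (1 / \<rho>)"
  have Cw: "0 \<le> Cw" using pos by (simp add: Cw_def le_max_iff_disj)
  show ?thesis
  proof (rule that[OF \<rho>(1) pos(1) Cw])
    show "q tm \<le> q t" if "1 \<le> n" "\<bar>\<theta>' - \<theta>\<bar> \<le> \<rho>" "1 / real n \<le> \<rho>" "\<theta>' \<le> t" "t \<le> \<theta>' + 1 / real n" for n \<theta>' t
      using that by (intro tm(2)) (auto simp: abs_le_iff)
    fix n k :: nat and \<theta>' assume n: "1 \<le> n" and \<theta>': "\<bar>\<theta>' - \<theta>\<bar> \<le> \<rho>"
    have n0: "0 < real n" using n by simp
    let ?A = "{u. real k \<le> \<bar>u\<bar> \<and> \<bar>u\<bar> < real k + 1}"
    note [measurable] = wn_measurable[of n \<theta>']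
    show "(\<integral>\<^sup>+u. ennreal (wn n \<theta>' u) * indicator ?A u \<partial>lborel) \<le> ennreal (Cw * (1 + real k))"
    proof (cases "(real k + 1) / real n \<le> \<rho>")
      case True
      have "(\<integral>\<^sup>+u. ennreal (wn n \<theta>' u) * indicator ?A u \<partial>lborel) \<le> (\<integral>\<^sup>+u. ennreal (q tM) * indicator ?A u \<partial>lborel)"
      proof (intro nn_integral_mono)
        fix u
        show "ennreal (wn n \<theta>' u) * indicator ?A u \<le> ennreal (q tM) * indicator ?A u"
        proof (cases "u \<in> ?A")
          case A: True
          have "\<bar>u / real n\<bar> \<le> (real k + 1) / real n"
            unfolding abs_divide using A by (auto intro: divide_right_mono)
          then have "\<bar>u / real n\<bar> \<le> \<rho>" using True by linarith
          then have "\<theta>' + u / real n \<in> ?I" using \<theta>' unfolding atLeastAtMost_iff by linarith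
          then have "wn n \<theta>' u \<le> q tM" using tM(2) pos by (auto simp: wn_def indicator_def)
          then show ?thesis using A by (simp add: ennreal_leI)
        qed simp
      qed
      also have "\<dots> = ennreal (q tM) * emeasure lborel ?A" by (rule nn_integral_cmult_indicator) simp
      also have "\<dots> \<le> ennreal (q tM) * ennreal 2" by (intro mult_left_mono emeasure_abs_cell_le) simp
      also have "\<dots> = ennreal (2 * q tM)" using pos by (simp add: ennreal_mult mult.commute)
      also have "\<dots> \<le> ennreal (Cw * (1 + real k))"
      proof (rule ennreal_leI)
        have "2 * q tM * 1 \<le> Cw * (1 + real k)" using Cw pos by (intro mult_mono) (auto simp: Cw_def)
        then show "2 * q tM \<le> Cw * (1 + real k)" by simp
      qed
      finally show ?thesis .
    next
      case False
      let ?f = "\<lambda>t. ennreal (indicator {\<alpha><..<\<beta>} t * q t)"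
      have "ennreal 1 = (\<integral>\<^sup>+t. ?f t \<partial>lborel)"
        using q_int q_one q_pos unfolding set_integrable_def set_lebesgue_integral_def
        by (subst nn_integral_eq_integral) (auto intro!: AE_I2 simp: indicator_def less_imp_le)
      also have "\<dots> = ennreal \<bar>1 / real n\<bar> * (\<integral>\<^sup>+u. ?f (\<theta>' + 1 / real n * u) \<partial>lborel)"
        using q_measurable n by (intro nn_integral_real_affine) auto
      also have "(\<integral>\<^sup>+u. ?f (\<theta>' + 1 / real n * u) \<partial>lborel) = (\<integral>\<^sup>+u. ennreal (wn n \<theta>' u) \<partial>lborel)"
        by (simp add: wn_def)
      finally have "ennreal (real n) * ennreal 1 = ennreal (real n) * (ennreal \<bar>1 / real n\<bar> * (\<integral>\<^sup>+u. ennreal (wn n \<theta>' u) \<partial>lborel))"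
        by (rule arg_cong)
      also have "\<dots> = (\<integral>\<^sup>+u. ennreal (wn n \<theta>' u) \<partial>lborel)"
        using n0 by (simp add: mult.assoc[symmetric] ennreal_mult[symmetric])
      finally have tot: "(\<integral>\<^sup>+u. ennreal (wn n \<theta>' u) \<partial>lborel) = ennreal (real n)" by simp
      have "(\<integral>\<^sup>+u. ennreal (wn n \<theta>' u) * indicator ?A u \<partial>lborel) \<le> (\<integral>\<^sup>+u. ennreal (wn n \<theta>' u) \<partial>lborel)"
        by (intro nn_integral_mono) (auto simp: indicator_def)
      also have "\<dots> \<le> ennreal (Cw * (1 + real k))"
        unfolding tot
      proof (rule ennreal_leI)
        have "\<rho> * real n < real k + 1" using False n0 by (simp add: not_le pos_less_divide_eq)
        then have "real n \<le> (1 / \<rho>) * (1 + real k)" using \<rho>(1) by (simp add: field_simps)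
        also have "\<dots> \<le> Cw * (1 + real k)" by (intro mult_right_mono) (auto simp: Cw_def)
        finally show "real n \<le> Cw * (1 + real k)" .
      qed
      finally show ?thesis .
    qed
  qed
qed

lemma eventually_small_enough:
  assumes \<theta>: "\<theta> \<in> {\<alpha><..<\<beta>}" and \<theta>s: "\<And>n. \<theta>s n \<in> {\<alpha><..<\<beta>}" "\<theta>s \<longlonglongrightarrow> \<theta>"
  shows "\<forall>\<^sub>F n in sequentially. small_enough n (\<theta>s n)"
proof -
  have 2: "(\<lambda>n. 2 / real n) \<longlonglongrightarrow> 0" by (rule lim_const_over_n)
  have "(\<lambda>n. \<theta>s n + 1 / real n) \<longlonglongrightarrow> \<theta> + 0" by (intro tendsto_intros \<theta>s(2) lim_1_over_n)
  then have "\<forall>\<^sub>F n in sequentially. \<theta>s n + 1 / real n < \<beta>" using \<theta> by (intro order_tendstoD(2)) auto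
  moreover have "\<forall>\<^sub>F n in sequentially. 2 / real n < \<alpha>" using \<alpha>\<beta> by (intro order_tendstoD(2)[OF 2]) auto
  moreover have "\<forall>\<^sub>F n in sequentially. 2 / real n < \<tau> - \<beta>" using \<alpha>\<beta> by (intro order_tendstoD(2)[OF 2]) auto
  moreover have "\<forall>\<^sub>F n in sequentially. \<delta> n < \<tau> - \<beta>" using \<alpha>\<beta> by (intro order_tendstoD(2)[OF \<delta>_lim]) auto
  moreover have "\<forall>\<^sub>F n in sequentially. real n * \<delta> n < 1" by (intro order_tendstoD(2)[OF n\<delta>_lim]) auto
  moreover have "\<forall>\<^sub>F n in sequentially. 1 \<le> n" by (rule eventually_ge_at_top)
  ultimately show ?thesis
    unfolding small_enough_def by eventually_elim (use \<theta>s(1) in auto)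
qed

text \<open>
  The constants \<open>Cw\<close> and \<open>cw\<close> come from a neighbourhood of \<open>\<theta>\<close> that eventually contains all \<open>\<theta>s n\<close>, hence
  serve all large \<open>n\<close>.
\<close>

lemma eventually_local_likelihood:
  assumes \<theta>: "\<theta> \<in> {\<alpha><..<\<beta>}" and \<theta>s: "\<And>n. \<theta>s n \<in> {\<alpha><..<\<beta>}" "\<theta>s \<longlonglongrightarrow> \<theta>"
  obtains Cw cw where "\<forall>\<^sub>F n in sequentially. small_enough n (\<theta>s n) \<and>
     local_likelihood (P n (\<theta>s n)) (Zn n (\<theta>s n)) (Yn n (\<theta>s n)) (wn n (\<theta>s n)) (Dn n (\<theta>s n)) (real n * \<delta> n) Kn hi hellinger_rate Cw cw"
proof -
  obtain \<rho> cw Cw where c: "0 < \<rho>" "0 < cw" "0 \<le> Cw"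
    and low: "\<And>n \<theta>' t. 1 \<le> n \<Longrightarrow> \<bar>\<theta>' - \<theta>\<bar> \<le> \<rho> \<Longrightarrow> 1 / real n \<le> \<rho> \<Longrightarrow> \<theta>' \<le> t \<Longrightarrow> t \<le> \<theta>' + 1 / real n \<Longrightarrow> cw \<le> q t"
    and cell: "\<And>n \<theta>' k. 1 \<le> n \<Longrightarrow> \<bar>\<theta>' - \<theta>\<bar> \<le> \<rho> \<Longrightarrow>
       (\<integral>\<^sup>+u. ennreal (wn n \<theta>' u) * indicator {u. real k \<le> \<bar>u\<bar> \<and> \<bar>u\<bar> < real k + 1} u \<partial>lborel) \<le> ennreal (Cw * (1 + real k))"
    by (rule prior_bounds[OF \<theta>]) (rule that)
  have "\<forall>\<^sub>F n in sequentially. 1 / real n < \<rho>" using c by (intro order_tendstoD(2)[OF lim_1_over_n]) auto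
  moreover have "\<forall>\<^sub>F n in sequentially. \<bar>\<theta>s n - \<theta>\<bar> < \<rho>"
    using tendstoD[OF \<theta>s(2) c(1)] by (simp add: dist_real_def)
  ultimately have "\<forall>\<^sub>F n in sequentially. small_enough n (\<theta>s n) \<and>
     local_likelihood (P n (\<theta>s n)) (Zn n (\<theta>s n)) (Yn n (\<theta>s n)) (wn n (\<theta>s n)) (Dn n (\<theta>s n)) (real n * \<delta> n) Kn hi hellinger_rate Cw cw"
    using eventually_small_enough[OF \<theta> \<theta>s]
  proof eventually_elim
    case (elim n)
    then have n: "1 \<le> n" by (simp add: small_enough_def)
    show ?case
      by (intro conjI elim(3) local_likelihood_Zn c(2,3) low[OF n, of "\<theta>s n"] cell[OF n, of "\<theta>s n"]) (use elim in auto)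
  qed
  then show ?thesis by (rule that)
qed

text \<open>
  The substitution \<open>t = \<theta> + u / n\<close> in numerator and denominator of the estimator; the common factor
  \<open>exp (L n \<omega> \<theta>)\<close> cancels.
\<close>

lemma scaled_error_eq_post:
  assumes s: "small_enough n \<theta>"
    and ll: "local_likelihood (P n \<theta>) (Zn n \<theta>) (Yn n \<theta>) (wn n \<theta>) (Dn n \<theta>) (real n * \<delta> n) Kn hi hellinger_rate Cw cw"
  shows "AE \<omega> in P n \<theta>. local_likelihood.post (Zn n \<theta>) (wn n \<theta>) \<omega> = real n * (est n \<omega> - \<theta>)"
proof -
  interpret l: local_likelihood "P n \<theta>" "Zn n \<theta>" "Yn n \<theta>" "wn n \<theta>" "Dn n \<theta>" "real n * \<delta> n" Kn hi hellinger_rate Cw cw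
    by (rule ll)
  have n: "1 \<le> n" "0 < real n" and \<theta>: "\<theta> \<in> {\<alpha><..<\<beta>}" using s by (auto simp: small_enough_def)
  show ?thesis
    using l.AE_tail_weight_finite[of 0] l.AE_tail_weight_finite[of 1] AE_space
  proof eventually_elim
    case (elim \<omega>)
    note \<omega> = elim(3)
    let ?f = "\<lambda>u. wn n \<theta> u * Zn n \<theta> u \<omega>"
    note i0 = l.posterior_integrable[OF \<omega> elim(1,1), simplified]
    note i1 = l.posterior_integrable[OF \<omega> elim(1,2), simplified]
    have [measurable]: "(\<lambda>u. Zn n \<theta> u \<omega>) \<in> borel_measurable borel" by (rule l.Z_measurable_u[OF \<omega>])
    have [measurable]: "wn n \<theta> \<in> borel_measurable borel" by (rule wn_measurable)
    have iu: "integrable lborel (\<lambda>u. u * ?f u)"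
      by (rule Bochner_Integration.integrable_bound[OF i1(1)]) (auto simp: abs_mult)
    define D N where "D = (LBINT u. ?f u)" and "N = (LBINT u. u * ?f u)"
    have D0: "0 < D" using i0(4) by (simp add: D_def)
    have prior_Z: "(indicator {\<alpha><..<\<beta>} (\<theta> + 1 / real n * u) * q (\<theta> + 1 / real n * u)) * exp (L n \<omega> (\<theta> + 1 / real n * u))
        = exp (L n \<omega> \<theta>) * ?f u" for u
      by (simp add: wn_def Zn_def exp_diff)
    have den: "(LBINT t. (indicator {\<alpha><..<\<beta>} t * q t) * exp (L n \<omega> t)) = (1 / real n) * (exp (L n \<omega> \<theta>) * D)"
      using n by (subst lborel_integral_real_affine[of "1 / real n" _ \<theta>]) (auto simp only: prior_Z D_def, simp_all)
    have num: "(LBINT t. t * ((indicator {\<alpha><..<\<beta>} t * q t) * exp (L n \<omega> t))) = (1 / real n) * (exp (L n \<omega> \<theta>) * (\<theta> * D + N / real n))"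
    proof -
      have "(LBINT t. t * ((indicator {\<alpha><..<\<beta>} t * q t) * exp (L n \<omega> t)))
        = \<bar>1 / real n\<bar> *\<^sub>R (LBINT u. (\<theta> + 1 / real n * u) * (exp (L n \<omega> \<theta>) * ?f u))"
        using n by (subst lborel_integral_real_affine[of "1 / real n" _ \<theta>]) (simp_all only: prior_Z, simp)
      also have "(LBINT u. (\<theta> + 1 / real n * u) * (exp (L n \<omega> \<theta>) * ?f u))
        = (LBINT u. exp (L n \<omega> \<theta>) * (\<theta> * ?f u + (1 / real n) * (u * ?f u)))"
        by (intro Bochner_Integration.integral_cong refl) (simp add: algebra_simps)
      also have "\<dots> = exp (L n \<omega> \<theta>) * (\<theta> * D + (1 / real n) * N)"
        using i0(1) iu by (simp add: D_def N_def)
      finally show ?thesis using n by simp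
    qed
    have "est n \<omega> = (\<theta> * D + N / real n) / D"
      unfolding est_eq[OF n(1) \<theta> \<omega>] num den using n by simp
    then have "real n * (est n \<omega> - \<theta>) = N / D" using n D0 by (simp add: field_simps)
    then show ?case unfolding l.post_def D_def N_def by simp
  qed
qed

text \<open>
  Over local distances the prior density and the log-jump are almost constant by continuity, and the
  ramps shrink.
\<close>

lemma eventually_local_grid:
  assumes \<theta>: "\<theta> \<in> {\<alpha><..<\<beta>}" and \<theta>s: "\<And>n. \<theta>s n \<in> {\<alpha><..<\<beta>}" "\<theta>s \<longlonglongrightarrow> \<theta>"
    and ll: "\<forall>\<^sub>F n in sequentially. small_enough n (\<theta>s n) \<and>
     local_likelihood (P n (\<theta>s n)) (Zn n (\<theta>s n)) (Yn n (\<theta>s n)) (wn n (\<theta>s n)) (Dn n (\<theta>s n)) (real n * \<delta> n) Kn hi hellinger_rate Cw cw"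
    and R: "1 \<le> R" and \<eta>: "0 < \<eta>" "\<eta> \<le> 1"
  shows "\<forall>\<^sub>F n in sequentially. local_grid (P n (\<theta>s n)) (Zn n (\<theta>s n)) (Yn n (\<theta>s n)) (wn n (\<theta>s n)) (Dn n (\<theta>s n)) (real n * \<delta> n) Kn hi hellinger_rate Cw cw
     (log_jump \<theta>) r (q \<theta>) \<eta> R"
proof -
  have q0: "0 < q \<theta>" by (rule q_pos[OF \<theta>])
  have op: "open {\<alpha><..<\<beta>}" by simp
  have "continuous_on {\<alpha><..<\<beta>} (\<lambda>t. ln (q t / q \<theta>))"
    using q_pos q0 by (intro continuous_intros q_cont) force+
  then have "isCont (\<lambda>t. ln (q t / q \<theta>)) \<theta>"
    using op \<theta> continuous_on_eq_continuous_at by blast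
  then have "((\<lambda>t. ln (q t / q \<theta>)) \<longlongrightarrow> ln (q \<theta> / q \<theta>)) (at \<theta>)"
    unfolding isCont_def .
  then have "\<forall>\<^sub>F t in at \<theta>. \<bar>ln (q t / q \<theta>)\<bar> < \<eta>" using \<eta>(1) q0 by (auto simp: tendsto_iff dist_real_def)
  then obtain d1 where d1: "0 < d1" "\<And>t. t \<noteq> \<theta> \<Longrightarrow> dist t \<theta> < d1 \<Longrightarrow> \<bar>ln (q t / q \<theta>)\<bar> < \<eta>"
    unfolding eventually_at by auto
  have d1': "\<bar>ln (q t / q \<theta>)\<bar> \<le> \<eta>" if "\<bar>t - \<theta>\<bar> < d1" for t
    using d1(2)[of t] that \<eta> q0 by (cases "t = \<theta>") (auto simp: dist_real_def less_imp_le)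
  have sub: "{\<alpha><..<\<beta>} \<subseteq> {0..\<tau>}" using \<alpha>\<beta> by auto
  have "continuous_on {\<alpha><..<\<beta>} log_jump"
    unfolding log_jump_def[abs_def]
    using \<psi>_bounds lo_pos sub by (intro continuous_intros continuous_on_subset[OF cont_\<psi> sub]) force+
  then have "isCont log_jump \<theta>" using op \<theta> continuous_on_eq_continuous_at by blast
  then have "(log_jump \<longlongrightarrow> log_jump \<theta>) (at \<theta>)" unfolding isCont_def .
  then have "\<forall>\<^sub>F t in at \<theta>. \<bar>log_jump t - log_jump \<theta>\<bar> < \<eta>" using \<eta>(1) by (auto simp: tendsto_iff dist_real_def)
  then obtain d2 where d2: "0 < d2" "\<And>t. t \<noteq> \<theta> \<Longrightarrow> dist t \<theta> < d2 \<Longrightarrow> \<bar>log_jump t - log_jump \<theta>\<bar> < \<eta>"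
    unfolding eventually_at by auto
  have d2': "\<bar>log_jump t - log_jump \<theta>\<bar> \<le> \<eta>" if "\<bar>t - \<theta>\<bar> < d2" for t
    using d2(2)[of t] that \<eta> by (cases "t = \<theta>") (auto simp: dist_real_def less_imp_le)
  define d where "d = Min {d1, d2, \<theta> - \<alpha>, \<beta> - \<theta>}"
  have d: "0 < d" "d \<le> d1" "d \<le> d2" "d \<le> \<theta> - \<alpha>" "d \<le> \<beta> - \<theta>" using d1 d2 \<theta> by (auto simp: d_def)
  have lim: "(\<lambda>n. \<bar>\<theta>s n - \<theta>\<bar> + real R / real n) \<longlonglongrightarrow> \<bar>\<theta> - \<theta>\<bar> + 0"
    by (intro tendsto_intros \<theta>s(2) lim_const_over_n)
  have lim2: "(\<lambda>n. 2 * \<bar>r\<bar> * (real n * \<delta> n)) \<longlonglongrightarrow> 2 * \<bar>r\<bar> * 0" by (intro tendsto_intros n\<delta>_lim)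
  have "\<forall>\<^sub>F n in sequentially. \<bar>\<theta>s n - \<theta>\<bar> + real R / real n < d" using d by (intro order_tendstoD(2)[OF lim]) auto
  moreover have "\<forall>\<^sub>F n in sequentially. 2 * \<bar>r\<bar> * (real n * \<delta> n) < \<eta>" using \<eta> by (intro order_tendstoD(2)[OF lim2]) auto
  ultimately show ?thesis using ll
  proof eventually_elim
    case (elim n)
    have s: "small_enough n (\<theta>s n)" and n: "1 \<le> n" "0 < real n" and dn: "0 \<le> real n * \<delta> n" "real n * \<delta> n \<le> 1"
      using elim \<delta>_pos[of n] by (auto simp: small_enough_def)
    have close: "\<bar>\<theta>s n + u / real n - \<theta>\<bar> < d" if "\<bar>u\<bar> \<le> real R" for u
    proof -
      have "\<bar>u / real n\<bar> \<le> real R / real n" unfolding abs_divide using that by (auto intro: divide_right_mono)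
      then show ?thesis using elim(1) by linarith
    qed
    have inD: "u \<in> Dn n (\<theta>s n)" if "\<bar>u\<bar> \<le> real R" for u
      using close[OF that] d unfolding Dn_def by auto
    interpret l: local_likelihood "P n (\<theta>s n)" "Zn n (\<theta>s n)" "Yn n (\<theta>s n)" "wn n (\<theta>s n)" "Dn n (\<theta>s n)" "real n * \<delta> n" Kn hi hellinger_rate Cw cw
      using elim(3) by simp
    show ?case
    proof unfold_locales
      show "1 \<le> R" by (rule R)
      show "{- real R..real R} \<subseteq> Dn n (\<theta>s n)" using inD by auto
      show "0 < q \<theta>" by (rule q0)
      show "0 \<le> \<eta>" "\<eta> \<le> 1" using \<eta> by auto
      show "Yn n (\<theta>s n) 0 \<omega> = 0" for \<omega> by (simp add: Yn_def)
      show "0 < wn n (\<theta>s n) u \<and> \<bar>ln (wn n (\<theta>s n) u / q \<theta>)\<bar> \<le> \<eta>" if "\<bar>u\<bar> < real R" for u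
      proof -
        have "wn n (\<theta>s n) u = q (\<theta>s n + u / real n)" "\<theta>s n + u / real n \<in> {\<alpha><..<\<beta>}"
          using inD[of u] that by (auto simp: wn_def Dn_def)
        then show ?thesis using q_pos d1'[of "\<theta>s n + u / real n"] close[of u] that d by auto
      qed
      show "Yn n (\<theta>s n) u \<in> borel_measurable (P n (\<theta>s n))" if "near (Dn n (\<theta>s n)) u" for u
        by (rule Yn_measurable[OF n(1) \<theta>s(1)]) (use near_Dn[OF s that] in auto)
      fix u \<omega> assume \<omega>: "\<omega> \<in> space (P n (\<theta>s n))" and u: "\<bar>u\<bar> < real R"
      let ?Y = "Yn n (\<theta>s n)" and ?e = "real n * \<delta> n"
      have Z0: "ln (Zn n (\<theta>s n) 0 \<omega>) = 0" and Y0: "?Y 0 \<omega> = 0" by (auto simp: Zn_def Yn_def)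
      have nr: "near (Dn n (\<theta>s n)) x" if "\<bar>x\<bar> \<le> real R + 1" for x
        unfolding near_def using inD[of "max (- real R) (min (real R) x)"] that
        by (intro bexI[of _ "max (- real R) (min (real R) x)"]) (auto simp: max_def min_def)
      have m: "?Y x \<omega> \<le> ?Y y \<omega>" if "\<bar>x\<bar> \<le> real R + 1" "\<bar>y\<bar> \<le> real R + 1" "x \<le> y" for x y
        by (rule Yn_mono[OF s \<omega> nr nr]) (use that in auto)
      have "\<bar>ln (Zn n (\<theta>s n) u \<omega>) - ln (Zn n (\<theta>s n) 0 \<omega>) + log_jump \<theta> * (?Y u \<omega> - ?Y 0 \<omega>) - r * (u - 0)\<bar>
         \<le> \<eta> * (?Y (max u 0) \<omega> - ?Y (min u 0) \<omega>)
           + log_range * (?Y (u + ?e) \<omega> - ?Y u \<omega>) + log_range * (?Y (0 + ?e) \<omega> - ?Y 0 \<omega>) + 2 * \<bar>r\<bar> * ?e"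
      proof (rule Zn_log_diff[OF s \<omega>])
        show "u \<in> Dn n (\<theta>s n)" "0 \<in> Dn n (\<theta>s n)" using inD u by auto
        show "0 \<le> \<eta>" using \<eta> by simp
        fix t assume t: "\<theta>s n + min u 0 / real n < t" "t \<le> \<theta>s n + max u 0 / real n"
        have "\<bar>min u 0\<bar> \<le> real R" "\<bar>max u 0\<bar> \<le> real R" using u by auto
        from close[OF this(1)] close[OF this(2)] have "\<bar>t - \<theta>\<bar> < d" using t by linarith
        then show "\<bar>log_jump t - log_jump \<theta>\<bar> \<le> \<eta>" using d2'[of t] d by auto
      qed
      also have "?Y (max u 0) \<omega> - ?Y (min u 0) \<omega> = \<bar>?Y u \<omega>\<bar>"
        using m[of u 0] m[of 0 u] u Y0 by (cases "0 \<le> u") (auto simp: max_def min_def)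
      finally have "\<bar>ln (Zn n (\<theta>s n) u \<omega>) + log_jump \<theta> * ?Y u \<omega> - r * u\<bar>
         \<le> \<eta> * \<bar>?Y u \<omega>\<bar> + log_range * (?Y (u + ?e) \<omega> - ?Y u \<omega>) + log_range * (?Y ?e \<omega> - ?Y 0 \<omega>) + 2 * \<bar>r\<bar> * ?e"
        by (simp add: Z0 Y0)
      also have "\<dots> \<le> \<eta> * \<bar>?Y u \<omega>\<bar> + Kn * (?Y (u + ?e) \<omega> - ?Y u \<omega>) + Kn * (?Y ?e \<omega> - ?Y 0 \<omega>) + \<eta>"
      proof -
        have "log_range \<le> Kn" using log_range_nonneg by (simp add: Kn_def)
        moreover have "0 \<le> ?Y (u + ?e) \<omega> - ?Y u \<omega>" "0 \<le> ?Y ?e \<omega> - ?Y 0 \<omega>"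
          using m[of u "u + ?e"] m[of 0 ?e] u dn by auto
        ultimately show ?thesis using elim(2) by (intro add_mono mult_right_mono) auto
      qed
      finally show "\<bar>ln (Zn n (\<theta>s n) u \<omega>) + log_jump \<theta> * ?Y u \<omega> - r * u\<bar>
         \<le> \<eta> * \<bar>?Y u \<omega>\<bar> + Kn * (?Y (u + ?e) \<omega> - ?Y u \<omega>) + Kn * (?Y ?e \<omega> - ?Y 0 \<omega>) + \<eta>" .
    qed
  qed
qed

lemma scaled_error_measurable:
  "small_enough n \<theta> \<Longrightarrow> (\<lambda>\<omega>. real n * (est n \<omega> - \<theta>)) \<in> borel_measurable (P n \<theta>)"
  using est_measurable[of n \<theta>] by (auto simp: small_enough_def)

text \<open>
  The counterpart of \<open>limit_approx\<close>. The thresholds for \<open>R\<close> and \<open>m\<close> precede the choice of \<open>n\<close>.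
\<close>

lemma prelimit_approx:
  assumes \<theta>: "\<theta> \<in> {\<alpha><..<\<beta>}" and \<theta>s: "\<And>n. \<theta>s n \<in> {\<alpha><..<\<beta>}" "\<theta>s \<longlonglongrightarrow> \<theta>" and e: "0 < e"
  shows "\<exists>R0. \<forall>R\<ge>R0. \<exists>m0. \<forall>m\<ge>m0. \<forall>\<^sub>F n in sequentially. mean_close (P n (\<theta>s n)) (\<lambda>\<omega>. real n * (est n \<omega> - \<theta>s n))
       (\<lambda>\<omega>. grid_mean (log_jump \<theta>) r R m (\<lambda>i. Yn n (\<theta>s n) (real_of_int i / real m) \<omega>)) e"
proof -
  obtain Cw cw where ll: "\<forall>\<^sub>F n in sequentially. small_enough n (\<theta>s n) \<and>
     local_likelihood (P n (\<theta>s n)) (Zn n (\<theta>s n)) (Yn n (\<theta>s n)) (wn n (\<theta>s n)) (Dn n (\<theta>s n)) (real n * \<delta> n) Kn hi hellinger_rate Cw cw"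
    using eventually_local_likelihood[OF \<theta> \<theta>s] by blast
  let ?T = "local_likelihood.tail_sum Kn hi hellinger_rate Cw cw"
  have T: "(\<lambda>R. ?T 1 R) \<longlonglongrightarrow> 0"
  proof -
    obtain n where "local_likelihood (P n (\<theta>s n)) (Zn n (\<theta>s n)) (Yn n (\<theta>s n)) (wn n (\<theta>s n)) (Dn n (\<theta>s n)) (real n * \<delta> n) Kn hi hellinger_rate Cw cw"
      using ll unfolding eventually_sequentially by blast
    then show ?thesis by (rule local_likelihood.tail_sum_tendsto)
  qed
  have "\<forall>\<^sub>F R in sequentially. ?T 1 R < e / 4" using e by (intro order_tendstoD(2)[OF T]) auto
  then obtain R0 where R0: "\<And>R. R0 \<le> R \<Longrightarrow> ?T 1 R < e / 4" unfolding eventually_sequentially by blast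
  show ?thesis
  proof (rule exI[of _ "max R0 1"], intro allI impI)
    fix R assume R: "max R0 1 \<le> R"
    let ?C = "grid_const Kn hi (log_jump \<theta>) r R"
    \<comment> \<open>small enough for an error of \<open>e / 2\<close> after multiplication of its square root with \<open>?C\<close>\<close>
    define s where "s = (e / (2 * (\<bar>?C\<bar> + 1)))\<^sup>2"
    have s: "0 < s" using e by (simp add: s_def add_nonneg_pos)
    have sC: "?C * sqrt x \<le> e / 2" if "0 \<le> x" "x \<le> s" for x
    proof -
      have "?C * sqrt x \<le> (\<bar>?C\<bar> + 1) * sqrt s" using that s by (intro mult_mono) auto
      also have "sqrt s = e / (2 * (\<bar>?C\<bar> + 1))"
        unfolding s_def using e by (intro real_sqrt_unique refl divide_nonneg_nonneg) auto
      also have "(\<bar>?C\<bar> + 1) * (e / (2 * (\<bar>?C\<bar> + 1))) = e / 2"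
      proof -
        have "x * (e / (2 * x)) = e / 2" if "0 < x" for x :: real using that by simp
        moreover have "0 < \<bar>?C\<bar> + 1" by linarith
        ultimately show ?thesis by blast
      qed
      finally show ?thesis .
    qed
    define \<eta> where "\<eta> = min 1 (s / 3)"
    have \<eta>: "0 < \<eta>" "\<eta> \<le> 1" "\<eta> \<le> s / 3" using s by (auto simp: \<eta>_def)
    have "\<forall>\<^sub>F m in sequentially. 1 / real m < s / 3" using s by (intro order_tendstoD(2)[OF lim_1_over_n]) auto
    then obtain m0 where m0: "\<And>m. m0 \<le> m \<Longrightarrow> 1 / real m < s / 3" unfolding eventually_sequentially by blast
    have ev_e: "\<forall>\<^sub>F n in sequentially. real n * \<delta> n < s / 3" using s by (intro order_tendstoD(2)[OF n\<delta>_lim]) auto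
    show "\<exists>m0. \<forall>m\<ge>m0. \<forall>\<^sub>F n in sequentially. mean_close (P n (\<theta>s n)) (\<lambda>\<omega>. real n * (est n \<omega> - \<theta>s n))
       (\<lambda>\<omega>. grid_mean (log_jump \<theta>) r R m (\<lambda>i. Yn n (\<theta>s n) (real_of_int i / real m) \<omega>)) e"
    proof (rule exI[of _ "max m0 1"], intro allI impI)
      fix m assume m: "max m0 1 \<le> m"
      have R1: "1 \<le> R" using R by simp
      show "\<forall>\<^sub>F n in sequentially. mean_close (P n (\<theta>s n)) (\<lambda>\<omega>. real n * (est n \<omega> - \<theta>s n))
       (\<lambda>\<omega>. grid_mean (log_jump \<theta>) r R m (\<lambda>i. Yn n (\<theta>s n) (real_of_int i / real m) \<omega>)) e"
        using eventually_local_grid[OF \<theta> \<theta>s ll R1 \<eta>(1,2)] ll ev_e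
      proof eventually_elim
        case (elim n)
        interpret g: local_grid "P n (\<theta>s n)" "Zn n (\<theta>s n)" "Yn n (\<theta>s n)" "wn n (\<theta>s n)" "Dn n (\<theta>s n)" "real n * \<delta> n" Kn hi hellinger_rate Cw cw
          "log_jump \<theta>" r "q \<theta>" \<eta> R by (rule elim(1))
        let ?G = "\<lambda>\<omega>. grid_mean (log_jump \<theta>) r R m (\<lambda>i. Yn n (\<theta>s n) (real_of_int i / real m) \<omega>)"
        have sm: "small_enough n (\<theta>s n)" using elim(2) by simp
        have "1 \<le> m" using m by simp
        note 1 = g.mean_le_post_grid[OF this]
        have b: "2 * ?T 1 R + ?C * sqrt (\<eta> + 1 / real m + real n * \<delta> n) \<le> e"
          using R0[of R] R sC[of "\<eta> + 1 / real m + real n * \<delta> n"] \<eta> m0[of m] m elim(3) g.eps by auto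
        note 2 = mean_le_mono[OF 1 mean_leD(1)[OF 1] order_refl b]
        have Gm: "?G \<in> borel_measurable (P n (\<theta>s n))"
          by (intro grid_mean_measurable g.Y_meas g.near_grid \<open>1 \<le> m\<close>)
        show ?case
          unfolding mean_close_def
        proof (intro conjI scaled_error_measurable[OF sm] Gm mean_le_cong_AE[OF 2])
          show "AE \<omega> in P n (\<theta>s n). \<bar>g.post \<omega> - ?G \<omega>\<bar> = \<bar>real n * (est n \<omega> - \<theta>s n) - ?G \<omega>\<bar>"
            using scaled_error_eq_post[OF sm conjunct2[OF elim(2)]] by eventually_elim simp
          show "(\<lambda>\<omega>. \<bar>real n * (est n \<omega> - \<theta>s n) - ?G \<omega>\<bar>) \<in> borel_measurable (P n (\<theta>s n))"
            by (intro borel_measurable_abs borel_measurable_diff scaled_error_measurable[OF sm] Gm)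
        qed
      qed
    qed
  qed
qed

lemma eventually_moment_bound:
  assumes \<theta>: "\<theta> \<in> {\<alpha><..<\<beta>}" and \<theta>s: "\<And>n. \<theta>s n \<in> {\<alpha><..<\<beta>}" "\<theta>s \<longlonglongrightarrow> \<theta>"
  shows "\<exists>C. \<forall>\<^sub>F n in sequentially. mean_le (P n (\<theta>s n)) (\<lambda>\<omega>. \<bar>real n * (est n \<omega> - \<theta>s n)\<bar> ^ k) C"
proof -
  obtain Cw cw where ll: "\<forall>\<^sub>F n in sequentially. small_enough n (\<theta>s n) \<and>
     local_likelihood (P n (\<theta>s n)) (Zn n (\<theta>s n)) (Yn n (\<theta>s n)) (wn n (\<theta>s n)) (Dn n (\<theta>s n)) (real n * \<delta> n) Kn hi hellinger_rate Cw cw"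
    using eventually_local_likelihood[OF \<theta> \<theta>s] by blast
  have "\<forall>\<^sub>F n in sequentially. mean_le (P n (\<theta>s n)) (\<lambda>\<omega>. \<bar>real n * (est n \<omega> - \<theta>s n)\<bar> ^ k)
      (local_likelihood.tail_sum Kn hi hellinger_rate Cw cw k 0)"
    using ll
  proof eventually_elim
    case (elim n)
    note h = elim
    interpret l: local_likelihood "P n (\<theta>s n)" "Zn n (\<theta>s n)" "Yn n (\<theta>s n)" "wn n (\<theta>s n)" "Dn n (\<theta>s n)" "real n * \<delta> n" Kn hi hellinger_rate Cw cw
      using h by simp
    show ?case
    proof (rule mean_le_cong_AE[OF l.mean_le_post_power])
      show "AE \<omega> in P n (\<theta>s n). \<bar>l.post \<omega>\<bar> ^ k = \<bar>real n * (est n \<omega> - \<theta>s n)\<bar> ^ k"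
        using scaled_error_eq_post[OF conjunct1[OF h] conjunct2[OF h]] by eventually_elim simp
      show "(\<lambda>\<omega>. \<bar>real n * (est n \<omega> - \<theta>s n)\<bar> ^ k) \<in> borel_measurable (P n (\<theta>s n))"
        by (intro borel_measurable_power borel_measurable_abs scaled_error_measurable conjunct1[OF h])
    qed
  qed
  then show ?thesis by blast
qed

end

section \<open>Weak convergence and convergence of moments\<close>

lemma LIMSEQ_by_approximation:
  fixes a :: "nat \<Rightarrow> real"
  assumes "\<And>e. 0 < e \<Longrightarrow> \<exists>b w. (\<forall>\<^sub>F n in sequentially. \<bar>a n - b n\<bar> \<le> e) \<and> \<bar>w - z\<bar> \<le> e \<and> b \<longlonglongrightarrow> w"
  shows "a \<longlonglongrightarrow> z"
proof (rule tendstoI)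
  fix e :: real assume e: "0 < e"
  then obtain b w where b: "\<forall>\<^sub>F n in sequentially. \<bar>a n - b n\<bar> \<le> e / 4" "\<bar>w - z\<bar> \<le> e / 4" "b \<longlonglongrightarrow> w"
    using assms[of "e / 4"] by auto
  have "\<forall>\<^sub>F n in sequentially. dist (b n) w < e / 4" using b(3) e by (intro tendstoD) auto
  with b(1) show "\<forall>\<^sub>F n in sequentially. dist (a n) z < e"
  proof eventually_elim
    case (elim n)
    then show ?case unfolding dist_real_def using b(2) e by linarith
  qed
qed

text \<open>
  Closeness in mean passes to expectations of bounded Lipschitz functions, which suffice to test
  convergence in law.
\<close>

lemma (in prob_space) lipschitz_expectation_close:
  assumes c: "mean_close M A B e" and f: "\<And>x y. \<bar>f x - f y\<bar> \<le> C * \<bar>x - y\<bar>" and bd: "\<And>x. \<bar>f x\<bar> \<le> D"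
    and C: "0 \<le> C" and fm: "f \<in> borel_measurable borel"
  shows "\<bar>expectation (\<lambda>\<omega>. f (A \<omega>)) - expectation (\<lambda>\<omega>. f (B \<omega>))\<bar> \<le> C * e"
proof -
  have [measurable]: "A \<in> borel_measurable M" "B \<in> borel_measurable M" "f \<in> borel_measurable borel"
    and m: "mean_le M (\<lambda>\<omega>. \<bar>A \<omega> - B \<omega>\<bar>) e" using c fm by (auto simp: mean_close_def)
  have iA: "integrable M (\<lambda>\<omega>. f (A \<omega>))" and iB: "integrable M (\<lambda>\<omega>. f (B \<omega>))"
    using bd by (auto intro!: integrable_const_bound[of _ D])
  have e: "0 \<le> e" "(\<integral>\<^sup>+\<omega>. ennreal \<bar>A \<omega> - B \<omega>\<bar> \<partial>M) \<le> ennreal e" using m by (auto simp: mean_le_def)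
  have "ennreal \<bar>expectation (\<lambda>\<omega>. f (A \<omega>) - f (B \<omega>))\<bar> \<le> (\<integral>\<^sup>+\<omega>. ennreal \<bar>f (A \<omega>) - f (B \<omega>)\<bar> \<partial>M)"
    using integral_norm_bound_ennreal[of M "\<lambda>\<omega>. f (A \<omega>) - f (B \<omega>)"] iA iB by simp
  also have "\<dots> \<le> (\<integral>\<^sup>+\<omega>. ennreal C * ennreal \<bar>A \<omega> - B \<omega>\<bar> \<partial>M)"
    by (intro nn_integral_mono) (simp add: ennreal_mult[symmetric] C ennreal_leI f)
  also have "\<dots> = ennreal C * (\<integral>\<^sup>+\<omega>. ennreal \<bar>A \<omega> - B \<omega>\<bar> \<partial>M)" by (rule nn_integral_cmult) measurable
  also have "\<dots> \<le> ennreal C * ennreal e" by (intro mult_left_mono e) simp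
  also have "\<dots> = ennreal (C * e)" using C e by (simp add: ennreal_mult)
  finally have "\<bar>expectation (\<lambda>\<omega>. f (A \<omega>) - f (B \<omega>))\<bar> \<le> C * e"
    using C e(1) by (simp add: ennreal_le_iff)
  then show ?thesis using iA iB by simp
qed

lemma cts_step_lipschitz:
  assumes "a < b"
  shows "\<bar>cts_step a b x - cts_step a b y\<bar> \<le> 1 / (b - a) * \<bar>x - y\<bar>"
proof -
  have c: "cts_step a b x = max 0 (min 1 ((b - x) / (b - a)))" for x
    using assms by (auto simp: cts_step_def max_def min_def field_simps)
  have "\<bar>cts_step a b x - cts_step a b y\<bar> \<le> \<bar>(b - x) / (b - a) - (b - y) / (b - a)\<bar>"
    unfolding c by (auto simp: max_def min_def)
  also have "\<dots> = 1 / (b - a) * \<bar>x - y\<bar>"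
    unfolding diff_divide_distrib[symmetric] abs_divide using assms by (simp add: abs_minus_commute)
  finally show ?thesis .
qed

lemma cts_step_bounded: "\<bar>cts_step a b x\<bar> \<le> 1"
  by (auto simp: cts_step_def divide_le_eq)

lemma cts_step_measurable: "a < b \<Longrightarrow> cts_step a b \<in> borel_measurable borel"
  by (intro borel_measurable_continuous_onI uniformly_continuous_imp_continuous cts_step_uniformly_continuous)

text \<open>
  The portmanteau theorem speaks of sequences of distributions all of whose members are genuine;
  the finitely many exceptional indices are filled in with the limit law.
\<close>

definition law_or :: "('a measure \<Rightarrow> ('a \<Rightarrow> real) \<Rightarrow> bool) \<Rightarrow> real measure \<Rightarrow> 'a measure \<Rightarrow> ('a \<Rightarrow> real) \<Rightarrow> real measure" where
  "law_or good \<nu> M A = (if good M A then distr M borel A else \<nu>)"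

abbreviation random_real :: "'a measure \<Rightarrow> ('a \<Rightarrow> real) \<Rightarrow> bool" where
  "random_real M A \<equiv> prob_space M \<and> A \<in> borel_measurable M"

lemma real_distribution_law_or:
  assumes "random_real N Z"
  shows "real_distribution (law_or random_real (distr N borel Z) M A)"
  using assms by (auto simp: law_or_def intro!: prob_space.real_distribution_distr)

lemma weak_conv_by_cts_steps:
  assumes g: "\<forall>\<^sub>F n in sequentially. random_real (M n) (A n)" and Z: "random_real N Z"
    and lim: "\<And>x y. x < y \<Longrightarrow> (\<lambda>n. \<integral>\<omega>. cts_step x y (A n \<omega>) \<partial>M n) \<longlonglongrightarrow> (\<integral>\<omega>. cts_step x y (Z \<omega>) \<partial>N)"
  shows "weak_conv_m (\<lambda>n. distr (M n) borel (A n)) (distr N borel Z)"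
proof -
  let ?\<mu> = "\<lambda>n. law_or random_real (distr N borel Z) (M n) (A n)"
  have "weak_conv_m ?\<mu> (distr N borel Z)"
  proof (rule integral_cts_step_conv_imp_weak_conv)
    show "real_distribution (?\<mu> n)" for n by (rule real_distribution_law_or[OF Z])
    show "real_distribution (distr N borel Z)" using Z by (auto intro!: prob_space.real_distribution_distr)
    fix x y :: real assume xy: "x < y"
    have "\<forall>\<^sub>F n in sequentially. (\<integral>\<omega>. cts_step x y (A n \<omega>) \<partial>M n) = integral\<^sup>L (?\<mu> n) (cts_step x y)"
      using g
    proof eventually_elim
      case (elim n)
      then show ?case
        unfolding law_or_def using cts_step_measurable[OF xy] by (simp add: integral_distr)
    qed
    moreover have "(\<integral>\<omega>. cts_step x y (Z \<omega>) \<partial>N) = integral\<^sup>L (distr N borel Z) (cts_step x y)"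
      using Z cts_step_measurable[OF xy] by (simp add: integral_distr)
    ultimately show "(\<lambda>n. integral\<^sup>L (?\<mu> n) (cts_step x y)) \<longlonglongrightarrow> integral\<^sup>L (distr N borel Z) (cts_step x y)"
      using Lim_transform_eventually[OF lim[OF xy]] by simp
  qed
  then have w: "(\<lambda>n. cdf (?\<mu> n) x) \<longlonglongrightarrow> cdf (distr N borel Z) x" if "isCont (cdf (distr N borel Z)) x" for x
    using that by (auto simp: weak_conv_m_def weak_conv_def)
  show ?thesis
    unfolding weak_conv_m_def weak_conv_def
  proof (intro allI impI)
    fix x assume "isCont (cdf (distr N borel Z)) x"
    moreover have "\<forall>\<^sub>F n in sequentially. cdf (?\<mu> n) x = cdf (distr (M n) borel (A n)) x"
      using g by eventually_elim (simp add: law_or_def)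
    ultimately show "(\<lambda>n. cdf (distr (M n) borel (A n)) x) \<longlonglongrightarrow> cdf (distr N borel Z) x"
      by (rule Lim_transform_eventually[OF w])
  qed
qed

lemma weak_conv_expectation_tendsto:
  fixes h :: "real \<Rightarrow> real"
  assumes g: "\<forall>\<^sub>F n in sequentially. random_real (M n) (A n)" and Z: "random_real N Z"
    and w: "weak_conv_m (\<lambda>n. distr (M n) borel (A n)) (distr N borel Z)"
    and h: "\<And>x. isCont h x" "\<And>x. \<bar>h x\<bar> \<le> B"
  shows "(\<lambda>n. \<integral>\<omega>. h (A n \<omega>) \<partial>M n) \<longlonglongrightarrow> (\<integral>\<omega>. h (Z \<omega>) \<partial>N)"
proof -
  let ?\<mu> = "\<lambda>n. law_or random_real (distr N borel Z) (M n) (A n)"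
  have hm: "h \<in> borel_measurable borel"
    using h(1) by (intro borel_measurable_continuous_onI continuous_at_imp_continuous_on) auto
  have "weak_conv_m ?\<mu> (distr N borel Z)"
    unfolding weak_conv_m_def weak_conv_def
  proof (intro allI impI)
    fix x assume "isCont (cdf (distr N borel Z)) x"
    then have "(\<lambda>n. cdf (distr (M n) borel (A n)) x) \<longlonglongrightarrow> cdf (distr N borel Z) x"
      using w by (auto simp: weak_conv_m_def weak_conv_def)
    moreover have "\<forall>\<^sub>F n in sequentially. cdf (distr (M n) borel (A n)) x = cdf (?\<mu> n) x"
      using g by eventually_elim (simp add: law_or_def)
    ultimately show "(\<lambda>n. cdf (?\<mu> n) x) \<longlonglongrightarrow> cdf (distr N borel Z) x"
      by (rule Lim_transform_eventually)
  qed
  then have "(\<lambda>n. integral\<^sup>L (?\<mu> n) h) \<longlonglongrightarrow> integral\<^sup>L (distr N borel Z) h"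
    using Z h by (intro weak_conv_imp_integral_bdd_continuous_conv real_distribution_law_or) (auto intro!: prob_space.real_distribution_distr)
  moreover have "\<forall>\<^sub>F n in sequentially. integral\<^sup>L (?\<mu> n) h = (\<integral>\<omega>. h (A n \<omega>) \<partial>M n)"
    using g
  proof eventually_elim
    case (elim n)
    then show ?case unfolding law_or_def using hm by (simp add: integral_distr)
  qed
  moreover have "integral\<^sup>L (distr N borel Z) h = (\<integral>\<omega>. h (Z \<omega>) \<partial>N)" using Z hm by (simp add: integral_distr)
  ultimately show ?thesis using Lim_transform_eventually by fastforce
qed

text \<open>
  Truncating \<open>\<bar>x\<bar> powr p\<close> at height \<open>T\<close> changes its mean by at most the mean of \<open>\<bar>x\<bar> powr (2 * p)\<close> over
  \<open>T\<close>, so a bound on one sufficiently high moment makes the truncation uniformly harmless.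
\<close>

lemma powr_truncation:
  assumes p: "0 < p" and k: "2 * p \<le> real k" and T: "0 < T"
  shows "\<bar>\<bar>x\<bar> powr p - min (\<bar>x\<bar> powr p) T\<bar> \<le> (1 + \<bar>x\<bar> ^ k) / T" and "\<bar>x\<bar> powr p \<le> 1 + \<bar>x\<bar> ^ k"
proof -
  let ?y = "\<bar>x\<bar> powr p"
  have le: "\<bar>x\<bar> powr s \<le> 1 + \<bar>x\<bar> ^ k" if s: "0 < s" "s \<le> real k" for s
  proof (cases "\<bar>x\<bar> \<le> 1")
    case True
    then have "\<bar>x\<bar> powr s \<le> 1" using s by (simp add: powr_le1)
    then show ?thesis using zero_le_power_abs[of x k] by linarith
  next
    case False
    then have "\<bar>x\<bar> powr s \<le> \<bar>x\<bar> powr real k" using s by (intro powr_mono) auto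
    also have "\<dots> = \<bar>x\<bar> ^ k" using False by (simp add: powr_realpow)
    finally show ?thesis by simp
  qed
  show "?y \<le> 1 + \<bar>x\<bar> ^ k" using p k by (intro le) auto
  have "?y * ?y = \<bar>x\<bar> powr (2 * p)" by (simp add: powr_add[symmetric])
  then have sq: "?y * ?y \<le> 1 + \<bar>x\<bar> ^ k" using le[of "2 * p"] p k by simp
  have "\<bar>?y - min ?y T\<bar> * T \<le> ?y * ?y"
  proof (cases "?y \<le> T")
    case False
    then have "(?y - T) * T \<le> ?y * ?y" using T by (intro mult_mono) auto
    then show ?thesis using False by simp
  qed simp
  with sq T show "\<bar>?y - min ?y T\<bar> \<le> (1 + \<bar>x\<bar> ^ k) / T" by (simp add: pos_le_divide_eq)
qed

text \<open>
  For each height \<open>T\<close> the truncated moments converge by convergence in law, and \<open>powr_truncation\<close> makes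
  the truncation error uniformly small. The bounds carry over to the limit by monotone convergence.
\<close>

lemma weak_conv_moments_tendsto:
  assumes g: "\<forall>\<^sub>F n in sequentially. random_real (M n) (A n)" and Z: "random_real N Z"
    and w: "weak_conv_m (\<lambda>n. distr (M n) borel (A n)) (distr N borel Z)"
    and p: "0 < p" and k: "2 * p \<le> real k" and C: "\<forall>\<^sub>F n in sequentially. mean_le (M n) (\<lambda>\<omega>. \<bar>A n \<omega>\<bar> ^ k) C"
  shows "integrable N (\<lambda>\<omega>. \<bar>Z \<omega>\<bar> powr p)"
    and "(\<lambda>n. \<integral>\<omega>. \<bar>A n \<omega>\<bar> powr p \<partial>M n) \<longlonglongrightarrow> (\<integral>\<omega>. \<bar>Z \<omega>\<bar> powr p \<partial>N)"
proof -
  interpret N: prob_space N using Z by simp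
  have [measurable]: "Z \<in> borel_measurable N" using Z by simp
  define h where "h T x = min (\<bar>x\<bar> powr p) (real T)" for T :: nat and x :: real
  have h_cont: "isCont (h T) x" for T x
    unfolding h_def isCont_def
    by (intro tendsto_min tendsto_const tendsto_powr' tendsto_rabs tendsto_ident_at) (use p in auto)
  have h_bound: "\<bar>h T x\<bar> \<le> real T" for T x by (auto simp: h_def min_def)
  have h_lim: "(\<lambda>n. \<integral>\<omega>. h T (A n \<omega>) \<partial>M n) \<longlonglongrightarrow> (\<integral>\<omega>. h T (Z \<omega>) \<partial>N)" for T
    by (rule weak_conv_expectation_tendsto[OF g Z w h_cont h_bound])
  have hm [measurable]: "h T \<in> borel_measurable borel" for T unfolding h_def[abs_def] by measurable
  have pre: "\<forall>\<^sub>F n in sequentially. integrable (M n) (\<lambda>\<omega>. \<bar>A n \<omega>\<bar> powr p) \<and>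
       (\<forall>T. (\<integral>\<omega>. h T (A n \<omega>) \<partial>M n) \<le> 1 + C \<and> (1 \<le> T \<longrightarrow> \<bar>(\<integral>\<omega>. \<bar>A n \<omega>\<bar> powr p \<partial>M n) - (\<integral>\<omega>. h T (A n \<omega>) \<partial>M n)\<bar> \<le> (1 + C) / real T))"
    using g C
  proof eventually_elim
    case (elim n)
    interpret M: prob_space "M n" using elim by simp
    have [measurable]: "A n \<in> borel_measurable (M n)" using elim by simp
    have m: "(\<integral>\<^sup>+\<omega>. ennreal (\<bar>A n \<omega>\<bar> ^ k) \<partial>M n) \<le> ennreal C" and C0: "0 \<le> C" using elim by (auto simp: mean_le_def)
    have i: "integrable (M n) (\<lambda>\<omega>. \<bar>A n \<omega>\<bar> ^ k)"
      using m by (intro integrableI_nonneg) (auto simp: less_top[symmetric] top_unique)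
    have "ennreal (\<integral>\<omega>. \<bar>A n \<omega>\<bar> ^ k \<partial>M n) = (\<integral>\<^sup>+\<omega>. ennreal (\<bar>A n \<omega>\<bar> ^ k) \<partial>M n)"
      by (rule nn_integral_eq_integral[symmetric, OF i]) auto
    with m C0 have mk: "(\<integral>\<omega>. \<bar>A n \<omega>\<bar> ^ k \<partial>M n) \<le> C" by (metis ennreal_le_iff)
    have i1: "integrable (M n) (\<lambda>\<omega>. 1 + \<bar>A n \<omega>\<bar> ^ k)" using i by simp
    have v1: "(\<integral>\<omega>. 1 + \<bar>A n \<omega>\<bar> ^ k \<partial>M n) \<le> 1 + C" using i mk by (simp add: M.prob_space)
    have ip: "integrable (M n) (\<lambda>\<omega>. \<bar>A n \<omega>\<bar> powr p)"
      using powr_truncation(2)[OF p k zero_less_one] by (intro Bochner_Integration.integrable_bound[OF i1]) auto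
    have ih: "integrable (M n) (\<lambda>\<omega>. h T (A n \<omega>))" for T
      using h_bound by (intro M.integrable_const_bound[of _ "real T"]) auto
    have 1: "(\<integral>\<omega>. h T (A n \<omega>) \<partial>M n) \<le> 1 + C" for T
    proof -
      have "(\<integral>\<omega>. h T (A n \<omega>) \<partial>M n) \<le> (\<integral>\<omega>. 1 + \<bar>A n \<omega>\<bar> ^ k \<partial>M n)"
        using powr_truncation(2)[OF p k zero_less_one] by (intro integral_mono ih i1) (auto simp: h_def min_le_iff_disj)
      then show ?thesis using v1 by simp
    qed
    have 2: "\<bar>(\<integral>\<omega>. \<bar>A n \<omega>\<bar> powr p \<partial>M n) - (\<integral>\<omega>. h T (A n \<omega>) \<partial>M n)\<bar> \<le> (1 + C) / real T" if "1 \<le> T" for T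
    proof -
      have "\<bar>(\<integral>\<omega>. \<bar>A n \<omega>\<bar> powr p \<partial>M n) - (\<integral>\<omega>. h T (A n \<omega>) \<partial>M n)\<bar> = \<bar>\<integral>\<omega>. \<bar>A n \<omega>\<bar> powr p - h T (A n \<omega>) \<partial>M n\<bar>"
        using ip ih by simp
      also have "\<dots> \<le> (\<integral>\<omega>. \<bar>\<bar>A n \<omega>\<bar> powr p - h T (A n \<omega>)\<bar> \<partial>M n)" by (rule integral_abs_bound)
      also have "\<dots> \<le> (\<integral>\<omega>. (1 + \<bar>A n \<omega>\<bar> ^ k) / real T \<partial>M n)"
        unfolding h_def using ip ih[of T] i1 that
        by (intro integral_mono powr_truncation(1)[OF p k]) (auto simp: h_def)
      also have "\<dots> \<le> (1 + C) / real T" using v1 by (simp add: divide_right_mono)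
      finally show ?thesis .
    qed
    show ?case using ip 1 2 by blast
  qed
  have ih: "integrable N (\<lambda>\<omega>. h T (Z \<omega>))" for T
    using h_bound by (intro N.integrable_const_bound[of _ "real T"]) auto
  let ?I = "\<lambda>T. \<integral>\<omega>. h T (Z \<omega>) \<partial>N"
  have I_le: "?I T \<le> 1 + C" for T
    by (rule tendsto_upperbound[OF h_lim]) (use pre in \<open>auto elim: eventually_mono\<close>)
  have I_mono: "incseq ?I" by (rule incseq_SucI, rule integral_mono[OF ih ih]) (auto simp: h_def)
  obtain x where x: "?I \<longlonglongrightarrow> x" using incseq_convergent[OF I_mono] I_le by blast
  have pw: "(\<lambda>T. h T y) \<longlonglongrightarrow> \<bar>y\<bar> powr p" for y
  proof (rule tendsto_eventually)
    obtain T0 :: nat where "\<bar>y\<bar> powr p \<le> real T0" using real_arch_simple by blast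
    then show "\<forall>\<^sub>F T in sequentially. h T y = \<bar>y\<bar> powr p"
      unfolding eventually_sequentially by (intro exI[of _ T0]) (auto simp: h_def)
  qed
  have mono: "mono (\<lambda>T. h T y)" for y by (auto simp: h_def mono_def)
  have lim: "integrable N (\<lambda>\<omega>. \<bar>Z \<omega>\<bar> powr p)" "(\<integral>\<omega>. \<bar>Z \<omega>\<bar> powr p \<partial>N) = x"
    by (rule integral_monotone_convergence_nonneg[OF ih, where u = "\<lambda>\<omega>. \<bar>Z \<omega>\<bar> powr p" and x = x];
        use mono pw x in \<open>auto simp: h_def\<close>)+
  show "integrable N (\<lambda>\<omega>. \<bar>Z \<omega>\<bar> powr p)" by (rule lim)
  show "(\<lambda>n. \<integral>\<omega>. \<bar>A n \<omega>\<bar> powr p \<partial>M n) \<longlonglongrightarrow> (\<integral>\<omega>. \<bar>Z \<omega>\<bar> powr p \<partial>N)"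
    unfolding lim(2)
  proof (rule LIMSEQ_by_approximation)
    fix e :: real assume e: "0 < e"
    have "\<forall>\<^sub>F T in sequentially. dist (?I T) x < e" using x e by (rule tendstoD)
    moreover have "\<forall>\<^sub>F T in sequentially. (1 + C) / real T < e"
      by (rule order_tendstoD(2)[OF lim_const_over_n e])
    moreover have "\<forall>\<^sub>F T in sequentially. 1 \<le> T" by (rule eventually_ge_at_top)
    ultimately have "\<forall>\<^sub>F T in sequentially. dist (?I T) x < e \<and> (1 + C) / real T < e \<and> 1 \<le> T"
      by eventually_elim simp
    then obtain T where T: "dist (?I T) x < e" "(1 + C) / real T < e" "1 \<le> T"
      unfolding eventually_sequentially by blast
    show "\<exists>b w. (\<forall>\<^sub>F n in sequentially. \<bar>(\<integral>\<omega>. \<bar>A n \<omega>\<bar> powr p \<partial>M n) - b n\<bar> \<le> e) \<and> \<bar>w - x\<bar> \<le> e \<and> b \<longlonglongrightarrow> w"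
    proof (intro exI conjI)
      show "\<forall>\<^sub>F n in sequentially. \<bar>(\<integral>\<omega>. \<bar>A n \<omega>\<bar> powr p \<partial>M n) - (\<integral>\<omega>. h T (A n \<omega>) \<partial>M n)\<bar> \<le> e"
        using pre by eventually_elim (use T in force)
      show "\<bar>?I T - x\<bar> \<le> e" using T by (simp add: dist_real_def)
    qed (rule h_lim)
  qed
qed

section \<open>Convergence in law and of moments along converging parameters\<close>

context ramp_experiment
begin

text \<open>
  The time point with local coordinate \<open>i / m\<close>; \<open>grid_count\<close> and \<open>cell_rate\<close> refer to the cell that starts
  there.
\<close>

definition grid_time :: "nat \<Rightarrow> real \<Rightarrow> nat \<Rightarrow> int \<Rightarrow> real" where
  "grid_time n \<theta> m i = \<theta> + (of_int i / real m) / real n"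

definition grid_count :: "nat \<Rightarrow> real \<Rightarrow> nat \<Rightarrow> int \<Rightarrow> 'a \<Rightarrow> nat" where
  "grid_count n \<theta> m i \<omega> = S n (grid_time n \<theta> m (i + 1)) \<omega> - S n (grid_time n \<theta> m i) \<omega>"

definition cell_rate :: "nat \<Rightarrow> real \<Rightarrow> nat \<Rightarrow> int \<Rightarrow> real" where
  "cell_rate n \<theta> m i = (LBINT u:{grid_time n \<theta> m i..grid_time n \<theta> m (i + 1)}. real n * lam (\<delta> n) \<theta> u)"

lemma grid_time_mono: "i \<le> j \<Longrightarrow> grid_time n \<theta> m i \<le> grid_time n \<theta> m j"
  by (auto simp: grid_time_def intro!: divide_right_mono)

lemma grid_time_Suc: "1 \<le> n \<Longrightarrow> 1 \<le> m \<Longrightarrow> grid_time n \<theta> m (i + 1) - grid_time n \<theta> m i = 1 / real m / real n"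
  by (simp add: grid_time_def add_divide_distrib)

text \<open>
  Increments over consecutive cells; the cells are numbered from \<open>0\<close> at the left end of the grid, and the
  indices translated back.
\<close>

lemma grid_count_indep:
  assumes n: "1 \<le> n" and \<theta>: "\<theta> \<in> {\<alpha><..<\<beta>}"
    and T: "\<And>i. \<bar>i\<bar> \<le> int (R * m) \<Longrightarrow> grid_time n \<theta> m i \<in> {0..\<tau>}"
  shows "prob_space.indep_vars (P n \<theta>) (\<lambda>_. count_space UNIV) (grid_count n \<theta> m) (grid R m)"
proof -
  note S = S_poisson[OF n \<theta>]
  interpret prob_space "P n \<theta>" by (rule poisson_processD(1)[OF S])
  define t where "t j = grid_time n \<theta> m (int j - int (R * m))" for j
  have "indep_vars (\<lambda>_. count_space UNIV) (\<lambda>j \<omega>. S n (t (Suc j)) \<omega> - S n (t j) \<omega>) {..<2 * (R * m)}"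
  proof (rule poisson_processD(7)[OF S])
    show "t j \<in> {0..\<tau>}" if "j \<le> 2 * (R * m)" for j unfolding t_def
    proof (rule T)
      have "int j \<le> 2 * int (R * m)" using that by linarith
      then show "\<bar>int j - int (R * m)\<bar> \<le> int (R * m)" by linarith
    qed
    show "mono_on {..2 * (R * m)} t" unfolding t_def by (intro mono_onI grid_time_mono) auto
  qed
  note 1 = this
  define e where "e i = nat (i + int (R * m))" for i
  have sub: "e ` grid R m \<subseteq> {..<2 * (R * m)}"
  proof (rule image_subsetI)
    fix i assume "i \<in> grid R m"
    then have "- int (R * m) \<le> i" "i < int (R * m)" unfolding grid_def by auto
    then show "e i \<in> {..<2 * (R * m)}" unfolding e_def lessThan_iff by linarith
  qed
  have inj: "inj_on e (grid R m)" by (auto simp: inj_on_def e_def grid_def)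
  have "indep_vars (\<lambda>i. PiM {e i} (\<lambda>_. count_space UNIV)) (\<lambda>i \<omega>. restrict (\<lambda>j. (\<lambda>j \<omega>. S n (t (Suc j)) \<omega> - S n (t j) \<omega>) j \<omega>) {e i}) (grid R m)"
    by (rule indep_vars_restrict[OF 1]) (use sub inj in \<open>auto simp: disjoint_family_on_def inj_on_def\<close>)
  then have "indep_vars (\<lambda>_. count_space UNIV) (\<lambda>i \<omega>. (\<lambda>f. f (e i)) (restrict (\<lambda>j. (\<lambda>j \<omega>. S n (t (Suc j)) \<omega> - S n (t j) \<omega>) j \<omega>) {e i})) (grid R m)"
    by (rule indep_vars_compose2) (auto intro: measurable_component_singleton)
  then show ?thesis
  proof (rule indep_vars_cong_space[rotated])
    fix i \<omega> assume "i \<in> grid R m"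
    then have "t (e i) = grid_time n \<theta> m i" "t (Suc (e i)) = grid_time n \<theta> m (i + 1)"
      by (auto simp: t_def e_def grid_def add.commute)
    then show "(\<lambda>f. f (e i)) (restrict (\<lambda>j. (\<lambda>j \<omega>. S n (t (Suc j)) \<omega> - S n (t j) \<omega>) j \<omega>) {e i}) = grid_count n \<theta> m i \<omega>"
      by (simp add: grid_count_def)
  qed
qed

lemma grid_count_law:
  assumes n: "1 \<le> n" and m: "1 \<le> m" and \<theta>: "\<theta> \<in> {\<alpha><..<\<beta>}"
    and T: "grid_time n \<theta> m i \<in> {0..\<tau>}" "grid_time n \<theta> m (i + 1) \<in> {0..\<tau>}"
  shows "distr (P n \<theta>) (count_space UNIV) (grid_count n \<theta> m i) = measure_pmf (poisson_pmf (cell_rate n \<theta> m i))"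
    and "0 < cell_rate n \<theta> m i"
proof -
  have "0 < 1 / real m / real n" using n m by simp
  then have lt: "grid_time n \<theta> m i < grid_time n \<theta> m (i + 1)" using grid_time_Suc[OF n m, of \<theta> i] by linarith
  show "distr (P n \<theta>) (count_space UNIV) (grid_count n \<theta> m i) = measure_pmf (poisson_pmf (cell_rate n \<theta> m i))"
    unfolding grid_count_def[abs_def] cell_rate_def by (rule poisson_processD(6)[OF S_poisson[OF n \<theta>] T lt])
  have "0 < lo * (grid_time n \<theta> m (i + 1) - grid_time n \<theta> m i)" using lt lo_pos by simp
  also have "\<dots> \<le> (LBINT u:{grid_time n \<theta> m i..grid_time n \<theta> m (i + 1)}. lam (\<delta> n) \<theta> u)"
    using integral_lam_bounds(1)[OF \<delta>_pos[OF n]] T lt by simp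
  finally show "0 < cell_rate n \<theta> m i" using n by (simp add: cell_rate_def)
qed

lemma real_grid_count:
  assumes n: "1 \<le> n" and \<theta>: "\<theta> \<in> {\<alpha><..<\<beta>}" and \<omega>: "\<omega> \<in> space (P n \<theta>)"
    and T: "grid_time n \<theta> m i \<in> {0..\<tau>}" "grid_time n \<theta> m (i + 1) \<in> {0..\<tau>}"
  shows "real (grid_count n \<theta> m i \<omega>) = Yn n \<theta> (of_int (i + 1) / real m) \<omega> - Yn n \<theta> (of_int i / real m) \<omega>"
proof -
  have "real (S n (grid_time n \<theta> m i) \<omega>) \<le> real (S n (grid_time n \<theta> m (i + 1)) \<omega>)"
    using T grid_time_mono[of i "i + 1"] by (intro S_mono[OF n \<theta> \<omega>]) auto
  then show ?thesis by (simp add: grid_count_def Yn_def grid_time_def of_nat_diff)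
qed

lemma eventually_grid_time_inside:
  assumes \<theta>: "\<theta> \<in> {\<alpha><..<\<beta>}" and \<theta>s: "\<theta>s \<longlonglongrightarrow> \<theta>" and m: "1 \<le> m"
  shows "\<forall>\<^sub>F n in sequentially. \<forall>i. \<bar>i\<bar> \<le> int (R * m) \<longrightarrow> grid_time n (\<theta>s n) m i \<in> {0..\<tau>}"
proof -
  have 1: "(\<lambda>n. \<theta>s n + real R / real n) \<longlonglongrightarrow> \<theta> + 0" and 2: "(\<lambda>n. \<theta>s n - real R / real n) \<longlonglongrightarrow> \<theta> - 0"
    by (intro tendsto_intros \<theta>s lim_const_over_n)+
  have "\<forall>\<^sub>F n in sequentially. \<theta>s n + real R / real n < \<tau>" by (rule order_tendstoD(2)[OF 1]) (use \<theta> \<alpha>\<beta> in auto)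
  moreover have "\<forall>\<^sub>F n in sequentially. 0 < \<theta>s n - real R / real n" by (rule order_tendstoD(1)[OF 2]) (use \<theta> \<alpha>\<beta> in auto)
  ultimately show ?thesis
  proof eventually_elim
    case (elim n)
    show ?case
    proof (intro allI impI)
      fix i assume "\<bar>i\<bar> \<le> int (R * m)"
      then have "real_of_int \<bar>i\<bar> \<le> real_of_int (int (R * m))" unfolding of_int_le_iff .
      then have "\<bar>real_of_int i\<bar> \<le> real R * real m" by simp
      then have "\<bar>of_int i / real m\<bar> \<le> real R" using m by (simp add: abs_divide pos_divide_le_eq)
      moreover have "\<bar>x / real n\<bar> \<le> real R / real n" if "\<bar>x\<bar> \<le> real R" for x :: real
        unfolding abs_divide using that by (auto intro: divide_right_mono)
      ultimately have "\<bar>of_int i / real m / real n\<bar> \<le> real R / real n" by blast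
      then show "grid_time n (\<theta>s n) m i \<in> {0..\<tau>}" using elim unfolding grid_time_def atLeastAtMost_iff by linarith
    qed
  qed
qed

text \<open>
  After rescaling, the ramp occupies a window of width \<open>n \<delta> n\<close> which shrinks to the origin: the
  rate of a cell is that of a jump.
\<close>

lemma cell_rate_tendsto:
  assumes \<theta>: "\<theta> \<in> {\<alpha><..<\<beta>}" and \<theta>s: "\<theta>s \<longlonglongrightarrow> \<theta>" and m: "1 \<le> m"
  shows "(\<lambda>n. cell_rate n (\<theta>s n) m i) \<longlonglongrightarrow> (if 0 \<le> i then \<psi> \<theta> + r else \<psi> \<theta>) / real m"
proof -
  let ?x = "real_of_int i / real m" and ?y = "real_of_int (i + 1) / real m"
  let ?c = "if 0 \<le> i then \<psi> \<theta> + r else \<psi> \<theta>"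
  define F where "F n v = indicator {?x..?y} v * lam (\<delta> n) (\<theta>s n) (\<theta>s n + v / real n)" for n v
  have xy: "?x \<le> ?y" "?y - ?x = 1 / real m" using m by (auto simp: divide_right_mono add_divide_distrib)
  have eq: "cell_rate n (\<theta>s n) m i = (LBINT v. F n v)" if n: "1 \<le> n" for n
  proof -
    have n0: "0 < real n" using n by simp
    have "cell_rate n (\<theta>s n) m i = \<bar>1 / real n\<bar> *\<^sub>R (LBINT v. indicator {grid_time n (\<theta>s n) m i..grid_time n (\<theta>s n) m (i + 1)} (\<theta>s n + 1 / real n * v)
        *\<^sub>R (real n * lam (\<delta> n) (\<theta>s n) (\<theta>s n + 1 / real n * v)))"
      unfolding cell_rate_def set_lebesgue_integral_def using n by (intro lborel_integral_real_affine) simp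
    also have "(LBINT v. indicator {grid_time n (\<theta>s n) m i..grid_time n (\<theta>s n) m (i + 1)} (\<theta>s n + 1 / real n * v)
        *\<^sub>R (real n * lam (\<delta> n) (\<theta>s n) (\<theta>s n + 1 / real n * v))) = (LBINT v. real n * F n v)"
    proof (intro Bochner_Integration.integral_cong refl)
      fix v
      have "\<theta>s n + 1 / real n * v \<in> {grid_time n (\<theta>s n) m i..grid_time n (\<theta>s n) m (i + 1)} \<longleftrightarrow> v \<in> {?x..?y}"
      proof -
        have "\<theta>s n + x / real n \<le> \<theta>s n + 1 / real n * v \<longleftrightarrow> x \<le> v" "\<theta>s n + 1 / real n * v \<le> \<theta>s n + x / real n \<longleftrightarrow> v \<le> x" for x
          using n0 by (simp_all add: divide_le_cancel)
        then show ?thesis unfolding grid_time_def atLeastAtMost_iff by blast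
      qed
      then show "indicator {grid_time n (\<theta>s n) m i..grid_time n (\<theta>s n) m (i + 1)} (\<theta>s n + 1 / real n * v)
        *\<^sub>R (real n * lam (\<delta> n) (\<theta>s n) (\<theta>s n + 1 / real n * v)) = real n * F n v"
        by (simp add: F_def indicator_def)
    qed
    finally show ?thesis using n0 by simp
  qed
  define R where "R = nat (\<bar>i\<bar> + 1)"
  have R: "\<bar>i\<bar> \<le> int (R * m)" "\<bar>i + 1\<bar> \<le> int (R * m)"
  proof -
    have "\<bar>i\<bar> + 1 \<le> (\<bar>i\<bar> + 1) * int m" using m mult_left_mono[of 1 "int m" "\<bar>i\<bar> + 1"] by simp
    moreover have "(\<bar>i\<bar> + 1) * int m = int (R * m)" by (simp add: R_def)
    ultimately show "\<bar>i\<bar> \<le> int (R * m)" "\<bar>i + 1\<bar> \<le> int (R * m)" by linarith+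
  qed
  have "\<forall>\<^sub>F n in sequentially. 1 \<le> n \<and> (\<forall>j. \<bar>j\<bar> \<le> int (R * m) \<longrightarrow> grid_time n (\<theta>s n) m j \<in> {0..\<tau>})"
    using eventually_grid_time_inside[OF \<theta> \<theta>s m, of R] eventually_ge_at_top[of 1] by eventually_elim simp
  then obtain n0 where n0: "\<And>n. n0 \<le> n \<Longrightarrow> 1 \<le> n \<and> (\<forall>j. \<bar>j\<bar> \<le> int (R * m) \<longrightarrow> grid_time n (\<theta>s n) m j \<in> {0..\<tau>})"
    unfolding eventually_sequentially by blast
  have inside: "\<theta>s n + v / real n \<in> {0..\<tau>}" if n: "n0 \<le> n" and v: "v \<in> {?x..?y}" for n v
  proof -
    have "grid_time n (\<theta>s n) m i \<in> {0..\<tau>}" "grid_time n (\<theta>s n) m (i + 1) \<in> {0..\<tau>}" using n0[OF n] R by auto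
    moreover have "?x / real n \<le> v / real n" "v / real n \<le> ?y / real n"
      using v by (intro divide_right_mono of_nat_0_le_iff; simp)+
    ultimately show ?thesis unfolding grid_time_def atLeastAtMost_iff by linarith
  qed
  have "(\<lambda>n. LBINT v. F (n + n0) v) \<longlonglongrightarrow> (LBINT v. indicator {?x..?y} v * ?c)"
  proof (rule integral_dominated_convergence)
    have "integrable lborel (indicat_real {?x..?y})" by (intro integrable_real_indicator emeasure_compact_finite) auto
    then show "integrable lborel (\<lambda>v. indicator {?x..?y} v * hi :: real)" by simp
    show "(\<lambda>v. indicator {?x..?y} v * ?c) \<in> borel_measurable lborel" by simp
    show "F (n + n0) \<in> borel_measurable lborel" for n
    proof -
      have c: "continuous_on {?x..?y} (\<lambda>v. lam (\<delta> (n + n0)) (\<theta>s (n + n0)) (\<theta>s (n + n0) + v / real (n + n0)))"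
        using n0[of "n + n0"] by (intro continuous_on_compose2[OF continuous_on_lam[OF \<delta>_pos]] continuous_intros) (use inside[of "n + n0"] in auto)
      have "(\<lambda>v. indicator {?x..?y} v *\<^sub>R lam (\<delta> (n + n0)) (\<theta>s (n + n0)) (\<theta>s (n + n0) + v / real (n + n0))) \<in> borel_measurable borel"
        by (rule borel_measurable_continuous_on_indicator[OF _ c]) simp
      then show ?thesis by (simp add: F_def[abs_def])
    qed
    show "AE v in lborel. norm (F (n + n0) v) \<le> indicator {?x..?y} v * hi" for n
    proof (rule AE_I2)
      fix v
      show "norm (F (n + n0) v) \<le> indicator {?x..?y} v * hi"
        using lam_bounds(4,5)[OF inside[of "n + n0" v], of "\<delta> (n + n0)" "\<theta>s (n + n0)"] by (cases "v \<in> {?x..?y}") (auto simp: F_def)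
    qed
    show "AE v in lborel. (\<lambda>n. F (n + n0) v) \<longlonglongrightarrow> indicator {?x..?y} v * ?c"
    proof -
      have pw: "(\<lambda>n. F (n + n0) v) \<longlonglongrightarrow> indicator {?x..?y} v * ?c" if v: "v \<noteq> 0" "v \<noteq> ?x" "v \<noteq> ?y" for v
      proof (cases "v \<in> {?x..?y}")
        case True
        have "(\<lambda>n. \<theta>s n + v / real n) \<longlonglongrightarrow> \<theta> + 0" by (intro tendsto_intros \<theta>s lim_const_over_n)
        moreover have "isCont \<psi> \<theta>"
          using continuous_on_interior[OF cont_\<psi>] \<theta> \<alpha>\<beta> by auto
        ultimately have \<psi>: "(\<lambda>n. \<psi> (\<theta>s n + v / real n)) \<longlonglongrightarrow> \<psi> \<theta>" using isCont_tendsto_compose by fastforce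
        have "\<forall>\<^sub>F n in sequentially. lam (\<delta> n) (\<theta>s n) (\<theta>s n + v / real n) = \<psi> (\<theta>s n + v / real n) + (if 0 \<le> i then r else 0)"
        proof (cases "0 \<le> i")
          case i: True
          then have "0 \<le> ?x" by simp
          then have "0 < v" using True v by auto
          then have "\<forall>\<^sub>F n in sequentially. real n * \<delta> n < v" by (intro order_tendstoD(2)[OF n\<delta>_lim])
          then show ?thesis using eventually_ge_at_top[of 1]
          proof eventually_elim
            case (elim n)
            then have "\<delta> n \<le> v / real n" by (simp add: field_simps)
            then show ?case using lam_after[of "\<delta> n" "\<theta>s n" "\<theta>s n + v / real n"] \<delta>_pos[of n] elim i by simp
          qed
        next
          case i: False
          then have "?y \<le> 0" by (simp add: divide_le_0_iff)
          then have "v \<le> 0" using True by auto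
          then have "v / real n \<le> 0" for n by (simp add: divide_le_0_iff)
          then have "\<And>n. 1 \<le> n \<Longrightarrow> lam (\<delta> n) (\<theta>s n) (\<theta>s n + v / real n) = \<psi> (\<theta>s n + v / real n)"
            using lam_before[OF \<delta>_pos] by simp
          then show ?thesis using i unfolding eventually_sequentially by auto
        qed
        moreover have "(\<lambda>n. \<psi> (\<theta>s n + v / real n) + (if 0 \<le> i then r else 0)) \<longlonglongrightarrow> \<psi> \<theta> + (if 0 \<le> i then r else 0)"
          by (intro tendsto_intros \<psi>)
        ultimately have "(\<lambda>n. lam (\<delta> n) (\<theta>s n) (\<theta>s n + v / real n)) \<longlonglongrightarrow> ?c"
          using Lim_transform_eventually[of "\<lambda>n. \<psi> (\<theta>s n + v / real n) + (if 0 \<le> i then r else 0)"]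
          by (auto simp: eq_commute)
        then have "(\<lambda>n. F n v) \<longlonglongrightarrow> indicator {?x..?y} v * ?c" using True by (simp add: F_def)
        then show ?thesis by (rule LIMSEQ_ignore_initial_segment)
      qed (simp add: F_def)
      have "AE v in lborel. v \<notin> {0, ?x, ?y}"
        by (intro AE_not_in finite_imp_null_set_lborel) auto
      then show ?thesis by eventually_elim (use pw in auto)
    qed
  qed
  also have "(LBINT v. indicator {?x..?y} v * ?c) = ?c / real m"
    using xy by simp
  finally have "(\<lambda>n. LBINT v. F n v) \<longlonglongrightarrow> ?c / real m" by (rule LIMSEQ_offset)
  moreover have "\<forall>\<^sub>F n in sequentially. (LBINT v. F n v) = cell_rate n (\<theta>s n) m i"
    using eventually_ge_at_top[of 1] by eventually_elim (simp add: eq)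
  ultimately show ?thesis by (rule Lim_transform_eventually)
qed

text \<open>
  Both grid means are the same function of independent Poisson counts, whose rates converge.
\<close>

lemma grid_mean_expectation_tendsto:
  fixes f :: "real \<Rightarrow> real"
  assumes lim: "limit_experiment N Yp Ym (\<psi> \<theta>) (\<psi> \<theta> + r)"
    and \<theta>: "\<theta> \<in> {\<alpha><..<\<beta>}" and \<theta>s: "\<And>n. \<theta>s n \<in> {\<alpha><..<\<beta>}" "\<theta>s \<longlonglongrightarrow> \<theta>"
    and m: "1 \<le> m" and R: "1 \<le> R" and f: "\<And>x. \<bar>f x\<bar> \<le> C"
  shows "(\<lambda>n. \<integral>\<omega>. f (grid_mean \<kappa> r R m (\<lambda>i. Yn n (\<theta>s n) (of_int i / real m) \<omega>)) \<partial>P n (\<theta>s n))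
     \<longlonglongrightarrow> (\<integral>\<omega>. f (grid_mean \<kappa> r R m (\<lambda>i. limit_experiment.Y Yp Ym (of_int i / real m) \<omega>)) \<partial>N)"
proof -
  interpret l: limit_experiment N Yp Ym "\<psi> \<theta>" "\<psi> \<theta> + r" by (rule lim)
  let ?g = "\<lambda>x. f (grid_mean \<kappa> r R m (cumsum x))"
  have gr: "grid_mean \<kappa> r R m (cumsum (\<lambda>i\<in>grid R m. x i)) = grid_mean \<kappa> r R m y"
    if "y 0 = 0" "\<And>j. j \<in> grid R m \<Longrightarrow> real (x j) = y (j + 1) - y j" for x y
    by (rule grid_mean_cong) (use that in \<open>simp add: cumsum_restrict cumsum_increments\<close>)
  have ev: "\<forall>\<^sub>F n in sequentially. 1 \<le> n \<and> (\<forall>i. \<bar>i\<bar> \<le> int (R * m) \<longrightarrow> grid_time n (\<theta>s n) m i \<in> {0..\<tau>})"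
    using eventually_grid_time_inside[OF \<theta> \<theta>s(2) m, of R] eventually_ge_at_top[of 1] by eventually_elim simp
  have "(\<lambda>n. \<integral>\<omega>. ?g (\<lambda>i\<in>grid R m. grid_count n (\<theta>s n) m i \<omega>) \<partial>P n (\<theta>s n)) \<longlonglongrightarrow> (\<integral>\<omega>. ?g (\<lambda>i\<in>grid R m. l.cell_count m i \<omega>) \<partial>N)"
  proof (rule poisson_vector_law_tendsto[where \<mu> = "\<lambda>n. cell_rate n (\<theta>s n) m" and \<mu>' = "\<lambda>i. (if 0 \<le> i then \<psi> \<theta> + r else \<psi> \<theta>) / real m" and C = C])
    have "1 \<le> R * m" using R m mult_le_mono[of 1 R 1 m] by simp
    then have "1 \<le> int (R * m)" by linarith
    then have "- 1 \<in> grid R m" unfolding grid_def by auto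
    then show "grid R m \<noteq> {}" by auto
    show "\<forall>\<^sub>F n in sequentially. prob_space (P n (\<theta>s n)) \<and> prob_space.indep_vars (P n (\<theta>s n)) (\<lambda>_. count_space UNIV) (grid_count n (\<theta>s n) m) (grid R m)
      \<and> (\<forall>i\<in>grid R m. 0 < cell_rate n (\<theta>s n) m i \<and> distr (P n (\<theta>s n)) (count_space UNIV) (grid_count n (\<theta>s n) m i) = measure_pmf (poisson_pmf (cell_rate n (\<theta>s n) m i)))"
      using ev
    proof eventually_elim
      case (elim n)
      have "grid_time n (\<theta>s n) m i \<in> {0..\<tau>}" "grid_time n (\<theta>s n) m (i + 1) \<in> {0..\<tau>}" if "i \<in> grid R m" for i
        using elim that by (auto simp: grid_def)
      then show ?case
        using elim grid_count_law[of n m "\<theta>s n"] m \<theta>s(1)[of n] poisson_processD(1)[OF S_poisson, of n "\<theta>s n"] grid_count_indep[of n "\<theta>s n" R m] by blast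
    qed
    show "0 < (if 0 \<le> i then \<psi> \<theta> + r else \<psi> \<theta>) / real m" for i using l.ab m by auto
  qed (use l.cell_count_indep[OF m] l.cell_count_law[OF m] cell_rate_tendsto[OF \<theta> \<theta>s(2) m] f l.N.prob_space_axioms in auto)
  moreover have "(\<integral>\<omega>. ?g (\<lambda>i\<in>grid R m. l.cell_count m i \<omega>) \<partial>N) = (\<integral>\<omega>. f (grid_mean \<kappa> r R m (\<lambda>i. l.Y (of_int i / real m) \<omega>)) \<partial>N)"
    by (intro Bochner_Integration.integral_cong refl arg_cong[of _ _ f] gr) (use l.Y_zero l.real_cell_count[OF m] in auto)
  moreover have "\<forall>\<^sub>F n in sequentially. (\<integral>\<omega>. ?g (\<lambda>i\<in>grid R m. grid_count n (\<theta>s n) m i \<omega>) \<partial>P n (\<theta>s n))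
      = (\<integral>\<omega>. f (grid_mean \<kappa> r R m (\<lambda>i. Yn n (\<theta>s n) (of_int i / real m) \<omega>)) \<partial>P n (\<theta>s n))"
    using ev
  proof eventually_elim
    case (elim n)
    have T: "grid_time n (\<theta>s n) m i \<in> {0..\<tau>}" "grid_time n (\<theta>s n) m (i + 1) \<in> {0..\<tau>}" if "i \<in> grid R m" for i
      using elim that by (auto simp: grid_def)
    show ?case
      by (intro Bochner_Integration.integral_cong refl arg_cong[of _ _ f] gr real_grid_count[OF conjunct1[OF elim] \<theta>s(1)] T)
        (auto simp: Yn_def)
  qed
  ultimately show ?thesis using Lim_transform_eventually by fastforce
qed

text \<open>
  Both variables are close in mean to grid means, with common \<open>R\<close> and \<open>m\<close>, and for fixed \<open>R\<close> and \<open>m\<close> the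
  grid means converge in law.
\<close>

lemma scaled_error_law:
  assumes lim: "limit_experiment N Yp Ym (\<psi> \<theta>) (\<psi> \<theta> + r)"
    and \<theta>: "\<theta> \<in> {\<alpha><..<\<beta>}" and \<theta>s: "\<And>n. \<theta>s n \<in> {\<alpha><..<\<beta>}" "\<theta>s \<longlonglongrightarrow> \<theta>"
  defines "\<zeta> \<equiv> \<lambda>\<omega>. zeta (\<psi> \<theta>) (\<psi> \<theta> + r) (\<lambda>u. Yp u \<omega>) (\<lambda>u. Ym u \<omega>)"
  shows "\<forall>\<^sub>F n in sequentially. random_real (P n (\<theta>s n)) (\<lambda>\<omega>. real n * (est n \<omega> - \<theta>s n))"
    and "random_real N \<zeta>"
    and "weak_conv_m (\<lambda>n. distr (P n (\<theta>s n)) borel (\<lambda>\<omega>. real n * (est n \<omega> - \<theta>s n))) (distr N borel \<zeta>)"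
proof -
  interpret l: limit_experiment N Yp Ym "\<psi> \<theta>" "\<psi> \<theta> + r" by (rule lim)
  show 1: "\<forall>\<^sub>F n in sequentially. random_real (P n (\<theta>s n)) (\<lambda>\<omega>. real n * (est n \<omega> - \<theta>s n))"
    using eventually_small_enough[OF \<theta> \<theta>s]
  proof eventually_elim
    case (elim n)
    then show ?case
      using scaled_error_measurable[OF elim] poisson_processD(1)[OF S_poisson, of n "\<theta>s n"] by (auto simp: small_enough_def)
  qed
  show 2: "random_real N \<zeta>" unfolding \<zeta>_def using l.zeta_measurable l.N.prob_space_axioms by simp
  show "weak_conv_m (\<lambda>n. distr (P n (\<theta>s n)) borel (\<lambda>\<omega>. real n * (est n \<omega> - \<theta>s n))) (distr N borel \<zeta>)"
  proof (rule weak_conv_by_cts_steps[OF 1 2], rule LIMSEQ_by_approximation)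
    fix x y e :: real assume xy: "x < y" and e: "0 < e"
    let ?C = "1 / (y - x)"
    define d where "d = e * (y - x)"
    have d: "0 < d" "?C * d = e" using e xy by (auto simp: d_def)
    have C: "0 \<le> ?C" using xy by simp
    let ?G = "\<lambda>R m n \<omega>. grid_mean (log_jump \<theta>) r R m (\<lambda>i. Yn n (\<theta>s n) (of_int i / real m) \<omega>)"
    let ?H = "\<lambda>R m \<omega>. grid_mean (log_jump \<theta>) r R m (\<lambda>i. l.Y (of_int i / real m) \<omega>)"
    obtain R1 where R1: "\<forall>R\<ge>R1. \<exists>m0. \<forall>m\<ge>m0. \<forall>\<^sub>F n in sequentially. mean_close (P n (\<theta>s n)) (\<lambda>\<omega>. real n * (est n \<omega> - \<theta>s n)) (?G R m n) d"
      using prelimit_approx[OF \<theta> \<theta>s d(1)] by blast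
    obtain R2 where R2: "\<forall>R\<ge>R2. \<exists>m0. \<forall>m\<ge>m0. mean_close N \<zeta> (?H R m) d"
      using l.limit_approx[OF d(1)] unfolding \<zeta>_def by (auto simp: log_jump_def)
    define R where "R = max 1 (max R1 R2)"
    have "R1 \<le> R" "R2 \<le> R" by (auto simp: R_def)
    obtain m1 where m1: "\<And>m. m1 \<le> m \<Longrightarrow> \<forall>\<^sub>F n in sequentially. mean_close (P n (\<theta>s n)) (\<lambda>\<omega>. real n * (est n \<omega> - \<theta>s n)) (?G R m n) d"
      using R1 \<open>R1 \<le> R\<close> by blast
    obtain m2 where m2: "\<And>m. m2 \<le> m \<Longrightarrow> mean_close N \<zeta> (?H R m) d"
      using R2 \<open>R2 \<le> R\<close> by blast
    define m where "m = max 1 (max m1 m2)"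
    have Rm: "1 \<le> R" "1 \<le> m" "m1 \<le> m" "m2 \<le> m" by (auto simp: R_def m_def)
    show "\<exists>b w. (\<forall>\<^sub>F n in sequentially. \<bar>(\<integral>\<omega>. cts_step x y (real n * (est n \<omega> - \<theta>s n)) \<partial>P n (\<theta>s n)) - b n\<bar> \<le> e)
        \<and> \<bar>w - (\<integral>\<omega>. cts_step x y (\<zeta> \<omega>) \<partial>N)\<bar> \<le> e \<and> b \<longlonglongrightarrow> w"
    proof (intro exI conjI)
      show "\<forall>\<^sub>F n in sequentially. \<bar>(\<integral>\<omega>. cts_step x y (real n * (est n \<omega> - \<theta>s n)) \<partial>P n (\<theta>s n)) - (\<integral>\<omega>. cts_step x y (?G R m n \<omega>) \<partial>P n (\<theta>s n))\<bar> \<le> e"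
        using m1[OF Rm(3)] 1
      proof eventually_elim
        case (elim n)
        then show ?case using prob_space.lipschitz_expectation_close[OF conjunct1[OF elim(2)] elim(1) cts_step_lipschitz[OF xy] cts_step_bounded C cts_step_measurable[OF xy]] d(2) by simp
      qed
      show "\<bar>(\<integral>\<omega>. cts_step x y (?H R m \<omega>) \<partial>N) - (\<integral>\<omega>. cts_step x y (\<zeta> \<omega>) \<partial>N)\<bar> \<le> e"
        using prob_space.lipschitz_expectation_close[OF conjunct1[OF 2] m2[OF Rm(4)] cts_step_lipschitz[OF xy] cts_step_bounded C cts_step_measurable[OF xy]] d(2)
        by (simp add: abs_minus_commute)
      show "(\<lambda>n. \<integral>\<omega>. cts_step x y (?G R m n \<omega>) \<partial>P n (\<theta>s n)) \<longlonglongrightarrow> (\<integral>\<omega>. cts_step x y (?H R m \<omega>) \<partial>N)"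
        by (rule grid_mean_expectation_tendsto[OF lim \<theta> \<theta>s Rm(2,1) cts_step_bounded])
    qed
  qed
qed

lemma scaled_error_moments:
  assumes lim: "limit_experiment N Yp Ym (\<psi> \<theta>) (\<psi> \<theta> + r)"
    and \<theta>: "\<theta> \<in> {\<alpha><..<\<beta>}" and \<theta>s: "\<And>n. \<theta>s n \<in> {\<alpha><..<\<beta>}" "\<theta>s \<longlonglongrightarrow> \<theta>" and p: "0 < p"
  defines "\<zeta> \<equiv> \<lambda>\<omega>. zeta (\<psi> \<theta>) (\<psi> \<theta> + r) (\<lambda>u. Yp u \<omega>) (\<lambda>u. Ym u \<omega>)"
  shows "integrable N (\<lambda>\<omega>. \<bar>\<zeta> \<omega>\<bar> powr p)"
    and "(\<lambda>n. \<integral>\<omega>. \<bar>real n * (est n \<omega> - \<theta>s n)\<bar> powr p \<partial>P n (\<theta>s n)) \<longlonglongrightarrow> (\<integral>\<omega>. \<bar>\<zeta> \<omega>\<bar> powr p \<partial>N)"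
proof -
  obtain k :: nat where k: "2 * p \<le> real k" using real_arch_simple by blast
  obtain C where C: "\<forall>\<^sub>F n in sequentially. mean_le (P n (\<theta>s n)) (\<lambda>\<omega>. \<bar>real n * (est n \<omega> - \<theta>s n)\<bar> ^ k) C"
    using eventually_moment_bound[OF \<theta> \<theta>s] by blast
  note law = scaled_error_law[OF lim \<theta> \<theta>s, folded \<zeta>_def]
  show "integrable N (\<lambda>\<omega>. \<bar>\<zeta> \<omega>\<bar> powr p)" 
    and "(\<lambda>n. \<integral>\<omega>. \<bar>real n * (est n \<omega> - \<theta>s n)\<bar> powr p \<partial>P n (\<theta>s n)) \<longlonglongrightarrow> (\<integral>\<omega>. \<bar>\<zeta> \<omega>\<bar> powr p \<partial>N)"
    by (rule weak_conv_moments_tendsto[OF law p k C])+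
qed

end

section \<open>Locally uniform convergence of the risk\<close>

lemma cSUP_close:
  fixes f g :: "'i \<Rightarrow> real"
  assumes A: "A \<noteq> {}" and g: "bdd_above (g ` A)" and fg: "\<And>t. t \<in> A \<Longrightarrow> \<bar>f t - g t\<bar> \<le> e"
  shows "\<bar>(SUP t\<in>A. f t) - (SUP t\<in>A. g t)\<bar> \<le> e"
proof -
  have 1: "f t \<le> (SUP t\<in>A. g t) + e" if "t \<in> A" for t
    using cSUP_upper[OF that g] fg[OF that] by linarith
  then have f: "bdd_above (f ` A)" by (intro bdd_aboveI2[of _ _ "(SUP t\<in>A. g t) + e"])
  have 2: "g t \<le> (SUP t\<in>A. f t) + e" if "t \<in> A" for t
    using cSUP_upper[OF that f] fg[OF that] by linarith
  have "(SUP t\<in>A. f t) \<le> (SUP t\<in>A. g t) + e" by (rule cSUP_least[OF A 1])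
  moreover have "(SUP t\<in>A. g t) \<le> (SUP t\<in>A. f t) + e" by (rule cSUP_least[OF A 2])
  ultimately show ?thesis by linarith
qed

text \<open>
  Convergence along all convergent sequences of arguments gives a common neighbourhood and a common
  threshold at every point: otherwise bad pairs \<open>(\<nu> k, t k)\<close> could be interpolated by a single
  sequence \<open>\<theta>s\<close>. The limit is then continuous and the convergence uniform on compact sets, so
  suprema over small balls converge to suprema of the limit, and those to its value at the centre.
\<close>

lemma SUP_tendsto_of_continuous_convergence:
  fixes G :: "nat \<Rightarrow> real \<Rightarrow> real" and g :: "real \<Rightarrow> real"
  assumes U: "open U" and \<theta>\<^sub>0: "\<theta>\<^sub>0 \<in> U"
    and cc: "\<And>\<theta> \<theta>s. \<theta> \<in> U \<Longrightarrow> (\<And>n. \<theta>s n \<in> U) \<Longrightarrow> \<theta>s \<longlonglongrightarrow> \<theta> \<Longrightarrow> (\<lambda>n. G n (\<theta>s n)) \<longlonglongrightarrow> g \<theta>"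
  shows "\<exists>l. (\<forall>\<^sub>F \<epsilon> in at_right 0. (\<lambda>n. SUP \<theta>\<in>{\<theta>\<in>U. \<bar>\<theta> - \<theta>\<^sub>0\<bar> < \<epsilon>}. G n \<theta>) \<longlonglongrightarrow> l \<epsilon>) \<and> (l \<longlongrightarrow> g \<theta>\<^sub>0) (at_right 0)"
proof -
  have local: "\<exists>d>0. \<exists>n0. \<forall>n\<ge>n0. \<forall>t\<in>U. \<bar>t - \<theta>\<bar> < d \<longrightarrow> \<bar>G n t - g \<theta>\<bar> \<le> e" if \<theta>: "\<theta> \<in> U" and e: "0 < e" for \<theta> e
  proof (rule ccontr)
    assume neg: "\<not> ?thesis"
    have "\<forall>k. \<exists>x. k \<le> fst x \<and> snd x \<in> U \<and> \<bar>snd x - \<theta>\<bar> < inverse (real (Suc k)) \<and> e < \<bar>G (fst x) (snd x) - g \<theta>\<bar>"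
    proof
      fix k
      have "0 < inverse (real (Suc k))" by simp
      with neg obtain n t where "k \<le> n" "t \<in> U" "\<bar>t - \<theta>\<bar> < inverse (real (Suc k))" "\<not> \<bar>G n t - g \<theta>\<bar> \<le> e"
        by blast
      then show "\<exists>x. k \<le> fst x \<and> snd x \<in> U \<and> \<bar>snd x - \<theta>\<bar> < inverse (real (Suc k)) \<and> e < \<bar>G (fst x) (snd x) - g \<theta>\<bar>"
        by (intro exI[of _ "(n, t)"]) simp
    qed
    from choice[OF this] obtain x where x: "\<And>k. k \<le> fst (x k) \<and> snd (x k) \<in> U \<and> \<bar>snd (x k) - \<theta>\<bar> < inverse (real (Suc k))
       \<and> e < \<bar>G (fst (x k)) (snd (x k)) - g \<theta>\<bar>" by blast
    define \<nu> t where "\<nu> k = fst (x k)" and "t k = snd (x k)" for k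
    have \<nu>: "\<And>k. k \<le> \<nu> k" and t: "\<And>k. t k \<in> U" "\<And>k. \<bar>t k - \<theta>\<bar> < inverse (real (Suc k))"
        "\<And>k. e < \<bar>G (\<nu> k) (t k) - g \<theta>\<bar>"
      using x by (auto simp only: \<nu>_def t_def)
    \<comment> \<open>distinct \<open>k\<close> may share the index \<open>\<nu> k\<close>; any of them will do, because \<open>k \<le> \<nu> k\<close> forces \<open>k\<close> to be large
    when \<open>n\<close> is large\<close>
    define \<theta>s where "\<theta>s n = (if n \<in> range \<nu> then t (SOME k. \<nu> k = n) else \<theta>)" for n
    have some: "\<exists>k. \<nu> k = n \<and> \<theta>s n = t k" if n: "n \<in> range \<nu>" for n
    proof -
      have "\<exists>k. \<nu> k = n" using n by auto
      then have "\<nu> (SOME k. \<nu> k = n) = n" by (rule someI_ex)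
      then show ?thesis using n by (auto simp: \<theta>s_def)
    qed
    have "\<theta>s \<longlonglongrightarrow> \<theta>"
    proof (rule LIMSEQ_I)
      fix d :: real assume d: "0 < d"
      then obtain K where K: "inverse (real (Suc K)) < d" using reals_Archimedean by blast
      have "norm (\<theta>s n - \<theta>) < d" if n: "Suc (Max (\<nu> ` {..K})) \<le> n" for n
      proof (cases "n \<in> range \<nu>")
        case True
        then obtain k where k: "\<nu> k = n" "\<theta>s n = t k" using some by blast
        have "K < k"
        proof (rule ccontr)
          assume "\<not> K < k"
          then have "\<nu> k \<le> Max (\<nu> ` {..K})" by (intro Max_ge) auto
          then show False using n k by simp
        qed
        then have "inverse (real (Suc k)) \<le> inverse (real (Suc K))" by (intro le_imp_inverse_le) auto
        then show ?thesis unfolding k(2) real_norm_def using t(2)[of k] K by linarith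
      qed (use d in \<open>simp add: \<theta>s_def\<close>)
      then show "\<exists>n0. \<forall>n\<ge>n0. norm (\<theta>s n - \<theta>) < d" by blast
    qed
    moreover have "\<theta>s n \<in> U" for n using t(1) \<theta> by (simp add: \<theta>s_def)
    ultimately have "(\<lambda>n. G n (\<theta>s n)) \<longlonglongrightarrow> g \<theta>" by (intro cc \<theta>)
    then have "\<forall>\<^sub>F n in sequentially. \<bar>G n (\<theta>s n) - g \<theta>\<bar> < e" using e by (auto simp: tendsto_iff dist_real_def)
    then obtain n0 where n0: "\<And>n. n0 \<le> n \<Longrightarrow> \<bar>G n (\<theta>s n) - g \<theta>\<bar> < e" unfolding eventually_sequentially by blast
    obtain k where k: "\<nu> k = \<nu> n0" "\<theta>s (\<nu> n0) = t k" using some[of "\<nu> n0"] by auto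
    show False using n0[OF \<nu>[of n0]] t(3)[of k] k by simp
  qed
  have pt: "(\<lambda>n. G n t) \<longlonglongrightarrow> g t" if "t \<in> U" for t using cc[of t "\<lambda>_. t"] that by simp
  have gclose: "\<bar>g t - g \<theta>\<bar> \<le> e" if t: "t \<in> U" and c: "\<And>n. n0 \<le> n \<Longrightarrow> \<bar>G n t - g \<theta>\<bar> \<le> e" for t \<theta> e n0
  proof (rule tendsto_upperbound)
    show "(\<lambda>n. \<bar>G n t - g \<theta>\<bar>) \<longlonglongrightarrow> \<bar>g t - g \<theta>\<bar>" by (intro tendsto_intros pt t)
    show "\<forall>\<^sub>F n in sequentially. \<bar>G n t - g \<theta>\<bar> \<le> e" unfolding eventually_sequentially using c by blast
  qed simp
  have unif: "\<exists>n0. \<forall>n\<ge>n0. \<forall>t\<in>K. \<bar>G n t - g t\<bar> \<le> e" if K: "compact K" "K \<subseteq> U" and e: "0 < e" for K e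
  proof (rule ccontr)
    assume "\<not> ?thesis"
    then have "\<forall>k. \<exists>x. k \<le> fst x \<and> snd x \<in> K \<and> e < \<bar>G (fst x) (snd x) - g (snd x)\<bar>" by (simp add: not_le) blast
    from choice[OF this] obtain x where x: "\<And>k. k \<le> fst (x k) \<and> snd (x k) \<in> K \<and> e < \<bar>G (fst (x k)) (snd (x k)) - g (snd (x k))\<bar>" by blast
    define \<nu> t where "\<nu> k = fst (x k)" and "t k = snd (x k)" for k
    have \<nu>: "\<And>k. k \<le> \<nu> k" and t: "\<And>k. t k \<in> K" "\<And>k. e < \<bar>G (\<nu> k) (t k) - g (t k)\<bar>"
      using x by (auto simp only: \<nu>_def t_def)
    obtain l s where l: "l \<in> K" and s: "strict_mono (s :: nat \<Rightarrow> nat)" "(t \<circ> s) \<longlonglongrightarrow> l"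
      using K(1) t(1) unfolding compact_eq_seq_compact_metric seq_compact_def by blast
    obtain d n0 where d: "0 < d" "\<And>n t. n0 \<le> n \<Longrightarrow> t \<in> U \<Longrightarrow> \<bar>t - l\<bar> < d \<Longrightarrow> \<bar>G n t - g l\<bar> \<le> e / 2"
      using local[of l "e / 2"] half_gt_zero[OF e] l K(2) by blast
    have "\<forall>\<^sub>F j in sequentially. dist ((t \<circ> s) j) l < d" using s(2) d(1) by (rule tendstoD)
    then obtain j0 where j0: "\<And>j. j0 \<le> j \<Longrightarrow> \<bar>t (s j) - l\<bar> < d"
      unfolding eventually_sequentially by (auto simp: dist_real_def)
    define j where "j = max j0 n0"
    have "n0 \<le> \<nu> (s j)" using \<nu>[of "s j"] seq_suble[OF s(1), of j] by (simp add: j_def)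
    moreover have tU: "t (s j) \<in> U" and tl: "\<bar>t (s j) - l\<bar> < d" using t(1) K(2) j0[of j] by (auto simp: j_def)
    ultimately have 1: "\<bar>G (\<nu> (s j)) (t (s j)) - g l\<bar> \<le> e / 2" by (intro d(2))
    have 2: "\<bar>g (t (s j)) - g l\<bar> \<le> e / 2" by (rule gclose[OF tU d(2)[OF _ tU tl]])
    show False using 1 2 t(2)[of "s j"] by linarith
  qed
  have bdd: "bdd_above (g ` K)" if K: "compact K" "K \<subseteq> U" for K
  proof (rule compact_imp_bounded[THEN bounded_imp_bdd_above, OF compact_continuous_image[OF _ K(1)]])
    show "continuous_on K g"
      unfolding continuous_on_iff
    proof (intro ballI allI impI)
      fix x and e :: real assume x: "x \<in> K" and e: "0 < e"
      then obtain d n0 where d: "0 < d" "\<And>n t. n0 \<le> n \<Longrightarrow> t \<in> U \<Longrightarrow> \<bar>t - x\<bar> < d \<Longrightarrow> \<bar>G n t - g x\<bar> \<le> e / 2"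
        using local[of x "e / 2"] half_gt_zero[OF e] K(2) by blast
      have "dist (g y) (g x) < e" if y: "y \<in> K" "dist y x < d" for y
      proof -
        have yU: "y \<in> U" "\<bar>y - x\<bar> < d" using y K(2) by (auto simp: dist_real_def)
        have "\<bar>g y - g x\<bar> \<le> e / 2" by (rule gclose[OF yU(1) d(2)[OF _ yU]])
        then show ?thesis using e unfolding dist_real_def by linarith
      qed
      then show "\<exists>d>0. \<forall>y\<in>K. dist y x < d \<longrightarrow> dist (g y) (g x) < e" using d(1) by blast
    qed
  qed
  obtain \<epsilon>0 where \<epsilon>0: "0 < \<epsilon>0" "cball \<theta>\<^sub>0 \<epsilon>0 \<subseteq> U" using U \<theta>\<^sub>0 open_contains_cball by blast
  let ?A = "\<lambda>\<epsilon>. {\<theta>\<in>U. \<bar>\<theta> - \<theta>\<^sub>0\<bar> < \<epsilon>}"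
  have Asub: "?A \<epsilon> \<subseteq> cball \<theta>\<^sub>0 \<epsilon>0" if "\<epsilon> \<le> \<epsilon>0" for \<epsilon> using that by (auto simp: dist_real_def)
  have Ane: "?A \<epsilon> \<noteq> {}" if "0 < \<epsilon>" for \<epsilon>
  proof -
    have "\<theta>\<^sub>0 \<in> ?A \<epsilon>" using \<theta>\<^sub>0 that by simp
    then show ?thesis by blast
  qed
  define l where "l \<epsilon> = (SUP \<theta>\<in>?A \<epsilon>. g \<theta>)" for \<epsilon>
  have lim: "(\<lambda>n. SUP \<theta>\<in>?A \<epsilon>. G n \<theta>) \<longlonglongrightarrow> l \<epsilon>" if \<epsilon>: "0 < \<epsilon>" "\<epsilon> \<le> \<epsilon>0" for \<epsilon>
  proof (rule LIMSEQ_I)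
    fix e :: real assume e: "0 < e"
    obtain n0 where n0: "\<And>n t. n0 \<le> n \<Longrightarrow> t \<in> cball \<theta>\<^sub>0 \<epsilon>0 \<Longrightarrow> \<bar>G n t - g t\<bar> \<le> e / 2"
      using unif[OF compact_cball \<epsilon>0(2) half_gt_zero[OF e]] by blast
    have "norm ((SUP \<theta>\<in>?A \<epsilon>. G n \<theta>) - l \<epsilon>) < e" if n: "n0 \<le> n" for n
    proof -
      have "\<bar>(SUP \<theta>\<in>?A \<epsilon>. G n \<theta>) - l \<epsilon>\<bar> \<le> e / 2"
        unfolding l_def
      proof (rule cSUP_close[OF Ane[OF \<epsilon>(1)]])
        show "bdd_above (g ` ?A \<epsilon>)"
          by (rule bdd_above_mono[OF bdd[OF compact_cball \<epsilon>0(2)] image_mono[OF Asub[OF \<epsilon>(2)]]])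
        show "\<bar>G n t - g t\<bar> \<le> e / 2" if "t \<in> ?A \<epsilon>" for t
          by (rule n0[OF n]) (use that Asub[OF \<epsilon>(2)] in blast)
      qed
      then show ?thesis using e by simp
    qed
    then show "\<exists>n0. \<forall>n\<ge>n0. norm ((SUP \<theta>\<in>?A \<epsilon>. G n \<theta>) - l \<epsilon>) < e" by blast
  qed
  have "(l \<longlongrightarrow> g \<theta>\<^sub>0) (at_right 0)"
  proof (rule tendstoI)
    fix e :: real assume e: "0 < e"
    obtain d n0 where d: "0 < d" "\<And>n t. n0 \<le> n \<Longrightarrow> t \<in> U \<Longrightarrow> \<bar>t - \<theta>\<^sub>0\<bar> < d \<Longrightarrow> \<bar>G n t - g \<theta>\<^sub>0\<bar> \<le> e / 2"
      using local[OF \<theta>\<^sub>0 half_gt_zero[OF e]] by blast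
    have "dist (l \<epsilon>) (g \<theta>\<^sub>0) < e" if \<epsilon>: "0 < \<epsilon>" "\<epsilon> < d" for \<epsilon>
    proof -
      have "\<bar>(SUP t\<in>?A \<epsilon>. g t) - (SUP t\<in>?A \<epsilon>. g \<theta>\<^sub>0)\<bar> \<le> e / 2"
      proof (rule cSUP_close[OF Ane[OF \<epsilon>(1)]])
        show "\<bar>g t - g \<theta>\<^sub>0\<bar> \<le> e / 2" if "t \<in> ?A \<epsilon>" for t
          by (rule gclose[of t n0]) (use that d(2) \<epsilon> in auto)
      qed (rule bdd_aboveI2[of _ _ "g \<theta>\<^sub>0"], simp)
      then show ?thesis using e by (simp add: l_def cSUP_const[OF Ane[OF \<epsilon>(1)]] dist_real_def)
    qed
    then show "\<forall>\<^sub>F \<epsilon> in at_right 0. dist (l \<epsilon>) (g \<theta>\<^sub>0) < e"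
      unfolding eventually_at_right_field using d(1) by blast
  qed
  moreover have "\<forall>\<^sub>F \<epsilon> in at_right 0. (\<lambda>n. SUP \<theta>\<in>?A \<epsilon>. G n \<theta>) \<longlonglongrightarrow> l \<epsilon>"
    unfolding eventually_at_right_field using lim \<epsilon>0(1) by (intro exI[of _ \<epsilon>0]) auto
  ultimately show ?thesis by blast
qed

context ramp_experiment
begin

text \<open>
  Markov's inequality with the bounded first moments of the rescaled error.
\<close>

lemma est_consistent:
  assumes \<theta>: "\<theta> \<in> {\<alpha><..<\<beta>}"
  shows "converges_in_probability (\<lambda>n. P n \<theta>) est \<theta>"
  unfolding converges_in_probability_def
proof (intro conjI allI impI)
  have m: "\<forall>\<^sub>F n in sequentially. 1 \<le> n \<and> prob_space (P n \<theta>) \<and> est n \<in> borel_measurable (P n \<theta>)"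
    using eventually_ge_at_top[of 1]
    by eventually_elim (use est_measurable \<theta> poisson_processD(1)[OF S_poisson] in blast)
  then show "\<forall>\<^sub>F n in sequentially. est n \<in> borel_measurable (P n \<theta>)" by eventually_elim simp
  fix e :: real assume e: "0 < e"
  obtain C where C: "\<forall>\<^sub>F n in sequentially. mean_le (P n \<theta>) (\<lambda>\<omega>. \<bar>real n * (est n \<omega> - \<theta>)\<bar> ^ 1) C"
    using eventually_moment_bound[OF \<theta>, of "\<lambda>_. \<theta>" 1] \<theta> by auto
  show "(\<lambda>n. measure (P n \<theta>) {\<omega> \<in> space (P n \<theta>). \<bar>est n \<omega> - \<theta>\<bar> > e}) \<longlonglongrightarrow> 0"
  proof (rule tendsto_sandwich[of "\<lambda>_. 0" _ _ "\<lambda>n. (C / e) / real n"])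
    show "\<forall>\<^sub>F n in sequentially. measure (P n \<theta>) {\<omega> \<in> space (P n \<theta>). \<bar>est n \<omega> - \<theta>\<bar> > e} \<le> (C / e) / real n"
      using C m
    proof eventually_elim
      case (elim n)
      interpret prob_space "P n \<theta>" using elim by simp
      have [measurable]: "est n \<in> borel_measurable (P n \<theta>)" using elim by simp
      have n: "0 < real n" using elim by simp
      let ?u = "\<lambda>\<omega>. ennreal \<bar>real n * (est n \<omega> - \<theta>)\<bar>"
      have u: "(\<integral>\<^sup>+\<omega>. ?u \<omega> \<partial>P n \<theta>) \<le> ennreal C" and C0: "0 \<le> C" using elim by (auto simp: mean_le_def)
      have "emeasure (P n \<theta>) {\<omega> \<in> space (P n \<theta>). \<bar>est n \<omega> - \<theta>\<bar> > e}
          \<le> emeasure (P n \<theta>) {\<omega> \<in> space (P n \<theta>). 1 \<le> ennreal (1 / (e * real n)) * ?u \<omega>}"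
      proof (rule emeasure_mono)
        show "{\<omega> \<in> space (P n \<theta>). \<bar>est n \<omega> - \<theta>\<bar> > e} \<subseteq> {\<omega> \<in> space (P n \<theta>). 1 \<le> ennreal (1 / (e * real n)) * ?u \<omega>}"
        proof safe
          fix \<omega> assume "e < \<bar>est n \<omega> - \<theta>\<bar>"
          then have "1 \<le> 1 / (e * real n) * \<bar>real n * (est n \<omega> - \<theta>)\<bar>"
            using e n by (simp add: abs_mult pos_le_divide_eq)
          then have "ennreal 1 \<le> ennreal (1 / (e * real n) * \<bar>real n * (est n \<omega> - \<theta>)\<bar>)" by (rule ennreal_leI)
          also have "\<dots> = ennreal (1 / (e * real n)) * ?u \<omega>" by (rule ennreal_mult) (use e in auto)
          finally show "1 \<le> ennreal (1 / (e * real n)) * ?u \<omega>" by simp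
        qed
      qed measurable
      also have "\<dots> \<le> ennreal (1 / (e * real n)) * (\<integral>\<^sup>+\<omega>. ?u \<omega> * indicator (space (P n \<theta>)) \<omega> \<partial>P n \<theta>)"
        by (rule nn_integral_Markov_inequality) measurable
      also have "(\<integral>\<^sup>+\<omega>. ?u \<omega> * indicator (space (P n \<theta>)) \<omega> \<partial>P n \<theta>) = (\<integral>\<^sup>+\<omega>. ?u \<omega> \<partial>P n \<theta>)"
        by (intro nn_integral_cong) simp
      also have "ennreal (1 / (e * real n)) * (\<integral>\<^sup>+\<omega>. ?u \<omega> \<partial>P n \<theta>) \<le> ennreal (1 / (e * real n)) * ennreal C"
        by (intro mult_left_mono u) simp
      also have "\<dots> = ennreal ((C / e) / real n)"
        using e n C0 by (subst ennreal_mult[symmetric]) auto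
      finally show ?case unfolding emeasure_eq_measure using e n C0 by (subst (asm) ennreal_le_iff) auto
    qed
    show "(\<lambda>n. (C / e) / real n) \<longlonglongrightarrow> 0" by (rule lim_const_over_n)
  qed auto
qed

lemma risk_tendsto:
  assumes lim: "limit_experiment N Yp Ym (\<psi> \<theta>) (\<psi> \<theta> + r)"
    and \<theta>: "\<theta> \<in> {\<alpha><..<\<beta>}" and \<theta>s: "\<And>n. \<theta>s n \<in> {\<alpha><..<\<beta>}" "\<theta>s \<longlonglongrightarrow> \<theta>"
  shows "(\<lambda>n. (real n)\<^sup>2 * (\<integral>\<omega>. (est n \<omega> - \<theta>s n)\<^sup>2 \<partial>P n (\<theta>s n)))
    \<longlonglongrightarrow> (\<integral>\<omega>. (zeta (\<psi> \<theta>) (\<psi> \<theta> + r) (\<lambda>u. Yp u \<omega>) (\<lambda>u. Ym u \<omega>))\<^sup>2 \<partial>N)"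
proof -
  have sq: "\<bar>x\<bar> powr 2 = x\<^sup>2" for x :: real by (cases "x = 0") (auto simp: powr_numeral)
  show ?thesis
    using scaled_error_moments(2)[OF lim \<theta> \<theta>s, of 2] unfolding sq power_mult_distrib by simp
qed

lemma powr_moment_tendsto:
  assumes lim: "limit_experiment N Yp Ym (\<psi> \<theta>) (\<psi> \<theta> + r)" and \<theta>: "\<theta> \<in> {\<alpha><..<\<beta>}" and p: "0 < p"
  shows "(\<lambda>n. real n powr p * (\<integral>\<omega>. \<bar>est n \<omega> - \<theta>\<bar> powr p \<partial>P n \<theta>))
    \<longlonglongrightarrow> (\<integral>\<omega>. \<bar>zeta (\<psi> \<theta>) (\<psi> \<theta> + r) (\<lambda>u. Yp u \<omega>) (\<lambda>u. Ym u \<omega>)\<bar> powr p \<partial>N)"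
proof -
  have "\<bar>real n * x\<bar> powr p = real n powr p * \<bar>x\<bar> powr p" for n x by (simp add: abs_mult powr_mult)
  then show ?thesis using scaled_error_moments(2)[OF lim \<theta> \<theta> tendsto_const p] by simp
qed

end

theorem theorem4:
  fixes \<alpha> \<beta> \<tau> r :: real
    and \<psi> q :: "real \<Rightarrow> real"
    and \<delta> :: "nat \<Rightarrow> real"
    and P :: "nat \<Rightarrow> real \<Rightarrow> 'a measure"
    and X :: "nat \<Rightarrow> nat \<Rightarrow> real \<Rightarrow> 'a \<Rightarrow> nat"
    and N :: "real \<Rightarrow> 'b measure"
    and Yp Ym :: "real \<Rightarrow> real \<Rightarrow> 'b \<Rightarrow> nat"
  defines "est \<equiv> \<lambda>n \<omega>. bayes_estimator \<alpha> \<beta> q \<psi> r \<tau> (\<delta> n) n (\<lambda>j t. X n j t \<omega>)"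
    and "\<zeta> \<equiv> \<lambda>\<theta> \<omega>. zeta (\<psi> \<theta>) (\<psi> \<theta> + r) (\<lambda>u. Yp \<theta> u \<omega>) (\<lambda>u. Ym \<theta> u \<omega>)"
  assumes "0 < \<alpha>" and "\<alpha> < \<beta>" and "\<beta> < \<tau>"
    and "continuous_on {0..\<tau>} \<psi>" and "\<And>t. t \<in> {0..\<tau>} \<Longrightarrow> 0 < \<psi> t"
    and "r > - (INF t\<in>{0..\<tau>}. \<psi> t)" and "r \<noteq> 0"
    and "\<And>n. 1 \<le> n \<Longrightarrow> 0 < \<delta> n"
    and "\<And>m n. 1 \<le> m \<Longrightarrow> m \<le> n \<Longrightarrow> \<delta> n \<le> \<delta> m"
    and "\<delta> \<longlonglongrightarrow> 0"
    and "(\<lambda>n. real n * \<delta> n) \<longlonglongrightarrow> 0"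
    \<comment> \<open>under \<open>P n \<theta>\<close>, the observations \<open>X n 1, \<dots>, X n n\<close> are independent Poisson processes\<close>
    and "\<And>n \<theta> j. 1 \<le> n \<Longrightarrow> \<theta> \<in> {\<alpha><..<\<beta>} \<Longrightarrow> j \<in> {1..n} \<Longrightarrow>
           poisson_process (P n \<theta>) {0..\<tau>} (intensity \<psi> r \<tau> (\<delta> n) \<theta>) (X n j)"
    and "\<And>n \<theta>. 1 \<le> n \<Longrightarrow> \<theta> \<in> {\<alpha><..<\<beta>} \<Longrightarrow>
           prob_space.indep_vars (P n \<theta>) (\<lambda>_. path_space {0..\<tau>})
             (\<lambda>j. path_of {0..\<tau>} (X n j)) {1..n}"
    \<comment> \<open>the pair of processes defining the limit variable, for each parameter value\<close>
    and "\<And>\<theta>. \<theta> \<in> {\<alpha><..<\<beta>} \<Longrightarrow> poisson_process (N \<theta>) {0..} (\<lambda>_. \<psi> \<theta> + r) (Yp \<theta>)"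
    and "\<And>\<theta>. \<theta> \<in> {\<alpha><..<\<beta>} \<Longrightarrow> poisson_process (N \<theta>) {0..} (\<lambda>_. \<psi> \<theta>) (Ym \<theta>)"
    and "\<And>\<theta>. \<theta> \<in> {\<alpha><..<\<beta>} \<Longrightarrow>
           prob_space.indep_var (N \<theta>) (path_space {0..}) (path_of {0..} (Yp \<theta>))
             (path_space {0..}) (path_of {0..} (Ym \<theta>))"
    \<comment> \<open>the prior density\<close>
    and "continuous_on {\<alpha><..<\<beta>} q" and "\<And>\<theta>. \<theta> \<in> {\<alpha><..<\<beta>} \<Longrightarrow> 0 < q \<theta>"
    and "set_integrable lborel {\<alpha><..<\<beta>} q" and "(LBINT \<theta>:{\<alpha><..<\<beta>}. q \<theta>) = 1"
  shows "(\<forall>\<theta>\<in>{\<alpha><..<\<beta>}. converges_in_probability (\<lambda>n. P n \<theta>) est \<theta>) \<and>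
         (\<forall>\<theta>\<in>{\<alpha><..<\<beta>}.
            converges_in_distribution (\<lambda>n. P n \<theta>) (\<lambda>n \<omega>. real n * (est n \<omega> - \<theta>)) (N \<theta>) (\<zeta> \<theta>)) \<and>
         (\<forall>\<theta>\<in>{\<alpha><..<\<beta>}. \<forall>p>0.
            integrable (N \<theta>) (\<lambda>\<omega>. \<bar>\<zeta> \<theta> \<omega>\<bar> powr p) \<and>
            (\<lambda>n. real n powr p * (\<integral>\<omega>. \<bar>est n \<omega> - \<theta>\<bar> powr p \<partial>P n \<theta>))
              \<longlonglongrightarrow> (\<integral>\<omega>. \<bar>\<zeta> \<theta> \<omega>\<bar> powr p \<partial>N \<theta>)) \<and>
         (\<forall>\<theta>\<^sub>0\<in>{\<alpha><..<\<beta>}. \<exists>l :: real \<Rightarrow> real.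
            (\<forall>\<^sub>F \<epsilon> in at_right 0.
               (\<lambda>n. SUP \<theta>\<in>{\<theta>\<in>{\<alpha><..<\<beta>}. \<bar>\<theta> - \<theta>\<^sub>0\<bar> < \<epsilon>}.
                      (real n)\<^sup>2 * (\<integral>\<omega>. (est n \<omega> - \<theta>)\<^sup>2 \<partial>P n \<theta>)) \<longlonglongrightarrow> l \<epsilon>) \<and>
            (l \<longlongrightarrow> (\<integral>\<omega>. (\<zeta> \<theta>\<^sub>0 \<omega>)\<^sup>2 \<partial>N \<theta>\<^sub>0)) (at_right 0))"
proof -
  have \<alpha>\<beta>: "0 < \<alpha>" "\<alpha> < \<beta>" "\<beta> < \<tau>" by fact+
  have \<psi>: "continuous_on {0..\<tau>} \<psi>" "\<And>t. t \<in> {0..\<tau>} \<Longrightarrow> 0 < \<psi> t" by fact+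
  have ne: "{0..\<tau>} \<noteq> {}" using \<alpha>\<beta> by auto
  obtain tm where tm: "tm \<in> {0..\<tau>}" "\<And>t. t \<in> {0..\<tau>} \<Longrightarrow> \<psi> tm \<le> \<psi> t"
    using continuous_attains_inf[OF compact_Icc ne \<psi>(1)] by blast
  obtain tM where tM: "tM \<in> {0..\<tau>}" "\<And>t. t \<in> {0..\<tau>} \<Longrightarrow> \<psi> t \<le> \<psi> tM"
    using continuous_attains_sup[OF compact_Icc ne \<psi>(1)] by blast
  have "(INF t\<in>{0..\<tau>}. \<psi> t) \<le> \<psi> tm"
    by (rule cINF_lower[OF bdd_belowI2[of _ "\<psi> tm"]]) (use tm in auto)
  then have pos: "0 < \<psi> tm" "0 < \<psi> tm + r" using \<psi>(2)[OF tm(1)] \<open>r > - (INF t\<in>{0..\<tau>}. \<psi> t)\<close> by auto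
  define lo hi where "lo = min (\<psi> tm) (\<psi> tm + r)" and "hi = max (\<psi> tM) (\<psi> tM + r)"
  interpret E: ramp_experiment \<psi> r \<tau> lo hi \<alpha> \<beta> q \<delta> P X
  proof unfold_locales
    show "0 < \<tau>" using \<alpha>\<beta> by simp
    show "0 < lo" using pos by (simp add: lo_def)
    show "lo \<le> \<psi> t \<and> \<psi> t \<le> hi \<and> lo \<le> \<psi> t + r \<and> \<psi> t + r \<le> hi" if "t \<in> {0..\<tau>}" for t
      using tm(2)[OF that] tM(2)[OF that] by (auto simp: lo_def hi_def)
  qed fact+
  have est: "est = E.est" by (intro ext) (simp add: est_def E.est_def)
  have lim: "limit_experiment (N \<theta>) (Yp \<theta>) (Ym \<theta>) (\<psi> \<theta>) (\<psi> \<theta> + r)" if \<theta>: "\<theta> \<in> {\<alpha><..<\<beta>}" for \<theta>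
  proof unfold_locales
    have t: "\<theta> \<in> {0..\<tau>}" using \<theta> \<alpha>\<beta> by auto
    show "0 < \<psi> \<theta>" "0 < \<psi> \<theta> + r" using tm(2)[OF t] pos by auto
    show "\<psi> \<theta> \<noteq> \<psi> \<theta> + r" using \<open>r \<noteq> 0\<close> by simp
  qed (fact | (use assms \<theta> in blast))+
  have "converges_in_distribution (\<lambda>n. P n \<theta>) (\<lambda>n \<omega>. real n * (est n \<omega> - \<theta>)) (N \<theta>) (\<zeta> \<theta>)"
    if \<theta>: "\<theta> \<in> {\<alpha><..<\<beta>}" for \<theta>
    using E.scaled_error_law[OF lim[OF \<theta>] \<theta> \<theta> tendsto_const]
    unfolding converges_in_distribution_def est \<zeta>_def by (auto elim: eventually_mono)
  moreover have "integrable (N \<theta>) (\<lambda>\<omega>. \<bar>\<zeta> \<theta> \<omega>\<bar> powr p) \<and>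
      (\<lambda>n. real n powr p * (\<integral>\<omega>. \<bar>est n \<omega> - \<theta>\<bar> powr p \<partial>P n \<theta>)) \<longlonglongrightarrow> (\<integral>\<omega>. \<bar>\<zeta> \<theta> \<omega>\<bar> powr p \<partial>N \<theta>)"
    if \<theta>: "\<theta> \<in> {\<alpha><..<\<beta>}" and p: "0 < p" for \<theta> p
    using E.scaled_error_moments(1)[OF lim[OF \<theta>] \<theta> \<theta> tendsto_const p] E.powr_moment_tendsto[OF lim[OF \<theta>] \<theta> p]
    unfolding est \<zeta>_def by blast
  moreover have "\<exists>l. (\<forall>\<^sub>F \<epsilon> in at_right 0. (\<lambda>n. SUP \<theta>\<in>{\<theta>\<in>{\<alpha><..<\<beta>}. \<bar>\<theta> - \<theta>\<^sub>0\<bar> < \<epsilon>}.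
        (real n)\<^sup>2 * (\<integral>\<omega>. (est n \<omega> - \<theta>)\<^sup>2 \<partial>P n \<theta>)) \<longlonglongrightarrow> l \<epsilon>) \<and>
      (l \<longlongrightarrow> (\<integral>\<omega>. (\<zeta> \<theta>\<^sub>0 \<omega>)\<^sup>2 \<partial>N \<theta>\<^sub>0)) (at_right 0)"
    if \<theta>\<^sub>0: "\<theta>\<^sub>0 \<in> {\<alpha><..<\<beta>}" for \<theta>\<^sub>0
  proof (rule SUP_tendsto_of_continuous_convergence[where g = "\<lambda>\<theta>. \<integral>\<omega>. (\<zeta> \<theta> \<omega>)\<^sup>2 \<partial>N \<theta>", OF open_greaterThanLessThan \<theta>\<^sub>0])
    fix \<theta> \<theta>s assume \<theta>: "\<theta> \<in> {\<alpha><..<\<beta>}" "\<And>n :: nat. \<theta>s n \<in> {\<alpha><..<\<beta>}" "\<theta>s \<longlonglongrightarrow> \<theta>"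
    show "(\<lambda>n. (real n)\<^sup>2 * (\<integral>\<omega>. (est n \<omega> - \<theta>s n)\<^sup>2 \<partial>P n (\<theta>s n))) \<longlonglongrightarrow> (\<integral>\<omega>. (\<zeta> \<theta> \<omega>)\<^sup>2 \<partial>N \<theta>)"
      unfolding est \<zeta>_def by (rule E.risk_tendsto[OF lim[OF \<theta>(1)] \<theta>])
  qed
  ultimately show ?thesis using E.est_consistent unfolding est by blast
qed

end
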